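(* Let $X$ be a smooth, projective, integral curve of genus $g$ over an algebraically closed field, and let $\phi\colon X\to E$ be a degree-2 map to an elliptic curve $E$. Let $2 < d < g$ and let $x \in W_X^d$. If $x + \phi^* \operatorname{Pic}_E^0 \subset W_X^d$, then there exists $y \in W_X^{d-2}$ such that $x + \phi^* \operatorname{Pic}_E^0 = y + \phi^* \operatorname{Pic}_E^1$.
   Context: $W_X^d \subset \operatorname{Pic}_X^d$ is the image of $\operatorname{Sym}_X^d \to \operatorname{Pic}_X^d$, i.e. the classes of effective divisors of degree $d$. $\phi^*\operatorname{Pic}_E^n\subset \operatorname{Pic}_X^{2n}$ denotes the image of the pullback map. *)

theory Defs
  imports
    "HOL-Analysis.Cartesian_Space"
    "HOL-Algebra.Free_Abelian_Groups"
    "HOL-Algebra.Embedded_Algebras"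
    "HOL-Computational_Algebra.Polynomial"
begin

text \<open>
  Smooth projective integral curves over an algebraically closed field are taken in the classical
  sense: irreducible Zariski closed sets of (closed) points of some projective space, reducedness
  being built in through the use of the full vanishing ideal.  Homogeneous coordinates are indexed
  by a finite type \<open>'n\<close>, so the ambient space has dimension \<open>CARD('n) - 1\<close>.
\<close>

subsection \<open>Multivariate polynomials and projective space\<close>

type_synonym ('k, 'n) mpoly = "('n \<Rightarrow>\<^sub>0 nat) \<Rightarrow>\<^sub>0 'k"

definition mconst :: "'k::field \<Rightarrow> ('k, 'n::finite) mpoly" where
  "mconst c = Poly_Mapping.single 0 c"

definition meval :: "('k::field, 'n::finite) mpoly \<Rightarrow> 'k ^ 'n \<Rightarrow> 'k" where
  "meval F v =
     (\<Sum>m\<in>Poly_Mapping.keys F.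
        Poly_Mapping.lookup F m * (\<Prod>i\<in>UNIV. (v $ i) ^ Poly_Mapping.lookup m i))"

definition mderiv :: "'n \<Rightarrow> ('k::field, 'n::finite) mpoly \<Rightarrow> ('k, 'n) mpoly" where
  "mderiv i F =
     (\<Sum>m\<in>Poly_Mapping.keys F.
        Poly_Mapping.single (m - Poly_Mapping.single i 1)
          (of_nat (Poly_Mapping.lookup m i) * Poly_Mapping.lookup F m))"

definition form :: "nat \<Rightarrow> ('k::field, 'n::finite) mpoly \<Rightarrow> bool" where
  "form d F \<longleftrightarrow> (\<forall>m\<in>Poly_Mapping.keys F. (\<Sum>i\<in>UNIV. Poly_Mapping.lookup m i) = d)"

definition proportional :: "'k::field ^ 'n::finite \<Rightarrow> 'k ^ 'n \<Rightarrow> bool" where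
  "proportional v w \<longleftrightarrow> v \<noteq> 0 \<and> w \<noteq> 0 \<and> (\<exists>c. c \<noteq> 0 \<and> v = c *s w)"

quotient_type (overloaded) ('k, 'n) proj_point = "'k::field ^ 'n::finite" / partial: proportional
proof (rule part_equivpI)
  have "proportional (1 :: 'k ^ 'n) 1"
    by (auto simp: proportional_def intro!: exI[of _ 1])
  then show "\<exists>v :: 'k ^ 'n. proportional v v" ..
  show "symp (proportional :: 'k ^ 'n \<Rightarrow> 'k ^ 'n \<Rightarrow> bool)"
  proof (rule sympI)
    fix v w :: "'k ^ 'n"
    assume "proportional v w"
    then obtain c where "v \<noteq> 0" "w \<noteq> 0" "c \<noteq> 0" "v = c *s w"
      by (auto simp: proportional_def)
    moreover from this have "w = inverse c *s v" by simp
    ultimately show "proportional w v"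
      unfolding proportional_def by (metis nonzero_imp_inverse_nonzero)
  qed
  show "transp (proportional :: 'k ^ 'n \<Rightarrow> 'k ^ 'n \<Rightarrow> bool)"
  proof (rule transpI)
    fix u v w :: "'k ^ 'n"
    assume "proportional u v" "proportional v w"
    then obtain c d where "u \<noteq> 0" "w \<noteq> 0" "c \<noteq> 0" "d \<noteq> 0" "u = c *s (d *s w)"
      by (auto simp: proportional_def)
    then show "proportional u w"
      unfolding proportional_def by (metis mult_eq_0_iff vector_smult_assoc)
  qed
qed

text \<open>
  \<open>rep_proj_point P\<close> is some vector of homogeneous coordinates of \<open>P\<close>.  It is only used below in
  ways that do not depend on the choice: vanishing of forms, quotients of forms of equal degree,
  and the rank of the Jacobian matrix of forms.
\<close>

abbreviation form_at :: "('k::field, 'n::finite) mpoly \<Rightarrow> ('k, 'n) proj_point \<Rightarrow> 'k" where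
  "form_at F P \<equiv> meval F (rep_proj_point P)"


subsection \<open>Projective varieties\<close>

definition zariski_closed :: "('k::field, 'n::finite) proj_point set \<Rightarrow> bool" where
  "zariski_closed Z \<longleftrightarrow>
     (\<exists>S. (\<forall>F\<in>S. \<exists>d. form d F) \<and> Z = {P. \<forall>F\<in>S. form_at F P = 0})"

definition irreducible_closed :: "('k::field, 'n::finite) proj_point set \<Rightarrow> bool" where
  "irreducible_closed Z \<longleftrightarrow>
     zariski_closed Z \<and> Z \<noteq> {} \<and>
     (\<forall>A B. zariski_closed A \<and> zariski_closed B \<and> Z \<subseteq> A \<union> B \<longrightarrow> Z \<subseteq> A \<or> Z \<subseteq> B)"

definition irreducible_chain ::
  "('k::field, 'n::finite) proj_point set \<Rightarrow> nat \<Rightarrow> (nat \<Rightarrow> ('k, 'n) proj_point set) \<Rightarrow> bool" where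
  "irreducible_chain Y r Z \<longleftrightarrow>
     (\<forall>i\<le>r. irreducible_closed (Z i) \<and> Z i \<subseteq> Y) \<and> (\<forall>i<r. Z i \<subset> Z (Suc i))"

definition has_krull_dim :: "('k::field, 'n::finite) proj_point set \<Rightarrow> nat \<Rightarrow> bool" where
  "has_krull_dim Y r \<longleftrightarrow>
     (\<exists>Z. irreducible_chain Y r Z) \<and> \<not> (\<exists>Z. irreducible_chain Y (Suc r) Z)"

definition vanishing_forms :: "('k::field, 'n::finite) proj_point set \<Rightarrow> ('k, 'n) mpoly set" where
  "vanishing_forms X = {F. (\<exists>d. form d F) \<and> (\<forall>P\<in>X. form_at F P = 0)}"

definition gradient_at :: "('k::field, 'n::finite) mpoly \<Rightarrow> ('k, 'n) proj_point \<Rightarrow> 'k ^ 'n" where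
  "gradient_at F P = (\<chi> i. form_at (mderiv i F) P)"

text \<open>
  Jacobian criterion: the Jacobian matrix has rank \<open>(CARD('n) - 1) - r\<close> at every point.
  By Euler's relation the homogeneous Jacobian matrix has, at points of \<open>X\<close>, the same rank as the
  Jacobian matrix in an affine chart.
\<close>
definition smooth_of_dim :: "('k::field, 'n::finite) proj_point set \<Rightarrow> nat \<Rightarrow> bool" where
  "smooth_of_dim X r \<longleftrightarrow>
     (\<forall>P\<in>X. vec.dim ((\<lambda>F. gradient_at F P) ` vanishing_forms X) + r + 1 = CARD('n))"

definition smooth_projective_curve :: "('k::alg_closed_field, 'n::finite) proj_point set \<Rightarrow> bool" where
  "smooth_projective_curve X \<longleftrightarrow>
     irreducible_closed X \<and> has_krull_dim X 1 \<and> smooth_of_dim X 1"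


subsection \<open>Function field, local rings and orders\<close>

text \<open>
  Rational functions on \<open>X\<close> are classes of fractions \<open>F/G\<close> of forms of equal degree, where \<open>G\<close> does
  not vanish identically on \<open>X\<close> and \<open>F/G = F'/G'\<close> means that \<open>F G' - F' G\<close> vanishes on \<open>X\<close>.
\<close>

type_synonym ('k, 'n) ratfun = "(('k, 'n) mpoly \<times> ('k, 'n) mpoly) set"

definition fractions :: "('k::field, 'n::finite) proj_point set \<Rightarrow> ('k, 'n) ratfun" where
  "fractions X = {(F, G). (\<exists>d. form d F \<and> form d G) \<and> (\<exists>P\<in>X. form_at G P \<noteq> 0)}"

definition frac ::
  "('k::field, 'n::finite) proj_point set \<Rightarrow> ('k, 'n) mpoly \<Rightarrow> ('k, 'n) mpoly \<Rightarrow> ('k, 'n) ratfun" where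
  "frac X F G = {(F', G') \<in> fractions X. \<forall>P\<in>X. form_at (F * G' - F' * G) P = 0}"

definition function_field :: "('k::field, 'n::finite) proj_point set \<Rightarrow> ('k, 'n) ratfun ring" where
  "function_field X =
     \<lparr>carrier = {frac X F G | F G. (F, G) \<in> fractions X},
      monoid.mult = (\<lambda>f h. \<Union>(F, G)\<in>f. \<Union>(F', G')\<in>h. frac X (F * F') (G * G')),
      one = frac X 1 1,
      zero = frac X 0 1,
      add = (\<lambda>f h. \<Union>(F, G)\<in>f. \<Union>(F', G')\<in>h. frac X (F * G' + F' * G) (G * G'))\<rparr>"

definition const_fun :: "('k::field, 'n::finite) proj_point set \<Rightarrow> 'k \<Rightarrow> ('k, 'n) ratfun" where
  "const_fun X c = frac X (mconst c) 1"

definition local_ring ::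
  "('k::field, 'n::finite) proj_point set \<Rightarrow> ('k, 'n) proj_point \<Rightarrow> ('k, 'n) ratfun set" where
  "local_ring X P = {f \<in> carrier (function_field X). \<exists>(F, G)\<in>f. form_at G P \<noteq> 0}"

definition value_at :: "('k::field, 'n::finite) ratfun \<Rightarrow> ('k, 'n) proj_point \<Rightarrow> 'k" where
  "value_at f P = (THE c. \<exists>(F, G)\<in>f. form_at G P \<noteq> 0 \<and> c = form_at F P / form_at G P)"

definition local_units ::
  "('k::field, 'n::finite) proj_point set \<Rightarrow> ('k, 'n) proj_point \<Rightarrow> ('k, 'n) ratfun set" where
  "local_units X P = {f \<in> local_ring X P. value_at f P \<noteq> 0}"

definition max_ideal ::
  "('k::field, 'n::finite) proj_point set \<Rightarrow> ('k, 'n) proj_point \<Rightarrow> ('k, 'n) ratfun set" where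
  "max_ideal X P = {f \<in> local_ring X P. value_at f P = 0}"

definition uniformizer ::
  "('k::field, 'n::finite) proj_point set \<Rightarrow> ('k, 'n) proj_point \<Rightarrow> ('k, 'n) ratfun \<Rightarrow> bool" where
  "uniformizer X P t \<longleftrightarrow>
     t \<in> max_ideal X P \<and> max_ideal X P = {t \<otimes>\<^bsub>function_field X\<^esub> h | h. h \<in> local_ring X P}"

text \<open>Only meaningful for nonzero \<open>f\<close>.\<close>
definition ord_at ::
  "('k::field, 'n::finite) proj_point set \<Rightarrow> ('k, 'n) proj_point \<Rightarrow> ('k, 'n) ratfun \<Rightarrow> int" where
  "ord_at X P f =
     (THE n. \<exists>t u. uniformizer X P t \<and> u \<in> local_units X P \<and>
        f = u \<otimes>\<^bsub>function_field X\<^esub> (t [^]\<^bsub>function_field X\<^esub> (n::int)))"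


subsection \<open>Genus\<close>

text \<open>
  The genus is the dimension of \<open>H\<^sup>1(X, O\<^sub>X)\<close>.  The flasque resolution
  \<open>0 \<rightarrow> O\<^sub>X \<rightarrow> K \<rightarrow> K/O\<^sub>X \<rightarrow> 0\<close>, with \<open>K\<close> the constant sheaf of rational functions, identifies this
  space with the cokernel of \<open>k(X) \<rightarrow> \<Oplus>\<^sub>P k(X)/O\<^sub>P\<close>, that is, with the space of repartitions modulo
  the sum of \<open>k(X)\<close> and the everywhere regular repartitions.  The definition says that this
  quotient has a basis consisting of the classes of \<open>r 0, \<dots>, r (g - 1)\<close>.
\<close>

definition repartitions ::
  "('k::field, 'n::finite) proj_point set \<Rightarrow> (('k, 'n) proj_point \<Rightarrow> ('k, 'n) ratfun) set" where
  "repartitions X =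
     {r. (\<forall>P\<in>X. r P \<in> carrier (function_field X)) \<and> finite {P \<in> X. r P \<notin> local_ring X P}}"

definition has_genus :: "('k::field, 'n::finite) proj_point set \<Rightarrow> nat \<Rightarrow> bool" where
  "has_genus X g \<longleftrightarrow>
     (\<exists>r :: nat \<Rightarrow> ('k, 'n) proj_point \<Rightarrow> ('k, 'n) ratfun.
        (\<forall>i<g. r i \<in> repartitions X) \<and>
        (\<forall>s\<in>repartitions X. \<exists>!c :: nat \<Rightarrow> 'k. (\<forall>i\<ge>g. c i = 0) \<and>
           (\<exists>f\<in>carrier (function_field X). \<forall>P\<in>X.
              s P \<ominus>\<^bsub>function_field X\<^esub>
                (f \<oplus>\<^bsub>function_field X\<^esub>
                 (\<Oplus>\<^bsub>function_field X\<^esub>i\<in>{..<g}. const_fun X (c i) \<otimes>\<^bsub>function_field X\<^esub> r i P))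
              \<in> local_ring X P)))"

definition elliptic_curve ::
  "('k::alg_closed_field, 'n::finite) proj_point set \<Rightarrow> ('k, 'n) proj_point \<Rightarrow> bool" where
  "elliptic_curve E e \<longleftrightarrow> smooth_projective_curve E \<and> has_genus E 1 \<and> e \<in> E"


subsection \<open>Divisors and the Picard group\<close>

definition divisor_degree :: "('a \<Rightarrow>\<^sub>0 int) \<Rightarrow> int" where
  "divisor_degree D = (\<Sum>P\<in>Poly_Mapping.keys D. Poly_Mapping.lookup D P)"

definition effective :: "('a \<Rightarrow>\<^sub>0 int) \<Rightarrow> bool" where
  "effective D \<longleftrightarrow> (\<forall>P. 0 \<le> Poly_Mapping.lookup D P)"

definition principal_divisors ::
  "('k::field, 'n::finite) proj_point set \<Rightarrow> (('k, 'n) proj_point \<Rightarrow>\<^sub>0 int) set" where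
  "principal_divisors X =
     {D \<in> carrier (free_Abelian_group X).
        \<exists>f\<in>carrier (function_field X) - {\<zero>\<^bsub>function_field X\<^esub>}.
          \<forall>P\<in>X. Poly_Mapping.lookup D P = ord_at X P f}"

definition Pic ::
  "('k::field, 'n::finite) proj_point set \<Rightarrow> (('k, 'n) proj_point \<Rightarrow>\<^sub>0 int) set monoid" where
  "Pic X = free_Abelian_group X Mod principal_divisors X"

definition divisor_class ::
  "('k::field, 'n::finite) proj_point set \<Rightarrow> (('k, 'n) proj_point \<Rightarrow>\<^sub>0 int)
     \<Rightarrow> (('k, 'n) proj_point \<Rightarrow>\<^sub>0 int) set" where
  "divisor_class X D = principal_divisors X #>\<^bsub>free_Abelian_group X\<^esub> D"

definition Pic_deg ::
  "('k::field, 'n::finite) proj_point set \<Rightarrow> int \<Rightarrow> (('k, 'n) proj_point \<Rightarrow>\<^sub>0 int) set set" where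
  "Pic_deg X n = divisor_class X ` {D \<in> carrier (free_Abelian_group X). divisor_degree D = n}"

definition W ::
  "('k::field, 'n::finite) proj_point set \<Rightarrow> nat \<Rightarrow> (('k, 'n) proj_point \<Rightarrow>\<^sub>0 int) set set" where
  "W X d = divisor_class X `
     {D \<in> carrier (free_Abelian_group X). effective D \<and> divisor_degree D = int d}"


subsection \<open>Morphisms, degree and pullback\<close>

text \<open>
  A morphism to a projective variety is given, near each point, by a tuple of forms of equal degree
  without common zeros.  Values of \<open>\<phi>\<close> outside \<open>X\<close> are irrelevant.
\<close>
definition morphism ::
  "('k::field, 'n::finite) proj_point set \<Rightarrow> ('k, 'm::finite) proj_point set
     \<Rightarrow> (('k, 'n) proj_point \<Rightarrow> ('k, 'm) proj_point) \<Rightarrow> bool" where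
  "morphism X Y \<phi> \<longleftrightarrow>
     \<phi> ` X \<subseteq> Y \<and>
     (\<forall>P\<in>X. \<exists>d. \<exists>\<Phi> :: 'm \<Rightarrow> ('k, 'n) mpoly.
        (\<forall>j. form d (\<Phi> j)) \<and> (\<exists>j. form_at (\<Phi> j) P \<noteq> 0) \<and>
        (\<forall>Q\<in>X. (\<exists>j. form_at (\<Phi> j) Q \<noteq> 0) \<longrightarrow>
           \<phi> Q = abs_proj_point (\<chi> j. form_at (\<Phi> j) Q)))"

definition dominant ::
  "('k::field, 'n::finite) proj_point set \<Rightarrow> ('k, 'm::finite) proj_point set
     \<Rightarrow> (('k, 'n) proj_point \<Rightarrow> ('k, 'm) proj_point) \<Rightarrow> bool" where
  "dominant X Y \<phi> \<longleftrightarrow> (\<forall>Z. zariski_closed Z \<and> \<phi> ` X \<subseteq> Z \<longrightarrow> Y \<subseteq> Z)"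

text \<open>Composition of rational functions with \<open>\<phi>\<close>; well defined for dominant morphisms.\<close>
definition pullback_fun ::
  "('k::field, 'n::finite) proj_point set \<Rightarrow> ('k, 'm::finite) proj_point set
     \<Rightarrow> (('k, 'n) proj_point \<Rightarrow> ('k, 'm) proj_point) \<Rightarrow> ('k, 'm) ratfun \<Rightarrow> ('k, 'n) ratfun" where
  "pullback_fun X Y \<phi> f =
     (THE h. h \<in> carrier (function_field X) \<and>
        (\<forall>P\<in>X. f \<in> local_ring Y (\<phi> P) \<longrightarrow>
           h \<in> local_ring X P \<and> value_at h P = value_at f (\<phi> P)))"

definition morphism_of_degree ::
  "nat \<Rightarrow> ('k::field, 'n::finite) proj_point set \<Rightarrow> ('k, 'm::finite) proj_point set
     \<Rightarrow> (('k, 'n) proj_point \<Rightarrow> ('k, 'm) proj_point) \<Rightarrow> bool" where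
  "morphism_of_degree n X Y \<phi> \<longleftrightarrow>
     morphism X Y \<phi> \<and> dominant X Y \<phi> \<and>
     ring.dimension (function_field X) n
       (pullback_fun X Y \<phi> ` carrier (function_field Y)) (carrier (function_field X))"

definition ramification_index ::
  "('k::field, 'n::finite) proj_point set \<Rightarrow> ('k, 'm::finite) proj_point set
     \<Rightarrow> (('k, 'n) proj_point \<Rightarrow> ('k, 'm) proj_point) \<Rightarrow> ('k, 'n) proj_point \<Rightarrow> int" where
  "ramification_index X Y \<phi> P =
     ord_at X P (pullback_fun X Y \<phi> (SOME t. uniformizer Y (\<phi> P) t))"

text \<open>The function below has finite support because dominant morphisms of curves have finite fibres.\<close>
definition pullback_divisor ::
  "('k::field, 'n::finite) proj_point set \<Rightarrow> ('k, 'm::finite) proj_point set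
     \<Rightarrow> (('k, 'n) proj_point \<Rightarrow> ('k, 'm) proj_point)
     \<Rightarrow> (('k, 'm) proj_point \<Rightarrow>\<^sub>0 int) \<Rightarrow> (('k, 'n) proj_point \<Rightarrow>\<^sub>0 int)" where
  "pullback_divisor X Y \<phi> D =
     Abs_poly_mapping
       (\<lambda>P. if P \<in> X then ramification_index X Y \<phi> P * Poly_Mapping.lookup D (\<phi> P) else 0)"

definition pullback_Pic ::
  "('k::field, 'n::finite) proj_point set \<Rightarrow> ('k, 'm::finite) proj_point set
     \<Rightarrow> (('k, 'n) proj_point \<Rightarrow> ('k, 'm) proj_point)
     \<Rightarrow> (('k, 'm) proj_point \<Rightarrow>\<^sub>0 int) set \<Rightarrow> (('k, 'n) proj_point \<Rightarrow>\<^sub>0 int) set" where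
  "pullback_Pic X Y \<phi> c = the_elem ((\<lambda>D. divisor_class X (pullback_divisor X Y \<phi> D)) ` c)"

end

theory Submission
  imports Defs "HOL-Computational_Algebra.Formal_Laurent_Series"
begin

text \<open>
  Write \<open>x = [D]\<close> with \<open>D\<close> effective of degree \<open>d\<close> and choose three points \<open>q, p\<^sub>1, p\<^sub>2\<close> of \<open>E\<close>.
  By hypothesis there are nonzero functions \<open>f\<^sub>i\<close> with \<open>D\<^sub>i = div f\<^sub>i + D + \<phi>\<^sup>*(p\<^sub>i - q)\<close> effective.
  It suffices that some \<open>D\<^sub>i\<close> contains a fibre of \<open>\<phi>\<close>: fibres have degree 2, and subtracting the
  fibre gives \<open>y\<close>.

  If \<open>f\<^sub>1 = h f\<^sub>2\<close> with \<open>h \<in> k(E)\<close>, then \<open>D\<^sub>1 - D\<^sub>2\<close> is the pullback of \<open>div h + p\<^sub>1 - p\<^sub>2\<close>, which is not zero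
  because no function on \<open>E\<close> has a single simple pole; as both \<open>D\<^sub>i\<close> are effective, one of them
  contains a fibre.  If \<open>f\<^sub>1, f\<^sub>2\<close> are independent over \<open>k(E)\<close>, they form a basis of \<open>k(X)\<close>, and
  by weak approximation every repartition of \<open>X\<close> is \<open>a f\<^sub>1 + b f\<^sub>2\<close> for repartitions \<open>a, b\<close> of \<open>E\<close>
  up to regular terms.  Since \<open>H\<^sup>1(E, q - p\<^sub>i) = 0\<close>, this gives \<open>H\<^sup>1(X, D) = 0\<close>, hence \<open>g \<le> deg D = d\<close>,
  a contradiction.

  No Riemann--Roch theorem and no properness beyond the finiteness of the genus are needed: if \<open>h\<close>
  has at most one simple pole, then multiplication by \<open>h\<close> acts on \<open>H\<^sup>1(X, O)\<close>, so some nonzero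
  polynomial in \<open>h\<close> annihilates this space, while every nonzero function acts surjectively on it.
  Hence \<open>h\<close> is constant as soon as the genus is positive.
\<close>

section \<open>Forms and their values\<close>

text \<open>The genus is given as the dimension of \<open>H^1\<close>, so every estimate is made
  with repartitions. That \<open>H^1(E, q - p)\<close> vanishes is elementary: a simple pole at
  \<open>q\<close> is a nonzero class, hence spans the one-dimensional \<open>H^1(E, O)\<close>, and
  a free constant then forces the zero at \<open>p\<close>. Multiplication by
  \<open>f\<^sub>i\<close> turns order at least the pullback of \<open>p\<^sub>i - q\<close> into
  order at least \<open>-D\<close>, which carries the vanishing to \<open>X\<close>.

  Degree 2 is known only as the dimension of \<open>k(X)\<close> over \<open>k(E)\<close>. Fibres
  are therefore bounded from both sides: degree above 2 would give three functions independent over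
  \<open>k(E)\<close>, degree below 2 would make every function a pullback.

  Discrete valuations are not given either, since smoothness is a rank condition on gradients. A
  first-order expansion of forms and Nakayama's lemma produce a local equation at each point; a
  Hilbert basis argument shows that no form nonzero on \<open>X\<close> is infinitely divisible by
  it. For calculations with type-class fields, \<open>k(X)\<close> and \<open>k(E)\<close> are
  embedded in Laurent series at one chosen point, and the orders at all points are transported along
  this embedding.\<close>

lemma poly_mapping_sum_single:
  "F = (\<Sum>m\<in>Poly_Mapping.keys F. Poly_Mapping.single m (Poly_Mapping.lookup F m))"
  by (rule poly_mapping_eqI)
    (auto simp: lookup_sum lookup_single when_def sum.delta in_keys_iff)

definition monom_value :: "('n::finite \<Rightarrow>\<^sub>0 nat) \<Rightarrow> 'k::field ^ 'n \<Rightarrow> 'k" where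
  "monom_value m v = (\<Prod>i\<in>UNIV. (v $ i) ^ Poly_Mapping.lookup m i)"

lemma monom_value_0 [simp]: "monom_value 0 v = 1"
  by (simp add: monom_value_def)

lemma monom_value_add: "monom_value (m + m') v = monom_value m v * monom_value m' v"
  by (simp add: monom_value_def lookup_add power_add prod.distrib)

lemma monom_value_single: "monom_value (Poly_Mapping.single i k) v = (v $ i) ^ k"
proof -
  have "monom_value (Poly_Mapping.single i k) v = (\<Prod>j\<in>UNIV. if j = i then (v $ i) ^ k else 1)"
    unfolding monom_value_def by (intro prod.cong) (auto simp: lookup_single when_def)
  then show ?thesis by (simp add: prod.delta)
qed

lemma meval_superset:
  assumes "finite M" "Poly_Mapping.keys F \<subseteq> M"
  shows "meval F v = (\<Sum>m\<in>M. Poly_Mapping.lookup F m * monom_value m v)"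
  unfolding meval_def monom_value_def[symmetric]
  using assms by (intro sum.mono_neutral_left) (auto simp: in_keys_iff)

lemma meval_0 [simp]: "meval 0 v = 0"
  by (simp add: meval_def)

lemma meval_single: "meval (Poly_Mapping.single m c) v = c * monom_value m v"
  by (subst meval_superset[of "{m}"]) auto

lemma meval_add [simp]: "meval (F + G) v = meval F v + meval G v"
proof -
  let ?M = "Poly_Mapping.keys F \<union> Poly_Mapping.keys G"
  have "Poly_Mapping.keys (F + G) \<subseteq> ?M" by (rule keys_add)
  then show ?thesis
    by (simp add: meval_superset[of ?M] lookup_add sum.distrib distrib_right)
qed

lemma meval_minus [simp]: "meval (- F) v = - meval F v"
  using meval_add[of F "- F" v] by (simp add: eq_neg_iff_add_eq_0 add.commute)

lemma meval_diff [simp]: "meval (F - G) v = meval F v - meval G v"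
  using meval_add[of F "- G" v] by simp

lemma meval_sum: "meval (sum F I) v = (\<Sum>i\<in>I. meval (F i) v)"
  by (induction I rule: infinite_finite_induct) auto

lemma meval_mult [simp]: "meval (F * G) v = meval F v * meval G v"
proof -
  have "meval (F * G) v = meval ((\<Sum>m\<in>Poly_Mapping.keys F. Poly_Mapping.single m (Poly_Mapping.lookup F m)) *
      (\<Sum>m\<in>Poly_Mapping.keys G. Poly_Mapping.single m (Poly_Mapping.lookup G m))) v"
    by (simp flip: poly_mapping_sum_single)
  also have "\<dots> = meval (\<Sum>m\<in>Poly_Mapping.keys F. Poly_Mapping.single m (Poly_Mapping.lookup F m)) v *
      meval (\<Sum>m\<in>Poly_Mapping.keys G. Poly_Mapping.single m (Poly_Mapping.lookup G m)) v"
    by (simp add: sum_product meval_sum mult_single meval_single monom_value_add mult_ac)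
  finally show ?thesis by (simp flip: poly_mapping_sum_single)
qed

lemma meval_mconst [simp]: "meval (mconst c) v = c"
  by (simp add: mconst_def meval_single)

lemma meval_1 [simp]: "meval 1 v = 1"
  using meval_mconst[of 1 v] by (simp add: mconst_def)

lemma meval_power [simp]: "meval (F ^ n) v = meval F v ^ n"
  by (induction n) auto

lemma meval_prod: "meval (prod F I) v = (\<Prod>i\<in>I. meval (F i) v)"
  by (induction I rule: infinite_finite_induct) auto

definition mdegree :: "('n::finite \<Rightarrow>\<^sub>0 nat) \<Rightarrow> nat" where
  "mdegree m = (\<Sum>i\<in>UNIV. Poly_Mapping.lookup m i)"

lemma mdegree_add: "mdegree (m + m') = mdegree m + mdegree m'"
  by (simp add: mdegree_def lookup_add sum.distrib)

lemma mdegree_0 [simp]: "mdegree 0 = 0"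
  by (simp add: mdegree_def)

lemma mdegree_single [simp]: "mdegree (Poly_Mapping.single i k) = k"
  by (simp add: mdegree_def lookup_single when_def sum.delta')

lemma form_iff: "form d F \<longleftrightarrow> (\<forall>m\<in>Poly_Mapping.keys F. mdegree m = d)"
  by (simp add: form_def mdegree_def)

lemma form_0 [simp]: "form d 0"
  by (simp add: form_iff)

lemma form_single: "mdegree m = d \<Longrightarrow> form d (Poly_Mapping.single m c)"
  by (simp add: form_iff)

lemma form_mconst [simp]: "form 0 (mconst c)"
  by (simp add: mconst_def form_single)

lemma form_1 [simp]: "form 0 1"
  using form_mconst[of 1] by (simp add: mconst_def)

lemma form_add: "form d F \<Longrightarrow> form d G \<Longrightarrow> form d (F + G)"
  unfolding form_iff using keys_add[of F G] by blast

lemma form_minus: "form d F \<Longrightarrow> form d (- F)"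
  by (auto simp: form_iff in_keys_iff)

lemma form_diff: "form d F \<Longrightarrow> form d G \<Longrightarrow> form d (F - G)"
  using form_add[OF _ form_minus, of d F G] by simp

lemma form_sum: "(\<And>i. i \<in> I \<Longrightarrow> form d (F i)) \<Longrightarrow> form d (sum F I)"
  by (induction I rule: infinite_finite_induct) (auto intro: form_add)

lemma form_mult:
  assumes "form d F" "form e G" shows "form (d + e) (F * G)"
  unfolding form_iff
proof
  fix m assume "m \<in> Poly_Mapping.keys (F * G)"
  then obtain a b where "m = a + b" "a \<in> Poly_Mapping.keys F" "b \<in> Poly_Mapping.keys G"
    using keys_mult[of F G] by blast
  then show "mdegree m = d + e" using assms by (auto simp: form_iff mdegree_add)
qed

lemma form_power: "form d F \<Longrightarrow> form (n * d) (F ^ n)"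
  by (induction n) (auto intro: form_mult)

lemma form_prod:
  "(\<And>i. i \<in> I \<Longrightarrow> form (d i) (F i)) \<Longrightarrow> form (sum d I) (prod F I)"
  by (induction I rule: infinite_finite_induct) (auto intro: form_mult)

lemma form_mconst_mult: "form d F \<Longrightarrow> form d (mconst c * F)"
  using form_mult[OF form_mconst, of d F c] by simp

lemma meval_scale:
  assumes "form d F" shows "meval F (c *s v) = c ^ d * meval F v"
proof -
  have "monom_value m (c *s v) = c ^ mdegree m * monom_value m v" for m :: "'a \<Rightarrow>\<^sub>0 nat"
    by (simp add: monom_value_def mdegree_def power_mult_distrib prod.distrib power_sum)
  then show ?thesis
    using assms unfolding meval_superset[OF finite_keys subset_refl] form_iff
    by (simp add: sum_distrib_left mult_ac cong: sum.cong)
qed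

definition linear_form :: "'k::field ^ 'n::finite \<Rightarrow> ('k, 'n) mpoly" where
  "linear_form w = (\<Sum>i\<in>UNIV. Poly_Mapping.single (Poly_Mapping.single i 1) (w $ i))"

lemma form_linear_form [simp]: "form 1 (linear_form w)"
  unfolding linear_form_def by (intro form_sum form_single) simp

lemma form_linear_form' [simp]: "form (Suc 0) (linear_form w)"
  using form_linear_form by simp

lemma meval_linear_form: "meval (linear_form w) v = (\<Sum>i\<in>UNIV. w $ i * v $ i)"
  by (simp add: linear_form_def meval_sum meval_single monom_value_single)

section \<open>Dickson's lemma and finite generation for forms\<close>

text \<open>A monotone subsequence of naturals that is not increasing decreases, and then it is
  constant from the point on where its least value is attained.\<close>

lemma nat_seq_incseq_subseq:
  fixes s :: "nat \<Rightarrow> nat"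
  shows "\<exists>r. strict_mono r \<and> incseq (\<lambda>n. s (r n))"
proof -
  obtain f where f: "strict_mono f" "monoseq (\<lambda>n. s (f n))" using seq_monosub[of s] by auto
  show ?thesis
  proof (cases "incseq (\<lambda>n. s (f n))")
    case False
    then have dec: "decseq (\<lambda>n. s (f n))" using f(2) monoseq_iff by blast
    obtain N where N: "\<And>n. s (f N) \<le> s (f n)"
      using ex_has_least_nat[of "\<lambda>_. True" _ "\<lambda>n. s (f n)"] by blast
    have "s (f (N + n)) = s (f N)" for n
    proof (rule antisym)
      show "s (f (N + n)) \<le> s (f N)" using dec[unfolded decseq_def, rule_format, of N "N + n"] by simp
    qed (rule N)
    then have "incseq (\<lambda>n. s (f (N + n)))" by (simp add: incseq_def)
    moreover have "strict_mono (\<lambda>n. f (N + n))" using f(1) by (simp add: strict_mono_def)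
    ultimately show ?thesis by blast
  qed (use f in blast)
qed

text \<open>The sequence is thinned out one coordinate at a time; once all coordinates increase, any
  two terms are comparable.\<close>

lemma Dickson:
  fixes f :: "nat \<Rightarrow> 'n::finite \<Rightarrow> nat"
  shows "\<exists>i j. i < j \<and> f i \<le> f j"
proof -
  have "\<exists>r. strict_mono r \<and> (\<forall>x\<in>S. incseq (\<lambda>n. f (r n) x))" for S :: "'n set"
  proof (induction S rule: finite_induct[OF finite])
    case 1
    then show ?case by (auto intro: strict_mono_id[unfolded id_def])
  next
    case (2 x S)
    then obtain r where r: "strict_mono r" "\<forall>x\<in>S. incseq (\<lambda>n. f (r n) x)" by blast
    obtain r' where r': "strict_mono r'" "incseq (\<lambda>n. f (r (r' n)) x)"
      using nat_seq_incseq_subseq[of "\<lambda>n. f (r n) x"] by blast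
    have "incseq (\<lambda>n. f (r (r' n)) y)" if "y \<in> S" for y
      using r(2) that strict_mono_mono[OF r'(1)] by (auto simp: incseq_def mono_def)
    moreover have "strict_mono (\<lambda>n. r (r' n))" using r(1) r'(1) by (simp add: strict_mono_def)
    ultimately show ?case using r'(2) by blast
  qed
  from this[of UNIV] obtain r where r: "strict_mono r" "\<And>x. incseq (\<lambda>n. f (r n) x)" by auto
  have "r 0 < r 1" using r(1) by (simp add: strict_mono_def)
  moreover have "f (r 0) \<le> f (r 1)" using r(2) by (auto simp: le_fun_def incseq_def)
  ultimately show ?thesis by blast
qed

text \<open>Integer polynomials, ordered by the sign of the leading coefficient, realise a
  lexicographic monomial order by an additive map.\<close>

lemma monomial_weight_exists:
  "\<exists>wt :: ('n::finite \<Rightarrow>\<^sub>0 nat) \<Rightarrow> int poly. inj wt \<and> (\<forall>m m'. wt (m + m') = wt m + wt m')"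
proof -
  obtain idx :: "'n \<Rightarrow> nat" where idx: "inj idx" using finite_imp_inj_to_nat_seg[OF finite[of "UNIV :: 'n set"]] by blast
  define wt :: "('n \<Rightarrow>\<^sub>0 nat) \<Rightarrow> int poly"
    where "wt m = (\<Sum>i\<in>UNIV. monom (int (Poly_Mapping.lookup m i)) (idx i))" for m
  have "coeff (wt m) (idx i) = int (Poly_Mapping.lookup m i)" for m i
  proof -
    have "coeff (wt m) (idx i) = (\<Sum>j\<in>UNIV. if j = i then int (Poly_Mapping.lookup m i) else 0)"
      unfolding wt_def coeff_sum by (intro sum.cong) (auto simp: inj_eq[OF idx])
    then show ?thesis by simp
  qed
  then have "inj wt" by (intro injI poly_mapping_eqI) (metis of_nat_eq_iff)
  moreover have "wt (m + m') = wt m + wt m'" for m m'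
    by (simp add: wt_def lookup_add flip: sum.distrib add_monom)
  ultimately show ?thesis by blast
qed

lemma lookup_le_mdegree: "Poly_Mapping.lookup m i \<le> mdegree m"
  unfolding mdegree_def by (rule member_le_sum) auto

text \<open>Serves in place of well-foundedness of the monomial order: forms of a fixed degree have
  only finitely many possible leading monomials, so least ones exist.\<close>

lemma finite_monomials_of_degree: "finite {m :: 'n::finite \<Rightarrow>\<^sub>0 nat. mdegree m = d}"
proof -
  have fin: "finite ((UNIV :: 'n set) \<rightarrow>\<^sub>E {..d})" by (rule finite_PiE) simp_all
  have "Poly_Mapping.lookup ` {m :: 'n \<Rightarrow>\<^sub>0 nat. mdegree m = d} \<subseteq> (UNIV :: 'n set) \<rightarrow>\<^sub>E {..d}"
  proof (intro image_subsetI PiE_I)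
    fix m :: "'n \<Rightarrow>\<^sub>0 nat" and i
    assume "m \<in> {m. mdegree m = d}"
    then show "Poly_Mapping.lookup m i \<in> {..d}" using lookup_le_mdegree[of m i] by simp
  qed simp
  from finite_subset[OF this fin] show ?thesis
    by (rule finite_imageD) (rule inj_onI, simp only: poly_mapping_eq_iff)
qed

text \<open>Membership in the ideal generated by the \<open>F i\<close> with \<open>i < n\<close>,
  with homogeneous cofactors. If \<open>\<delta> i\<close> exceeds \<open>d\<close>, the cofactor is
  forced to be 0, because truncated subtraction would otherwise admit a nonzero constant.\<close>

definition form_combination ::
  "(nat \<Rightarrow> nat) \<Rightarrow> (nat \<Rightarrow> ('k::field, 'n::finite) mpoly) \<Rightarrow> nat \<Rightarrow> nat \<Rightarrow> ('k, 'n) mpoly \<Rightarrow> bool" where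
  "form_combination \<delta> F n d A \<longleftrightarrow>
     (\<exists>H. (\<forall>i<n. if \<delta> i \<le> d then form (d - \<delta> i) (H i) else H i = 0) \<and> A = (\<Sum>i<n. H i * F i))"

lemma form_combination_add:
  assumes "form_combination \<delta> F n d A" "form_combination \<delta> F n d B"
  shows "form_combination \<delta> F n d (A + B)"
proof -
  obtain H H' where "\<forall>i<n. if \<delta> i \<le> d then form (d - \<delta> i) (H i) else H i = 0" "A = (\<Sum>i<n. H i * F i)"
    "\<forall>i<n. if \<delta> i \<le> d then form (d - \<delta> i) (H' i) else H' i = 0" "B = (\<Sum>i<n. H' i * F i)"
    using assms unfolding form_combination_def by blast
  then show ?thesis unfolding form_combination_def
    by (intro exI[of _ "\<lambda>i. H i + H' i"]) (auto intro: form_add simp: distrib_right sum.distrib)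
qed

lemma form_combination_mult:
  assumes "form_combination \<delta> F n d A" "form e M"
  shows "form_combination \<delta> F n (d + e) (M * A)"
proof -
  obtain H where H: "\<forall>i<n. if \<delta> i \<le> d then form (d - \<delta> i) (H i) else H i = 0" "A = (\<Sum>i<n. H i * F i)"
    using assms unfolding form_combination_def by blast
  have "if \<delta> i \<le> d + e then form (d + e - \<delta> i) (M * H i) else M * H i = 0" if "i < n" for i
    using H(1) that form_mult[OF assms(2), of "d - \<delta> i" "H i"]
    by (cases "\<delta> i \<le> d") (auto simp: add.commute)
  then show ?thesis unfolding form_combination_def H(2)
    by (intro exI[of _ "\<lambda>i. M * H i"]) (auto simp: sum_distrib_left mult.assoc)
qed

lemma form_combination_mono:
  assumes "form_combination \<delta> F n d A" "n \<le> n'"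
  shows "form_combination \<delta> F n' d A"
proof -
  obtain H where H: "\<forall>i<n. if \<delta> i \<le> d then form (d - \<delta> i) (H i) else H i = 0" "A = (\<Sum>i<n. H i * F i)"
    using assms unfolding form_combination_def by blast
  have "A = (\<Sum>i<n'. (if i < n then H i else 0) * F i)"
    unfolding H(2) using assms(2) by (intro sum.mono_neutral_cong_left) auto
  then show ?thesis unfolding form_combination_def
    using H(1) by (intro exI[of _ "\<lambda>i. if i < n then H i else 0"]) auto
qed

lemma form_combination_self: "form_combination \<delta> F (Suc n) (\<delta> n) (F n)"
proof -
  have "F n = (\<Sum>i<Suc n. (if i = n then 1 else 0) * F i)" by simp
  then show ?thesis unfolding form_combination_def
    by (intro exI[of _ "\<lambda>i. if i = n then 1 else 0"]) auto
qed

lemma form_combination_uminus: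
  "form_combination \<delta> F n d A \<Longrightarrow> form_combination \<delta> F n d (- A)"
  using form_combination_mult[of \<delta> F n d A 0 "mconst (-1)"]
  by (simp add: mconst_def single_uminus form_minus)

text \<open>Hilbert's basis theorem for forms, in the manner of Groebner bases: each
  \<open>F n\<close> is replaced by a remainder \<open>A n\<close> modulo its predecessors with
  least leading monomial. By Dickson's lemma the leading monomial of some \<open>A i\<close> divides
  that of a later \<open>A n\<close>, and subtracting a multiple of \<open>A i\<close> lowers the
  latter further.\<close>

theorem form_sequence_dependent:
  fixes F :: "nat \<Rightarrow> ('k::field, 'n::finite) mpoly"
  assumes F: "\<And>n. form (\<delta> n) (F n)"
  shows "\<exists>n. form_combination \<delta> F n (\<delta> n) (F n)"
proof (rule ccontr)
  assume contra: "\<not> ?thesis"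
  obtain wt :: "('n \<Rightarrow>\<^sub>0 nat) \<Rightarrow> int poly"
    where wt: "inj wt" "\<And>m m'. wt (m + m') = wt m + wt m'" using monomial_weight_exists by blast
  \<comment> \<open>Remainders: the forms congruent to \<open>F n\<close> modulo the earlier
    \<open>F i\<close>. Under the negated claim none of them is zero.\<close>
  define R where "R n = {A. form (\<delta> n) A \<and> form_combination \<delta> F n (\<delta> n) (F n - A)}" for n
  define lw where "lw A = Max (wt ` Poly_Mapping.keys A)" for A :: "('k, 'n) mpoly"
  have nz: "A \<noteq> 0" if "A \<in> R n" for A n using that contra by (auto simp: R_def)
  have lw_le: "wt m \<le> lw A" if "m \<in> Poly_Mapping.keys A" for m A
    unfolding lw_def using that by (intro Max_ge) auto
  have lw_ex: "\<exists>m\<in>Poly_Mapping.keys A. wt m = lw A" if "A \<noteq> 0" for A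
  proof -
    have "lw A \<in> wt ` Poly_Mapping.keys A" unfolding lw_def using that by (intro Max_in) auto
    then show ?thesis by auto
  qed
  have "\<exists>A\<in>R n. \<forall>A'\<in>R n. lw A \<le> lw A'" for n
  proof -
    have "lw ` R n \<subseteq> wt ` {m. mdegree m = \<delta> n}"
    proof
      fix x assume "x \<in> lw ` R n"
      then obtain A where A: "A \<in> R n" "x = lw A" by blast
      obtain m where "m \<in> Poly_Mapping.keys A" "wt m = lw A" using lw_ex[OF nz[OF A(1)]] by blast
      then show "x \<in> wt ` {m. mdegree m = \<delta> n}"
        using A by (auto simp: R_def form_iff intro!: rev_image_eqI[of m])
    qed
    then have fin: "finite (lw ` R n)" using finite_monomials_of_degree finite_subset by blast
    have "F n \<in> R n" using F by (auto simp: R_def form_combination_def intro: exI[of _ "\<lambda>_. 0"])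
    then have "lw ` R n \<noteq> {}" by blast
    then obtain A where "A \<in> R n" "lw A = Min (lw ` R n)" using Min_in[OF fin] by (metis imageE)
    then show ?thesis using fin by (metis Min_le imageI)
  qed
  then obtain A where A: "\<And>n. A n \<in> R n" "\<And>n A'. A' \<in> R n \<Longrightarrow> lw (A n) \<le> lw A'" by metis
  have "\<forall>n. \<exists>m. m \<in> Poly_Mapping.keys (A n) \<and> wt m = lw (A n)" using lw_ex nz A(1) by blast
  then obtain lm where lm: "\<And>n. lm n \<in> Poly_Mapping.keys (A n)" "\<And>n. wt (lm n) = lw (A n)" by metis
  obtain i n where "i < n" and le: "\<And>x. Poly_Mapping.lookup (lm i) x \<le> Poly_Mapping.lookup (lm n) x"
    using Dickson[of "\<lambda>n. Poly_Mapping.lookup (lm n)"] by (auto simp: le_fun_def)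
  define m' where "m' = lm n - lm i"
  have m': "lm n = m' + lm i" unfolding m'_def
    by (rule poly_mapping_eqI) (simp add: lookup_add lookup_minus le)
  \<comment> \<open>Chosen so that the leading terms of \<open>A n\<close> and
    \<open>T * A i\<close> cancel.\<close>
  define c where "c = Poly_Mapping.lookup (A n) (lm n) / Poly_Mapping.lookup (A i) (lm i)"
  define T where "T = Poly_Mapping.single m' c"
  have degs: "mdegree (lm n) = \<delta> n" "mdegree (lm i) = \<delta> i"
    using A(1) lm(1) by (auto simp: R_def form_iff)
  then have deg: "\<delta> n = \<delta> i + mdegree m'" using m' by (simp add: mdegree_add)
  have formT: "form (mdegree m') T" by (simp add: T_def form_single)
  have Ai: "form (\<delta> i) (A i)" "form_combination \<delta> F n (\<delta> i) (A i)"
  proof -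
    show "form (\<delta> i) (A i)" using A(1) by (simp add: R_def)
    have "form_combination \<delta> F n (\<delta> i) (F i)" "form_combination \<delta> F n (\<delta> i) (F i - A i)"
      using form_combination_mono[OF form_combination_self, of i n] form_combination_mono[of \<delta> F i _ _ n]
        \<open>i < n\<close> A(1)[of i] by (auto simp: R_def)
    from form_combination_add[OF this(1) form_combination_uminus[OF this(2)]]
    show "form_combination \<delta> F n (\<delta> i) (A i)" by simp
  qed
  define B where "B = A n - T * A i"
  have BR: "B \<in> R n"
  proof -
    have "form (\<delta> n) B"
      using A(1)[of n] form_mult[OF formT Ai(1)] deg by (auto simp: B_def R_def add.commute intro: form_diff)
    moreover have "form_combination \<delta> F n (\<delta> n) ((F n - A n) + T * A i)"
      using A(1)[of n] form_combination_mult[OF Ai(2) formT] deg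
      by (intro form_combination_add) (auto simp: R_def)
    ultimately show ?thesis by (simp add: R_def B_def algebra_simps)
  qed
  have lookup_T: "Poly_Mapping.lookup (T * A i) (m' + l) = c * Poly_Mapping.lookup (A i) l" for l
  proof -
    have "T * A i = (\<Sum>m\<in>Poly_Mapping.keys (A i). Poly_Mapping.single (m' + m) (c * Poly_Mapping.lookup (A i) m))"
      by (subst poly_mapping_sum_single[of "A i"]) (simp add: T_def sum_distrib_left mult_single)
    then show ?thesis by (simp add: lookup_sum lookup_single when_def in_keys_iff)
  qed
  obtain l where l: "l \<in> Poly_Mapping.keys B" "wt l = lw B" using lw_ex[OF nz[OF BR]] by blast
  have "wt l \<le> lw (A n)"
  proof -
    have "l \<in> Poly_Mapping.keys (A n) \<union> Poly_Mapping.keys (T * A i)"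
      using l(1) keys_diff unfolding B_def by (auto simp: in_keys_iff lookup_minus)
    \<comment> \<open>Additivity of \<open>wt\<close> makes the order compatible with
      multiplication: no weight in \<open>T * A i\<close> exceeds \<open>wt m' + wt (lm i)\<close>,
      which is the weight of \<open>lm n\<close>.\<close>
    moreover have "wt l \<le> lw (A n)" if tl: "l \<in> Poly_Mapping.keys (T * A i)"
    proof -
      obtain a b where ab: "l = a + b" "a \<in> Poly_Mapping.keys T" "b \<in> Poly_Mapping.keys (A i)"
        using keys_mult[of T "A i"] tl by blast
      then have "a = m'" by (auto simp: T_def split: if_splits)
      then have "wt l \<le> wt m' + wt (lm i)" using lw_le[OF ab(3)] lm(2)[of i] by (simp add: ab(1) wt(2))
      then show ?thesis using m' lm(2)[of n] wt(2) by metis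
    qed
    ultimately show ?thesis using lw_le by blast
  qed
  moreover have "l \<noteq> lm n"
  proof
    assume "l = lm n"
    have "Poly_Mapping.lookup (A i) (lm i) \<noteq> 0" using lm(1)[of i] by (simp add: in_keys_iff)
    then have "Poly_Mapping.lookup B (lm n) = 0"
      using lookup_T[of "lm i"] by (simp add: B_def lookup_minus c_def flip: m')
    then show False using l(1) \<open>l = lm n\<close> by (simp add: in_keys_iff)
  qed
  then have "wt l \<noteq> lw (A n)" using wt(1) lm(2)[of n] by (metis injD)
  ultimately have "lw B < lw (A n)" using l(2) by simp
  then show False using A(2)[OF BR] by simp
qed

section \<open>Zariski closed sets of a curve\<close>

lemma rep_proj_point_nonzero: "rep_proj_point P \<noteq> 0"
  using Quotient3_rep_reflp[OF Quotient3_proj_point, of P] by (simp add: proportional_def)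

lemma abs_rep_proj_point: "abs_proj_point (rep_proj_point P) = P"
  by (rule Quotient3_abs_rep[OF Quotient3_proj_point])

lemma rep_abs_proj_point:
  assumes "v \<noteq> 0" obtains c where "c \<noteq> 0" "rep_proj_point (abs_proj_point v) = c *s v"
proof -
  have "proportional v v" using assms by (auto simp: proportional_def intro!: exI[of _ 1])
  then have "proportional (rep_proj_point (abs_proj_point v)) v"
    by (rule Quotient3_rep_abs[OF Quotient3_proj_point])
  then show thesis using that by (auto simp: proportional_def)
qed

lemma zariski_closed_zeros: "form d F \<Longrightarrow> zariski_closed {P. form_at F P = 0}"
  unfolding zariski_closed_def by (intro exI[of _ "{F}"]) auto

lemma zariski_closed_Int: "zariski_closed A \<Longrightarrow> zariski_closed B \<Longrightarrow> zariski_closed (A \<inter> B)"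
  unfolding zariski_closed_def
proof (elim exE conjE)
  fix S T
  assume "\<forall>F\<in>S. \<exists>d. form d F" "A = {P. \<forall>F\<in>S. form_at F P = 0}"
    "\<forall>F\<in>T. \<exists>d. form d F" "B = {P. \<forall>F\<in>T. form_at F P = 0}"
  then show "\<exists>S. (\<forall>F\<in>S. \<exists>d. form d F) \<and> A \<inter> B = {P. \<forall>F\<in>S. form_at F P = 0}"
    by (intro exI[of _ "S \<union> T"]) auto
qed

lemma zariski_closed_separating_form:
  assumes "zariski_closed Z" "P \<notin> Z"
  obtains d F where "form d F" "form_at F P \<noteq> 0" "\<forall>Q\<in>Z. form_at F Q = 0"
  using assms unfolding zariski_closed_def by blast

text \<open>Non-proportional coordinate vectors \<open>v\<close>, \<open>u\<close> have a nonzero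
  2x2 minor; with \<open>u\<close> replaced by the variable \<open>x\<close>, this minor is the
  linear form \<open>v $ j * x $ i - v $ i * x $ j\<close>.\<close>

lemma linear_form_separating:
  assumes "P \<noteq> Q"
  obtains w where "meval (linear_form w) (rep_proj_point P) = 0" "meval (linear_form w) (rep_proj_point Q) \<noteq> 0"
proof -
  define v where "v = rep_proj_point P"
  define u where "u = rep_proj_point Q"
  have nz: "v \<noteq> 0" "u \<noteq> 0" unfolding u_def v_def by (rule rep_proj_point_nonzero)+
  then obtain j where j: "v $ j \<noteq> 0" by (auto simp: vec_eq_iff)
  have "\<exists>i. u $ i * v $ j \<noteq> u $ j * v $ i"
  proof (rule ccontr)
    assume "\<not> ?thesis"
    then have eq: "\<And>i. u $ i * v $ j = u $ j * v $ i" by blast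
    have u: "u = (u $ j / v $ j) *s v" using eq j by (auto simp: vec_eq_iff field_simps)
    then have "u $ j / v $ j \<noteq> 0" using nz by auto
    then have "proportional u v" using u nz unfolding proportional_def by blast
    then have "abs_proj_point u = abs_proj_point v"
      using Quotient3_rel_abs[OF Quotient3_proj_point] by blast
    then show False using assms by (simp add: u_def v_def abs_rep_proj_point)
  qed
  then obtain i where i: "u $ i * v $ j \<noteq> u $ j * v $ i" by blast
  have ev: "meval (linear_form (v $ j *s axis i 1 - v $ i *s axis j 1)) x = v $ j * x $ i - v $ i * x $ j" for x
  proof -
    have "meval (linear_form (v $ j *s axis i 1 - v $ i *s axis j 1)) x =
        (\<Sum>l\<in>UNIV. (if l = i then v $ j * x $ i else 0) - (if l = j then v $ i * x $ j else 0))"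
      unfolding meval_linear_form by (intro sum.cong) (auto simp: axis_def left_diff_distrib)
    then show ?thesis by (simp add: sum_subtractf)
  qed
  show thesis
    by (rule that[of "v $ j *s axis i 1 - v $ i *s axis j 1"]; unfold ev)
      (use i in \<open>auto simp: u_def v_def mult.commute\<close>)
qed

lemma zariski_closed_point: "zariski_closed {P}"
  unfolding zariski_closed_def
proof (intro exI conjI)
  let ?S = "{F. \<exists>w. F = linear_form w \<and> form_at F P = 0}"
  show "\<forall>F\<in>?S. \<exists>d. form d F" using form_linear_form by blast
  show "{P} = {Q. \<forall>F\<in>?S. form_at F Q = 0}"
  proof (intro equalityI subsetI)
    fix Q assume Q: "Q \<in> {Q. \<forall>F\<in>?S. form_at F Q = 0}"
    show "Q \<in> {P}"
    proof (rule ccontr)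
      assume "Q \<notin> {P}"
      then have "P \<noteq> Q" by simp
      from linear_form_separating[OF this] obtain w
        where "form_at (linear_form w) P = 0" "form_at (linear_form w) Q \<noteq> 0" .
      then show False using Q by blast
    qed
  qed simp
qed

lemma irreducible_closed_point: "irreducible_closed {P}"
  unfolding irreducible_closed_def using zariski_closed_point by auto

text \<open>A strictly descending chain yields forms \<open>F n\<close> that vanish on
  \<open>Z (Suc n)\<close> but not at some \<open>p n\<close> in \<open>Z n\<close>. An
  \<open>F n\<close> that is a combination of earlier ones would vanish at \<open>p n\<close>, since
  all earlier ones do.\<close>

lemma zariski_noetherian:
  fixes Z :: "nat \<Rightarrow> ('k::field, 'n::finite) proj_point set"
  assumes closed: "\<And>n. zariski_closed (Z n)"
  shows "\<not> (\<forall>n. Z (Suc n) \<subset> Z n)"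
proof
  assume dec: "\<forall>n. Z (Suc n) \<subset> Z n"
  have mono: "Z n \<subseteq> Z m" if "m \<le> n" for m n
    using that dec by (induction n rule: dec_induct) auto
  have "\<forall>n. \<exists>F. \<exists>d P. form d F \<and> P \<in> Z n \<and> form_at F P \<noteq> 0 \<and> (\<forall>Q\<in>Z (Suc n). form_at F Q = 0)"
  proof
    fix n
    obtain P where P: "P \<in> Z n" "P \<notin> Z (Suc n)" using dec by blast
    from zariski_closed_separating_form[OF closed P(2)] obtain d F
      where "form d F" "form_at F P \<noteq> 0" "\<forall>Q\<in>Z (Suc n). form_at F Q = 0" .
    then show "\<exists>F. \<exists>d P. form d F \<and> P \<in> Z n \<and> form_at F P \<noteq> 0 \<and> (\<forall>Q\<in>Z (Suc n). form_at F Q = 0)"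
      using P by blast
  qed
  then obtain F \<delta> p where F: "\<And>n. form (\<delta> n) (F n)" "\<And>n. p n \<in> Z n" "\<And>n. form_at (F n) (p n) \<noteq> 0"
    "\<And>n Q. Q \<in> Z (Suc n) \<Longrightarrow> form_at (F n) Q = 0"
    by metis
  obtain n where "form_combination \<delta> F n (\<delta> n) (F n)" using form_sequence_dependent[of \<delta> F] F(1) by blast
  then obtain H where H: "F n = (\<Sum>i<n. H i * F i)" by (auto simp: form_combination_def)
  have "form_at (F i) (p n) = 0" if "i < n" for i
    using F(4)[of "p n" i] mono[of "Suc i" n] F(2)[of n] that by auto
  then have "form_at (F n) (p n) = 0" unfolding H by (simp add: meval_sum)
  then show False using F(3) by blast
qed

text \<open>Noetherian induction, stated as existence of a minimal closed subset; it is applied with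
  infinitude as \<open>R\<close>.\<close>

lemma zariski_closed_minimal:
  fixes Z :: "('k::field, 'n::finite) proj_point set"
  assumes "zariski_closed Z" "R Z"
  obtains Y where "zariski_closed Y" "R Y" "Y \<subseteq> Z" "\<forall>A. zariski_closed A \<longrightarrow> R A \<longrightarrow> A \<subseteq> Y \<longrightarrow> A = Y"
proof -
  let ?r = "{(A :: ('k, 'n) proj_point set, B). zariski_closed A \<and> zariski_closed B \<and> A \<subset> B}"
  have "wf ?r"
    unfolding wf_iff_no_infinite_down_chain
  proof
    assume "\<exists>f. \<forall>i. (f (Suc i), f i) \<in> ?r"
    then obtain f where f: "\<forall>i. (f (Suc i), f i) \<in> ?r" by (elim exE)
    have "zariski_closed (f i)" "f (Suc i) \<subset> f i" for i using spec[OF f, of i] by simp_all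
    then show False using zariski_noetherian[of f] by blast
  qed
  then have "\<exists>Y\<in>{A. zariski_closed A \<and> R A \<and> A \<subseteq> Z}.
      \<forall>A. (A, Y) \<in> ?r \<longrightarrow> A \<notin> {A. zariski_closed A \<and> R A \<and> A \<subseteq> Z}"
    by (rule mp[OF spec[OF spec[OF iffD1[OF wf_eq_minimal]]], of _ Z]) (use assms in simp)
  then obtain Y where Y: "zariski_closed Y" "R Y" "Y \<subseteq> Z"
    "\<forall>A. (A, Y) \<in> ?r \<longrightarrow> A \<notin> {A. zariski_closed A \<and> R A \<and> A \<subseteq> Z}" by blast
  show thesis
  proof (rule that[OF Y(1-3)], intro allI impI)
    fix A assume A: "zariski_closed A" "R A" "A \<subseteq> Y"
    show "A = Y"
    proof (rule ccontr)
      assume "A \<noteq> Y"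
      then have "(A, Y) \<in> ?r" using A Y(1) by auto
      then have "A \<notin> {A. zariski_closed A \<and> R A \<and> A \<subseteq> Z}" using Y(4) by blast
      then show False using A Y(3) by auto
    qed
  qed
qed

section \<open>Primality of the vanishing ideal, and finiteness of proper closed subsets of a
  curve\<close>

definition vanishes_on :: "('k::field, 'n::finite) proj_point set \<Rightarrow> ('k, 'n) mpoly \<Rightarrow> bool" where
  "vanishes_on X F \<longleftrightarrow> (\<forall>P\<in>X. form_at F P = 0)"

locale irreducible_variety =
  fixes X :: "('k::field, 'n::finite) proj_point set"
  assumes irreducible: "irreducible_closed X"
begin

lemma nonempty: "X \<noteq> {}" and closed: "zariski_closed X"
  using irreducible by (auto simp: irreducible_closed_def)

text \<open>Irreducibility of \<open>X\<close>, applied to the zero sets of \<open>F\<close> and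
  \<open>G\<close>, makes the homogeneous vanishing ideal prime. This is what turns fractions of
  forms into a field.\<close>

lemma vanishes_on_mult:
  assumes "form d F" "form e G"
  shows "vanishes_on X (F * G) \<longleftrightarrow> vanishes_on X F \<or> vanishes_on X G"
proof
  assume "vanishes_on X (F * G)"
  then have "X \<subseteq> {P. form_at F P = 0} \<union> {P. form_at G P = 0}" by (auto simp: vanishes_on_def)
  then have "X \<subseteq> {P. form_at F P = 0} \<or> X \<subseteq> {P. form_at G P = 0}"
    using irreducible assms zariski_closed_zeros unfolding irreducible_closed_def by blast
  then show "vanishes_on X F \<or> vanishes_on X G" by (auto simp: vanishes_on_def)
qed (auto simp: vanishes_on_def)

lemma not_vanishes_on_1 [simp]: "\<not> vanishes_on X 1"
  using nonempty by (auto simp: vanishes_on_def)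

lemma vanishes_on_power:
  assumes "form d F" "vanishes_on X (F ^ n)" shows "vanishes_on X F"
  using assms(2)
proof (induction n)
  case (Suc n)
  then show ?case using vanishes_on_mult[OF assms(1) form_power[OF assms(1), of n]] by auto
qed auto

end

locale smooth_curve =
  fixes X :: "('k::alg_closed_field, 'n::finite) proj_point set"
  assumes smooth_projective_curve: "smooth_projective_curve X"

sublocale smooth_curve \<subseteq> irreducible_variety
  using smooth_projective_curve by unfold_locales (simp add: smooth_projective_curve_def)

context smooth_curve
begin

lemma other_point: "\<exists>Q\<in>X. Q \<noteq> P"
proof -
  obtain Z where Z: "irreducible_chain X 1 Z"
    using smooth_projective_curve by (auto simp: smooth_projective_curve_def has_krull_dim_def)
  have "Z 0 \<subset> Z 1" "Z 1 \<subseteq> X" "irreducible_closed (Z 0)"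
    using Z by (simp_all add: irreducible_chain_def)
  moreover from this(3) have "Z 0 \<noteq> {}" by (simp add: irreducible_closed_def)
  ultimately have "\<exists>x y. x \<in> X \<and> y \<in> X \<and> x \<noteq> y" by blast
  then show ?thesis by metis
qed

text \<open>A minimal infinite closed subset \<open>Y\<close> of the intersection is irreducible,
  and then a point, \<open>Y\<close> and \<open>X\<close> form a chain too long for dimension
  1.\<close>

lemma finite_proper_closed:
  assumes Z: "zariski_closed Z" "\<not> X \<subseteq> Z"
  shows "finite (X \<inter> Z)"
proof (rule ccontr)
  assume "infinite (X \<inter> Z)"
  from zariski_closed_minimal[of "X \<inter> Z" infinite, OF zariski_closed_Int[OF closed Z(1)] this] obtain Y
    where Y: "zariski_closed Y" "infinite Y" "Y \<subseteq> X \<inter> Z"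
      "\<forall>A. zariski_closed A \<longrightarrow> infinite A \<longrightarrow> A \<subseteq> Y \<longrightarrow> A = Y" .
  have irr: "irreducible_closed Y"
    unfolding irreducible_closed_def
  proof (intro conjI allI impI)
    show "zariski_closed Y" by (rule Y)
    show "Y \<noteq> {}" using Y(2) by auto
    fix A B assume AB: "zariski_closed A \<and> zariski_closed B \<and> Y \<subseteq> A \<union> B"
    then have "Y = (Y \<inter> A) \<union> (Y \<inter> B)" by blast
    \<comment> \<open>One of the two closed pieces is infinite, so by minimality it is all of
      \<open>Y\<close>.\<close>
    then have "infinite (Y \<inter> A) \<or> infinite (Y \<inter> B)" using Y(2) by (metis finite_UnI)
    then have "Y \<inter> A = Y \<or> Y \<inter> B = Y"
      using Y(4)[rule_format, of "Y \<inter> A"] Y(4)[rule_format, of "Y \<inter> B"] AB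
        zariski_closed_Int[OF Y(1), of A] zariski_closed_Int[OF Y(1), of B] by blast
    then show "Y \<subseteq> A \<or> Y \<subseteq> B" by blast
  qed
  obtain P where P: "P \<in> Y" using Y(2) by fastforce
  have "{P} \<subset> Y" using P Y(2) by (metis finite.emptyI finite_insert psubsetI singletonD subsetI)
  moreover have "Y \<subset> X" using Y(3) Z(2) by blast
  ultimately have "irreducible_chain X (Suc 1) (\<lambda>i. if i = 0 then {P} else if i = 1 then Y else X)"
    using irreducible irreducible_closed_point irr P
    by (auto simp: irreducible_chain_def)
  then show False
    using smooth_projective_curve unfolding smooth_projective_curve_def has_krull_dim_def by blast
qed

lemma finite_zeros:
  assumes "form d F" "\<not> vanishes_on X F"
  shows "finite {P \<in> X. form_at F P = 0}"
proof -
  have "\<not> X \<subseteq> {P. form_at F P = 0}" using assms by (auto simp: vanishes_on_def)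
  from finite_proper_closed[OF zariski_closed_zeros[OF assms(1)] this] show ?thesis
    by (simp add: Int_def conj_commute)
qed

end

section \<open>Local structure at a smooth point\<close>

text \<open>When \<open>l\<close> has value 1 at \<open>v\<close>, this is the homogeneous version
  of the affine function \<open>w\<close> minus its value at \<open>v\<close>, in the chart where
  \<open>l\<close> does not vanish; in particular it vanishes at \<open>v\<close>.\<close>

definition centered :: "'k::field ^ 'n::finite \<Rightarrow> 'k ^ 'n \<Rightarrow> 'k ^ 'n \<Rightarrow> ('k, 'n) mpoly" where
  "centered l v w = linear_form w - mconst (meval (linear_form w) v) * linear_form l"

lemma form_centered [simp]: "form 1 (centered l v w)"
  unfolding centered_def by (intro form_diff form_mconst_mult form_linear_form)

lemma form_centered' [simp]: "form (Suc 0) (centered l v w)"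
  using form_centered by simp

lemma meval_centered:
  "meval (centered l v w) x =
     meval (linear_form w) x - meval (linear_form w) v * meval (linear_form l) x"
  by (simp add: centered_def)

lemma meval_linear_form_add:
  "meval (linear_form (w + w')) x = meval (linear_form w) x + meval (linear_form w') x"
  by (simp add: meval_linear_form distrib_right sum.distrib)

lemma meval_linear_form_scale:
  "meval (linear_form (c *s w)) x = c * meval (linear_form w) x"
  by (simp add: meval_linear_form sum_distrib_left mult.assoc)

lemma linear_form_axis: "linear_form (axis j 1) = Poly_Mapping.single (Poly_Mapping.single j 1) 1"
proof -
  have "linear_form (axis j 1) =
      (\<Sum>i\<in>UNIV. if i = j then Poly_Mapping.single (Poly_Mapping.single j 1) 1 else 0)"
    unfolding linear_form_def by (intro sum.cong) (auto simp: axis_def)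
  then show ?thesis by simp
qed

lemma meval_linear_form_axis [simp]: "meval (linear_form (axis j 1)) x = x $ j"
  by (simp add: linear_form_axis meval_single monom_value_single)

lemma meval_mderiv:
  "meval (mderiv i F) v = (\<Sum>m\<in>Poly_Mapping.keys F.
     of_nat (Poly_Mapping.lookup m i) * Poly_Mapping.lookup F m * monom_value (m - Poly_Mapping.single i 1) v)"
  by (simp add: mderiv_def meval_sum meval_single)

lemma monom_value_minus_single:
  assumes "0 < Poly_Mapping.lookup m i"
  shows "v $ i * monom_value (m - Poly_Mapping.single i 1) v = monom_value m v"
proof -
  have "m = Poly_Mapping.single i 1 + (m - Poly_Mapping.single i 1)"
    using assms by (intro poly_mapping_eqI) (auto simp: lookup_add lookup_minus lookup_single when_def)
  then have "monom_value m v = monom_value (Poly_Mapping.single i 1 + (m - Poly_Mapping.single i 1)) v"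
    by simp
  then show ?thesis by (simp only: monom_value_add monom_value_single power_one_right)
qed

text \<open>The operator \<open>x_i d/dx_i\<close> multiplies a monomial by its exponent in
  \<open>x_i\<close>, and the exponents add up to the degree. At zeros of \<open>F\<close> the
  relation makes the coordinate vector orthogonal to the gradient.\<close>

lemma euler_relation:
  assumes "form d F"
  shows "(\<Sum>i\<in>UNIV. v $ i * meval (mderiv i F) v) = of_nat d * meval F v"
proof -
  have eq: "v $ i * (of_nat (Poly_Mapping.lookup m i) * c * monom_value (m - Poly_Mapping.single i 1) v) =
      of_nat (Poly_Mapping.lookup m i) * (c * monom_value m v)" for i m c
    using monom_value_minus_single[of m i v] by (cases "Poly_Mapping.lookup m i = 0") (auto simp: algebra_simps)
  have "(\<Sum>i\<in>UNIV. v $ i * meval (mderiv i F) v) =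
      (\<Sum>i\<in>UNIV. \<Sum>m\<in>Poly_Mapping.keys F. of_nat (Poly_Mapping.lookup m i) * (Poly_Mapping.lookup F m * monom_value m v))"
    by (simp only: meval_mderiv sum_distrib_left eq)
  also have "\<dots> = (\<Sum>m\<in>Poly_Mapping.keys F. of_nat (mdegree m) * (Poly_Mapping.lookup F m * monom_value m v))"
    by (subst sum.swap) (simp add: mdegree_def sum_distrib_right)
  also have "\<dots> = (\<Sum>m\<in>Poly_Mapping.keys F. of_nat d * (Poly_Mapping.lookup F m * monom_value m v))"
    using assms by (intro sum.cong) (auto simp: form_iff)
  also have "\<dots> = of_nat d * meval F v"
    by (simp add: meval_superset[OF finite_keys subset_refl] sum_distrib_left)
  finally show ?thesis .
qed

text \<open>First-order Taylor expansion at \<open>v\<close>, homogenised with \<open>l\<close>: the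
  \<open>N i\<close> take the values of the partial derivatives at \<open>v\<close>. The monomial is
  built up one variable at a time. Degree 0 has its own clause because \<open>mdegree m - 1\<close>
  is truncated there.\<close>

lemma monomial_expansion:
  assumes L: "meval (linear_form l) v = 1"
  shows "\<exists>N. (\<forall>i. form (mdegree m - 1) (N i) \<and>
        meval (N i) v = of_nat (Poly_Mapping.lookup m i) * monom_value (m - Poly_Mapping.single i 1) v) \<and>
      (mdegree m = 0 \<longrightarrow> (\<forall>i. N i = 0)) \<and>
      Poly_Mapping.single m 1 =
        mconst (monom_value m v) * linear_form l ^ mdegree m + (\<Sum>i\<in>UNIV. N i * centered l v (axis i 1))"
proof (induction "mdegree m" arbitrary: m)
  case 0
  then have "m = 0" by (auto simp: mdegree_def intro: poly_mapping_eqI)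
  then show ?case by (intro exI[of _ "\<lambda>_. 0"]) (simp add: mconst_def)
next
  case (Suc d)
  have "\<exists>j. 0 < Poly_Mapping.lookup m j"
    using Suc.hyps(2) by (metis gr0I mdegree_def nat.distinct(1) sum.neutral)
  then obtain j where j: "0 < Poly_Mapping.lookup m j" by blast
  define m' where "m' = m - Poly_Mapping.single j 1"
  have m: "m = Poly_Mapping.single j 1 + m'"
    unfolding m'_def using j by (intro poly_mapping_eqI) (auto simp: lookup_add lookup_minus lookup_single when_def)
  have d: "mdegree m' = d" using Suc.hyps(2) unfolding m by (simp add: mdegree_add)
  from Suc.hyps(1)[OF d[symmetric]] obtain N
    where N_all: "(\<forall>i. form (mdegree m' - 1) (N i) \<and>
        meval (N i) v = of_nat (Poly_Mapping.lookup m' i) * monom_value (m' - Poly_Mapping.single i 1) v) \<and>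
      (mdegree m' = 0 \<longrightarrow> (\<forall>i. N i = 0)) \<and>
      Poly_Mapping.single m' 1 =
        mconst (monom_value m' v) * linear_form l ^ mdegree m' + (\<Sum>i\<in>UNIV. N i * centered l v (axis i 1))"
    by (elim exE)
  note N = conjunct1[OF N_all] conjunct1[OF conjunct2[OF N_all]] conjunct2[OF conjunct2[OF N_all]]
  define x where "x = (linear_form (axis j 1) :: ('a, 'b) mpoly)"
  \<comment> \<open>Product rule for \<open>x\<close> times the expansion of \<open>m'\<close>: the
    second summand comes from splitting \<open>x\<close> into its centred part and
    \<open>v $ j\<close> times \<open>linear_form l\<close>.\<close>
  define N' where "N' i = x * N i + (if i = j then mconst (monom_value m' v) * linear_form l ^ d else 0)" for i
  have "form (mdegree m - 1) (N' i)" for i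
  proof -
    have "form d (x * N i)"
    proof (cases "d = 0")
      case False
      then show ?thesis using form_mult[of 1 x "d - 1" "N i"] N(1) d by (simp add: x_def)
    qed (use N(2) d in simp)
    moreover have "form d (mconst (monom_value m' v) * linear_form l ^ d)"
      using form_mconst_mult[OF form_power[OF form_linear_form, of d]] by simp
    moreover have "mdegree m - 1 = d" using Suc.hyps(2) by simp
    ultimately show ?thesis unfolding N'_def by (simp only:) (intro form_add, auto)
  qed
  moreover have "meval (N' i) v =
      of_nat (Poly_Mapping.lookup m i) * monom_value (m - Poly_Mapping.single i 1) v" for i
  proof (cases "i = j")
    case True
    have "v $ j * meval (N j) v = of_nat (Poly_Mapping.lookup m' j) * monom_value m' v"
      using monom_value_minus_single[of m' j v] N(1)
      by (cases "Poly_Mapping.lookup m' j = 0") (auto simp: algebra_simps)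
    moreover have "m - Poly_Mapping.single i 1 = m'" by (simp add: m'_def True)
    moreover have "Poly_Mapping.lookup m j = Suc (Poly_Mapping.lookup m' j)"
      by (subst m) (simp add: lookup_add)
    ultimately show ?thesis
      by (simp only: True) (simp add: N'_def x_def L algebra_simps)
  next
    case False
    have lk: "Poly_Mapping.lookup m i = Poly_Mapping.lookup m' i"
      using False by (subst m) (simp add: lookup_add lookup_single when_def)
    show ?thesis
    proof (cases "Poly_Mapping.lookup m' i = 0")
      case False
      then have "m - Poly_Mapping.single i 1 = Poly_Mapping.single j 1 + (m' - Poly_Mapping.single i 1)"
        by (subst m, intro poly_mapping_eqI) (auto simp: lookup_add lookup_minus lookup_single when_def)
      then have "monom_value (m - Poly_Mapping.single i 1) v = v $ j * monom_value (m' - Poly_Mapping.single i 1) v"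
        by (simp only: monom_value_add monom_value_single power_one_right)
      then show ?thesis using \<open>i \<noteq> j\<close> N(1) lk by (simp add: N'_def x_def algebra_simps)
    qed (use False N(1) lk in \<open>simp add: N'_def\<close>)
  qed
  moreover have "Poly_Mapping.single m 1 =
      mconst (monom_value m v) * linear_form l ^ mdegree m + (\<Sum>i\<in>UNIV. N' i * centered l v (axis i 1))"
  proof -
    have x: "x = centered l v (axis j 1) + mconst (v $ j) * linear_form l"
      by (simp add: x_def centered_def)
    have "Poly_Mapping.single m 1 = x * Poly_Mapping.single m' 1"
      by (subst m) (simp add: x_def linear_form_axis mult_single)
    also have "\<dots> = x * (mconst (monom_value m' v) * linear_form l ^ d) + (\<Sum>i\<in>UNIV. x * N i * centered l v (axis i 1))"
      by (simp only: N(3) d distrib_left sum_distrib_left mult.assoc)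
    also have "x * (mconst (monom_value m' v) * linear_form l ^ d) =
        mconst (monom_value m' v) * linear_form l ^ d * centered l v (axis j 1) +
        (mconst (v $ j) * mconst (monom_value m' v)) * linear_form l ^ Suc d"
      by (subst x) (simp add: algebra_simps)
    also have "mconst (v $ j) * mconst (monom_value m' v) = mconst (monom_value m v)"
      by (simp add: m monom_value_add monom_value_single mconst_def mult_single)
    also have "mconst (monom_value m' v) * linear_form l ^ d * centered l v (axis j 1) =
        (\<Sum>i\<in>UNIV. (if i = j then mconst (monom_value m' v) * linear_form l ^ d else 0) * centered l v (axis i 1))"
      by (simp add: if_distrib[of "\<lambda>x. x * _"] sum.delta cong: if_cong)
    finally show ?thesis
      by (simp only: N'_def distrib_right sum.distrib Suc.hyps(2)[symmetric]) (simp add: algebra_simps)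
  qed
  ultimately show ?case using Suc.hyps(2) by (intro exI[of _ N']) auto
qed

lemma form_expansion:
  assumes L: "meval (linear_form l) v = 1" and F: "form d F"
  shows "\<exists>N. (\<forall>i. form (d - 1) (N i) \<and> meval (N i) v = meval (mderiv i F) v) \<and>
      (d = 0 \<longrightarrow> (\<forall>i. N i = 0)) \<and>
      F = mconst (meval F v) * linear_form l ^ d + (\<Sum>i\<in>UNIV. N i * centered l v (axis i 1))"
proof -
  have "\<forall>m. \<exists>N. (\<forall>i. form (mdegree m - 1) (N i) \<and>
        meval (N i) v = of_nat (Poly_Mapping.lookup m i) * monom_value (m - Poly_Mapping.single i 1) v) \<and>
      (mdegree m = 0 \<longrightarrow> (\<forall>i. N i = 0)) \<and>
      Poly_Mapping.single m 1 =
        mconst (monom_value m v) * linear_form l ^ mdegree m + (\<Sum>i\<in>UNIV. N i * centered l v (axis i 1))"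
    by (intro allI monomial_expansion L)
  from choice[OF this] obtain N where N_all: "\<forall>m.
      (\<forall>i. form (mdegree m - 1) (N m i) \<and>
        meval (N m i) v = of_nat (Poly_Mapping.lookup m i) * monom_value (m - Poly_Mapping.single i 1) v) \<and>
      (mdegree m = 0 \<longrightarrow> (\<forall>i. N m i = 0)) \<and>
      Poly_Mapping.single m 1 =
        mconst (monom_value m v) * linear_form l ^ mdegree m + (\<Sum>i\<in>UNIV. N m i * centered l v (axis i 1))"
    by (elim exE)
  have N: "form (mdegree m - 1) (N m i)"
    "meval (N m i) v = of_nat (Poly_Mapping.lookup m i) * monom_value (m - Poly_Mapping.single i 1) v"
    "mdegree m = 0 \<Longrightarrow> N m i = 0"
    "Poly_Mapping.single m 1 =
        mconst (monom_value m v) * linear_form l ^ mdegree m + (\<Sum>i\<in>UNIV. N m i * centered l v (axis i 1))"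
    for m i
    using spec[OF conjunct1[OF spec[OF N_all, of m]], of i] conjunct1[OF conjunct2[OF spec[OF N_all, of m]]]
      conjunct2[OF conjunct2[OF spec[OF N_all, of m]]] by blast+
  define c where "c m = Poly_Mapping.lookup F m" for m
  define N' where "N' i = (\<Sum>m\<in>Poly_Mapping.keys F. mconst (c m) * N m i)" for i
  have deg: "mdegree m = d" if "m \<in> Poly_Mapping.keys F" for m using F that by (simp add: form_iff)
  have "form (d - 1) (N' i)" for i
    unfolding N'_def using N(1)[of _ i] deg by (intro form_sum form_mconst_mult) metis
  moreover have "meval (N' i) v = meval (mderiv i F) v" for i
    by (simp add: N'_def meval_sum N(2) meval_mderiv c_def mult_ac)
  moreover have "N' i = 0" if "d = 0" for i
    unfolding N'_def using N(3) deg that by (intro sum.neutral) auto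
  moreover have "F = mconst (meval F v) * linear_form l ^ d + (\<Sum>i\<in>UNIV. N' i * centered l v (axis i 1))"
  proof -
    have mc: "mconst (sum f S) = (\<Sum>i\<in>S. mconst (f i))" for f :: "_ \<Rightarrow> 'a" and S
      unfolding mconst_def by (induction S rule: infinite_finite_induct) (auto simp: single_add)
    have "F = (\<Sum>m\<in>Poly_Mapping.keys F. mconst (c m) * Poly_Mapping.single m 1)"
      by (subst poly_mapping_sum_single) (simp add: mconst_def mult_single c_def)
    also have "\<dots> = (\<Sum>m\<in>Poly_Mapping.keys F. mconst (c m * monom_value m v) * linear_form l ^ d +
        (\<Sum>i\<in>UNIV. mconst (c m) * N m i * centered l v (axis i 1)))"
    proof (intro sum.cong refl)
      fix m assume "m \<in> Poly_Mapping.keys F"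
      then have "mconst (c m) * Poly_Mapping.single m 1 = mconst (c m) * (mconst (monom_value m v) * linear_form l ^ d +
          (\<Sum>i\<in>UNIV. N m i * centered l v (axis i 1)))"
        using N(4)[of m] deg by simp
      also have "\<dots> = mconst (c m) * mconst (monom_value m v) * linear_form l ^ d +
          (\<Sum>i\<in>UNIV. mconst (c m) * N m i * centered l v (axis i 1))"
        by (simp only: distrib_left sum_distrib_left mult.assoc)
      finally show "mconst (c m) * Poly_Mapping.single m 1 = mconst (c m * monom_value m v) * linear_form l ^ d +
          (\<Sum>i\<in>UNIV. mconst (c m) * N m i * centered l v (axis i 1))"
        by (simp add: mconst_def mult_single)
    qed
    also have "\<dots> = mconst (meval F v) * linear_form l ^ d + (\<Sum>i\<in>UNIV. N' i * centered l v (axis i 1))"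
    proof -
      have "(\<Sum>m\<in>Poly_Mapping.keys F. \<Sum>i\<in>UNIV. mconst (c m) * N m i * centered l v (axis i 1)) =
          (\<Sum>i\<in>UNIV. N' i * centered l v (axis i 1))"
        by (subst sum.swap) (simp add: N'_def sum_distrib_right)
      then show ?thesis
        by (simp add: sum.distrib meval_superset[OF finite_keys subset_refl] mc sum_distrib_right c_def)
    qed
    finally show ?thesis .
  qed
  ultimately show ?thesis by (intro exI[of _ N']) auto
qed

lemma form_mult': "form d F \<Longrightarrow> form e G \<Longrightarrow> form (e + d) (F * G)"
  using form_mult[of d F e G] by (simp add: add.commute)

section \<open>The maximal ideal at a smooth point of a curve has a single generator\<close>

context smooth_curve
begin

text \<open>Locally at \<open>P\<close>, the form \<open>Y\<close> lies in \<open>(\<tau>) + \<Sum>\<^sub>i m\<^sub>P z i\<close>; multiplying by \<open>U\<close> clears denominators.\<close>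

definition reduces ::
  "('k, 'n) proj_point \<Rightarrow> ('k, 'n) mpoly \<Rightarrow> ('i \<Rightarrow> ('k, 'n) mpoly) \<Rightarrow> 'i set \<Rightarrow> ('k, 'n) mpoly \<Rightarrow> bool" where
  "reduces P \<tau> z s Y \<longleftrightarrow> (\<exists>e U A M. form e U \<and> form_at U P \<noteq> 0 \<and> form e A \<and>
     (\<forall>i\<in>s. form e (M i) \<and> form_at (M i) P = 0) \<and>
     (\<forall>Q\<in>X. form_at U Q * form_at Y Q = form_at A Q * form_at \<tau> Q + (\<Sum>i\<in>s. form_at (M i) Q * form_at (z i) Q)))"

lemma reduces_cong:
  assumes "\<And>Q. Q \<in> X \<Longrightarrow> form_at Y Q = form_at Y' Q"
  shows "reduces P \<tau> z s Y \<longleftrightarrow> reduces P \<tau> z s Y'"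
  unfolding reduces_def using assms by simp

lemma reduces_add:
  assumes "reduces P \<tau> z s Y" "reduces P \<tau> z s Y'"
  shows "reduces P \<tau> z s (Y + Y')"
proof -
  obtain e U A M where 1: "form e U" "form_at U P \<noteq> 0" "form e A" "\<forall>i\<in>s. form e (M i) \<and> form_at (M i) P = 0"
    "\<forall>Q\<in>X. form_at U Q * form_at Y Q = form_at A Q * form_at \<tau> Q + (\<Sum>i\<in>s. form_at (M i) Q * form_at (z i) Q)"
    using assms(1) unfolding reduces_def by blast
  obtain e' U' A' M' where 2: "form e' U'" "form_at U' P \<noteq> 0" "form e' A'" "\<forall>i\<in>s. form e' (M' i) \<and> form_at (M' i) P = 0"
    "\<forall>Q\<in>X. form_at U' Q * form_at Y' Q = form_at A' Q * form_at \<tau> Q + (\<Sum>i\<in>s. form_at (M' i) Q * form_at (z i) Q)"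
    using assms(2) unfolding reduces_def by blast
  have "form_at (U * U') Q * form_at (Y + Y') Q = form_at (U' * A + U * A') Q * form_at \<tau> Q +
      (\<Sum>i\<in>s. form_at (U' * M i + U * M' i) Q * form_at (z i) Q)" if Q: "Q \<in> X" for Q
  proof -
    have "form_at (U * U') Q * form_at (Y + Y') Q =
        form_at U' Q * (form_at U Q * form_at Y Q) + form_at U Q * (form_at U' Q * form_at Y' Q)"
      by (simp add: algebra_simps)
    also have "\<dots> = form_at U' Q * (form_at A Q * form_at \<tau> Q + (\<Sum>i\<in>s. form_at (M i) Q * form_at (z i) Q)) +
        form_at U Q * (form_at A' Q * form_at \<tau> Q + (\<Sum>i\<in>s. form_at (M' i) Q * form_at (z i) Q))"
      using 1(5) 2(5) Q by simp
    finally show ?thesis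
      by (simp add: distrib_right distrib_left sum.distrib sum_distrib_left mult.assoc)
  qed
  then have eq: "\<forall>Q\<in>X. form_at (U * U') Q * form_at (Y + Y') Q = form_at (U' * A + U * A') Q * form_at \<tau> Q +
      (\<Sum>i\<in>s. form_at (U' * M i + U * M' i) Q * form_at (z i) Q)" by (rule ballI)
  have f1: "form (e + e') (U * U')" by (rule form_mult) (rule 1 2)+
  have nz: "form_at (U * U') P \<noteq> 0" using 1 2 by simp
  have f2: "form (e + e') (U' * A + U * A')"
    by (rule form_add[OF form_mult' form_mult]) (rule 1 2)+
  have f3: "\<forall>i\<in>s. form (e + e') (U' * M i + U * M' i) \<and> form_at (U' * M i + U * M' i) P = 0"
  proof
    fix i assume "i \<in> s"
    then have "form e (M i)" "form e' (M' i)" "form_at (M i) P = 0" "form_at (M' i) P = 0" using 1 2 by auto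
    then show "form (e + e') (U' * M i + U * M' i) \<and> form_at (U' * M i + U * M' i) P = 0"
      using form_add[OF form_mult'[OF 2(1)] form_mult[OF 1(1)]] by simp
  qed
  show ?thesis unfolding reduces_def by (intro exI conjI) (rule f1, rule nz, rule f2, rule f3, rule eq)
qed

lemma reduces_scale:
  assumes "reduces P \<tau> z s Y" shows "reduces P \<tau> z s (mconst c * Y)"
proof -
  obtain e U A M where 1: "form e U" "form_at U P \<noteq> 0" "form e A" "\<forall>i\<in>s. form e (M i) \<and> form_at (M i) P = 0"
    "\<forall>Q\<in>X. form_at U Q * form_at Y Q = form_at A Q * form_at \<tau> Q + (\<Sum>i\<in>s. form_at (M i) Q * form_at (z i) Q)"
    using assms(1) unfolding reduces_def by blast
  have "form_at U Q * form_at (mconst c * Y) Q = form_at (mconst c * A) Q * form_at \<tau> Q +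
      (\<Sum>i\<in>s. form_at (mconst c * M i) Q * form_at (z i) Q)" if Q: "Q \<in> X" for Q
  proof -
    have "form_at U Q * form_at (mconst c * Y) Q = c * (form_at U Q * form_at Y Q)" by (simp add: algebra_simps)
    also have "\<dots> = c * (form_at A Q * form_at \<tau> Q + (\<Sum>i\<in>s. form_at (M i) Q * form_at (z i) Q))"
      using 1(5) Q by simp
    finally show ?thesis by (simp add: distrib_left sum_distrib_left mult.assoc)
  qed
  then have eq: "\<forall>Q\<in>X. form_at U Q * form_at (mconst c * Y) Q = form_at (mconst c * A) Q * form_at \<tau> Q +
      (\<Sum>i\<in>s. form_at (mconst c * M i) Q * form_at (z i) Q)" by (rule ballI)
  have f2: "form e (mconst c * A)" by (rule form_mconst_mult) (rule 1)
  have f3: "\<forall>i\<in>s. form e (mconst c * M i) \<and> form_at (mconst c * M i) P = 0"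
    using 1(4) by (auto intro: form_mconst_mult)
  show ?thesis unfolding reduces_def by (intro exI conjI) (rule 1, rule 1, rule f2, rule f3, rule eq)
qed

text \<open>One step of Nakayama's lemma: the generator \<open>z j\<close> is redundant, since \<open>1 - M j\<close> is a unit.\<close>

lemma reduces_drop:
  assumes s: "finite s" "j \<notin> s" and j: "reduces P \<tau> z (insert j s) (z j)" and Y: "reduces P \<tau> z (insert j s) Y"
  shows "reduces P \<tau> z s Y"
proof -
  obtain e0 U0 A0 M0 where 0: "form e0 U0" "form_at U0 P \<noteq> 0" "form e0 A0"
    "\<forall>i\<in>insert j s. form e0 (M0 i) \<and> form_at (M0 i) P = 0"
    "\<forall>Q\<in>X. form_at U0 Q * form_at (z j) Q = form_at A0 Q * form_at \<tau> Q + (\<Sum>i\<in>insert j s. form_at (M0 i) Q * form_at (z i) Q)"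
    using j unfolding reduces_def by blast
  obtain e U A M where 1: "form e U" "form_at U P \<noteq> 0" "form e A"
    "\<forall>i\<in>insert j s. form e (M i) \<and> form_at (M i) P = 0"
    "\<forall>Q\<in>X. form_at U Q * form_at Y Q = form_at A Q * form_at \<tau> Q + (\<Sum>i\<in>insert j s. form_at (M i) Q * form_at (z i) Q)"
    using Y unfolding reduces_def by blast
  define W where "W = U0 - M0 j"
  have W: "form e0 W" "form_at W P \<noteq> 0" using 0 by (auto simp: W_def intro: form_diff)
  have eq: "form_at (U * W) Q * form_at Y Q = form_at (A * W + M j * A0) Q * form_at \<tau> Q +
      (\<Sum>i\<in>s. form_at (M i * W + M j * M0 i) Q * form_at (z i) Q)" if Q: "Q \<in> X" for Q
  proof -
    have z: "form_at W Q * form_at (z j) Q = form_at A0 Q * form_at \<tau> Q + (\<Sum>i\<in>s. form_at (M0 i) Q * form_at (z i) Q)"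
      using 0(5) Q s by (simp add: W_def left_diff_distrib)
    have "form_at (U * W) Q * form_at Y Q = form_at W Q * (form_at U Q * form_at Y Q)" by (simp add: mult_ac)
    also have "\<dots> = form_at W Q * (form_at A Q * form_at \<tau> Q + (\<Sum>i\<in>s. form_at (M i) Q * form_at (z i) Q)) +
        form_at (M j) Q * (form_at W Q * form_at (z j) Q)"
      using 1(5) Q s by (simp add: algebra_simps)
    also have "\<dots> = form_at W Q * (form_at A Q * form_at \<tau> Q + (\<Sum>i\<in>s. form_at (M i) Q * form_at (z i) Q)) +
        form_at (M j) Q * (form_at A0 Q * form_at \<tau> Q + (\<Sum>i\<in>s. form_at (M0 i) Q * form_at (z i) Q))"
      by (simp only: z)
    finally show ?thesis
      by (simp add: distrib_left distrib_right sum.distrib sum_distrib_left mult_ac)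
  qed
  then have eq: "\<forall>Q\<in>X. form_at (U * W) Q * form_at Y Q = form_at (A * W + M j * A0) Q * form_at \<tau> Q +
      (\<Sum>i\<in>s. form_at (M i * W + M j * M0 i) Q * form_at (z i) Q)" by (rule ballI)
  have Mj: "form e (M j)" "form_at (M j) P = 0" using 1(4) by auto
  have f1: "form (e + e0) (U * W)" by (rule form_mult) (rule 1 W)+
  have nz: "form_at (U * W) P \<noteq> 0" using 1 W by simp
  have f2: "form (e + e0) (A * W + M j * A0)"
    by (rule form_add[OF form_mult form_mult]) (rule 1 W Mj 0)+
  have f3: "\<forall>i\<in>s. form (e + e0) (M i * W + M j * M0 i) \<and> form_at (M i * W + M j * M0 i) P = 0"
  proof
    fix i assume "i \<in> s"
    then have "form e (M i)" "form e0 (M0 i)" "form_at (M i) P = 0" using 0 1 by auto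
    then show "form (e + e0) (M i * W + M j * M0 i) \<and> form_at (M i * W + M j * M0 i) P = 0"
      using form_add[OF form_mult[OF _ W(1)] form_mult[OF Mj(1)]] Mj(2) by simp
  qed
  show ?thesis unfolding reduces_def by (intro exI conjI) (rule f1, rule nz, rule f2, rule f3, rule eq)
qed

text \<open>Dropping one generator keeps the hypothesis true for all \<open>j\<close> over the
  smaller set, so the induction runs down to the empty set, where only multiples of
  \<open>\<tau>\<close> remain.\<close>

lemma reduces_nakayama:
  assumes "finite s" "\<And>j. reduces P \<tau> z s (z j)"
  shows "reduces P \<tau> z {} (z j)"
  using assms
proof (induction s arbitrary: j rule: finite_induct)
  case (insert i s)
  show ?case
  proof (rule insert.IH)
    fix j show "reduces P \<tau> z s (z j)"
      by (rule reduces_drop[OF insert.hyps]) (rule insert.prems)+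
  qed
qed

text \<open>Smoothness of dimension 1 gives the span of the gradients codimension 2. By Euler's
  relation gradients annihilate the coordinate vector of \<open>P\<close>, which \<open>l\<close>
  does not, so \<open>l\<close> lies outside their span. One more vector \<open>t\<close>, the
  cotangent direction of the curve, completes it.\<close>

lemma tangent_basis:
  assumes P: "P \<in> X" and l: "meval (linear_form l) (rep_proj_point P) = 1"
  shows "\<exists>t. \<forall>w. \<exists>a b. w - a *s t - b *s l \<in> vec.span ((\<lambda>F. gradient_at F P) ` vanishing_forms X)"
proof -
  let ?v = "rep_proj_point P"
  let ?G = "(\<lambda>F. gradient_at F P) ` vanishing_forms X"
  have dim: "vec.dim ?G + 2 = CARD('n)"
    using smooth_projective_curve P by (auto simp: smooth_projective_curve_def smooth_of_dim_def)
  have orth: "meval (linear_form x) ?v = 0" if "x \<in> vec.span ?G" for x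
    using that
  proof (induction rule: vec.span_induct_alt)
    case base
    then show ?case by (simp add: meval_linear_form)
  next
    case (step c x y)
    then obtain F where F: "F \<in> vanishing_forms X" "x = gradient_at F P" by blast
    then obtain d where d: "form d F" "form_at F P = 0" using P by (auto simp: vanishing_forms_def)
    have "meval (linear_form x) ?v = 0"
      using euler_relation[OF d(1), of ?v] d(2) by (simp add: F(2) meval_linear_form gradient_at_def mult.commute)
    then show ?case using step by (simp add: meval_linear_form_add meval_linear_form_scale)
  qed
  have "l \<notin> vec.span ?G" using orth l by force
  then have dim1: "vec.dim (insert l ?G) + 1 = CARD('n)" using dim by (simp add: vec.dim_insert)
  have "vec.span (insert l ?G) \<noteq> UNIV"
  proof
    assume "vec.span (insert l ?G) = UNIV"
    then have "vec.dim (insert l ?G) = CARD('n)" by (metis vec.dim_span vec_dim_card)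
    then show False using dim1 by simp
  qed
  then obtain t where t: "t \<notin> vec.span (insert l ?G)" by blast
  then have "vec.dim (insert t (insert l ?G)) = CARD('n)" using dim1 by (simp add: vec.dim_insert)
  then have "vec.span (insert t (insert l ?G)) = UNIV"
    by (metis vec.dim_eq_full vec.span_UNIV vec_dim_card)
  then have "w \<in> vec.span (insert t (insert l ?G))" for w by blast
  then show ?thesis unfolding vec.span_breakdown_eq by blast
qed

text \<open>The centred coordinates generate the maximal ideal at \<open>P\<close>. Centred forms of
  gradients lie in its square on \<open>X\<close>, so \<open>\<tau>\<close>, the centred form of the
  remaining direction \<open>t\<close>, generates the ideal modulo its square; Nakayama's lemma
  removes the square.\<close>

lemma local_parameter_exists:
  assumes P: "P \<in> X"
  shows "\<exists>l \<tau>. form_at (linear_form l) P = 1 \<and> form 1 \<tau> \<and> form_at \<tau> P = 0 \<and>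
    (\<forall>j. reduces P \<tau> (\<lambda>_. 0) ({} :: nat set) (centered l (rep_proj_point P) (axis j 1)))"
proof -
  let ?v = "rep_proj_point P"
  let ?G = "(\<lambda>F. gradient_at F P) ` vanishing_forms X"
  obtain i where i: "?v $ i \<noteq> 0" using rep_proj_point_nonzero[of P] by (auto simp: vec_eq_iff)
  define l where "l = inverse (?v $ i) *s axis i 1"
  have l: "meval (linear_form l) ?v = 1" using i by (simp add: l_def meval_linear_form_scale)
  obtain t where t: "\<And>w. \<exists>a b. w - a *s t - b *s l \<in> vec.span ?G" using tangent_basis[OF P l] by blast
  define z where "z = (\<lambda>j. centered l ?v (axis j 1))"
  define \<tau> where "\<tau> = centered l ?v t"
  have \<tau>: "form 1 \<tau>" "form_at \<tau> P = 0" using l by (auto simp: \<tau>_def meval_centered)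
  have red_span: "reduces P \<tau> z UNIV (centered l ?v g)" if "g \<in> vec.span ?G" for g
    using that
  proof (induction rule: vec.span_induct_alt)
    case base
    show ?case unfolding reduces_def
      by (intro exI[of _ 0] exI[of _ 1] exI[of _ "\<lambda>_. 0"])
        (simp add: meval_centered meval_linear_form)
  next
    case (step c x y)
    then obtain F d where F: "F \<in> vanishing_forms X" "x = gradient_at F P" "form d F"
      by (auto simp: vanishing_forms_def)
    have F0: "form_at F Q = 0" if "Q \<in> X" for Q using F(1) that by (simp add: vanishing_forms_def)
    obtain N where N: "\<And>i. form (d - 1) (N i)" "\<And>i. meval (N i) ?v = meval (mderiv i F) ?v"
      "F = mconst (meval F ?v) * linear_form l ^ d + (\<Sum>i\<in>UNIV. N i * centered l ?v (axis i 1))"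
      using form_expansion[OF l F(3)] by blast
    have NF: "(\<Sum>i\<in>UNIV. form_at (N i) Q * form_at (z i) Q) = 0" if Q: "Q \<in> X" for Q
    proof -
      have "form_at F Q = (\<Sum>i\<in>UNIV. form_at (N i) Q * form_at (z i) Q)"
        by (subst N(3)) (simp add: F0[OF P] meval_sum z_def)
      then show ?thesis using F0[OF Q] by simp
    qed
    have cx: "form_at (centered l ?v x) Q = (\<Sum>i\<in>UNIV. x $ i * form_at (z i) Q)" for Q
      by (simp add: z_def meval_centered meval_linear_form[of x] right_diff_distrib sum_subtractf
          sum_distrib_right mult.assoc)
    \<comment> \<open>The relation \<open>NF\<close> is subtracted so that the coefficients vanish
      at \<open>P\<close>: there \<open>N i\<close> equals the entry \<open>x $ i\<close> of the
      gradient and \<open>linear_form l\<close> equals 1.\<close>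
    define M where "M i = mconst (x $ i) * linear_form l ^ (d - 1) - N i" for i
    have lpow: "form (d - 1) (linear_form l ^ (d - 1))" using form_power[OF form_linear_form, of "d - 1" l] by simp
    have "form (d - 1) (M i) \<and> form_at (M i) P = 0" for i
      using N(1,2)[of i] l F(2) lpow
      by (auto simp: M_def gradient_at_def intro!: form_diff form_mconst_mult)
    moreover have "form_at (linear_form l ^ (d - 1)) Q * form_at (centered l ?v x) Q =
        (\<Sum>i\<in>UNIV. form_at (M i) Q * form_at (z i) Q)" if Q: "Q \<in> X" for Q
    proof -
      have "(\<Sum>i\<in>UNIV. form_at (M i) Q * form_at (z i) Q) =
          (\<Sum>i\<in>UNIV. x $ i * form_at (linear_form l ^ (d - 1)) Q * form_at (z i) Q)"
        using NF[OF Q] by (simp add: M_def left_diff_distrib sum_subtractf)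
      then show ?thesis unfolding cx by (simp add: sum_distrib_left mult_ac)
    qed
    ultimately have "reduces P \<tau> z UNIV (centered l ?v x)"
      unfolding reduces_def using lpow l
      by (intro exI[of _ "d - 1"] exI[of _ "linear_form l ^ (d - 1)"] exI[of _ 0] exI[of _ M]) auto
    from reduces_add[OF reduces_scale[OF this, of c] step(2)]
    have "reduces P \<tau> z UNIV (mconst c * centered l ?v x + centered l ?v y)" .
    then show ?case
      by (rule reduces_cong[THEN iffD1, rotated])
        (simp add: meval_centered meval_linear_form_add meval_linear_form_scale algebra_simps)
  qed
  have red_\<tau>: "reduces P \<tau> z UNIV \<tau>" unfolding reduces_def
    by (intro exI[of _ 0] exI[of _ 1] exI[of _ 1] exI[of _ "\<lambda>_. 0"]) simp
  have red_z: "reduces P \<tau> z UNIV (z j)" for j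
  proof -
    \<comment> \<open>The \<open>l\<close> component will drop out, since
      \<open>centered l ?v l\<close> vanishes identically when \<open>l\<close> has value 1 at
      \<open>P\<close>.\<close>
    obtain a b where ab: "axis j 1 - a *s t - b *s l \<in> vec.span ?G" using t by blast
    define g where "g = axis j 1 - a *s t - b *s l"
    have ax: "axis j 1 = g + a *s t + b *s l" by (simp add: g_def)
    have "form_at (z j) Q = form_at (centered l ?v g + mconst a * \<tau>) Q" for Q
      using l unfolding z_def ax
      by (simp add: \<tau>_def meval_centered meval_linear_form_add meval_linear_form_scale algebra_simps)
    moreover have "reduces P \<tau> z UNIV (centered l ?v g + mconst a * \<tau>)"
      by (intro reduces_add reduces_scale red_\<tau> red_span) (use ab in \<open>simp add: g_def\<close>)
    ultimately show ?thesis using reduces_cong by metis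
  qed
  have "reduces P \<tau> z {} (z j)" for j by (rule reduces_nakayama[OF finite red_z])
  then have "\<forall>j. reduces P \<tau> (\<lambda>_. 0) ({} :: nat set) (centered l ?v (axis j 1))"
    unfolding reduces_def z_def by simp
  then show ?thesis using l \<tau> by blast
qed

end

section \<open>The order of vanishing of a form at a point\<close>

context smooth_curve
begin

text \<open>Locally at \<open>P\<close>, the form \<open>F\<close> of degree \<open>d\<close> is \<open>\<tau>\<^sup>n A\<close> up to a unit, with \<open>A\<close> of degree \<open>a\<close>.\<close>

definition local_multiple ::
  "('k, 'n) proj_point \<Rightarrow> ('k, 'n) mpoly \<Rightarrow> nat \<Rightarrow> nat \<Rightarrow> ('k, 'n) mpoly \<Rightarrow> nat \<Rightarrow> ('k, 'n) mpoly \<Rightarrow> bool" where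
  "local_multiple P \<tau> n d F a A \<longleftrightarrow> (\<exists>e U. form e U \<and> form_at U P \<noteq> 0 \<and> e + d = a + n \<and>
     (\<forall>Q\<in>X. form_at U Q * form_at F Q = form_at A Q * form_at \<tau> Q ^ n))"

text \<open>A linear form that generates the maximal ideal of \<open>P\<close> locally on
  \<open>X\<close>. The degree \<open>a\<close> of the cofactor is left open, since it depends on
  the degree of the clearing unit.\<close>

definition local_equation :: "('k, 'n) proj_point \<Rightarrow> ('k, 'n) mpoly \<Rightarrow> bool" where
  "local_equation P \<tau> \<longleftrightarrow> form 1 \<tau> \<and> form_at \<tau> P = 0 \<and>
     (\<forall>d F. form d F \<longrightarrow> form_at F P = 0 \<longrightarrow> (\<exists>a A. form a A \<and> local_multiple P \<tau> 1 d F a A))"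

lemma local_multiple_0: "local_multiple P \<tau> 0 d F d F"
  unfolding local_multiple_def by (intro exI[of _ 0] exI[of _ 1]) simp

lemma local_multiple_trans:
  assumes "local_multiple P \<tau> n d F a A" "local_multiple P \<tau> m a A b B"
  shows "local_multiple P \<tau> (n + m) d F b B"
proof -
  obtain e U where 1: "form e U" "form_at U P \<noteq> 0" "e + d = a + n"
    "\<forall>Q\<in>X. form_at U Q * form_at F Q = form_at A Q * form_at \<tau> Q ^ n"
    using assms(1) unfolding local_multiple_def by blast
  obtain e' U' where 2: "form e' U'" "form_at U' P \<noteq> 0" "e' + a = b + m"
    "\<forall>Q\<in>X. form_at U' Q * form_at A Q = form_at B Q * form_at \<tau> Q ^ m"
    using assms(2) unfolding local_multiple_def by blast
  have "form_at (U * U') Q * form_at F Q = form_at B Q * form_at \<tau> Q ^ (n + m)" if Q: "Q \<in> X" for Q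
  proof -
    have "form_at (U * U') Q * form_at F Q = form_at U' Q * (form_at U Q * form_at F Q)" by simp
    also have "\<dots> = (form_at U' Q * form_at A Q) * form_at \<tau> Q ^ n" using 1(4) Q by simp
    also have "\<dots> = form_at B Q * form_at \<tau> Q ^ (n + m)" using 2(4) Q by (simp add: power_add)
    finally show ?thesis .
  qed
  then show ?thesis unfolding local_multiple_def using 1 2 form_mult[OF 1(1) 2(1)]
    by (intro exI[of _ "e + e'"] exI[of _ "U * U'"]) auto
qed

text \<open>Expanding a form that vanishes at \<open>P\<close> leaves only multiples of the centred
  coordinates, each of which is locally a multiple of \<open>\<tau>\<close>. The finitely many
  denominators are multiplied together.\<close>

lemma local_equation_exists:
  assumes P: "P \<in> X"
  shows "\<exists>l \<tau>. form_at (linear_form l) P = 1 \<and> local_equation P \<tau>"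
proof -
  let ?v = "rep_proj_point P"
  obtain l \<tau> where l: "form_at (linear_form l) P = 1" and \<tau>: "form 1 \<tau>" "form_at \<tau> P = 0"
    and red: "\<And>j. reduces P \<tau> (\<lambda>_. 0) ({} :: nat set) (centered l ?v (axis j 1))"
    using local_parameter_exists[OF P] by blast
  define z where "z = (\<lambda>j. centered l ?v (axis j 1))"
  have div: "\<exists>a A. form a A \<and> local_multiple P \<tau> 1 d F a A" if F: "form d F" "form_at F P = 0" for d F
  proof -
    obtain N where N: "\<And>i. form (d - 1) (N i)" "d = 0 \<longrightarrow> (\<forall>i. N i = 0)"
      "F = mconst (form_at F P) * linear_form l ^ d + (\<Sum>i\<in>UNIV. N i * z i)"
      using form_expansion[OF l F(1)] unfolding z_def by blast
    have F': "F = (\<Sum>i\<in>UNIV. N i * z i)" by (subst N(3)) (simp add: F(2) mconst_def)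
    show ?thesis
    proof (cases "d = 0")
      case True
      then have "F = 0" using F' N(2) by simp
      \<comment> \<open>The balance \<open>e + d = a + 1\<close> with \<open>d = a = 0\<close> asks
        for a unit of degree 1; \<open>linear_form l\<close> serves.\<close>
      then show ?thesis unfolding local_multiple_def using True l
        by (intro exI[of _ 0] exI[of _ 0] conjI exI[of _ 1] exI[of _ "linear_form l"]) auto
    next
      case False
      have "\<exists>e U A. form e U \<and> form_at U P \<noteq> 0 \<and> form (e + (d - 1)) A \<and>
          (\<forall>Q\<in>X. form_at U Q * (\<Sum>i\<in>S. form_at (N i) Q * form_at (z i) Q) = form_at A Q * form_at \<tau> Q)"
        if "finite S" for S
        using that
      proof (induction S rule: finite_induct)
        case empty
        show ?case by (intro exI[of _ 0] exI[of _ 1]) (auto intro: exI[of _ 0])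
      next
        case (insert i S)
        obtain e U A where 1: "form e U" "form_at U P \<noteq> 0" "form (e + (d - 1)) A"
          "\<forall>Q\<in>X. form_at U Q * (\<Sum>i\<in>S. form_at (N i) Q * form_at (z i) Q) = form_at A Q * form_at \<tau> Q"
          using insert.IH by blast
        obtain e' U' A' where 2: "form e' U'" "form_at U' P \<noteq> 0" "form e' A'"
          "\<forall>Q\<in>X. form_at U' Q * form_at (z i) Q = form_at A' Q * form_at \<tau> Q"
          using red[of i] unfolding reduces_def z_def by auto
        have eq: "form_at (U * U') Q * (\<Sum>i\<in>insert i S. form_at (N i) Q * form_at (z i) Q) =
            form_at (U' * A + U * N i * A') Q * form_at \<tau> Q" if Q: "Q \<in> X" for Q
        proof -
          have "form_at (U * U') Q * (\<Sum>i\<in>insert i S. form_at (N i) Q * form_at (z i) Q) =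
              form_at U' Q * (form_at U Q * (\<Sum>i\<in>S. form_at (N i) Q * form_at (z i) Q)) +
              form_at U Q * form_at (N i) Q * (form_at U' Q * form_at (z i) Q)"
            using insert.hyps by (simp add: algebra_simps)
          also have "\<dots> = form_at U' Q * (form_at A Q * form_at \<tau> Q) +
              form_at U Q * form_at (N i) Q * (form_at A' Q * form_at \<tau> Q)"
            using 1(4) 2(4) Q by simp
          finally show ?thesis by (simp add: algebra_simps)
        qed
        have "form (e' + (e + (d - 1))) (U' * A)" by (rule form_mult[OF 2(1) 1(3)])
        moreover have "form (e + (d - 1) + e') (U * N i * A')"
          by (rule form_mult[OF form_mult[OF 1(1) N(1)] 2(3)])
        ultimately have "form (e + e' + (d - 1)) (U' * A + U * N i * A')"
          by (intro form_add) (simp_all add: add_ac)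
        then show ?case using eq 1 2 form_mult[OF 1(1) 2(1)]
          by (intro exI[of _ "e + e'"] exI[of _ "U * U'"] exI[of _ "U' * A + U * N i * A'"]) auto
      qed
      from this[of UNIV] obtain e U A where "form e U" "form_at U P \<noteq> 0" "form (e + (d - 1)) A"
          "\<forall>Q\<in>X. form_at U Q * (\<Sum>i\<in>UNIV. form_at (N i) Q * form_at (z i) Q) = form_at A Q * form_at \<tau> Q"
        by auto
      moreover have "form_at F Q = (\<Sum>i\<in>UNIV. form_at (N i) Q * form_at (z i) Q)" for Q
        by (subst F') (simp add: meval_sum)
      ultimately show ?thesis unfolding local_multiple_def using False
        by (intro exI[of _ "e + (d - 1)"] exI[of _ A] conjI exI[of _ e] exI[of _ U]) auto
    qed
  qed
  then show ?thesis using l \<tau> unfolding local_equation_def by blast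
qed

lemma local_multiple_vanishes:
  assumes \<tau>: "local_equation P \<tau>" and P: "P \<in> X" and F: "form d F" and "local_multiple P \<tau> n d F a A"
    and A: "vanishes_on X A"
  shows "vanishes_on X F"
proof -
  obtain e U where U: "form e U" "form_at U P \<noteq> 0"
    "\<forall>Q\<in>X. form_at U Q * form_at F Q = form_at A Q * form_at \<tau> Q ^ n"
    using assms(4) unfolding local_multiple_def by blast
  have "vanishes_on X (U * F)" using U(3) A by (simp add: vanishes_on_def)
  moreover have "\<not> vanishes_on X U" using U P by (auto simp: vanishes_on_def)
  ultimately show ?thesis using vanishes_on_mult[OF U(1) F] by blast
qed

text \<open>Otherwise every form vanishing at \<open>P\<close> would vanish on all of
  \<open>X\<close>, but a linear form separates \<open>P\<close> from a second point of the
  curve.\<close>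

lemma local_equation_not_vanishes:
  assumes \<tau>: "local_equation P \<tau>" and P: "P \<in> X"
  shows "\<not> vanishes_on X \<tau>"
proof
  assume van: "vanishes_on X \<tau>"
  obtain Q where Q: "Q \<in> X" "Q \<noteq> P" using other_point by blast
  from linear_form_separating[OF Q(2)[symmetric]] obtain w
    where w: "form_at (linear_form w) P = 0" "form_at (linear_form w) Q \<noteq> 0" .
  obtain a A where "local_multiple P \<tau> 1 1 (linear_form w) a A"
    using \<tau> w form_linear_form[of w] unfolding local_equation_def by blast
  then obtain e U where U: "form e U" "form_at U P \<noteq> 0"
    "\<forall>Q\<in>X. form_at U Q * form_at (linear_form w) Q = form_at A Q * form_at \<tau> Q ^ 1"
    unfolding local_multiple_def by blast
  have "vanishes_on X (U * linear_form w)" using U(3) van by (simp add: vanishes_on_def)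
  moreover have "\<not> vanishes_on X U" "\<not> vanishes_on X (linear_form w)"
    using U P Q w by (auto simp: vanishes_on_def)
  ultimately show False using vanishes_on_mult[OF U(1) form_linear_form] by blast
qed

text \<open>If the division by \<open>\<tau>\<close> never stopped, finite generation would make some quotient
  \<open>F n\<close> a multiple of \<open>\<tau> F n\<close> locally at \<open>P\<close>, hence zero.\<close>

lemma form_order_exists:
  assumes \<tau>: "local_equation P \<tau>" and P: "P \<in> X" and F: "form d F" "\<not> vanishes_on X F"
  shows "\<exists>n a A. form a A \<and> form_at A P \<noteq> 0 \<and> local_multiple P \<tau> n d F a A"
proof (rule ccontr)
  assume contra: "\<not> ?thesis"
  have \<tau>1: "form 1 \<tau>" "form_at \<tau> P = 0" using \<tau> by (auto simp: local_equation_def)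
  have "\<exists>f. \<forall>n. (form (fst (f n)) (snd (f n)) \<and> local_multiple P \<tau> n d F (fst (f n)) (snd (f n))) \<and>
      local_multiple P \<tau> 1 (fst (f n)) (snd (f n)) (fst (f (Suc n))) (snd (f (Suc n)))"
  proof (rule dependent_nat_choice)
    show "\<exists>x. form (fst x) (snd x) \<and> local_multiple P \<tau> 0 d F (fst x) (snd x)"
      using F local_multiple_0 by (intro exI[of _ "(d, F)"]) simp
    fix x n assume x: "form (fst x) (snd x) \<and> local_multiple P \<tau> n d F (fst x) (snd x)"
    then have "form_at (snd x) P = 0" using contra by blast
    then obtain a A where A: "form a A" "local_multiple P \<tau> 1 (fst x) (snd x) a A"
      using \<tau> x unfolding local_equation_def by blast
    then show "\<exists>y. (form (fst y) (snd y) \<and> local_multiple P \<tau> (Suc n) d F (fst y) (snd y)) \<and>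
        local_multiple P \<tau> 1 (fst x) (snd x) (fst y) (snd y)"
      using local_multiple_trans[OF conjunct2[OF x] A(2)] by (intro exI[of _ "(a, A)"]) simp
  qed
  then obtain f where f: "\<And>n. form (fst (f n)) (snd (f n))" "\<And>n. local_multiple P \<tau> n d F (fst (f n)) (snd (f n))"
    "\<And>n. local_multiple P \<tau> 1 (fst (f n)) (snd (f n)) (fst (f (Suc n))) (snd (f (Suc n)))" by blast
  define G where "G n = snd (f n)" for n
  define \<delta> where "\<delta> n = fst (f n)" for n
  have G: "form (\<delta> n) (G n)" for n using f by (simp add: G_def \<delta>_def)
  have step: "local_multiple P \<tau> k (\<delta> i) (G i) (\<delta> (i + k)) (G (i + k))" for i k
  proof (induction k)
    case (Suc k)
    from local_multiple_trans[OF Suc f(3)[of "i + k", folded G_def \<delta>_def]] show ?case by simp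
  qed (simp add: local_multiple_0)
  obtain n where "form_combination \<delta> G n (\<delta> n) (G n)" using form_sequence_dependent[of \<delta> G, OF G] by blast
  then obtain H where H: "\<And>i. i < n \<Longrightarrow> if \<delta> i \<le> \<delta> n then form (\<delta> n - \<delta> i) (H i) else H i = 0"
    "G n = (\<Sum>i<n. H i * G i)" unfolding form_combination_def by blast
  have "\<forall>i\<in>{..<n}. \<exists>U. \<exists>e. form e U \<and> form_at U P \<noteq> 0 \<and> e + \<delta> i = \<delta> n + (n - i) \<and>
      (\<forall>Q\<in>X. form_at U Q * form_at (G i) Q = form_at (G n) Q * form_at \<tau> Q ^ (n - i))"
  proof
    fix i assume "i \<in> {..<n}"
    then show "\<exists>U. \<exists>e. form e U \<and> form_at U P \<noteq> 0 \<and> e + \<delta> i = \<delta> n + (n - i) \<and>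
      (\<forall>Q\<in>X. form_at U Q * form_at (G i) Q = form_at (G n) Q * form_at \<tau> Q ^ (n - i))"
      using step[of "n - i" i] unfolding local_multiple_def by auto
  qed
  from bchoice[OF this] obtain U where U0: "\<forall>i\<in>{..<n}. \<exists>e. form e (U i) \<and> form_at (U i) P \<noteq> 0 \<and> e + \<delta> i = \<delta> n + (n - i) \<and>
      (\<forall>Q\<in>X. form_at (U i) Q * form_at (G i) Q = form_at (G n) Q * form_at \<tau> Q ^ (n - i))"
    by (elim exE)
  from bchoice[OF this] obtain e where U1: "\<forall>i\<in>{..<n}. form (e i) (U i) \<and> form_at (U i) P \<noteq> 0 \<and> e i + \<delta> i = \<delta> n + (n - i) \<and>
      (\<forall>Q\<in>X. form_at (U i) Q * form_at (G i) Q = form_at (G n) Q * form_at \<tau> Q ^ (n - i))"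
    by (elim exE)
  then have U: "\<And>i. i < n \<Longrightarrow> form (e i) (U i)" "\<And>i. i < n \<Longrightarrow> form_at (U i) P \<noteq> 0"
    "\<And>i. i < n \<Longrightarrow> e i + \<delta> i = \<delta> n + (n - i)"
    "\<And>i Q. i < n \<Longrightarrow> Q \<in> X \<Longrightarrow> form_at (U i) Q * form_at (G i) Q = form_at (G n) Q * form_at \<tau> Q ^ (n - i)"
    by simp_all
  define V where "V = (\<Prod>i<n. U i)"
  define V' where "V' i = (\<Prod>j\<in>{..<n} - {i}. U j)" for i
  define T where "T = (\<Sum>i<n. H i * V' i * \<tau> ^ (n - i))"
  have V: "form (sum e {..<n}) V" "form_at V P \<noteq> 0"
    unfolding V_def using U by (auto intro!: form_prod simp: meval_prod)
  have VU: "form_at V Q = form_at (V' i) Q * form_at (U i) Q" if "i < n" for i Q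
    unfolding V_def V'_def using that by (subst prod.remove[of _ i]) (auto simp: mult.commute)
  have "form (sum e {..<n}) T"
    unfolding T_def
  proof (rule form_sum)
    fix i assume "i \<in> {..<n}"
    then have i: "i < n" by simp
    show "form (sum e {..<n}) (H i * V' i * \<tau> ^ (n - i))"
    proof (cases "\<delta> i \<le> \<delta> n")
      case True
      have "form ((\<delta> n - \<delta> i) + sum e ({..<n} - {i}) + (n - i)) (H i * V' i * \<tau> ^ (n - i))"
        using H(1)[OF i] True U(1) form_power[OF \<tau>1(1), of "n - i"]
        by (intro form_mult form_prod) (auto simp: V'_def intro!: form_prod)
      moreover have "sum e {..<n} = e i + sum e ({..<n} - {i})" using i by (intro sum.remove) auto
      then have "(\<delta> n - \<delta> i) + sum e ({..<n} - {i}) + (n - i) = sum e {..<n}"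
        using U(3)[OF i] True by linarith
      ultimately show ?thesis by (simp only:)
    qed (use H(1)[OF i] in simp)
  qed
  then have VT: "form (sum e {..<n}) (V - T)" using V by (intro form_diff)
  have "form_at T P = 0" using \<tau>1(2) by (auto simp: T_def meval_sum power_0_left intro!: sum.neutral)
  then have nz: "\<not> vanishes_on X (V - T)"
    unfolding vanishes_on_def using V(2) P by (auto intro!: bexI[of _ P])
  have "form_at ((V - T) * G n) Q = 0" if Q: "Q \<in> X" for Q
  proof -
    have "form_at V Q * form_at (G n) Q = (\<Sum>i<n. form_at V Q * (form_at (H i) Q * form_at (G i) Q))"
      by (subst H(2)) (simp add: meval_sum sum_distrib_left)
    also have "\<dots> = (\<Sum>i<n. form_at (H i * V' i * \<tau> ^ (n - i)) Q * form_at (G n) Q)"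
    proof (intro sum.cong refl)
      fix i assume "i \<in> {..<n}"
      then have i: "i < n" by simp
      have "form_at V Q * (form_at (H i) Q * form_at (G i) Q) =
          form_at (H i) Q * form_at (V' i) Q * (form_at (U i) Q * form_at (G i) Q)"
        by (simp add: VU[OF i])
      also have "\<dots> = form_at (H i) Q * form_at (V' i) Q * (form_at (G n) Q * form_at \<tau> Q ^ (n - i))"
        by (simp only: U(4)[OF i Q])
      finally show "form_at V Q * (form_at (H i) Q * form_at (G i) Q) =
          form_at (H i * V' i * \<tau> ^ (n - i)) Q * form_at (G n) Q"
        by (simp only: meval_mult meval_power mult_ac)
    qed
    also have "\<dots> = form_at T Q * form_at (G n) Q" by (simp add: T_def meval_sum sum_distrib_right)
    finally show ?thesis by (simp add: left_diff_distrib)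
  qed
  then have "vanishes_on X ((V - T) * G n)" by (simp add: vanishes_on_def)
  then have "vanishes_on X (G n)" using vanishes_on_mult[OF VT G] nz by blast
  then show False
    using local_multiple_vanishes[OF \<tau> P F(1) f(2)[of n]] F(2) by (simp add: G_def)
qed

text \<open>If \<open>n'\<close> exceeded \<open>n\<close>, cancelling \<open>\<tau> ^ n\<close>
  from the two expressions for \<open>U * U' * F\<close> would leave an identity on \<open>X\<close>
  with one side nonzero at \<open>P\<close> and the other still divisible by
  \<open>\<tau>\<close>.\<close>

lemma form_order_unique_aux:
  assumes \<tau>: "local_equation P \<tau>" and P: "P \<in> X"
    and 1: "form a A" "form_at A P \<noteq> 0" "local_multiple P \<tau> n d F a A"
    and 2: "form a' A'" "local_multiple P \<tau> n' d F a' A'"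
  shows "n' \<le> n"
proof (rule ccontr)
  assume "\<not> n' \<le> n"
  have \<tau>1: "form 1 \<tau>" "form_at \<tau> P = 0" using \<tau> by (auto simp: local_equation_def)
  obtain e U where U: "form e U" "form_at U P \<noteq> 0" "e + d = a + n"
    "\<forall>Q\<in>X. form_at U Q * form_at F Q = form_at A Q * form_at \<tau> Q ^ n"
    using 1(3) unfolding local_multiple_def by blast
  obtain e' U' where U': "form e' U'" "form_at U' P \<noteq> 0" "e' + d = a' + n'"
    "\<forall>Q\<in>X. form_at U' Q * form_at F Q = form_at A' Q * form_at \<tau> Q ^ n'"
    using 2(2) unfolding local_multiple_def by blast
  define B where "B = U' * A - U * A' * \<tau> ^ (n' - n)"
  have "form (e' + a) B"
  proof -
    have "form (e + a' + (n' - n)) (U * A' * \<tau> ^ (n' - n))"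
      using form_power[OF \<tau>1(1), of "n' - n"] by (intro form_mult U 2) simp
    moreover have "e + a' + (n' - n) = e' + a" using U(3) U'(3) \<open>\<not> n' \<le> n\<close> by simp
    ultimately have "form (e' + a) (U * A' * \<tau> ^ (n' - n))" by (simp only:)
    from form_diff[OF form_mult[OF U'(1) 1(1)] this] show ?thesis unfolding B_def .
  qed
  moreover have "form_at B P \<noteq> 0" using U'(2) 1(2) \<tau>1(2) \<open>\<not> n' \<le> n\<close> by (simp add: B_def power_0_left)
  then have "\<not> vanishes_on X B" using P by (auto simp: vanishes_on_def)
  moreover have "form_at (B * \<tau> ^ n) Q = 0" if Q: "Q \<in> X" for Q
  proof -
    have "form_at \<tau> Q ^ n' = form_at \<tau> Q ^ (n' - n) * form_at \<tau> Q ^ n"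
      using \<open>\<not> n' \<le> n\<close> by (simp flip: power_add)
    then have "form_at (B * \<tau> ^ n) Q = form_at U' Q * (form_at A Q * form_at \<tau> Q ^ n) -
        form_at U Q * (form_at A' Q * form_at \<tau> Q ^ n')"
      by (simp add: B_def algebra_simps)
    also have "\<dots> = 0" using U(4)[rule_format, OF Q, symmetric] U'(4)[rule_format, OF Q, symmetric]
      by (simp add: algebra_simps)
    finally show ?thesis .
  qed
  then have "vanishes_on X (B * \<tau> ^ n)" by (simp add: vanishes_on_def)
  ultimately show False
    using vanishes_on_mult[of "e' + a" B "n * 1" "\<tau> ^ n"] form_power[OF \<tau>1(1), of n]
      vanishes_on_power[OF \<tau>1(1)] local_equation_not_vanishes[OF \<tau> P] by blast
qed

end

section \<open>The function field\<close>

text \<open>The field operations are unions over all representatives; such a union equals the common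
  value once the representatives do not matter.\<close>

lemma UN_UN_const:
  assumes "A \<noteq> {}" "B \<noteq> {}" "\<And>a b a' b'. (a, b) \<in> A \<Longrightarrow> (a', b') \<in> B \<Longrightarrow> h a b a' b' = c"
  shows "(\<Union>(a, b)\<in>A. \<Union>(a', b')\<in>B. h a b a' b') = c"
proof -
  have "(\<Union>(a, b)\<in>A. \<Union>(a', b')\<in>B. h a b a' b') = (\<Union>p\<in>A. \<Union>q\<in>B. c)"
    using assms(3) by (intro SUP_cong refl) (auto simp: case_prod_beta)
  then show ?thesis using assms(1,2) by simp
qed

context irreducible_variety
begin

abbreviation FF where "FF \<equiv> function_field X"

lemma fractions_iff: "(F, G) \<in> fractions X \<longleftrightarrow> (\<exists>d. form d F \<and> form d G) \<and> \<not> vanishes_on X G"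
  by (auto simp: fractions_def vanishes_on_def)

lemma fractionsI: "form d F \<Longrightarrow> form d G \<Longrightarrow> \<not> vanishes_on X G \<Longrightarrow> (F, G) \<in> fractions X"
  by (auto simp: fractions_iff)

lemma fractions_at: "form d F \<Longrightarrow> form d G \<Longrightarrow> P \<in> X \<Longrightarrow> form_at G P \<noteq> 0 \<Longrightarrow> (F, G) \<in> fractions X"
  by (rule fractionsI) (auto simp: vanishes_on_def)

lemma cancel_form:
  assumes "form e G" "\<not> vanishes_on X G" "form d H" "\<And>P. P \<in> X \<Longrightarrow> form_at G P * form_at H P = 0" "P \<in> X"
  shows "form_at H P = 0"
proof -
  have "vanishes_on X (G * H)" using assms(4) by (simp add: vanishes_on_def)
  then show ?thesis using vanishes_on_mult[OF assms(1,3)] assms(2,5) by (auto simp: vanishes_on_def)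
qed

lemma mem_frac: "(F', G') \<in> frac X F G \<longleftrightarrow> (F', G') \<in> fractions X \<and>
    (\<forall>P\<in>X. form_at F P * form_at G' P = form_at F' P * form_at G P)"
  by (auto simp: frac_def)

lemma frac_refl: "(F, G) \<in> fractions X \<Longrightarrow> (F, G) \<in> frac X F G"
  by (simp add: mem_frac)

text \<open>The content is transitivity of cross-multiplication: the required equation holds after
  multiplication by \<open>G\<close>, which is cancelled because the vanishing ideal is
  prime.\<close>

lemma frac_eqI:
  assumes 1: "(F, G) \<in> fractions X" and 2: "(F', G') \<in> fractions X"
    and eq: "\<And>P. P \<in> X \<Longrightarrow> form_at F P * form_at G' P = form_at F' P * form_at G P"
  shows "frac X F G = frac X F' G'"
proof -
  have *: "form_at F' P * form_at B P = form_at A P * form_at G' P"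
    if 1: "(F, G) \<in> fractions X" and 2: "(F', G') \<in> fractions X"
      and eq: "\<And>P. P \<in> X \<Longrightarrow> form_at F P * form_at G' P = form_at F' P * form_at G P"
      and 3: "(A, B) \<in> fractions X" and eq': "\<And>P. P \<in> X \<Longrightarrow> form_at F P * form_at B P = form_at A P * form_at G P"
      and P: "P \<in> X" for F G F' G' A B P
  proof -
    obtain d d' d'' where d: "form d F" "form d G" "form d' F'" "form d' G'" "form d'' A" "form d'' B" "\<not> vanishes_on X G"
      using 1 2 3 by (auto simp: fractions_iff)
    have "form_at (F' * B - A * G') P = 0"
    proof (rule cancel_form[OF d(2,7) _ _ P])
      show "form (d' + d'') (F' * B - A * G')" using d by (intro form_diff form_mult form_mult')
      fix Q assume Q: "Q \<in> X"
      have "form_at G Q * form_at (F' * B - A * G') Q =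
          (form_at F' Q * form_at G Q) * form_at B Q - (form_at A Q * form_at G Q) * form_at G' Q"
        by (simp add: algebra_simps)
      also have "\<dots> = 0" unfolding eq[OF Q, symmetric] eq'[OF Q, symmetric] by (simp add: algebra_simps)
      finally show "form_at G Q * form_at (F' * B - A * G') Q = 0" .
    qed
    then show ?thesis by simp
  qed
  have "(A, B) \<in> frac X F G \<longleftrightarrow> (A, B) \<in> frac X F' G'" for A B
    unfolding mem_frac using *[OF 1 2 eq] *[OF 2 1 eq[symmetric]] by blast
  then show ?thesis by (auto intro: set_eqI)
qed

lemma frac_eq_iff:
  assumes "(F, G) \<in> fractions X" "(F', G') \<in> fractions X"
  shows "frac X F G = frac X F' G' \<longleftrightarrow> (\<forall>P\<in>X. form_at F P * form_at G' P = form_at F' P * form_at G P)"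
proof
  assume "frac X F G = frac X F' G'"
  then have "(F', G') \<in> frac X F G" using frac_refl[OF assms(2)] by simp
  then show "\<forall>P\<in>X. form_at F P * form_at G' P = form_at F' P * form_at G P" by (simp add: mem_frac)
qed (use frac_eqI[OF assms] in blast)

lemma frac_of_mem: "(F, G) \<in> fractions X \<Longrightarrow> (F', G') \<in> frac X F G \<Longrightarrow> frac X F' G' = frac X F G"
  using frac_eqI[of F G F' G'] by (simp add: mem_frac)

lemma fractions_mult:
  "(F, G) \<in> fractions X \<Longrightarrow> (F', G') \<in> fractions X \<Longrightarrow> (F * F', G * G') \<in> fractions X"
  using vanishes_on_mult by (auto simp: fractions_iff intro: form_mult)

lemma fractions_add:
  "(F, G) \<in> fractions X \<Longrightarrow> (F', G') \<in> fractions X \<Longrightarrow> (F * G' + F' * G, G * G') \<in> fractions X"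
proof -
  assume "(F, G) \<in> fractions X" "(F', G') \<in> fractions X"
  then obtain d d' where d: "form d F" "form d G" "\<not> vanishes_on X G" "form d' F'" "form d' G'" "\<not> vanishes_on X G'"
    by (auto simp: fractions_iff)
  then have "\<not> vanishes_on X (G * G')" using vanishes_on_mult[OF d(2,5)] by blast
  moreover have "form (d + d') (F * G' + F' * G)" "form (d + d') (G * G')"
    using d by (auto intro: form_add form_mult form_mult')
  ultimately show ?thesis by (auto simp: fractions_iff)
qed

lemma fractions_minus: "(F, G) \<in> fractions X \<Longrightarrow> (- F, G) \<in> fractions X"
  using form_minus by (auto simp: fractions_iff)

lemma FF_carrier: "carrier FF = {frac X F G | F G. (F, G) \<in> fractions X}"
  by (simp add: function_field_def)

lemma frac_carrier [simp]: "(F, G) \<in> fractions X \<Longrightarrow> frac X F G \<in> carrier FF"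
  by (auto simp: FF_carrier)

lemma FF_mult:
  assumes "(F, G) \<in> fractions X" "(F', G') \<in> fractions X"
  shows "frac X F G \<otimes>\<^bsub>FF\<^esub> frac X F' G' = frac X (F * F') (G * G')"
  unfolding function_field_def monoid.simps
proof (rule UN_UN_const)
  fix A B A' B' assume "(A, B) \<in> frac X F G" "(A', B') \<in> frac X F' G'"
  then have *: "(A, B) \<in> fractions X" "(A', B') \<in> fractions X"
    "\<And>P. P \<in> X \<Longrightarrow> form_at F P * form_at B P = form_at A P * form_at G P"
    "\<And>P. P \<in> X \<Longrightarrow> form_at F' P * form_at B' P = form_at A' P * form_at G' P"
    by (auto simp: mem_frac)
  show "frac X (A * A') (B * B') = frac X (F * F') (G * G')"
  proof (rule frac_eqI)
    fix P assume "P \<in> X"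
    have "form_at (A * A') P * form_at (G * G') P = (form_at A P * form_at G P) * (form_at A' P * form_at G' P)"
      by simp
    also have "\<dots> = form_at (F * F') P * form_at (B * B') P"
      unfolding *(3,4)[OF \<open>P \<in> X\<close>, symmetric] by simp
    finally show "form_at (A * A') P * form_at (G * G') P = form_at (F * F') P * form_at (B * B') P" .
  qed (intro fractions_mult * assms)+
qed (use frac_refl[OF assms(1)] frac_refl[OF assms(2)] in auto)

lemma FF_add:
  assumes "(F, G) \<in> fractions X" "(F', G') \<in> fractions X"
  shows "frac X F G \<oplus>\<^bsub>FF\<^esub> frac X F' G' = frac X (F * G' + F' * G) (G * G')"
  unfolding function_field_def ring.simps
proof (rule UN_UN_const)
  fix A B A' B' assume "(A, B) \<in> frac X F G" "(A', B') \<in> frac X F' G'"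
  then have *: "(A, B) \<in> fractions X" "(A', B') \<in> fractions X"
    "\<And>P. P \<in> X \<Longrightarrow> form_at F P * form_at B P = form_at A P * form_at G P"
    "\<And>P. P \<in> X \<Longrightarrow> form_at F' P * form_at B' P = form_at A' P * form_at G' P"
    by (auto simp: mem_frac)
  show "frac X (A * B' + A' * B) (B * B') = frac X (F * G' + F' * G) (G * G')"
  proof (rule frac_eqI)
    fix P assume "P \<in> X"
    have "form_at (A * B' + A' * B) P * form_at (G * G') P =
        (form_at A P * form_at G P) * (form_at B' P * form_at G' P) +
        (form_at A' P * form_at G' P) * (form_at B P * form_at G P)"
      by (simp add: algebra_simps)
    also have "\<dots> = form_at (F * G' + F' * G) P * form_at (B * B') P"
      unfolding *(3,4)[OF \<open>P \<in> X\<close>, symmetric] by (simp add: algebra_simps)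
    finally show "form_at (A * B' + A' * B) P * form_at (G * G') P = form_at (F * G' + F' * G) P * form_at (B * B') P" .
  qed (intro fractions_add * assms)+
qed (use frac_refl[OF assms(1)] frac_refl[OF assms(2)] in auto)

lemma FF_one: "\<one>\<^bsub>FF\<^esub> = frac X 1 1" and FF_zero: "\<zero>\<^bsub>FF\<^esub> = frac X 0 1"
  by (simp_all add: function_field_def)

lemma fractions_const [simp]: "(mconst c, 1) \<in> fractions X" "(1, 1) \<in> fractions X" "(0, 1) \<in> fractions X"
  by (auto simp: fractions_iff intro: exI[of _ 0])

lemma frac_eq_zero: "(F, G) \<in> fractions X \<Longrightarrow> frac X F G = \<zero>\<^bsub>FF\<^esub> \<longleftrightarrow> vanishes_on X F"
  unfolding FF_zero by (subst frac_eq_iff) (auto simp: vanishes_on_def)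

lemma FF_carrierE:
  assumes "f \<in> carrier FF" obtains F G where "(F, G) \<in> fractions X" "f = frac X F G"
  using assms by (auto simp: FF_carrier)

lemma cring_FF: "cring FF"
proof (rule cringI)
  show "abelian_group FF"
  proof (rule abelian_groupI)
    fix x y z assume xyz: "x \<in> carrier FF" "y \<in> carrier FF" "z \<in> carrier FF"
    from xyz(1) obtain F G where x: "(F, G) \<in> fractions X" "x = frac X F G" by (rule FF_carrierE)
    from xyz(2) obtain F' G' where y: "(F', G') \<in> fractions X" "y = frac X F' G'" by (rule FF_carrierE)
    from xyz(3) obtain F'' G'' where z: "(F'', G'') \<in> fractions X" "z = frac X F'' G''" by (rule FF_carrierE)
    show "x \<oplus>\<^bsub>FF\<^esub> y \<in> carrier FF" using x y by (simp add: FF_add fractions_add)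
    show "x \<oplus>\<^bsub>FF\<^esub> y \<oplus>\<^bsub>FF\<^esub> z = x \<oplus>\<^bsub>FF\<^esub> (y \<oplus>\<^bsub>FF\<^esub> z)"
      using x y z by (simp add: FF_add fractions_add fractions_mult algebra_simps)
    show "x \<oplus>\<^bsub>FF\<^esub> y = y \<oplus>\<^bsub>FF\<^esub> x" using x y by (simp add: FF_add algebra_simps)
    show "\<zero>\<^bsub>FF\<^esub> \<oplus>\<^bsub>FF\<^esub> x = x" unfolding FF_zero using x by (simp add: FF_add)
    have x': "(- F, G) \<in> fractions X" using x(1) by (rule fractions_minus)
    then have "frac X (- F) G \<oplus>\<^bsub>FF\<^esub> x = \<zero>\<^bsub>FF\<^esub>"
      unfolding FF_zero using x by (simp add: FF_add) (intro frac_eqI, use x x' fractions_add[OF x' x(1)] in auto)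
    then show "\<exists>y\<in>carrier FF. y \<oplus>\<^bsub>FF\<^esub> x = \<zero>\<^bsub>FF\<^esub>" using x' by (meson frac_carrier)
  qed (simp add: FF_zero)
  show "comm_monoid FF"
  proof (rule comm_monoidI)
    fix x y z assume xyz: "x \<in> carrier FF" "y \<in> carrier FF" "z \<in> carrier FF"
    from xyz(1) obtain F G where x: "(F, G) \<in> fractions X" "x = frac X F G" by (rule FF_carrierE)
    from xyz(2) obtain F' G' where y: "(F', G') \<in> fractions X" "y = frac X F' G'" by (rule FF_carrierE)
    from xyz(3) obtain F'' G'' where z: "(F'', G'') \<in> fractions X" "z = frac X F'' G''" by (rule FF_carrierE)
    show "x \<otimes>\<^bsub>FF\<^esub> y \<in> carrier FF" using x y by (simp add: FF_mult fractions_mult)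
    show "x \<otimes>\<^bsub>FF\<^esub> y \<otimes>\<^bsub>FF\<^esub> z = x \<otimes>\<^bsub>FF\<^esub> (y \<otimes>\<^bsub>FF\<^esub> z)"
      using x y z by (simp add: FF_mult fractions_mult mult.assoc)
    show "x \<otimes>\<^bsub>FF\<^esub> y = y \<otimes>\<^bsub>FF\<^esub> x" using x y by (simp add: FF_mult mult.commute)
    show "\<one>\<^bsub>FF\<^esub> \<otimes>\<^bsub>FF\<^esub> x = x" unfolding FF_one using x by (simp add: FF_mult)
  qed (simp add: FF_one)
  fix x y z assume xyz: "x \<in> carrier FF" "y \<in> carrier FF" "z \<in> carrier FF"
  from xyz(1) obtain F G where x: "(F, G) \<in> fractions X" "x = frac X F G" by (rule FF_carrierE)
  from xyz(2) obtain F' G' where y: "(F', G') \<in> fractions X" "y = frac X F' G'" by (rule FF_carrierE)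
  from xyz(3) obtain F'' G'' where z: "(F'', G'') \<in> fractions X" "z = frac X F'' G''" by (rule FF_carrierE)
  show "(x \<oplus>\<^bsub>FF\<^esub> y) \<otimes>\<^bsub>FF\<^esub> z = x \<otimes>\<^bsub>FF\<^esub> z \<oplus>\<^bsub>FF\<^esub> y \<otimes>\<^bsub>FF\<^esub> z"
    using x y z
    by (simp add: FF_mult FF_add fractions_mult fractions_add)
      (intro frac_eqI fractions_mult fractions_add, auto simp: algebra_simps)
qed

lemma field_FF: "field FF"
proof (rule cring.cring_fieldI2[OF cring_FF])
  show "\<zero>\<^bsub>FF\<^esub> \<noteq> \<one>\<^bsub>FF\<^esub>"
    using frac_eq_zero[of 1 1] by (simp add: FF_one)
  fix a assume a: "a \<in> carrier FF" "a \<noteq> \<zero>\<^bsub>FF\<^esub>"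
  from a(1) obtain F G where FG: "(F, G) \<in> fractions X" "a = frac X F G" by (rule FF_carrierE)
  then have GF: "(G, F) \<in> fractions X" using a(2) frac_eq_zero[OF FG(1)] by (auto simp: fractions_iff)
  have "a \<otimes>\<^bsub>FF\<^esub> frac X G F = \<one>\<^bsub>FF\<^esub>"
    using FG GF by (simp add: FF_mult FF_one) (intro frac_eqI fractions_mult, auto)
  then show "\<exists>b\<in>carrier FF. a \<otimes>\<^bsub>FF\<^esub> b = \<one>\<^bsub>FF\<^esub>" using GF by (meson frac_carrier)
qed

end

sublocale irreducible_variety \<subseteq> FF: field "function_field X"
  by (rule field_FF)

context irreducible_variety
begin

lemma const_fun_carrier [simp]: "const_fun X c \<in> carrier FF"
  by (simp add: const_fun_def)

lemma const_fun_mult: "const_fun X c \<otimes>\<^bsub>FF\<^esub> const_fun X d = const_fun X (c * d)"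
  by (simp add: const_fun_def FF_mult) (simp add: mconst_def mult_single)

lemma const_fun_add: "const_fun X c \<oplus>\<^bsub>FF\<^esub> const_fun X d = const_fun X (c + d)"
  by (simp add: const_fun_def FF_add) (simp add: mconst_def single_add)

lemma const_fun_one: "const_fun X 1 = \<one>\<^bsub>FF\<^esub>" and const_fun_zero: "const_fun X 0 = \<zero>\<^bsub>FF\<^esub>"
  by (simp_all add: const_fun_def FF_one FF_zero mconst_def)

lemma FF_minus: "(F, G) \<in> fractions X \<Longrightarrow> \<ominus>\<^bsub>FF\<^esub> frac X F G = frac X (- F) G"
proof -
  assume FG: "(F, G) \<in> fractions X"
  then have m: "(- F, G) \<in> fractions X" by (rule fractions_minus)
  have "frac X (- F) G \<oplus>\<^bsub>FF\<^esub> frac X F G = \<zero>\<^bsub>FF\<^esub>"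
    unfolding FF_zero using FG m by (simp add: FF_add) (intro frac_eqI, use FG m fractions_add[OF m FG] in auto)
  then show ?thesis using FG m FF.minus_equality[of "frac X (- F) G" "frac X F G"] by simp
qed

section \<open>Local rings\<close>

lemma local_ringE:
  assumes "f \<in> local_ring X P"
  obtains F G where "(F, G) \<in> fractions X" "f = frac X F G" "form_at G P \<noteq> 0"
proof -
  have "f \<in> carrier FF" using assms by (simp add: local_ring_def)
  then obtain A B where AB: "(A, B) \<in> fractions X" "f = frac X A B" by (rule FF_carrierE)
  obtain p where p: "p \<in> f" "form_at (snd p) P \<noteq> 0" using assms by (auto simp: local_ring_def)
  then have m: "(fst p, snd p) \<in> frac X A B" using AB by simp
  then have "(fst p, snd p) \<in> fractions X" by (simp only: mem_frac)
  moreover have "f = frac X (fst p) (snd p)" using frac_of_mem[OF AB(1) m] AB(2) by simp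
  ultimately show thesis using p(2) by (rule that)
qed

lemma frac_local_ring: "(F, G) \<in> fractions X \<Longrightarrow> form_at G P \<noteq> 0 \<Longrightarrow> frac X F G \<in> local_ring X P"
  using frac_refl by (auto simp: local_ring_def intro!: bexI)

lemma local_ring_carrier: "f \<in> local_ring X P \<Longrightarrow> f \<in> carrier FF"
  by (simp add: local_ring_def)

lemma value_at_frac:
  assumes P: "P \<in> X" and FG: "(F, G) \<in> fractions X" "form_at G P \<noteq> 0"
  shows "value_at (frac X F G) P = form_at F P / form_at G P"
  unfolding value_at_def
proof (rule the_equality)
  show "\<exists>(A, B)\<in>frac X F G. form_at B P \<noteq> 0 \<and> form_at F P / form_at G P = form_at A P / form_at B P"
    using frac_refl[OF FG(1)] FG(2) by (intro bexI[of _ "(F, G)"]) auto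
  fix c assume "\<exists>(A, B)\<in>frac X F G. form_at B P \<noteq> 0 \<and> c = form_at A P / form_at B P"
  then obtain A B where "(A, B) \<in> frac X F G" "form_at B P \<noteq> 0" "c = form_at A P / form_at B P" by auto
  moreover from this(1) have "form_at F P * form_at B P = form_at A P * form_at G P"
    using P by (simp add: mem_frac)
  ultimately show "c = form_at F P / form_at G P" using FG(2) by (simp add: frac_eq_eq)
qed

lemma local_ring_add: "f \<in> local_ring X P \<Longrightarrow> h \<in> local_ring X P \<Longrightarrow> f \<oplus>\<^bsub>FF\<^esub> h \<in> local_ring X P"
  by (elim local_ringE) (auto simp: FF_add intro!: frac_local_ring fractions_add)

lemma local_ring_mult: "f \<in> local_ring X P \<Longrightarrow> h \<in> local_ring X P \<Longrightarrow> f \<otimes>\<^bsub>FF\<^esub> h \<in> local_ring X P"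
  by (elim local_ringE) (auto simp: FF_mult intro!: frac_local_ring fractions_mult)

lemma local_ring_const [simp]: "const_fun X c \<in> local_ring X P"
  unfolding const_fun_def by (rule frac_local_ring) auto

lemma value_at_const [simp]: "P \<in> X \<Longrightarrow> value_at (const_fun X c) P = c"
  unfolding const_fun_def by (subst value_at_frac) auto

lemma value_at_add:
  assumes P: "P \<in> X" and f: "f \<in> local_ring X P" and h: "h \<in> local_ring X P"
  shows "value_at (f \<oplus>\<^bsub>FF\<^esub> h) P = value_at f P + value_at h P"
proof -
  from f obtain F G where FG: "(F, G) \<in> fractions X" "f = frac X F G" "form_at G P \<noteq> 0" by (rule local_ringE)
  from h obtain F' G' where FG': "(F', G') \<in> fractions X" "h = frac X F' G'" "form_at G' P \<noteq> 0" by (rule local_ringE)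
  have "value_at (f \<oplus>\<^bsub>FF\<^esub> h) P = form_at (F * G' + F' * G) P / form_at (G * G') P"
    unfolding FG(2) FG'(2) FF_add[OF FG(1) FG'(1)]
    using FG FG' by (intro value_at_frac P fractions_add) auto
  then show ?thesis
    using FG(3) FG'(3) by (simp add: FG(2) FG'(2) value_at_frac[OF P FG(1,3)] value_at_frac[OF P FG'(1,3)] add_frac_eq)
qed

lemma value_at_mult:
  "P \<in> X \<Longrightarrow> f \<in> local_ring X P \<Longrightarrow> h \<in> local_ring X P \<Longrightarrow> value_at (f \<otimes>\<^bsub>FF\<^esub> h) P = value_at f P * value_at h P"
  by (elim local_ringE) (auto simp: FF_mult value_at_frac fractions_mult)

lemma local_ring_minus: "f \<in> local_ring X P \<Longrightarrow> \<ominus>\<^bsub>FF\<^esub> f \<in> local_ring X P"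
  by (elim local_ringE) (auto simp: FF_minus intro!: frac_local_ring fractions_minus)

lemma local_ring_diff: "f \<in> local_ring X P \<Longrightarrow> h \<in> local_ring X P \<Longrightarrow> f \<ominus>\<^bsub>FF\<^esub> h \<in> local_ring X P"
  by (simp add: a_minus_def local_ring_add local_ring_minus)

lemma value_at_minus: "P \<in> X \<Longrightarrow> f \<in> local_ring X P \<Longrightarrow> value_at (\<ominus>\<^bsub>FF\<^esub> f) P = - value_at f P"
  by (elim local_ringE) (auto simp: FF_minus value_at_frac fractions_minus)

lemma value_at_diff:
  "P \<in> X \<Longrightarrow> f \<in> local_ring X P \<Longrightarrow> h \<in> local_ring X P \<Longrightarrow> value_at (f \<ominus>\<^bsub>FF\<^esub> h) P = value_at f P - value_at h P"
  by (simp add: a_minus_def value_at_add local_ring_minus value_at_minus)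

lemma local_unit_inv:
  assumes P: "P \<in> X" and f: "f \<in> local_ring X P" "value_at f P \<noteq> 0"
  shows "inv\<^bsub>FF\<^esub> f \<in> local_ring X P" "f \<noteq> \<zero>\<^bsub>FF\<^esub>" "value_at (inv\<^bsub>FF\<^esub> f) P \<noteq> 0"
proof -
  from f(1) obtain F G where FG: "(F, G) \<in> fractions X" "f = frac X F G" "form_at G P \<noteq> 0" by (rule local_ringE)
  have FP: "form_at F P \<noteq> 0" using f(2) value_at_frac[OF P FG(1,3)] FG(2) by auto
  then have GF: "(G, F) \<in> fractions X" using FG(1) P by (auto simp: fractions_iff vanishes_on_def)
  have "f \<otimes>\<^bsub>FF\<^esub> frac X G F = \<one>\<^bsub>FF\<^esub>"
    using FG GF by (simp add: FF_mult FF_one) (intro frac_eqI fractions_mult, auto)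
  then have inv: "inv\<^bsub>FF\<^esub> f = frac X G F"
    using FG GF FF.comm_inv_char[of f "frac X G F"] by simp
  show "inv\<^bsub>FF\<^esub> f \<in> local_ring X P" unfolding inv using GF FP by (rule frac_local_ring)
  show "f \<noteq> \<zero>\<^bsub>FF\<^esub>" using frac_eq_zero[OF FG(1)] FG(2) FP P by (auto simp: vanishes_on_def)
  show "value_at (inv\<^bsub>FF\<^esub> f) P \<noteq> 0" unfolding inv using value_at_frac[OF P GF FP] FP FG(3) by simp
qed

end

context irreducible_variety
begin

lemma max_ideal_iff: "f \<in> max_ideal X P \<longleftrightarrow> f \<in> local_ring X P \<and> value_at f P = 0"
  by (simp add: max_ideal_def)

lemma frac_nat_pow:
  assumes "(F, G) \<in> fractions X"
  shows "(F ^ n, G ^ n) \<in> fractions X" "frac X F G [^]\<^bsub>FF\<^esub> (n :: nat) = frac X (F ^ n) (G ^ n)"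
proof (induction n)
  case 0
  { case 1 show ?case by simp }
  { case 2 show ?case by (simp add: FF_one) }
next
  case (Suc n)
  { case 1 show ?case using fractions_mult[OF assms Suc.IH(1)] by simp }
  { case 2 show ?case using Suc.IH by (simp add: FF_mult[OF Suc.IH(1) assms] mult.commute) }
qed

lemma local_ring_nat_pow: "f \<in> local_ring X P \<Longrightarrow> f [^]\<^bsub>FF\<^esub> (n :: nat) \<in> local_ring X P"
  using local_ring_const[of 1 P] by (induction n) (auto simp: const_fun_one local_ring_mult)

end

section \<open>Uniformizers from local equations\<close>

context smooth_curve
begin

text \<open>The uniformizer is a local equation divided by a linear form nonzero at
  \<open>P\<close>. The last clause is Krull's intersection theorem for this ring: \<open>t\<close>
  divides \<open>f\<close> at most as often as \<open>\<tau>\<close> divides the numerator of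
  \<open>f\<close>.\<close>

lemma uniformizer_exists:
  assumes P: "P \<in> X"
  shows "\<exists>t. uniformizer X P t \<and> t \<noteq> \<zero>\<^bsub>FF\<^esub> \<and> (\<forall>f\<in>local_ring X P. f \<noteq> \<zero>\<^bsub>FF\<^esub> \<longrightarrow>
    (\<exists>N. \<forall>n h. h \<in> local_ring X P \<longrightarrow> f = t [^]\<^bsub>FF\<^esub> (n :: nat) \<otimes>\<^bsub>FF\<^esub> h \<longrightarrow> n \<le> N))"
proof -
  obtain l \<tau> where l: "form_at (linear_form l) P = 1" and \<tau>: "local_equation P \<tau>"
    using local_equation_exists[OF P] by blast
  have \<tau>1: "form 1 \<tau>" "form_at \<tau> P = 0" using \<tau> by (auto simp: local_equation_def)
  define L where "L = linear_form l"
  have L: "form 1 L" "form_at L P \<noteq> 0" using l by (auto simp: L_def)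
  have tL: "(\<tau>, L) \<in> fractions X" using \<tau>1(1) L P by (intro fractions_at)
  define t where "t = frac X \<tau> L"
  have tO: "t \<in> local_ring X P" unfolding t_def using tL L by (intro frac_local_ring)
  have tv: "value_at t P = 0" unfolding t_def using value_at_frac[OF P tL L(2)] \<tau>1 by simp
  have "max_ideal X P = {t \<otimes>\<^bsub>FF\<^esub> h | h. h \<in> local_ring X P}"
  proof (intro equalityI subsetI)
    fix f assume "f \<in> max_ideal X P"
    then have f: "f \<in> local_ring X P" "value_at f P = 0" by (auto simp: max_ideal_iff)
    from f(1) obtain F G where FG: "(F, G) \<in> fractions X" "f = frac X F G" "form_at G P \<noteq> 0" by (rule local_ringE)
    then obtain d where d: "form d F" "form d G" by (auto simp: fractions_iff)
    have "form_at F P = 0" using f(2) value_at_frac[OF P FG(1,3)] FG by simp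
    then obtain a A where A: "form a A" "local_multiple P \<tau> 1 d F a A"
      using \<tau> d unfolding local_equation_def by blast
    then obtain e U where U: "form e U" "form_at U P \<noteq> 0" "e + d = a + 1"
      "\<forall>Q\<in>X. form_at U Q * form_at F Q = form_at A Q * form_at \<tau> Q ^ 1"
      unfolding local_multiple_def by blast
    \<comment> \<open>The factor \<open>L\<close> restores equal degrees, since
      \<open>e + d = a + 1\<close>.\<close>
    have AL: "(A * L, U * G) \<in> fractions X"
      using form_mult[OF A(1) L(1)] form_mult[OF U(1) d(2)] U FG(3) P by (intro fractions_at[of "a + 1"]) auto
    have "f = t \<otimes>\<^bsub>FF\<^esub> frac X (A * L) (U * G)"
      unfolding FG(2) t_def FF_mult[OF tL AL]
    proof (rule frac_eqI[OF FG(1) fractions_mult[OF tL AL]])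
      fix Q assume Q: "Q \<in> X"
      have "form_at F Q * form_at (L * (U * G)) Q = (form_at U Q * form_at F Q) * form_at L Q * form_at G Q"
        by (simp add: mult_ac)
      also have "\<dots> = (form_at A Q * form_at \<tau> Q) * form_at L Q * form_at G Q"
        using U(4) Q by simp
      finally show "form_at F Q * form_at (L * (U * G)) Q = form_at (\<tau> * (A * L)) Q * form_at G Q"
        by (simp add: mult_ac)
    qed
    moreover have "frac X (A * L) (U * G) \<in> local_ring X P"
      using AL U FG(3) by (intro frac_local_ring) auto
    ultimately show "f \<in> {t \<otimes>\<^bsub>FF\<^esub> h | h. h \<in> local_ring X P}" by blast
  qed (use tO tv in \<open>auto simp: max_ideal_iff local_ring_mult value_at_mult[OF P]\<close>)
  moreover have "t \<in> max_ideal X P" using tO tv by (simp add: max_ideal_iff)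
  ultimately have "uniformizer X P t" unfolding uniformizer_def by (intro conjI)
  moreover have "t \<noteq> \<zero>\<^bsub>FF\<^esub>"
    using frac_eq_zero[OF tL] local_equation_not_vanishes[OF \<tau> P] by (simp add: t_def)
  moreover have "\<exists>N. \<forall>n h. h \<in> local_ring X P \<longrightarrow> f = t [^]\<^bsub>FF\<^esub> (n :: nat) \<otimes>\<^bsub>FF\<^esub> h \<longrightarrow> n \<le> N"
    if f: "f \<in> local_ring X P" "f \<noteq> \<zero>\<^bsub>FF\<^esub>" for f
  proof -
    from f(1) obtain F G where FG: "(F, G) \<in> fractions X" "f = frac X F G" "form_at G P \<noteq> 0" by (rule local_ringE)
    then obtain d where d: "form d F" "form d G" by (auto simp: fractions_iff)
    have "\<not> vanishes_on X F" using frac_eq_zero[OF FG(1)] f(2) FG(2) by simp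
    then obtain N a A where A: "form a A" "form_at A P \<noteq> 0" "local_multiple P \<tau> N d F a A"
      using form_order_exists[OF \<tau> P d(1)] by blast
    have bound: "n \<le> N" if h: "h \<in> local_ring X P" "f = t [^]\<^bsub>FF\<^esub> n \<otimes>\<^bsub>FF\<^esub> h" for n h
    proof -
      from h(1) obtain F' G' where FG': "(F', G') \<in> fractions X" "h = frac X F' G'" "form_at G' P \<noteq> 0" by (rule local_ringE)
      then obtain d' where d': "form d' F'" "form d' G'" by (auto simp: fractions_iff)
      note tn = frac_nat_pow[OF tL, of n]
      have "frac X F G = frac X (\<tau> ^ n * F') (L ^ n * G')"
        using h(2) unfolding FG(2) FG'(2) t_def tn(2) FF_mult[OF tn(1) FG'(1)] .
      then have eq: "\<forall>Q\<in>X. form_at F Q * form_at (L ^ n * G') Q = form_at (\<tau> ^ n * F') Q * form_at G Q"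
        using frac_eq_iff[OF FG(1) fractions_mult[OF tn(1) FG'(1)]] by blast
      have LG: "form (n + d') (L ^ n * G')" using form_mult[OF form_power[OF L(1), of n] d'(2)] by simp
      have "local_multiple P \<tau> n d F (d' + d) (F' * G)"
        unfolding local_multiple_def
        using LG eq L(2) FG'(3)
        by (intro exI[of _ "n + d'"] exI[of _ "L ^ n * G'"]) (auto simp: mult_ac)
      then show "n \<le> N" using form_order_unique_aux[OF \<tau> P A] form_mult[OF d'(1) d(2)] by blast
    qed
    show ?thesis by (intro exI[of _ N] allI impI) (rule bound)
  qed
  ultimately show ?thesis by blast
qed

end

section \<open>Power series expansion\<close>

text \<open>Expanding functions in powers of a uniformizer embeds the function field in the type of
  formal Laurent series, where the field operations are available as type class operations.\<close>

locale expansion_point = smooth_curve +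
  fixes P :: "('a, 'b) proj_point" and t :: "('a, 'b) ratfun"
  assumes P: "P \<in> X" and unif: "uniformizer X P t" and t_nonzero: "t \<noteq> \<zero>\<^bsub>function_field X\<^esub>"
    and finite_order: "\<And>f. f \<in> local_ring X P \<Longrightarrow> f \<noteq> \<zero>\<^bsub>function_field X\<^esub> \<Longrightarrow>
      \<exists>N. \<forall>n h. h \<in> local_ring X P \<longrightarrow> f = t [^]\<^bsub>function_field X\<^esub> (n :: nat) \<otimes>\<^bsub>function_field X\<^esub> h \<longrightarrow> n \<le> N"
begin

abbreviation OP where "OP \<equiv> local_ring X P"

lemma t_local: "t \<in> OP" "value_at t P = 0" "t \<in> carrier FF"
  using unif by (auto simp: uniformizer_def max_ideal_iff local_ring_carrier)

text \<open>Subtracts the value at \<open>P\<close> and divides by \<open>t\<close>; iterating it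
  reads off the Taylor coefficients.\<close>

definition shift where
  "shift f = (THE h. h \<in> OP \<and> f = const_fun X (value_at f P) \<oplus>\<^bsub>FF\<^esub> t \<otimes>\<^bsub>FF\<^esub> h)"

lemma shift_unique:
  assumes f: "f = const_fun X c \<oplus>\<^bsub>FF\<^esub> t \<otimes>\<^bsub>FF\<^esub> h" and h: "h \<in> OP"
  shows "value_at f P = c" "shift f = h"
proof -
  note [simp] = local_ring_carrier[of _ P] t_local
  show c: "value_at f P = c"
    unfolding f using h by (simp add: value_at_add[OF P] value_at_mult[OF P] local_ring_mult P)
  show "shift f = h"
    unfolding shift_def c
  proof (rule the_equality)
    show "h \<in> OP \<and> f = const_fun X c \<oplus>\<^bsub>FF\<^esub> t \<otimes>\<^bsub>FF\<^esub> h" using assms by simp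
    fix k assume k: "k \<in> OP \<and> f = const_fun X c \<oplus>\<^bsub>FF\<^esub> t \<otimes>\<^bsub>FF\<^esub> k"
    then have "const_fun X c \<oplus>\<^bsub>FF\<^esub> t \<otimes>\<^bsub>FF\<^esub> k = const_fun X c \<oplus>\<^bsub>FF\<^esub> t \<otimes>\<^bsub>FF\<^esub> h" using f by simp
    then have "\<ominus>\<^bsub>FF\<^esub> const_fun X c \<oplus>\<^bsub>FF\<^esub> (const_fun X c \<oplus>\<^bsub>FF\<^esub> t \<otimes>\<^bsub>FF\<^esub> k) =
        \<ominus>\<^bsub>FF\<^esub> const_fun X c \<oplus>\<^bsub>FF\<^esub> (const_fun X c \<oplus>\<^bsub>FF\<^esub> t \<otimes>\<^bsub>FF\<^esub> h)" by simp
    then have "t \<otimes>\<^bsub>FF\<^esub> k = t \<otimes>\<^bsub>FF\<^esub> h" using k h by (subst (asm) (1 2) FF.r_neg1) auto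
    then show "k = h" using k h t_nonzero by (subst (asm) FF.m_lcancel) auto
  qed
qed

lemma shift:
  assumes f: "f \<in> OP"
  shows "shift f \<in> OP" "f = const_fun X (value_at f P) \<oplus>\<^bsub>FF\<^esub> t \<otimes>\<^bsub>FF\<^esub> shift f"
proof -
  let ?c = "const_fun X (value_at f P)"
  have "f \<ominus>\<^bsub>FF\<^esub> ?c \<in> max_ideal X P"
    using f P by (simp add: max_ideal_iff local_ring_diff value_at_diff)
  then obtain h where h: "h \<in> OP" "f \<ominus>\<^bsub>FF\<^esub> ?c = t \<otimes>\<^bsub>FF\<^esub> h"
    using unif unfolding uniformizer_def by blast
  have "f = ?c \<oplus>\<^bsub>FF\<^esub> (f \<ominus>\<^bsub>FF\<^esub> ?c)"
    using local_ring_carrier[OF f] by (simp add: a_minus_def FF.a_lcomm FF.r_neg)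
  then have fh: "f = ?c \<oplus>\<^bsub>FF\<^esub> t \<otimes>\<^bsub>FF\<^esub> h" by (simp only: h(2))
  then have "shift f = h" using shift_unique(2)[OF fh h(1)] by simp
  then show "shift f \<in> OP" "f = ?c \<oplus>\<^bsub>FF\<^esub> t \<otimes>\<^bsub>FF\<^esub> shift f" using h(1) fh by simp_all
qed

definition expansion where "expansion f = Abs_fps (\<lambda>n. value_at ((shift ^^ n) f) P)"

lemma expansion_rec: "expansion f = fps_const (value_at f P) + fps_X * expansion (shift f)"
proof (rule fps_ext)
  fix n show "fps_nth (expansion f) n = fps_nth (fps_const (value_at f P) + fps_X * expansion (shift f)) n"
    by (cases n) (simp_all add: expansion_def funpow_Suc_right del: funpow.simps)
qed

lemma expansion_eq:
  assumes "f = const_fun X c \<oplus>\<^bsub>FF\<^esub> t \<otimes>\<^bsub>FF\<^esub> h" "h \<in> OP"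
  shows "expansion f = fps_const c + fps_X * expansion h"
  using expansion_rec[of f] shift_unique[OF assms] by simp

text \<open>Induction on the index with arbitrary functions: \<open>expansion_rec\<close> exposes
  one coefficient and passes to the shifts.\<close>

lemma expansion_nth_add: "f \<in> OP \<Longrightarrow> h \<in> OP \<Longrightarrow>
    fps_nth (expansion (f \<oplus>\<^bsub>FF\<^esub> h)) n = fps_nth (expansion f) n + fps_nth (expansion h) n"
proof (induction n arbitrary: f h)
  case 0
  then show ?case by (simp add: expansion_def value_at_add[OF P])
next
  case (Suc n)
  note [simp] = local_ring_carrier[of _ P] t_local
  note f = shift[OF Suc.prems(1)]
  note h = shift[OF Suc.prems(2)]
  have "f \<oplus>\<^bsub>FF\<^esub> h = (const_fun X (value_at f P) \<oplus>\<^bsub>FF\<^esub> const_fun X (value_at h P)) \<oplus>\<^bsub>FF\<^esub> t \<otimes>\<^bsub>FF\<^esub> (shift f \<oplus>\<^bsub>FF\<^esub> shift h)"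
    by (subst f(2), subst h(2)) (use f(1) h(1) in \<open>simp add: FF.r_distr FF.a_ac\<close>)
  from expansion_eq[OF this[unfolded const_fun_add] local_ring_add[OF f(1) h(1)]]
  show ?case using Suc.IH[OF f(1) h(1)] by (simp add: expansion_rec[of f] expansion_rec[of h])
qed

lemma expansion_add: "f \<in> OP \<Longrightarrow> h \<in> OP \<Longrightarrow> expansion (f \<oplus>\<^bsub>FF\<^esub> h) = expansion f + expansion h"
  by (rule fps_ext) (simp add: expansion_nth_add)

lemma expansion_t_mult: "h \<in> OP \<Longrightarrow> expansion (t \<otimes>\<^bsub>FF\<^esub> h) = fps_X * expansion h"
  using expansion_eq[of "t \<otimes>\<^bsub>FF\<^esub> h" 0 h] t_local(3) local_ring_carrier[of h P]
  by (simp add: const_fun_zero)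

lemma expansion_nth_const_mult: "h \<in> OP \<Longrightarrow>
    fps_nth (expansion (const_fun X c \<otimes>\<^bsub>FF\<^esub> h)) n = c * fps_nth (expansion h) n"
proof (induction n arbitrary: h)
  case 0
  then show ?case by (simp add: expansion_def value_at_mult[OF P] P)
next
  case (Suc n)
  note [simp] = local_ring_carrier[of _ P] t_local
  note h = shift[OF Suc.prems]
  have "const_fun X c \<otimes>\<^bsub>FF\<^esub> h = (const_fun X c \<otimes>\<^bsub>FF\<^esub> const_fun X (value_at h P)) \<oplus>\<^bsub>FF\<^esub> t \<otimes>\<^bsub>FF\<^esub> (const_fun X c \<otimes>\<^bsub>FF\<^esub> shift h)"
    by (subst h(2)) (use h(1) in \<open>simp add: FF.r_distr FF.m_lcomm\<close>)
  from expansion_eq[OF this[unfolded const_fun_mult] local_ring_mult[OF local_ring_const h(1)]]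
  show ?case using Suc.IH[OF h(1)] by (simp add: expansion_rec[of h])
qed

lemma expansion_const_mult: "h \<in> OP \<Longrightarrow> expansion (const_fun X c \<otimes>\<^bsub>FF\<^esub> h) = fps_const c * expansion h"
  by (rule fps_ext) (simp add: expansion_nth_const_mult)

lemma expansion_zero: "expansion \<zero>\<^bsub>FF\<^esub> = 0"
  using expansion_const_mult[OF local_ring_const[of 0], of 0] by (simp add: const_fun_mult const_fun_zero)

lemma expansion_const: "expansion (const_fun X c) = fps_const c"
  using expansion_eq[of "const_fun X c" c "\<zero>\<^bsub>FF\<^esub>"] t_local(3) local_ring_const[of 0 P]
  by (simp add: const_fun_zero expansion_zero)

text \<open>With \<open>f = a + t f1\<close> and \<open>h = b + t h1\<close> the product is
  \<open>a b + t (a h1 + b f1 + t f1 h1)\<close>. Sums and scalar multiples are already settled, and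
  \<open>f1 h1\<close> enters two coefficients later, hence strong induction.\<close>

lemma expansion_nth_mult: "f \<in> OP \<Longrightarrow> h \<in> OP \<Longrightarrow>
    fps_nth (expansion (f \<otimes>\<^bsub>FF\<^esub> h)) n = fps_nth (expansion f * expansion h) n"
proof (induction n arbitrary: f h rule: less_induct)
  case (less n)
  note [simp] = local_ring_carrier[of _ P] t_local
  note f = shift[OF less.prems(1)]
  note h = shift[OF less.prems(2)]
  define a where "a = value_at f P"
  define b where "b = value_at h P"
  define f1 where "f1 = shift f"
  define h1 where "h1 = shift h"
  note fh = f(1)[folded f1_def] h(1)[folded h1_def]
  define r where "r = const_fun X a \<otimes>\<^bsub>FF\<^esub> h1 \<oplus>\<^bsub>FF\<^esub> (const_fun X b \<otimes>\<^bsub>FF\<^esub> f1 \<oplus>\<^bsub>FF\<^esub> t \<otimes>\<^bsub>FF\<^esub> (f1 \<otimes>\<^bsub>FF\<^esub> h1))"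
  have rO: "r \<in> OP" unfolding r_def using fh by (intro local_ring_add local_ring_mult local_ring_const t_local)
  have "f \<otimes>\<^bsub>FF\<^esub> h = (const_fun X a \<otimes>\<^bsub>FF\<^esub> const_fun X b) \<oplus>\<^bsub>FF\<^esub> t \<otimes>\<^bsub>FF\<^esub> r"
    unfolding r_def
    by (subst f(2), subst h(2), fold a_def b_def f1_def h1_def)
      (use fh in \<open>simp add: FF.r_distr FF.l_distr FF.a_ac FF.m_ac\<close>)
  from expansion_eq[OF this[unfolded const_fun_mult] rO]
  have E: "expansion (f \<otimes>\<^bsub>FF\<^esub> h) = fps_const (a * b) + fps_X * expansion r" .
  have r: "expansion r = fps_const a * expansion h1 + (fps_const b * expansion f1 + fps_X * expansion (f1 \<otimes>\<^bsub>FF\<^esub> h1))"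
    unfolding r_def using fh
    by (simp add: expansion_add expansion_const_mult expansion_t_mult local_ring_add local_ring_mult)
  have prod: "expansion f * expansion h = fps_const (a * b) + fps_X *
      (fps_const a * expansion h1 + (fps_const b * expansion f1 + fps_X * (expansion f1 * expansion h1)))"
    unfolding expansion_rec[of f] expansion_rec[of h] a_def[symmetric] b_def[symmetric] f1_def[symmetric] h1_def[symmetric]
    by (simp add: algebra_simps flip: fps_const_mult)
  show ?case
  proof (cases n)
    case 0
    then show ?thesis by (simp add: E prod)
  next
    case (Suc m)
    have "fps_nth (fps_X * expansion (f1 \<otimes>\<^bsub>FF\<^esub> h1)) m = fps_nth (fps_X * (expansion f1 * expansion h1)) m"
      using less.IH[of "m - 1" f1 h1] Suc fh by (cases m) auto
    then show ?thesis by (simp add: E prod r Suc)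
  qed
qed

lemma expansion_mult: "f \<in> OP \<Longrightarrow> h \<in> OP \<Longrightarrow> expansion (f \<otimes>\<^bsub>FF\<^esub> h) = expansion f * expansion h"
  by (rule fps_ext) (simp add: expansion_nth_mult)

text \<open>A zero expansion allows division by \<open>t\<close> without end, which
  \<open>finite_order\<close> forbids for nonzero functions. This makes quotients of expansions
  available.\<close>

lemma expansion_eq_0:
  assumes f: "f \<in> OP" shows "expansion f = 0 \<longleftrightarrow> f = \<zero>\<^bsub>FF\<^esub>"
proof
  assume E: "expansion f = 0"
  show "f = \<zero>\<^bsub>FF\<^esub>"
  proof (rule ccontr)
    assume nz: "f \<noteq> \<zero>\<^bsub>FF\<^esub>"
    note [simp] = local_ring_carrier[of _ P] t_local
    have "\<exists>h. h \<in> OP \<and> f = t [^]\<^bsub>FF\<^esub> n \<otimes>\<^bsub>FF\<^esub> h \<and> expansion h = 0" for n :: nat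
    proof (induction n)
      case 0
      show ?case using f E by (intro exI[of _ f]) simp
    next
      case (Suc n)
      then obtain h where h: "h \<in> OP" "f = t [^]\<^bsub>FF\<^esub> n \<otimes>\<^bsub>FF\<^esub> h" "expansion h = 0" by blast
      note s = shift[OF h(1)]
      have "value_at h P = fps_nth (expansion h) 0" by (simp add: expansion_def)
      then have v0: "value_at h P = 0" using h(3) by simp
      have "h = t \<otimes>\<^bsub>FF\<^esub> shift h" using s v0 by (simp add: const_fun_zero)
      moreover have "expansion (shift h) = 0" using expansion_rec[of h] v0 h(3) by simp
      moreover have "f = t [^]\<^bsub>FF\<^esub> Suc n \<otimes>\<^bsub>FF\<^esub> shift h"
        by (subst h(2), subst calculation(1)) (use s(1) in \<open>simp add: FF.m_assoc\<close>)
      ultimately show ?case using s(1) by blast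
    qed
    moreover obtain N where N: "\<forall>n h. h \<in> OP \<longrightarrow> f = t [^]\<^bsub>FF\<^esub> (n :: nat) \<otimes>\<^bsub>FF\<^esub> h \<longrightarrow> n \<le> N"
      using finite_order[OF f nz] by blast
    ultimately obtain h where "h \<in> OP" "f = t [^]\<^bsub>FF\<^esub> Suc N \<otimes>\<^bsub>FF\<^esub> h" by blast
    then show False using N by (metis Suc_n_not_le_n)
  qed
qed (simp add: expansion_zero)

end

section \<open>Places of a function field and repartitions\<close>

text \<open>Gaussian elimination: equation \<open>j\<close> with pivot \<open>p\<close> removes one
  equation and one unknown, and \<open>c p\<close> is recovered from it at the end.\<close>

lemma homogeneous_system_nontrivial_solution:
  fixes M :: "'i \<Rightarrow> 'j \<Rightarrow> 'k::field"
  assumes "finite J" "finite I" "card J < card I"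
  shows "\<exists>c. (\<exists>i\<in>I. c i \<noteq> 0) \<and> (\<forall>j\<in>J. (\<Sum>i\<in>I. c i * M i j) = 0)"
  using assms
proof (induction J arbitrary: I M rule: finite_induct)
  case empty
  then have "I \<noteq> {}" by auto
  then show ?case by (intro exI[of _ "\<lambda>_. 1"]) auto
next
  case (insert j J)
  show ?case
  proof (cases "\<exists>p\<in>I. M p j \<noteq> 0")
    case False
    obtain c where "\<exists>i\<in>I. c i \<noteq> 0" "\<forall>j\<in>J. (\<Sum>i\<in>I. c i * M i j) = 0"
      using insert.IH[of I M] insert.prems insert.hyps by auto
    with False show ?thesis by (intro exI[of _ c]) auto
  next
    case True
    then obtain p where p: "p \<in> I" "M p j \<noteq> 0" by blast
    define I' where "I' = I - {p}"
    define M' where "M' i l = M i l - M i j / M p j * M p l" for i l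
    have "finite I'" "card J < card I'"
      using insert.prems insert.hyps p by (auto simp: I'_def)
    then obtain c' where c': "\<exists>i\<in>I'. c' i \<noteq> 0" "\<forall>l\<in>J. (\<Sum>i\<in>I'. c' i * M' i l) = 0"
      using insert.IH by blast
    define c where "c = c'(p := - (\<Sum>i\<in>I'. c' i * M i j / M p j))"
    have "(\<Sum>i\<in>I. c i * M i l) = (\<Sum>i\<in>I'. c' i * M' i l)" for l
    proof -
      have "(\<Sum>i\<in>I. c i * M i l) = c p * M p l + (\<Sum>i\<in>I'. c i * M i l)"
        unfolding I'_def using insert.prems p by (intro sum.remove) auto
      also have "(\<Sum>i\<in>I'. c i * M i l) = (\<Sum>i\<in>I'. c' i * M i l)"
        by (intro sum.cong) (auto simp: c_def I'_def)
      also have "c p * M p l = - (\<Sum>i\<in>I'. c' i * (M i j / M p j * M p l))"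
        by (simp add: c_def sum_distrib_right mult.assoc)
      finally show ?thesis by (simp add: M'_def right_diff_distrib sum_subtractf)
    qed
    moreover have "M' i j = 0" for i using p by (simp add: M'_def)
    ultimately have "\<forall>l\<in>insert j J. (\<Sum>i\<in>I. c i * M i l) = 0" using c' by auto
    moreover have "\<exists>i\<in>I. c i \<noteq> 0" using c'(1) by (auto simp: c_def I'_def)
    ultimately show ?thesis by blast
  qed
qed

text \<open>What the argument uses of a function field over \<open>k\<close>: its points as discrete
  valuations with residue field \<open>k\<close>. The value \<open>v P 0\<close> carries no meaning,
  hence the guards. \<open>separation\<close> speaks of first order only; weak approximation to any
  order is deduced from it.\<close>

locale places =
  fixes K :: "'f::field set" and C :: "'k::alg_closed_field \<Rightarrow> 'f"
    and X :: "'p set" and v :: "'p \<Rightarrow> 'f \<Rightarrow> int"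
  assumes one_K [simp, intro]: "1 \<in> K"
    and diff_K [simp, intro]: "\<And>f g. f \<in> K \<Longrightarrow> g \<in> K \<Longrightarrow> f - g \<in> K"
    and mult_K [simp, intro]: "\<And>f g. f \<in> K \<Longrightarrow> g \<in> K \<Longrightarrow> f * g \<in> K"
    and inverse_K [simp, intro]: "\<And>f. f \<in> K \<Longrightarrow> inverse f \<in> K"
    and C_K [simp, intro]: "\<And>c. C c \<in> K"
    and C_add: "\<And>a b. C (a + b) = C a + C b"
    and C_mult: "\<And>a b. C (a * b) = C a * C b"
    and C_one [simp]: "C 1 = 1"
    and v_mult: "\<And>P f g. P \<in> X \<Longrightarrow> f \<in> K \<Longrightarrow> g \<in> K \<Longrightarrow> f \<noteq> 0 \<Longrightarrow> g \<noteq> 0 \<Longrightarrow>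
      v P (f * g) = v P f + v P g"
    and v_C [simp]: "\<And>P c. P \<in> X \<Longrightarrow> c \<noteq> 0 \<Longrightarrow> v P (C c) = 0"
    and v_diff: "\<And>P f g. P \<in> X \<Longrightarrow> f \<in> K \<Longrightarrow> g \<in> K \<Longrightarrow> f \<noteq> 0 \<Longrightarrow> g \<noteq> 0 \<Longrightarrow> f \<noteq> g \<Longrightarrow>
      min (v P f) (v P g) \<le> v P (f - g)"
    and residue: "\<And>P f. P \<in> X \<Longrightarrow> f \<in> K \<Longrightarrow> f \<noteq> 0 \<Longrightarrow> 0 \<le> v P f \<Longrightarrow>
      \<exists>c. f = C c \<or> 1 \<le> v P (f - C c)"
    and local_parameter: "\<And>P. P \<in> X \<Longrightarrow> \<exists>t\<in>K. t \<noteq> 0 \<and> v P t = 1"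
    and finite_v: "\<And>f. f \<in> K \<Longrightarrow> f \<noteq> 0 \<Longrightarrow> finite {P \<in> X. v P f \<noteq> 0}"
    and separation: "\<And>S P. finite S \<Longrightarrow> S \<subseteq> X \<Longrightarrow> P \<in> S \<Longrightarrow>
      \<exists>z\<in>K. (z = 1 \<or> 1 \<le> v P (z - 1)) \<and> (\<forall>Q\<in>S - {P}. z = 0 \<or> 1 \<le> v Q z)"
begin

lemma zero_K [simp, intro]: "0 \<in> K" using diff_K[OF one_K one_K] by simp
lemma minus_K [simp, intro]: "f \<in> K \<Longrightarrow> - f \<in> K" using diff_K[OF zero_K] by simp
lemma add_K [simp, intro]: "f \<in> K \<Longrightarrow> g \<in> K \<Longrightarrow> f + g \<in> K" using diff_K[OF _ minus_K, of f g] by simp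
lemma divide_K [simp, intro]: "f \<in> K \<Longrightarrow> g \<in> K \<Longrightarrow> f / g \<in> K" by (simp add: divide_inverse)
lemma power_K [simp, intro]: "f \<in> K \<Longrightarrow> f ^ n \<in> K" by (induction n) auto
lemma sum_K [simp, intro]: "(\<And>i. i \<in> I \<Longrightarrow> f i \<in> K) \<Longrightarrow> sum f I \<in> K"
  by (induction I rule: infinite_finite_induct) auto
lemma prod_K [simp, intro]: "(\<And>i. i \<in> I \<Longrightarrow> f i \<in> K) \<Longrightarrow> prod f I \<in> K"
  by (induction I rule: infinite_finite_induct) auto

lemma C_zero [simp]: "C 0 = 0" using C_add[of 0 0] by (metis add.right_neutral add_left_cancel)
lemma C_minus: "C (- a) = - C a" using C_add[of a "- a"] by (simp add: eq_neg_iff_add_eq_0 add.commute)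
lemma C_eq_0 [simp]: "C c = 0 \<longleftrightarrow> c = 0"
proof
  assume "C c = 0"
  show "c = 0"
  proof (rule ccontr)
    assume "c \<noteq> 0"
    then have "C c * C (inverse c) = 1" by (simp flip: C_mult)
    with \<open>C c = 0\<close> show False by simp
  qed
qed simp
lemma C_sum: "C (sum f I) = (\<Sum>i\<in>I. C (f i))"
  by (induction I rule: infinite_finite_induct) (auto simp: C_add)

lemma v_one [simp]: "P \<in> X \<Longrightarrow> v P 1 = 0" using v_C[of P 1] by simp
lemma v_minus [simp]:
  assumes "P \<in> X" "f \<in> K" shows "v P (- f) = v P f"
proof (cases "f = 0")
  case False
  have "v P (C (-1) * f) = v P f"
    using v_mult[of P "C (-1)" f] False assms by simp
  then show ?thesis by (simp add: C_minus)
qed auto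
lemma v_inverse [simp]: "P \<in> X \<Longrightarrow> f \<in> K \<Longrightarrow> v P (inverse f) = - v P f" if "f \<noteq> 0"
  using v_mult[of P f "inverse f"] that by simp
lemma v_divide: "P \<in> X \<Longrightarrow> f \<in> K \<Longrightarrow> g \<in> K \<Longrightarrow> f \<noteq> 0 \<Longrightarrow> g \<noteq> 0 \<Longrightarrow> v P (f / g) = v P f - v P g"
  by (simp add: divide_inverse v_mult)
lemma v_power: "P \<in> X \<Longrightarrow> f \<in> K \<Longrightarrow> f \<noteq> 0 \<Longrightarrow> v P (f ^ n) = int n * v P f"
  by (induction n) (auto simp: v_mult algebra_simps)

text \<open>Treats 0 as having infinite order, so that sums and products need no case
  distinction.\<close>

definition vge :: "'p \<Rightarrow> int \<Rightarrow> 'f \<Rightarrow> bool" where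
  "vge P n f \<longleftrightarrow> f \<in> K \<and> (f = 0 \<or> n \<le> v P f)"

lemma vge_K: "vge P n f \<Longrightarrow> f \<in> K" by (simp add: vge_def)
lemma vge_zero [simp, intro]: "vge P n 0" by (simp add: vge_def)
lemma vge_mono: "vge P m f \<Longrightarrow> n \<le> m \<Longrightarrow> vge P n f" by (auto simp: vge_def)
lemma vge_diff: "P \<in> X \<Longrightarrow> vge P n f \<Longrightarrow> vge P n g \<Longrightarrow> vge P n (f - g)"
  unfolding vge_def using v_diff[of P f g] by (cases "f = g"; cases "f = 0"; cases "g = 0") auto
lemma vge_minus: "P \<in> X \<Longrightarrow> vge P n f \<Longrightarrow> vge P n (- f)"
  using vge_diff[of P n 0 f] by simp
lemma vge_minus_iff: "P \<in> X \<Longrightarrow> vge P n (- f) \<longleftrightarrow> vge P n f"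
  using vge_minus[of P n f] vge_minus[of P n "- f"] by auto
lemma vge_add: "P \<in> X \<Longrightarrow> vge P n f \<Longrightarrow> vge P n g \<Longrightarrow> vge P n (f + g)"
  using vge_diff[OF _ _ vge_minus, of P n f g] by simp
lemma vge_sum: "P \<in> X \<Longrightarrow> (\<And>i. i \<in> I \<Longrightarrow> vge P n (f i)) \<Longrightarrow> vge P n (sum f I)"
  by (induction I rule: infinite_finite_induct) (auto intro: vge_add)
lemma vge_mult: "P \<in> X \<Longrightarrow> vge P m f \<Longrightarrow> vge P n g \<Longrightarrow> vge P (m + n) (f * g)"
  by (cases "f = 0"; cases "g = 0") (auto simp: vge_def v_mult)
lemma vge_C [simp, intro]: "P \<in> X \<Longrightarrow> vge P 0 (C c)"
  by (cases "c = 0") (auto simp: vge_def)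
lemma vge_C_mult: "P \<in> X \<Longrightarrow> vge P n f \<Longrightarrow> vge P n (C c * f)"
  using vge_mult[of P 0 "C c" n f] by simp
lemma vge_power: "P \<in> X \<Longrightarrow> vge P 1 f \<Longrightarrow> vge P (int n) (f ^ n)"
  by (cases "f = 0") (auto simp: vge_def v_power mult_le_cancel_left1 power_0_left)
lemma vge_divide_unit: "P \<in> X \<Longrightarrow> vge P n f \<Longrightarrow> u \<in> K \<Longrightarrow> u \<noteq> 0 \<Longrightarrow> v P u = 0 \<Longrightarrow> vge P n (f / u)"
  by (cases "f = 0") (auto simp: vge_def v_divide)
lemma vge_residue: "P \<in> X \<Longrightarrow> vge P 0 f \<Longrightarrow> \<exists>c. vge P 1 (f - C c)"
  using residue[of P f] unfolding vge_def by (cases "f = 0") (auto intro: exI[of _ 0])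
lemma v_le_imp_vge: "f \<in> K \<Longrightarrow> n \<le> v P f \<Longrightarrow> vge P n f" by (simp add: vge_def)

text \<open>A larger order of \<open>f + g\<close> would pass to
  \<open>f = (f + g) - g\<close>.\<close>

lemma v_add_dominated:
  assumes P: "P \<in> X" and f: "f \<in> K" "f \<noteq> 0" and g: "vge P (v P f + 1) g"
  shows "f + g \<noteq> 0" "v P (f + g) = v P f"
proof -
  have gK: "g \<in> K" using g by (rule vge_K)
  show nz: "f + g \<noteq> 0"
  proof
    assume "f + g = 0"
    then have "f = - g" by (simp add: eq_neg_iff_add_eq_0)
    then have "vge P (v P f + 1) f" using g vge_minus[OF P] by simp
    then show False using f by (simp add: vge_def)
  qed
  have "vge P (v P f) (f + g)"
    using vge_add[OF P, of "v P f" f g] f vge_mono[OF g, of "v P f"] by (simp add: vge_def)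
  then have 1: "v P f \<le> v P (f + g)" using nz by (simp add: vge_def)
  show "v P (f + g) = v P f"
  proof (rule ccontr)
    assume "v P (f + g) \<noteq> v P f"
    with 1 have "v P f + 1 \<le> v P (f + g)" by simp
    then have "vge P (v P f + 1) ((f + g) - g)"
      using vge_diff[OF P _ g, of "f + g"] f gK by (simp add: vge_def)
    then show False using f by (simp add: vge_def)
  qed
qed

lemma finite_not_vge: "f \<in> K \<Longrightarrow> finite {P \<in> X. \<not> vge P 0 f}"
  by (cases "f = 0") (auto simp: vge_def intro: finite_subset[OF _ finite_v[of f]])

text \<open>Sharpens \<open>z\<close> to \<open>z^N / (z^N + (1 - z)^N)\<close>. At each point of
  \<open>S\<close> one of \<open>z\<close> and \<open>1 - z\<close> is a unit and the other
  vanishes, so the denominator is a unit there and high powers give high order.\<close>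

lemma approximate_idempotent:
  assumes "finite S" "S \<subseteq> X" "P \<in> S"
  shows "\<exists>e\<in>K. vge P (int M) (e - 1) \<and> (\<forall>Q\<in>S - {P}. vge Q (int M) e)"
proof -
  obtain z where z: "z \<in> K" "z = 1 \<or> 1 \<le> v P (z - 1)" "\<forall>Q\<in>S - {P}. z = 0 \<or> 1 \<le> v Q z"
    using separation[OF assms] by blast
  \<comment> \<open>One more than \<open>M\<close>, so that the vanishing power has order at least 1
    even for \<open>M = 0\<close> and is dominated by the other.\<close>
  define N where "N = Suc M"
  define a where "a = z ^ N"
  define b where "b = (1 - z) ^ N"
  have PX: "P \<in> X" using assms by auto
  have zP: "vge P 1 (z - 1)" using z by (auto simp: vge_def)
  then have zP': "vge P 1 (1 - z)" using vge_minus[OF PX zP] by simp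
  have zu: "z \<noteq> 0" "v P z = 0"
    using v_add_dominated[OF PX, of 1 "z - 1"] zP PX by auto
  have bP: "vge P (int N) b" unfolding b_def by (intro vge_power PX zP')
  have "vge P (v P a + 1) b" using vge_mono[OF bP] zu z PX by (simp add: a_def N_def v_power v_mult)
  note ab = v_add_dominated[OF PX _ _ this]
  have denP: "a + b \<noteq> 0" "v P (a + b) = 0"
    using ab zu z PX by (auto simp: a_def v_power)
  have K: "a \<in> K" "b \<in> K" using z by (auto simp: a_def b_def)
  have "a / (a + b) - 1 = - (b / (a + b))" using denP by (simp add: field_simps)
  moreover have "vge P (int M) (b / (a + b))"
    using vge_divide_unit[OF PX vge_mono[OF bP], of "int M"] denP K by (simp add: N_def)
  ultimately have 1: "vge P (int M) (a / (a + b) - 1)" using vge_minus[OF PX] by simp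
  have 2: "vge Q (int M) (a / (a + b))" if Q: "Q \<in> S - {P}" for Q
  proof -
    have QX: "Q \<in> X" using Q assms by auto
    have zQ: "vge Q 1 z" using z Q by (auto simp: vge_def)
    have u: "1 - z \<noteq> 0" "v Q (1 - z) = 0"
      using v_add_dominated[OF QX, of 1 "- z"] vge_minus[OF QX zQ] QX by auto
    have aQ: "vge Q (int N) a" unfolding a_def by (intro vge_power QX zQ)
    have "vge Q (v Q b + 1) a" using vge_mono[OF aQ] u z QX by (simp add: b_def N_def v_power v_mult)
    note ab = v_add_dominated[OF QX _ _ this]
    have "v Q (a + b) = 0" using ab u z QX by (simp add: b_def v_power add.commute)
    then show ?thesis
      using vge_divide_unit[OF QX vge_mono[OF aQ], of "int M"] denP K by (simp add: N_def)
  qed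
  show ?thesis using 1 2 K by (intro bexI[of _ "a / (a + b)"]) auto
qed

lemma weak_approximation:
  assumes S: "finite S" "S \<subseteq> X" and G: "\<And>P. P \<in> S \<Longrightarrow> G P \<in> K"
  shows "\<exists>f\<in>K. \<forall>P\<in>S. vge P n (f - G P)"
proof -
  \<comment> \<open>\<open>M\<close> has to outweigh the worst pole of any \<open>G P\<close> at any
    point of \<open>S\<close>; the inserted 0 keeps the maximum defined and nonnegative.\<close>
  define B where "B = insert 0 ((\<lambda>(P, Q). n - v Q (G P)) ` (S \<times> S))"
  define M where "M = nat (Max B)"
  have "finite B" using S by (auto simp: B_def)
  then have "\<And>b. b \<in> B \<Longrightarrow> b \<le> int M" unfolding M_def
    by (metis Max_ge B_def insertI1 int_nat_eq nat_0_le order_trans)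
  then have M: "vge Q (n - int M) (G P)" if "P \<in> S" "Q \<in> S" for P Q
    using that G by (force simp: vge_def B_def)
  obtain e where e: "\<And>P. P \<in> S \<Longrightarrow> e P \<in> K" "\<And>P. P \<in> S \<Longrightarrow> vge P (int M) (e P - 1)"
    "\<And>P Q. P \<in> S \<Longrightarrow> Q \<in> S \<Longrightarrow> Q \<noteq> P \<Longrightarrow> vge Q (int M) (e P)"
    using approximate_idempotent[OF S, of _ M] by (metis Diff_iff singletonD)
  define f where "f = (\<Sum>P\<in>S. G P * e P)"
  have "vge Q n (f - G Q)" if Q: "Q \<in> S" for Q
  proof -
    have QX: "Q \<in> X" using Q S by auto
    have "f - G Q = G Q * (e Q - 1) + (\<Sum>P\<in>S - {Q}. G P * e P)"
      unfolding f_def using S Q by (simp add: sum.remove algebra_simps)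
    moreover have "vge Q n (G Q * (e Q - 1))"
      using vge_mult[OF QX M[OF Q Q] e(2)[OF Q]] by simp
    moreover have "vge Q n (\<Sum>P\<in>S - {Q}. G P * e P)"
    proof (rule vge_sum[OF QX])
      fix P assume "P \<in> S - {Q}"
      then show "vge Q n (G P * e P)"
        using vge_mult[OF QX M[of P Q] e(3)[of P Q]] Q by auto
    qed
    ultimately show ?thesis using vge_add[OF QX] by simp
  qed
  moreover have "f \<in> K" using e G by (auto simp: f_def)
  ultimately show ?thesis by blast
qed

text \<open>Values off \<open>X\<close> are also required to lie in \<open>K\<close>, so that
  membership of a value in \<open>K\<close> never depends on its point.\<close>

definition adeles :: "('p \<Rightarrow> 'f) set" where
  "adeles = {r. (\<forall>P. r P \<in> K) \<and> finite {P \<in> X. \<not> vge P 0 (r P)}}"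

text \<open>The class of \<open>s\<close> in \<open>H\<^sup>1(X, O)\<close>, the cokernel of \<open>K \<rightarrow> \<Oplus>\<^sub>P K/O\<^sub>P\<close>, vanishes.\<close>

definition splits :: "('p \<Rightarrow> 'f) \<Rightarrow> bool" where
  "splits s \<longleftrightarrow> (\<exists>f\<in>K. \<forall>P\<in>X. vge P 0 (s P - f))"

definition genus :: "nat \<Rightarrow> bool" where
  "genus g \<longleftrightarrow> (\<exists>r :: nat \<Rightarrow> 'p \<Rightarrow> 'f. (\<forall>i<g. r i \<in> adeles) \<and>
     (\<forall>s\<in>adeles. \<exists>!c :: nat \<Rightarrow> 'k. (\<forall>i\<ge>g. c i = 0) \<and>
        (\<exists>f\<in>K. \<forall>P\<in>X. vge P 0 (s P - (f + (\<Sum>i<g. C (c i) * r i P))))))"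

lemma adeles_K: "r \<in> adeles \<Longrightarrow> r P \<in> K" by (simp add: adeles_def)

lemma zero_adeles: "(\<lambda>_. 0) \<in> adeles" by (simp add: adeles_def)

lemma mult_adeles:
  assumes "h \<in> K" "r \<in> adeles" shows "(\<lambda>P. h * r P) \<in> adeles"
proof -
  have "{P \<in> X. \<not> vge P 0 (h * r P)} \<subseteq> {P \<in> X. \<not> vge P 0 h} \<union> {P \<in> X. \<not> vge P 0 (r P)}"
    using vge_mult[of _ 0 h 0] by fastforce
  then show ?thesis using assms finite_not_vge[of h]
    by (auto simp: adeles_def intro: finite_subset)
qed

lemma pole_at_adeles: "f \<in> K \<Longrightarrow> (\<lambda>Q. if Q = P then f else 0) \<in> adeles"
  by (auto simp: adeles_def intro: finite_subset[of _ "{P}"] split: if_splits)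

lemma splits_add: "splits s \<Longrightarrow> splits s' \<Longrightarrow> splits (\<lambda>P. s P + s' P)"
  unfolding splits_def
proof (elim bexE)
  fix f f' assume "f \<in> K" "f' \<in> K" "\<forall>P\<in>X. vge P 0 (s P - f)" "\<forall>P\<in>X. vge P 0 (s' P - f')"
  then show "\<exists>f\<in>K. \<forall>P\<in>X. vge P 0 (s P + s' P - f)"
    using vge_add[of _ 0 "s _ - f" "s' _ - f'"]
    by (intro bexI[of _ "f + f'"]) (auto simp: algebra_simps)
qed

lemma splits_C_mult: "splits s \<Longrightarrow> splits (\<lambda>P. C c * s P)"
  unfolding splits_def
proof (elim bexE)
  fix f assume "f \<in> K" "\<forall>P\<in>X. vge P 0 (s P - f)"
  then show "\<exists>f\<in>K. \<forall>P\<in>X. vge P 0 (C c * s P - f)"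
    using vge_C_mult[of _ 0 "s _ - f" c]
    by (intro bexI[of _ "C c * f"]) (auto simp: algebra_simps)
qed

lemma splits_zero: "splits (\<lambda>_. 0)"
  unfolding splits_def by (auto intro: bexI[of _ 0])

lemma splits_sum: "(\<And>i. i \<in> I \<Longrightarrow> splits (s i)) \<Longrightarrow> splits (\<lambda>P. \<Sum>i\<in>I. s i P)"
  by (induction I rule: infinite_finite_induct) (auto intro: splits_add splits_zero)

lemma splits_iff_diff:
  "(\<exists>f\<in>K. \<forall>P\<in>X. vge P 0 (s P - (f + t P))) \<longleftrightarrow> splits (\<lambda>P. s P - t P)"
  unfolding splits_def by (simp add: algebra_simps)

lemma genus_basis:
  assumes "genus g"
  shows "\<exists>r. (\<forall>i<g. r i \<in> adeles) \<and> (\<forall>s\<in>adeles. \<exists>!c :: nat \<Rightarrow> 'k. (\<forall>i\<ge>g. c i = 0) \<and>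
        splits (\<lambda>P. s P - (\<Sum>i<g. C (c i) * r i P)))"
  using assms unfolding genus_def splits_iff_diff .

text \<open>More than \<open>card J\<close> basis classes, expressed through the \<open>s j\<close>,
  would be linearly dependent, contrary to the uniqueness of the coordinates of 0.\<close>

lemma genus_le_card:
  assumes g: "genus g" and J: "finite J"
    and span: "\<And>r. r \<in> adeles \<Longrightarrow> \<exists>c. splits (\<lambda>P. r P - (\<Sum>j\<in>J. C (c j) * s j P))"
  shows "g \<le> card J"
proof (rule ccontr)
  assume "\<not> g \<le> card J"
  obtain r where basis: "(\<forall>i<g. r i \<in> adeles) \<and> (\<forall>s\<in>adeles. \<exists>!c :: nat \<Rightarrow> 'k. (\<forall>i\<ge>g. c i = 0) \<and>
        splits (\<lambda>P. s P - (\<Sum>i<g. C (c i) * r i P)))"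
    using genus_basis[OF g] by (elim exE)
  note r = conjunct1[OF basis, rule_format]
  note uniq = bspec[OF conjunct2[OF basis]]
  have "\<forall>i\<in>{..<g}. \<exists>c. splits (\<lambda>P. r i P - (\<Sum>j\<in>J. C (c j) * s j P))"
    by (intro ballI span r) simp
  from bchoice[OF this] obtain M
    where M: "\<forall>i\<in>{..<g}. splits (\<lambda>P. r i P - (\<Sum>j\<in>J. C (M i j) * s j P))"
    by (elim exE)
  have "card J < card {..<g}" using \<open>\<not> g \<le> card J\<close> by simp
  then obtain c where c: "\<exists>i<g. c i \<noteq> 0" "\<And>j. j \<in> J \<Longrightarrow> (\<Sum>i<g. c i * M i j) = 0"
    using homogeneous_system_nontrivial_solution[OF J, of "{..<g}" M] by auto
  \<comment> \<open>Uniqueness speaks of 0 minus a combination whose coefficients are zero from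
    \<open>g\<close> on; hence the sign and the cut-off.\<close>
  define c' where "c' i = (if i < g then - c i else 0)" for i
  have "(\<Sum>i<g. C (c i) * (r i P - (\<Sum>j\<in>J. C (M i j) * s j P))) = 0 - (\<Sum>i<g. C (c' i) * r i P)" for P
  proof -
    have "(\<Sum>i<g. C (c i) * (\<Sum>j\<in>J. C (M i j) * s j P)) = (\<Sum>i<g. \<Sum>j\<in>J. C (c i * M i j) * s j P)"
      by (simp add: sum_distrib_left C_mult mult.assoc)
    also have "\<dots> = (\<Sum>j\<in>J. C (\<Sum>i<g. c i * M i j) * s j P)"
      by (subst sum.swap) (simp add: C_sum sum_distrib_right)
    also have "\<dots> = 0" using c(2) by simp
    finally have 1: "(\<Sum>i<g. C (c i) * (\<Sum>j\<in>J. C (M i j) * s j P)) = 0" .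
    have "(\<Sum>i<g. C (c' i) * r i P) = (\<Sum>i<g. - (C (c i) * r i P))"
      by (intro sum.cong) (auto simp: c'_def C_minus)
    then show ?thesis using 1 by (simp only: right_diff_distrib sum_subtractf sum_negf) simp
  qed
  moreover have "splits (\<lambda>P. \<Sum>i<g. C (c i) * (r i P - (\<Sum>j\<in>J. C (M i j) * s j P)))"
    by (intro splits_sum splits_C_mult M[rule_format])
  ultimately have "splits (\<lambda>P. 0 - (\<Sum>i<g. C (c' i) * r i P))" by simp
  then have 1: "(\<forall>i\<ge>g. c' i = 0) \<and> splits (\<lambda>P. 0 - (\<Sum>i<g. C (c' i) * r i P))"
    by (simp add: c'_def)
  have 2: "(\<forall>i\<ge>g. (\<lambda>_. 0) i = 0) \<and> splits (\<lambda>P. 0 - (\<Sum>i<g. C ((\<lambda>_. 0) i) * r i P))"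
    using splits_zero by simp
  have "c' = (\<lambda>_. 0)"
    using 1 2 by (rule Uniq_D[OF conjunct2[OF uniq[OF zero_adeles, unfolded ex1_iff_ex_Uniq]],
          of c' "\<lambda>_. 0"])
  then show False using c(1) by (metis c'_def neg_equal_0_iff_equal)
qed

end

section \<open>Consequences of the genus: absence and existence of poles, and a bound by
  degrees\<close>

context places begin

text \<open>A nonconstant function is transcendental over the algebraically closed field
  \<open>k\<close>: a polynomial splits into linear factors, and no \<open>h - C x\<close> is
  zero.\<close>

lemma alg_closed_hom_root:
  assumes h: "h \<notin> range C" and p: "p \<noteq> 0"
  shows "poly (map_poly C p) h \<noteq> 0"
  using p
proof (induction "degree p" arbitrary: p)
  case 0
  then obtain c where "p = [:c:]" "c \<noteq> 0" by (metis degree_eq_zeroE pCons_0_0)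
  then show ?case by (simp add: map_poly_pCons)
next
  case (Suc n)
  have add: "map_poly C (p + q) = map_poly C p + map_poly C q" for p q
    by (intro poly_eqI) (simp add: coeff_map_poly C_add)
  have smult: "map_poly C (smult a q) = smult (C a) (map_poly C q)" for a q
    by (intro poly_eqI) (simp add: coeff_map_poly C_mult)
  obtain x where "poly p x = 0" using alg_closed_imp_poly_has_root[of p] Suc.hyps by auto
  then obtain q where q: "p = [:- x, 1:] * q" by (metis dvdE poly_eq_0_iff_dvd)
  with Suc.prems have "q \<noteq> 0" by auto
  moreover have "degree p = 1 + degree q"
    unfolding q by (subst degree_mult_eq) (use \<open>q \<noteq> 0\<close> in auto)
  then have "degree q = n" using Suc.hyps by simp
  ultimately have "poly (map_poly C q) h \<noteq> 0" using Suc.hyps(1) by simp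
  moreover have "poly (map_poly C p) h = (h - C x) * poly (map_poly C q) h"
  proof -
    have "p = smult (- x) q + pCons 0 q" by (simp add: q)
    then show ?thesis by (simp only: add smult) (simp add: map_poly_pCons C_minus algebra_simps)
  qed
  ultimately show ?case using h by auto
qed

lemma no_simple_pole:
  assumes g: "genus g" and g1: "g \<ge> 1" and P: "P \<in> X"
    and hP: "vge P (-1) h" and hQ: "\<And>Q. Q \<in> X \<Longrightarrow> Q \<noteq> P \<Longrightarrow> vge Q 0 h"
  shows "h \<in> range C"
proof (rule ccontr)
  assume h: "h \<notin> range C"
  have hK: "h \<in> K" using hP by (rule vge_K)
  let ?ev = "\<lambda>p. poly (map_poly C p) h"
  have evK: "?ev p \<in> K" for p
    by (induction p) (auto simp: map_poly_pCons hK)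
  \<comment> \<open>Multiplication by \<open>h\<close> respects splitting despite the pole: the
    value \<open>c\<close> at \<open>P\<close> of the regular remainder is subtracted first, and the
    correction \<open>C c * h\<close> is a global function.\<close>
  have stable: "splits (\<lambda>Q. h * s Q)" if s: "splits s" for s
  proof -
    obtain f where f: "f \<in> K" "\<And>Q. Q \<in> X \<Longrightarrow> vge Q 0 (s Q - f)"
      using s by (auto simp: splits_def)
    obtain c where c: "vge P 1 (s P - f - C c)" using vge_residue[OF P f(2)[OF P]] by blast
    have "vge Q 0 (h * s Q - (h * f + C c * h))" if Q: "Q \<in> X" for Q
    proof -
      have "h * s Q - (h * f + C c * h) = h * (s Q - f - C c)" by (simp add: algebra_simps)
      moreover have "vge Q 0 (h * (s Q - f - C c))"
      proof (cases "Q = P")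
        case True
        then show ?thesis using vge_mult[OF P hP c] by simp
      next
        case False
        have "vge Q 0 (s Q - f - C c)" by (intro vge_diff Q f vge_C)
        then show ?thesis using vge_mult[OF Q hQ[OF Q False]] by fastforce
      qed
      ultimately show ?thesis by simp
    qed
    then show ?thesis unfolding splits_def using hK f by (intro bexI[of _ "h * f + C c * h"]) auto
  qed
  have stable_ev: "splits (\<lambda>Q. ?ev p * s Q)" if s: "splits s" for s p
  proof (induction p)
    case 0
    then show ?case by (simp add: splits_zero)
  next
    case (pCons a p)
    have "splits (\<lambda>Q. C a * s Q + h * (?ev p * s Q))"
      by (intro splits_add splits_C_mult stable s pCons)
    then show ?case by (simp add: map_poly_pCons algebra_simps)
  qed
  obtain r where basis: "(\<forall>i<g. r i \<in> adeles) \<and> (\<forall>s\<in>adeles. \<exists>!c :: nat \<Rightarrow> 'k. (\<forall>i\<ge>g. c i = 0) \<and>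
        splits (\<lambda>P. s P - (\<Sum>i<g. C (c i) * r i P)))"
    using genus_basis[OF g] by (elim exE)
  note r = conjunct1[OF basis, rule_format]
  have coords: "\<exists>c. splits (\<lambda>P. s P - (\<Sum>i<g. C (c i) * r i P))" if "s \<in> adeles" for s
    using bspec[OF conjunct2[OF basis] that] by (elim ex1E) (intro exI, erule conjunct2)
  have "\<exists>p. p \<noteq> 0 \<and> splits (\<lambda>Q. ?ev p * r l Q)" if l: "l < g" for l
  proof -
    have "\<exists>c. splits (\<lambda>Q. h ^ j * r l Q - (\<Sum>i<g. C (c i) * r i Q))" for j
      by (intro coords mult_adeles r l power_K hK)
    then obtain M where M: "\<And>j. splits (\<lambda>Q. h ^ j * r l Q - (\<Sum>i<g. C (M j i) * r i Q))"
      by metis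
    \<comment> \<open>The \<open>g + 1\<close> multiples \<open>h ^ j * r l\<close> have coordinates
      in a space of dimension \<open>g\<close>; a dependency among them is the annihilating
      polynomial.\<close>
    obtain c where c: "\<exists>j\<in>{..g}. c j \<noteq> 0" "\<forall>i\<in>{..<g}. (\<Sum>j\<in>{..g}. c j * M j i) = 0"
      using homogeneous_system_nontrivial_solution[of "{..<g}" "{..g}" M] by auto
    define p where "p = (\<Sum>j\<le>g. monom (c j) j)"
    have coeff: "coeff p j = (if j \<le> g then c j else 0)" for j
      by (simp add: p_def coeff_sum if_distrib[of "\<lambda>f. f j"] sum.delta)
    have "p \<noteq> 0" using c(1) coeff by (metis atMost_iff coeff_0)
    have "?ev p = (\<Sum>j\<le>g. C (c j) * h ^ j)"
    proof -
      have "map_poly C p = (\<Sum>j\<le>g. monom (C (c j)) j)"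
        by (intro poly_eqI) (simp add: coeff_map_poly coeff coeff_sum sum.delta)
      then show ?thesis by (simp add: poly_sum poly_monom)
    qed
    moreover have "splits (\<lambda>Q. \<Sum>j\<le>g. C (c j) * (h ^ j * r l Q - (\<Sum>i<g. C (M j i) * r i Q)))"
      by (intro splits_sum splits_C_mult M)
    moreover have "(\<Sum>j\<le>g. C (c j) * (h ^ j * r l Q - (\<Sum>i<g. C (M j i) * r i Q))) =
        (\<Sum>j\<le>g. C (c j) * h ^ j) * r l Q" for Q
    proof -
      have "(\<Sum>j\<le>g. C (c j) * (\<Sum>i<g. C (M j i) * r i Q)) = (\<Sum>j\<le>g. \<Sum>i<g. C (c j * M j i) * r i Q)"
        by (simp add: sum_distrib_left C_mult mult.assoc)
      also have "\<dots> = (\<Sum>i<g. C (\<Sum>j\<le>g. c j * M j i) * r i Q)"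
        by (subst sum.swap) (simp add: C_sum sum_distrib_right)
      also have "\<dots> = 0" using c(2) by simp
      finally show ?thesis
        by (simp add: right_diff_distrib sum_subtractf sum_distrib_right mult.assoc)
    qed
    ultimately show ?thesis using \<open>p \<noteq> 0\<close> by auto
  qed
  then obtain p where p: "\<And>l. l < g \<Longrightarrow> p l \<noteq> 0" "\<And>l. l < g \<Longrightarrow> splits (\<lambda>Q. ?ev (p l) * r l Q)"
    by metis
  \<comment> \<open>The product annihilates every basis class at once, and it is nonzero because
    \<open>h\<close> is transcendental.\<close>
  define w where "w = ?ev (\<Prod>l<g. p l)"
  have w: "w \<noteq> 0" "w \<in> K"
    unfolding w_def using p(1) by (auto intro!: alg_closed_hom_root[OF h] evK)
  have hom_mult: "?ev (p * q) = ?ev p * ?ev q" for p q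
  proof (induction p)
    case (pCons a p)
    have add: "map_poly C (p + q) = map_poly C p + map_poly C q" for p q
      by (intro poly_eqI) (simp add: coeff_map_poly C_add)
    have smult: "map_poly C (smult a q) = smult (C a) (map_poly C q)" for a q
      by (intro poly_eqI) (simp add: coeff_map_poly C_mult)
    show ?case using pCons by (simp add: map_poly_pCons add smult algebra_simps)
  qed simp
  have wr: "splits (\<lambda>Q. w * r l Q)" if l: "l < g" for l
  proof -
    have "(\<Prod>l<g. p l) = (\<Prod>i\<in>{..<g} - {l}. p i) * p l"
      using l by (subst prod.remove[of _ l]) auto
    then have "(\<lambda>Q. w * r l Q) = (\<lambda>Q. ?ev (\<Prod>i\<in>{..<g} - {l}. p i) * (?ev (p l) * r l Q))"
      by (simp add: w_def hom_mult mult.assoc)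
    then show ?thesis using stable_ev[OF p(2)[OF l], of "\<Prod>i\<in>{..<g} - {l}. p i"] by (simp only:)
  qed
  \<comment> \<open>Surjectivity: \<open>s\<close> is \<open>w\<close> times the adele
    \<open>inverse w * s\<close>, and \<open>w\<close> kills every class, so \<open>H^1\<close>
    would be zero.\<close>
  have "splits s" if s: "s \<in> adeles" for s
  proof -
    have "(\<lambda>Q. inverse w * s Q) \<in> adeles" using w s by (intro mult_adeles) auto
    from coords[OF this] obtain c
      where c: "splits (\<lambda>Q. inverse w * s Q - (\<Sum>i<g. C (c i) * r i Q))" by blast
    have "splits (\<lambda>Q. w * (inverse w * s Q - (\<Sum>i<g. C (c i) * r i Q)))"
      unfolding w_def by (rule stable_ev[OF c[unfolded w_def]])
    then have "splits (\<lambda>Q. w * (inverse w * s Q - (\<Sum>i<g. C (c i) * r i Q)) + (\<Sum>i<g. C (c i) * (w * r i Q)))"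
      by (intro splits_add splits_sum splits_C_mult wr) auto
    moreover have "w * (inverse w * s Q - (\<Sum>i<g. C (c i) * r i Q)) + (\<Sum>i<g. C (c i) * (w * r i Q)) = s Q" for Q
      using w by (simp add: algebra_simps sum_distrib_left)
    ultimately show ?thesis by simp
  qed
  then have "g \<le> card ({} :: nat set)"
    by (intro genus_le_card[OF g, of _ "\<lambda>_ _. 0"]) auto
  then show False using g1 by simp
qed

text \<open>\<open>H^1(P) = 0\<close> in genus one: the class of a simple pole at \<open>P\<close>
  is nonzero by \<open>no_simple_pole\<close>, hence spans the one-dimensional \<open>H^1\<close>,
  and it dies once a simple pole at \<open>P\<close> is allowed.\<close>

lemma genus_one_pole_spans:
  assumes g: "genus 1" and P: "P \<in> X" and s: "s \<in> adeles"
  shows "\<exists>f\<in>K. vge P (-1) (s P - f) \<and> (\<forall>Q\<in>X - {P}. vge Q 0 (s Q - f))"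
proof -
  obtain t where t: "t \<in> K" "t \<noteq> 0" "v P t = 1" using local_parameter[OF P] by blast
  define a where "a = (\<lambda>Q. if Q = P then inverse t else 0)"
  have aA: "a \<in> adeles" unfolding a_def using t by (intro pole_at_adeles) auto
  have na: "\<not> splits a"
  proof
    assume "splits a"
    then obtain f where f: "f \<in> K" "\<And>Q. Q \<in> X \<Longrightarrow> vge Q 0 (a Q - f)" by (auto simp: splits_def)
    have 1: "vge P 0 (f - inverse t)"
      using f(2)[OF P] vge_minus[OF P, of 0 "inverse t - f"] by (simp add: a_def)
    have vf: "inverse t + (f - inverse t) \<noteq> 0" "v P (inverse t + (f - inverse t)) = -1"
      using v_add_dominated[OF P, of "inverse t" "f - inverse t"] 1 t P by auto
    have "vge Q 0 f" if "Q \<in> X" "Q \<noteq> P" for Q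
      using f(2)[OF that(1)] that vge_minus[OF that(1), of 0 "- f"] by (simp add: a_def)
    then have "f \<in> range C"
      using no_simple_pole[OF g _ P, of f] vf f by (auto simp: vge_def)
    then show False using vf P by (cases "f = 0") auto
  qed
  obtain r where basis: "(\<forall>i<1. r i \<in> adeles) \<and> (\<forall>s\<in>adeles. \<exists>!c :: nat \<Rightarrow> 'k. (\<forall>i\<ge>1. c i = 0) \<and>
        splits (\<lambda>P. s P - (\<Sum>i<1. C (c i) * r i P)))"
    using genus_basis[OF g] by (elim exE)
  have coords: "\<exists>c. splits (\<lambda>P. s P - (\<Sum>i<(1::nat). C (c i) * r i P))" if "s \<in> adeles" for s
    using bspec[OF conjunct2[OF basis] that] by (elim ex1E) (intro exI, erule conjunct2)
  obtain b where b: "splits (\<lambda>Q. a Q - C b * r 0 Q)" using coords[OF aA] by auto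
  obtain c where c: "splits (\<lambda>Q. s Q - C c * r 0 Q)" using coords[OF s] by auto
  have "b \<noteq> 0" using b na by auto
  \<comment> \<open>Eliminates the unknown basis adele \<open>r 0\<close> in favour of the simple
    pole \<open>a\<close>, which is possible as \<open>b\<close> is nonzero.\<close>
  have "splits (\<lambda>Q. (s Q - C c * r 0 Q) + C (- c / b) * (a Q - C b * r 0 Q))"
    by (intro splits_add splits_C_mult b c)
  moreover have "(s Q - C c * r 0 Q) + C (- c / b) * (a Q - C b * r 0 Q) = s Q - C (c / b) * a Q" for Q
  proof -
    have "C c = C (c / b) * C b" using \<open>b \<noteq> 0\<close> by (simp flip: C_mult)
    then show ?thesis by (simp add: C_minus algebra_simps)
  qed
  ultimately have "splits (\<lambda>Q. s Q - C (c / b) * a Q)" by (simp only:)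
  then obtain f where f: "f \<in> K" "\<And>Q. Q \<in> X \<Longrightarrow> vge Q 0 (s Q - C (c / b) * a Q - f)"
    by (auto simp: splits_def)
  have "vge P (-1) (C (c / b) * inverse t)"
    using t P by (intro vge_C_mult) (auto simp: vge_def)
  moreover have "vge P (-1) (s P - C (c / b) * inverse t - f)"
    using vge_mono[OF f(2)[OF P]] by (simp add: a_def)
  ultimately have "vge P (-1) ((s P - C (c / b) * inverse t - f) + C (c / b) * inverse t)"
    using vge_add[OF P] by blast
  moreover have "vge Q 0 (s Q - f)" if "Q \<in> X - {P}" for Q
    using f(2)[of Q] that by (auto simp: a_def)
  ultimately show ?thesis using f by (intro bexI[of _ f]) (auto simp: algebra_simps)
qed

text \<open>\<open>H^1(P - Q) = 0\<close>: in \<open>genus_one_pole_spans\<close> the function is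
  free up to a constant, and the constant is spent on a zero at \<open>Q\<close>.\<close>

lemma genus_one_approximation:
  assumes g: "genus 1" and P: "P \<in> X" and Q: "Q \<in> X" and "P \<noteq> Q" and s: "s \<in> adeles"
  shows "\<exists>f\<in>K. \<forall>R\<in>X. vge R ((if R = Q then 1 else 0) - (if R = P then 1 else 0)) (s R - f)"
proof -
  obtain f where f: "f \<in> K" "vge P (-1) (s P - f)" "\<And>R. R \<in> X - {P} \<Longrightarrow> vge R 0 (s R - f)"
    using genus_one_pole_spans[OF g P s] by blast
  obtain c where c: "vge Q 1 (s Q - f - C c)" using vge_residue[OF Q, of "s Q - f"] f(3) Q \<open>P \<noteq> Q\<close> by auto
  have "vge R ((if R = Q then 1 else 0) - (if R = P then 1 else 0)) (s R - (f + C c))"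
    if R: "R \<in> X" for R
  proof -
    have "vge R (if R = P then -1 else 0) (s R - f)" using f R by auto
    moreover have "vge R (if R = P then -1 else 0) (C c)" using vge_C[OF R, of c] vge_mono by auto
    ultimately have "vge R (if R = P then -1 else 0) (s R - f - C c)" by (rule vge_diff[OF R])
    then show ?thesis using c \<open>P \<noteq> Q\<close> by (auto simp: algebra_simps)
  qed
  then show ?thesis using f(1) by (intro bexI[of _ "f + C c"]) auto
qed

text \<open>A function that approximates the principal part \<open>inverse (t ^ n)\<close> up to a
  simple pole has the exact order \<open>-n\<close>, as soon as \<open>n\<close> exceeds 1.\<close>

lemma genus_one_pole_order:
  assumes g: "genus 1" and P: "P \<in> X" and n: "n \<ge> 2"
  shows "\<exists>u\<in>K. u \<noteq> 0 \<and> v P u = - int n \<and> (\<forall>Q\<in>X - {P}. vge Q 0 u)"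
proof -
  obtain t where t: "t \<in> K" "t \<noteq> 0" "v P t = 1" using local_parameter[OF P] by blast
  define a where "a = (\<lambda>Q. if Q = P then inverse (t ^ n) else 0)"
  have aA: "a \<in> adeles" unfolding a_def using t by (intro pole_at_adeles) auto
  obtain f where f: "f \<in> K" "vge P (-1) (a P - f)" "\<And>R. R \<in> X - {P} \<Longrightarrow> vge R 0 (a R - f)"
    using genus_one_pole_spans[OF g P aA] by blast
  have vt: "v P (inverse (t ^ n)) = - int n" using t P by (simp add: v_power)
  have "vge P (v P (inverse (t ^ n)) + 1) (f - inverse (t ^ n))"
    using vge_minus[OF P f(2)] n vt by (auto simp: a_def intro: vge_mono)
  from v_add_dominated[OF P _ _ this] have "f \<noteq> 0" "v P f = - int n"
    using t vt by auto
  moreover have "vge R 0 f" if "R \<in> X - {P}" for R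
    using f(3)[OF that] that vge_minus_iff[of R 0 f] by (simp add: a_def)
  ultimately show ?thesis using f(1) by blast
qed

text \<open>On a finite set of points, weak approximation would split every adele. Applied to
  \<open>E\<close>, this later provides the three points.\<close>

lemma genus_pos_imp_infinite:
  assumes "genus g" "g \<ge> 1" shows "infinite X"
proof
  assume "finite X"
  have "splits s" if s: "s \<in> adeles" for s
  proof -
    obtain f where "f \<in> K" "\<forall>P\<in>X. vge P 0 (f - s P)"
      using weak_approximation[OF \<open>finite X\<close> subset_refl, of s 0] adeles_K[OF s] by auto
    then show ?thesis unfolding splits_def by (metis minus_diff_eq vge_minus)
  qed
  then have "g \<le> card ({} :: nat set)"
    by (intro genus_le_card[OF assms(1), of _ "\<lambda>_ _. 0"]) auto
  then show False using assms by simp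
qed

text \<open>Multiplying by \<open>t ^ Suc n\<close> exposes the leading coefficient as a residue;
  subtracting its term lowers the pole order.\<close>

lemma principal_part:
  assumes P: "P \<in> X" and t: "t \<in> K" "t \<noteq> 0" "v P t = 1" and x: "vge P (- int n) x"
  shows "\<exists>c. vge P 0 (x - (\<Sum>j=1..n. C (c j) * inverse (t ^ j)))"
  using x
proof (induction n arbitrary: x)
  case (Suc n)
  have xK: "x \<in> K" using Suc.prems by (rule vge_K)
  have "vge P (int (Suc n)) (t ^ Suc n)" using t P by (intro v_le_imp_vge) (auto simp: v_power v_mult)
  from vge_mult[OF P Suc.prems this] have "vge P 0 (x * t ^ Suc n)" by simp
  from vge_residue[OF P this] obtain c0 where c0: "vge P 1 (x * t ^ Suc n - C c0)" by blast
  have "vge P (- int (Suc n)) (inverse (t ^ Suc n))"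
    using t P by (intro v_le_imp_vge) (auto simp: v_power v_mult simp del: power_Suc)
  from vge_mult[OF P c0 this] have "vge P (- int n) ((x * t ^ Suc n - C c0) * inverse (t ^ Suc n))"
    by simp
  also have "(x * t ^ Suc n - C c0) * inverse (t ^ Suc n) = x - C c0 * inverse (t ^ Suc n)"
    using t by (simp add: field_simps)
  finally obtain c where c: "vge P 0 (x - C c0 * inverse (t ^ Suc n) - (\<Sum>j=1..n. C (c j) * inverse (t ^ j)))"
    using Suc.IH by blast
  have "(\<Sum>j=1..Suc n. C ((c(Suc n := c0)) j) * inverse (t ^ j)) =
      (\<Sum>j=1..n. C (c j) * inverse (t ^ j)) + C c0 * inverse (t ^ Suc n)"
    by simp
  then have "vge P 0 (x - (\<Sum>j=1..Suc n. C ((c(Suc n := c0)) j) * inverse (t ^ j)))"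
    using c by (simp only: diff_diff_eq add.commute)
  then show ?case by blast
qed auto

text \<open>The hypothesis \<open>approx\<close> is \<open>H^1(D) = 0\<close>. Every class of
  \<open>H^1(O)\<close> then comes from principal parts of pole order at most \<open>D\<close>, and
  these are spanned by the powers \<open>inverse (t P ^ j)\<close> with
  \<open>1 \<le> j \<le> D P\<close>, which are \<open>deg D\<close> in number.\<close>

lemma genus_le_degree:
  assumes g: "genus g" and D: "\<And>P. P \<in> X \<Longrightarrow> 0 \<le> D P" and fin: "finite {P \<in> X. D P \<noteq> 0}"
    and approx: "\<And>r. r \<in> adeles \<Longrightarrow> \<exists>f\<in>K. \<forall>P\<in>X. vge P (- D P) (r P - f)"
  shows "int g \<le> (\<Sum>P\<in>{P \<in> X. D P \<noteq> 0}. D P)"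
proof -
  define S where "S = {P \<in> X. D P \<noteq> 0}"
  define J where "J = (SIGMA P:S. {1..nat (D P)})"
  have "\<forall>P\<in>X. \<exists>t. t \<in> K \<and> t \<noteq> 0 \<and> v P t = 1" using local_parameter by blast
  then obtain t where t: "\<And>P. P \<in> X \<Longrightarrow> t P \<in> K" "\<And>P. P \<in> X \<Longrightarrow> t P \<noteq> 0" "\<And>P. P \<in> X \<Longrightarrow> v P (t P) = 1"
    by metis
  define s where "s = (\<lambda>(P, j) Q. if Q = P then inverse (t P ^ j) else 0)"
  have "g \<le> card J"
  proof (rule genus_le_card[OF g])
    show "finite J" using fin by (auto simp: J_def S_def)
    fix r assume r: "r \<in> adeles"
    obtain f where f: "f \<in> K" "\<And>P. P \<in> X \<Longrightarrow> vge P (- D P) (r P - f)"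
      using approx[OF r] by blast
    have "\<exists>c. vge P 0 (r P - f - (\<Sum>j=1..nat (D P). C (c j) * inverse (t P ^ j)))" if P: "P \<in> X" for P
      using f(2)[OF P] D[OF P] by (intro principal_part P t) simp
    then obtain c where c: "\<And>P. P \<in> X \<Longrightarrow> vge P 0 (r P - f - (\<Sum>j=1..nat (D P). C (c P j) * inverse (t P ^ j)))"
      by metis
    have "(\<Sum>i\<in>J. C (case_prod c i) * s i Q) = (\<Sum>j=1..nat (D Q). C (c Q j) * inverse (t Q ^ j))"
      if Q: "Q \<in> X" for Q
    proof -
      have "(\<Sum>i\<in>J. C (case_prod c i) * s i Q) =
          (\<Sum>P\<in>S. \<Sum>j=1..nat (D P). C (c P j) * (if Q = P then inverse (t P ^ j) else 0))"
        unfolding J_def s_def using fin by (subst sum.Sigma) (auto simp: S_def case_prod_beta)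
      also have "\<dots> = (\<Sum>P\<in>S. if Q = P then (\<Sum>j=1..nat (D P). C (c P j) * inverse (t P ^ j)) else 0)"
        by (intro sum.cong) auto
      also have "\<dots> = (\<Sum>j=1..nat (D Q). C (c Q j) * inverse (t Q ^ j))"
        using fin Q by (auto simp: S_def sum.delta')
      finally show ?thesis .
    qed
    then have "splits (\<lambda>P. r P - (\<Sum>i\<in>J. C (case_prod c i) * s i P))"
      unfolding splits_def using f(1) c by (intro bexI[of _ f]) (auto simp: algebra_simps)
    then show "\<exists>c. splits (\<lambda>P. r P - (\<Sum>j\<in>J. C (c j) * s j P))" by blast
  qed
  moreover have "int (card J) = (\<Sum>P\<in>S. D P)"
    unfolding J_def using D fin by (simp add: S_def)
  ultimately show ?thesis by (simp add: S_def)
qed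

lemma vge_prod: "P \<in> X \<Longrightarrow> (\<And>i. i \<in> I \<Longrightarrow> vge P 0 (f i)) \<Longrightarrow> vge P 0 (prod f I)"
proof (induction I rule: infinite_finite_induct)
  case (insert i I)
  then show ?case using vge_mult[of P 0 "f i" 0 "prod f I"] by simp
qed (auto simp: vge_def)

lemma vge_regular_power: "P \<in> X \<Longrightarrow> vge P 0 f \<Longrightarrow> vge P 0 (f ^ n)"
  using vge_prod[of P "{..<n}" "\<lambda>_. f"] by simp

end

section \<open>Double covers of a curve of genus one\<close>

lemma finite_has_least_image:
  fixes f :: "'a \<Rightarrow> 'b::linorder"
  assumes "finite S" "S \<noteq> {}"
  shows "\<exists>x\<in>S. \<forall>y\<in>S. f x \<le> f y"
  using assms arg_min_if_finite(1)[of S f] arg_min_least[of S _ f] by blast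

text \<open>\<open>\<psi>\<close> is the inclusion of \<open>k(E)\<close> in \<open>k(X)\<close>,
  and \<open>v_\<psi>\<close> makes \<open>e\<close> the ramification index. Degree 2 enters in two
  halves: \<open>dependent\<close> bounds the degree by 2, \<open>proper\<close> excludes degree
  1.\<close>

locale cover = X: places K C X v + E: places L B E w
  for K :: "'f::field set" and C :: "'k::alg_closed_field \<Rightarrow> 'f" and X :: "'p set" and v
    and L :: "'h::field set" and B :: "'k \<Rightarrow> 'h" and E :: "'q set" and w +
  fixes \<phi> :: "'p \<Rightarrow> 'q" and \<psi> :: "'h \<Rightarrow> 'f" and e :: "'p \<Rightarrow> int"
  assumes \<phi>: "\<And>P. P \<in> X \<Longrightarrow> \<phi> P \<in> E"
    and \<psi>_K [simp, intro]: "\<And>h. h \<in> L \<Longrightarrow> \<psi> h \<in> K"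
    and \<psi>_diff: "\<And>a b. a \<in> L \<Longrightarrow> b \<in> L \<Longrightarrow> \<psi> (a - b) = \<psi> a - \<psi> b"
    and \<psi>_mult: "\<And>a b. a \<in> L \<Longrightarrow> b \<in> L \<Longrightarrow> \<psi> (a * b) = \<psi> a * \<psi> b"
    and \<psi>_B [simp]: "\<And>c. \<psi> (B c) = C c"
    and e_pos: "\<And>P. P \<in> X \<Longrightarrow> 1 \<le> e P"
    and v_\<psi>: "\<And>P h. P \<in> X \<Longrightarrow> h \<in> L \<Longrightarrow> h \<noteq> 0 \<Longrightarrow> v P (\<psi> h) = e P * w (\<phi> P) h"
    and dependent: "\<And>u :: nat \<Rightarrow> 'f. (\<And>i. i < 3 \<Longrightarrow> u i \<in> K) \<Longrightarrow>
      \<exists>a. (\<forall>i<3. a i \<in> L) \<and> (\<exists>i<3. a i \<noteq> 0) \<and> (\<Sum>i<3. \<psi> (a i) * u i) = 0"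
    and proper: "\<exists>f\<in>K. f \<notin> \<psi> ` L"
begin

lemma \<psi>_zero [simp]: "\<psi> 0 = 0" using \<psi>_diff[of 1 1] by simp
lemma \<psi>_one [simp]: "\<psi> 1 = 1" using \<psi>_B[of 1] by simp
lemma \<psi>_minus: "a \<in> L \<Longrightarrow> \<psi> (- a) = - \<psi> a" using \<psi>_diff[of 0 a] by simp
lemma \<psi>_add: "a \<in> L \<Longrightarrow> b \<in> L \<Longrightarrow> \<psi> (a + b) = \<psi> a + \<psi> b"
  using \<psi>_diff[of a "- b"] by (simp add: \<psi>_minus)
lemma \<psi>_eq_0 [simp]: "\<psi> h = 0 \<longleftrightarrow> h = 0" if h: "h \<in> L"
proof
  assume "\<psi> h = 0"
  then show "h = 0" using \<psi>_mult[of h "inverse h"] h by (cases "h = 0") auto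
qed simp
lemma \<psi>_inverse: "h \<in> L \<Longrightarrow> \<psi> (inverse h) = inverse (\<psi> h)"
  using \<psi>_mult[of h "inverse h"] by (cases "h = 0") (auto simp: field_simps)
lemma \<psi>_divide: "a \<in> L \<Longrightarrow> b \<in> L \<Longrightarrow> \<psi> (a / b) = \<psi> a / \<psi> b"
  by (simp add: divide_inverse \<psi>_mult \<psi>_inverse)

lemma vge_\<psi>: "P \<in> X \<Longrightarrow> E.vge (\<phi> P) n h \<Longrightarrow> X.vge P (e P * n) (\<psi> h)"
  using e_pos[of P] by (cases "h = 0") (auto simp: X.vge_def E.vge_def v_\<psi>)

definition fibre :: "'q \<Rightarrow> 'p set" where "fibre q = {P \<in> X. \<phi> P = q}"

lemma e_pos_fibre: "P \<in> fibre q \<Longrightarrow> 1 \<le> e P" by (simp add: fibre_def e_pos)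
lemma e_nonneg_fibre: "P \<in> fibre q \<Longrightarrow> 0 \<le> e P" using e_pos_fibre[of P q] by simp

text \<open>Points of the fibre are zeros of the pullback of a function of order 1 at
  \<open>q\<close>.\<close>

lemma finite_fibre: assumes q: "q \<in> E" shows "finite (fibre q)"
proof -
  obtain t where t: "t \<in> L" "t \<noteq> 0" "w q t = 1" using E.local_parameter[OF q] by blast
  have "fibre q \<subseteq> {P \<in> X. v P (\<psi> t) \<noteq> 0}" using e_pos t by (force simp: fibre_def v_\<psi>)
  then show ?thesis using X.finite_v[of "\<psi> t"] t finite_subset by auto
qed

text \<open>In a linear relation between local functions \<open>u\<close> of order \<open>j < e P\<close> at one point of the fibre
  and of high order at the others, the term with lexicographically least pair (order of the
  coefficient, \<open>j\<close>) would strictly dominate.\<close>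

lemma fibre_degree_le: assumes q: "q \<in> E" shows "(\<Sum>P\<in>fibre q. e P) \<le> 2"
proof (rule ccontr)
  assume asm: "\<not> (\<Sum>P\<in>fibre q. e P) \<le> 2"
  have fX: "fibre q \<subseteq> X" by (auto simp: fibre_def)
  define J where "J = (SIGMA P:fibre q. {..<nat (e P)})"
  have "int (card J) = (\<Sum>P\<in>fibre q. e P)"
    unfolding J_def using finite_fibre[OF q] e_nonneg_fibre[of _ q] by simp
  then have "3 \<le> card J" using asm by simp
  then obtain J' where J': "J' \<subseteq> J" "card J' = 3" "finite J'" by (meson obtain_subset_with_card_n)
  then obtain pr where pr: "bij_betw pr {..<3::nat} J'"
    using ex_bij_betw_nat_finite[OF J'(3)] by (auto simp: atLeast0LessThan)
  have prJ: "fst (pr i) \<in> fibre q" "int (snd (pr i)) < e (fst (pr i))" if "i < 3" for i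
  proof -
    have "pr i \<in> J" using pr that J'(1) by (auto simp: bij_betw_def)
    then show "fst (pr i) \<in> fibre q" "int (snd (pr i)) < e (fst (pr i))" by (auto simp: J_def)
  qed
  \<comment> \<open>\<open>N\<close> is at least every ramification index of the fibre, so a
    function of order \<open>N\<close> at \<open>P\<close> is negligible against the orders
    \<open>j < e P\<close>.\<close>
  define N where "N = (\<Sum>P\<in>fibre q. e P)"
  have eN: "e P \<le> N" if "P \<in> fibre q" for P
    unfolding N_def using that finite_fibre[OF q] e_nonneg_fibre[of _ q] by (intro member_le_sum) auto
  have "\<exists>u\<in>K. (\<forall>Q\<in>fibre q - {P}. X.vge Q N u) \<and> u \<noteq> 0 \<and> v P u = int j"
    if P: "P \<in> fibre q" and j: "int j < e P" for P j
  proof -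
    have PX: "P \<in> X" using P fX by auto
    obtain t where t: "t \<in> K" "t \<noteq> 0" "v P t = 1" using X.local_parameter[OF PX] by blast
    have "\<exists>u\<in>K. \<forall>Q\<in>fibre q. X.vge Q N (u - (if Q = P then t ^ j else 0))"
      using t by (intro X.weak_approximation finite_fibre q fX) auto
    then obtain u where u: "u \<in> K" "\<forall>Q\<in>fibre q. X.vge Q N (u - (if Q = P then t ^ j else 0))"
      by blast
    have vt: "v P (t ^ j) = int j" using t PX by (simp add: X.v_power)
    have "X.vge P (v P (t ^ j) + 1) (u - t ^ j)"
      using bspec[OF u(2) P] eN[OF P] j vt by (auto intro: X.vge_mono)
    from X.v_add_dominated[OF PX _ _ this] have "u \<noteq> 0" "v P u = int j" using t vt by auto
    moreover have "X.vge Q N u" if "Q \<in> fibre q - {P}" for Q using u(2) that by (auto split: if_splits)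
    ultimately show ?thesis using u(1) by blast
  qed
  then have "\<forall>i\<in>{..<3}. \<exists>u. u \<in> K \<and> (\<forall>Q\<in>fibre q - {fst (pr i)}. X.vge Q N u) \<and> u \<noteq> 0 \<and>
      v (fst (pr i)) u = int (snd (pr i))"
    using prJ by blast
  from bchoice[OF this] obtain u where u_all: "\<forall>i\<in>{..<3}. u i \<in> K \<and>
      (\<forall>Q\<in>fibre q - {fst (pr i)}. X.vge Q N (u i)) \<and> u i \<noteq> 0 \<and> v (fst (pr i)) (u i) = int (snd (pr i))"
    by (elim exE)
  have u: "\<And>i. i < 3 \<Longrightarrow> u i \<in> K"
    "\<And>i Q. i < 3 \<Longrightarrow> Q \<in> fibre q \<Longrightarrow> Q \<noteq> fst (pr i) \<Longrightarrow> X.vge Q N (u i)"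
    "\<And>i. i < 3 \<Longrightarrow> u i \<noteq> 0" "\<And>i. i < 3 \<Longrightarrow> v (fst (pr i)) (u i) = int (snd (pr i))"
    using u_all by simp_all
  have "\<exists>a. (\<forall>i<3. a i \<in> L) \<and> (\<exists>i<3. a i \<noteq> 0) \<and> (\<Sum>i<3. \<psi> (a i) * u i) = 0"
    by (intro dependent u)
  then obtain a
    where a_all: "(\<forall>i<3. a i \<in> L) \<and> (\<exists>i<3. a i \<noteq> 0) \<and> (\<Sum>i<3. \<psi> (a i) * u i) = 0"
    by (elim exE)
  note a = conjunct1[OF a_all, rule_format] conjunct1[OF conjunct2[OF a_all]] conjunct2[OF conjunct2[OF a_all]]
  define I where "I = {i. i < 3 \<and> a i \<noteq> 0}"
  have I: "finite I" "I \<noteq> {}" using a(2) by (auto simp: I_def)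
  obtain i1 where i1: "i1 \<in> I" "\<And>i. i \<in> I \<Longrightarrow> w q (a i1) \<le> w q (a i)"
    using finite_has_least_image[OF I, of "\<lambda>i. w q (a i)"] by blast
  define \<mu> where "\<mu> = w q (a i1)"
  define I2 where "I2 = {i \<in> I. w q (a i) = \<mu>}"
  have "finite I2" "I2 \<noteq> {}" using i1 I by (auto simp: \<mu>_def I2_def)
  then obtain i0 where "i0 \<in> I2" "\<forall>i\<in>I2. snd (pr i0) \<le> snd (pr i)"
    using finite_has_least_image[of I2 "\<lambda>i. snd (pr i)"] by blast
  then have i0: "i0 \<in> I" "w q (a i0) = \<mu>" "\<And>i. i \<in> I \<Longrightarrow> w q (a i) = \<mu> \<Longrightarrow> snd (pr i0) \<le> snd (pr i)"
    by (auto simp: I2_def)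
  have i03: "i0 < 3" "a i0 \<noteq> 0" using i0 by (auto simp: I_def)
  define P where "P = fst (pr i0)"
  define j where "j = int (snd (pr i0))"
  have P: "P \<in> fibre q" "P \<in> X" "\<phi> P = q" "j < e P" "0 \<le> j" "e P \<le> N"
    using prJ[OF i03(1)] eN by (auto simp: P_def fibre_def j_def)
  have v0: "v P (\<psi> (a i0) * u i0) = e P * \<mu> + j"
    using i03 P a(1) u i0 by (simp add: X.v_mult v_\<psi> P_def j_def)
  have "X.vge P (v P (\<psi> (a i0) * u i0) + 1) (\<psi> (a i) * u i)" if i: "i \<in> {..<3} - {i0}" for i
  proof (cases "a i = 0")
    case False
    then have iI: "i \<in> I" using i by (simp add: I_def)
    have "\<mu> \<le> w q (a i)" using i1(2)[OF iI] by (simp add: \<mu>_def)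
    have 1: "v P (\<psi> (a i)) = e P * w q (a i)" using False i P a(1) by (simp add: v_\<psi>)
    show ?thesis
    proof (cases "fst (pr i) = P")
      case True
      have 2: "v P (\<psi> (a i) * u i) = e P * w q (a i) + int (snd (pr i))"
        using False i P a(1) u(1,3) u(4)[of i, unfolded True] 1 by (simp add: X.v_mult)
      have "e P * \<mu> + j + 1 \<le> e P * w q (a i) + int (snd (pr i))"
      proof (cases "w q (a i) = \<mu>")
        case True
        have "pr i \<noteq> pr i0" using pr i i03 by (auto simp: bij_betw_def inj_on_def)
        then have "snd (pr i) \<noteq> snd (pr i0)" using \<open>fst (pr i) = P\<close> by (auto simp: P_def prod_eq_iff)
        then show ?thesis using i0(3)[OF iI True] True by (simp add: j_def)
      next
        case False
        then have "\<mu> + 1 \<le> w q (a i)" using \<open>\<mu> \<le> w q (a i)\<close> by simp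
        \<comment> \<open>One more order in the coefficient adds \<open>e P\<close>, which is more
          than \<open>j\<close>.\<close>
        then have "e P * (\<mu> + 1) \<le> e P * w q (a i)" using e_pos[OF P(2)] by (intro mult_left_mono) auto
        then show ?thesis using P by (simp add: algebra_simps)
      qed
      then show ?thesis using 2 v0 i a(1) u by (intro X.v_le_imp_vge) auto
    next
      case False
      have "X.vge P (e P * w q (a i)) (\<psi> (a i))" using 1 i a(1) by (intro X.v_le_imp_vge) auto
      moreover have "X.vge P N (u i)" using u(2)[of i P] i P False by auto
      ultimately have 2: "X.vge P (e P * w q (a i) + N) (\<psi> (a i) * u i)" by (rule X.vge_mult[OF P(2)])
      have "e P * \<mu> \<le> e P * w q (a i)" using e_pos[OF P(2)] \<open>\<mu> \<le> w q (a i)\<close> by (intro mult_left_mono) auto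
      then have "v P (\<psi> (a i0) * u i0) + 1 \<le> e P * w q (a i) + N"
        unfolding v0 using P(4,6) by linarith
      with 2 show ?thesis by (rule X.vge_mono)
    qed
  qed simp
  then have "X.vge P (v P (\<psi> (a i0) * u i0) + 1) (\<Sum>i\<in>{..<3} - {i0}. \<psi> (a i) * u i)"
    by (intro X.vge_sum P)
  from X.v_add_dominated(1)[OF P(2) _ _ this] have "\<psi> (a i0) * u i0 + (\<Sum>i\<in>{..<3} - {i0}. \<psi> (a i) * u i) \<noteq> 0"
    using i03 a(1) u by auto
  then show False using a(3) i03(1) by (simp add: sum.remove[of "{..<3}" i0])
qed

text \<open>\<open>E\<close> without \<open>q\<close> behaves like an affine curve: \<open>u\<close>
  has its only pole at \<open>q\<close>, so \<open>u\<close> minus its value at the image of a bad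
  point vanishes there, and the pullback of a high power absorbs the pole of
  \<open>f\<close>.\<close>

lemma clear_poles:
  assumes g: "E.genus 1" and q: "q \<in> E" and f: "f \<in> K"
  shows "\<exists>h\<in>L. h \<noteq> 0 \<and> (\<forall>P\<in>X - fibre q. X.vge P 0 (\<psi> h * f))"
proof -
  obtain u where u: "u \<in> L" "u \<noteq> 0" "w q u = - int 2" "\<And>Q. Q \<in> E - {q} \<Longrightarrow> E.vge Q 0 u"
    using E.genus_one_pole_order[OF g q, of 2] by auto
  define S where "S = {P \<in> X. \<phi> P \<noteq> q \<and> \<not> X.vge P 0 f}"
  have S: "finite S" unfolding S_def by (rule finite_subset[OF _ X.finite_not_vge[OF f]]) auto
  have "\<forall>s\<in>\<phi> ` S. \<exists>c. E.vge s 1 (u - B c)"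
    using u(4) \<phi> by (intro ballI E.vge_residue) (auto simp: S_def)
  from bchoice[OF this] obtain c where c: "\<And>s. s \<in> \<phi> ` S \<Longrightarrow> E.vge s 1 (u - B (c s))" by blast
  define n where "n = nat (Max (insert 0 ((\<lambda>P. - v P f) ` S)))"
  have n: "X.vge P (- int n) f" if "P \<in> S" for P
  proof -
    have "- v P f \<le> Max (insert 0 ((\<lambda>P. - v P f) ` S))" using S that by (intro Max_ge) auto
    then show ?thesis using f by (intro X.v_le_imp_vge) (auto simp: n_def)
  qed
  define h where "h = (\<Prod>s\<in>\<phi> ` S. (u - B (c s)) ^ n)"
  have uB: "u \<noteq> B c" for c
  proof
    assume "u = B c"
    then show False using u E.v_C[OF q, of c] by (cases "c = 0") auto
  qed
  have h: "h \<in> L" "h \<noteq> 0" using u uB S by (auto simp: h_def)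
  have reg: "E.vge Q 0 (u - B d)" if "Q \<in> E - {q}" for Q d
    using that u(4)[OF that] by (intro E.vge_diff E.vge_C) auto
  have "X.vge P 0 (\<psi> h * f)" if P: "P \<in> X - fibre q" for P
  proof -
    have PX: "P \<in> X" and Pq: "\<phi> P \<in> E - {q}" using P \<phi> by (auto simp: fibre_def)
    show ?thesis
    proof (cases "P \<in> S")
      case True
      have "h = (u - B (c (\<phi> P))) ^ n * (\<Prod>s\<in>\<phi> ` S - {\<phi> P}. (u - B (c s)) ^ n)"
        unfolding h_def using S True by (intro prod.remove) auto
      moreover have "E.vge (\<phi> P) (int n) ((u - B (c (\<phi> P))) ^ n)"
        using Pq c True by (intro E.vge_power) auto
      moreover have "E.vge (\<phi> P) 0 (\<Prod>s\<in>\<phi> ` S - {\<phi> P}. (u - B (c s)) ^ n)"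
        using Pq reg by (intro E.vge_prod E.vge_regular_power) auto
      ultimately have "E.vge (\<phi> P) (int n) h" using E.vge_mult[of "\<phi> P" "int n" _ 0] Pq by auto
      from vge_\<psi>[OF PX this] have "X.vge P (int n) (\<psi> h)"
        using e_pos[OF PX] by (elim X.vge_mono) (simp add: mult_le_cancel_right1)
      from X.vge_mult[OF PX this n[OF True]] show ?thesis by simp
    next
      case False
      then have "X.vge P 0 f" using PX Pq by (auto simp: S_def)
      moreover have "E.vge (\<phi> P) 0 h"
        unfolding h_def using Pq reg by (intro E.vge_prod E.vge_regular_power) auto
      from vge_\<psi>[OF PX this] have "X.vge P 0 (\<psi> h)" by simp
      ultimately show ?thesis using X.vge_mult[OF PX, of 0 _ 0] by fastforce
    qed
  qed
  then show ?thesis using h by blast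
qed

text \<open>If the fibre has degree at most 1, a function outside \<open>k(E)\<close> whose poles lie in the fibre can be
  reduced modulo \<open>k(E)\<close> to one with at most a simple pole, hence to a constant.\<close>

lemma fibre_degree_ge:
  assumes gX: "X.genus g" "g \<ge> 1" and gE: "E.genus 1" and q: "q \<in> E"
  shows "2 \<le> (\<Sum>P\<in>fibre q. e P)"
proof (rule ccontr)
  assume less: "\<not> 2 \<le> (\<Sum>P\<in>fibre q. e P)"
  obtain f0 where f0: "f0 \<in> K" "f0 \<notin> \<psi> ` L" using proper by blast
  obtain h where h: "h \<in> L" "h \<noteq> 0" "\<And>P. P \<in> X - fibre q \<Longrightarrow> X.vge P 0 (\<psi> h * f0)"
    using clear_poles[OF gE q f0(1)] by blast
  define f where "f = \<psi> h * f0"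
  have f: "f \<in> K" "\<And>P. P \<in> X - fibre q \<Longrightarrow> X.vge P 0 f" using h f0 by (auto simp: f_def)
  have fL: "f \<notin> \<psi> ` L"
  proof
    assume "f \<in> \<psi> ` L"
    then obtain k where k: "k \<in> L" "f = \<psi> k" by blast
    then have "f0 = \<psi> (k / h)" using h by (simp add: f_def \<psi>_divide field_simps)
    then show False using f0(2) k h by auto
  qed
  have CL: "range C \<subseteq> \<psi> ` L" using \<psi>_B by (metis E.C_K image_eqI image_subsetI)
  consider "fibre q = {}" | P where "fibre q = {P}" "e P = 1"
  proof (cases "fibre q = {}")
    case False
    then obtain P where P: "P \<in> fibre q" by blast
    have fX: "fibre q \<subseteq> X" by (auto simp: fibre_def)
    have eq: "(\<Sum>P\<in>fibre q. e P) = e P + (\<Sum>P\<in>fibre q - {P}. e P)"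
      using finite_fibre[OF q] P by (intro sum.remove) auto
    have "fibre q - {P} = {}"
    proof (rule ccontr)
      assume "fibre q - {P} \<noteq> {}"
      then obtain P' where P': "P' \<in> fibre q - {P}" by blast
      have "e P' \<le> (\<Sum>P\<in>fibre q - {P}. e P)"
        using finite_fibre[OF q] e_nonneg_fibre[of _ q] P' by (intro member_le_sum) auto
      moreover have "1 \<le> e P" "1 \<le> e P'" using e_pos_fibre[of _ q] P P' by auto
      ultimately show False using less eq by simp
    qed
    moreover have "e P = 1" using less eq calculation e_pos_fibre[OF P] by auto
    ultimately show thesis using that(2)[of P] P by auto
  qed
  then show False
  proof cases
    case 1
    obtain P where P: "P \<in> X" using X.genus_pos_imp_infinite[OF gX] by (metis ex_in_conv finite.emptyI)
    have "f \<in> range C"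
      using f 1 P X.vge_mono[of P 0 f "-1"] by (intro X.no_simple_pole[OF gX P]) auto
    then show False using CL fL by blast
  next
    case (2 P)
    have PX: "P \<in> X" and \<phi>P: "\<phi> P = q" using 2 by (auto simp: fibre_def)
    \<comment> \<open>Descent on the pole order at the only point \<open>P\<close> of the fibre. As
      \<open>e P = 1\<close>, a function on \<open>E\<close> with pole order \<open>n\<close> at
      \<open>q\<close> pulls back to pole order \<open>n\<close>. For \<open>n \<ge> 2\<close> such
      a function exists and cancels the leading term; for \<open>n \<le> 1\<close> the function
      \<open>k\<close> is constant.\<close>
    have "k \<in> \<psi> ` L" if "X.vge P (- int n) k" "\<And>Q. Q \<in> X - fibre q \<Longrightarrow> X.vge Q 0 k" for n k
      using that
    proof (induction n arbitrary: k rule: less_induct)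
      case (less n)
      show ?case
      proof (cases "n \<le> 1")
        case True
        then have "X.vge P (-1) k" using less.prems(1) by (auto intro: X.vge_mono)
        then have "k \<in> range C" using less.prems(2) 2 by (intro X.no_simple_pole[OF gX PX]) auto
        then show ?thesis using CL by blast
      next
        case False
        obtain u where u: "u \<in> L" "u \<noteq> 0" "w q u = - int n" "\<And>Q. Q \<in> E - {q} \<Longrightarrow> E.vge Q 0 u"
          using E.genus_one_pole_order[OF gE q, of n] False by auto
        have vu: "v P (\<psi> u) = - int n" using u PX \<phi>P 2 by (simp add: v_\<psi>)
        have "X.vge P (int n) (inverse (\<psi> u))" using vu u PX by (intro X.v_le_imp_vge) auto
        from X.vge_mult[OF PX less.prems(1) this] have "X.vge P 0 (k * inverse (\<psi> u))" by simp
        from X.vge_residue[OF PX this] obtain c where c: "X.vge P 1 (k * inverse (\<psi> u) - C c)" by blast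
        have "X.vge P (- int n) (\<psi> u)" using vu u by (intro X.v_le_imp_vge) auto
        from X.vge_mult[OF PX c this] have "X.vge P (1 + - int n) ((k * inverse (\<psi> u) - C c) * \<psi> u)" .
        also have "(k * inverse (\<psi> u) - C c) * \<psi> u = k - C c * \<psi> u" using u by (simp add: field_simps)
        also have "1 + - int n = - int (n - 1)" using False by simp
        finally have 1: "X.vge P (- int (n - 1)) (k - C c * \<psi> u)" .
        have "X.vge Q 0 (k - C c * \<psi> u)" if Q: "Q \<in> X - fibre q" for Q
        proof -
          have QX: "Q \<in> X" "\<phi> Q \<in> E - {q}" using Q \<phi> by (auto simp: fibre_def)
          have "X.vge Q 0 (\<psi> u)" using vge_\<psi>[OF QX(1) u(4)[OF QX(2)]] by simp
          then show ?thesis using QX less.prems(2)[OF Q] by (intro X.vge_diff X.vge_C_mult)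
        qed
        with 1 have "k - C c * \<psi> u \<in> \<psi> ` L" 
          using False by (intro less.IH[of "n - 1"]) auto
        then obtain l where l: "l \<in> L" "k - C c * \<psi> u = \<psi> l" by blast
        then have "k = \<psi> (l + B c * u)" using u by (simp add: \<psi>_add \<psi>_mult algebra_simps)
        then show ?thesis using l u by blast
      qed
    qed
    moreover have "X.vge P (- int (nat (- v P f))) f" using f(1) by (intro X.v_le_imp_vge) auto
    ultimately show False using f fL by blast
  qed
qed

text \<open>Carries \<open>H^1(q - p1) = 0\<close> and \<open>H^1(q - p2) = 0\<close> on
  \<open>E\<close> over to \<open>H^1(D) = 0\<close> on \<open>X\<close>: by \<open>D1\<close> and
  \<open>D2\<close>, multiplication by \<open>f1\<close> and \<open>f2\<close> takes pullbacks of
  functions of order at least \<open>p1 - q\<close> and \<open>p2 - q\<close> to functions of order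
  at least \<open>-D\<close>.\<close>

lemma genus_le_of_independent_sections:
  assumes gX: "X.genus g" and gE: "E.genus 1"
    and D: "\<And>P. P \<in> X \<Longrightarrow> 0 \<le> D P" and fin: "finite {P \<in> X. D P \<noteq> 0}"
    and pts: "q \<in> E" "p1 \<in> E" "p2 \<in> E" "p1 \<noteq> q" "p2 \<noteq> q"
    and f1: "f1 \<in> K" "f1 \<noteq> 0" and f2: "f2 \<in> K" "f2 \<noteq> 0"
    and D1: "\<And>P. P \<in> X \<Longrightarrow> 0 \<le> v P f1 + D P + e P * ((if \<phi> P = p1 then 1 else 0) - (if \<phi> P = q then 1 else 0))"
    and D2: "\<And>P. P \<in> X \<Longrightarrow> 0 \<le> v P f2 + D P + e P * ((if \<phi> P = p2 then 1 else 0) - (if \<phi> P = q then 1 else 0))"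
    and indep: "\<And>h. h \<in> L \<Longrightarrow> f1 \<noteq> \<psi> h * f2"
  shows "int g \<le> (\<Sum>P\<in>{P \<in> X. D P \<noteq> 0}. D P)"
proof (rule X.genus_le_degree[OF gX D fin])
  \<comment> \<open>In a relation between \<open>f1\<close>, \<open>f2\<close> and a third function,
    independence forces a nonzero coefficient at the third.\<close>
  have gen: "\<exists>a\<in>L. \<exists>b\<in>L. f = \<psi> a * f1 + \<psi> b * f2" if f: "f \<in> K" for f
  proof -
    define u where "u i = (if i = 0 then f1 else if i = 1 then f2 else f)" for i :: nat
    have "\<exists>a. (\<forall>i<3. a i \<in> L) \<and> (\<exists>i<3. a i \<noteq> 0) \<and> (\<Sum>i<3. \<psi> (a i) * u i) = 0"
      using f f1 f2 by (intro dependent) (auto simp: u_def)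
    then obtain a
      where a_all: "(\<forall>i<3. a i \<in> L) \<and> (\<exists>i<3. a i \<noteq> 0) \<and> (\<Sum>i<3. \<psi> (a i) * u i) = 0"
      by (elim exE)
    note a = conjunct1[OF a_all] conjunct1[OF conjunct2[OF a_all]] conjunct2[OF conjunct2[OF a_all]]
    have aL: "a 0 \<in> L" "a 1 \<in> L" "a 2 \<in> L" using a(1) by auto
    have rel: "\<psi> (a 0) * f1 + \<psi> (a 1) * f2 + \<psi> (a 2) * f = 0"
      using a(3) by (simp add: eval_nat_numeral u_def)
    have nz: "a 2 \<noteq> 0"
    proof
      assume 0: "a 2 = 0"
      show False
      proof (cases "a 0 = 0")
        case True
        then have "a 1 = 0" using rel 0 f2 aL by auto
        have "a i = 0" if "i < 3" for i
        proof -
          have "i = 0 \<or> i = 1 \<or> i = 2" using that by auto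
          then show ?thesis using True \<open>a 1 = 0\<close> 0 by auto
        qed
        then show False using a(2) by blast
      next
        case False
        have "f1 = \<psi> (- (a 1 / a 0)) * f2"
          using rel 0 False aL by (simp add: \<psi>_minus \<psi>_divide field_simps eq_neg_iff_add_eq_0)
        then show False using indep[of "- (a 1 / a 0)"] aL by auto
      qed
    qed
    then have "f = \<psi> (- (a 0 / a 2)) * f1 + \<psi> (- (a 1 / a 2)) * f2"
      using rel aL by (simp add: \<psi>_minus \<psi>_divide field_simps eq_neg_iff_add_eq_0)
    then show ?thesis using aL by blast
  qed
  fix r assume r: "r \<in> X.adeles"
  \<comment> \<open>The images of the bad points. Below, \<open>r\<close> is approximated over a
    whole fibre at once, so that the coefficients depend on the point of \<open>E\<close> alone;
    putting them to 0 off \<open>S\<close> makes them adeles of \<open>E\<close>.\<close>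
  define S where "S = \<phi> ` {P \<in> X. \<not> X.vge P 0 (r P)}"
  have S: "finite S" "S \<subseteq> E" using r \<phi> by (auto simp: S_def X.adeles_def)
  have "\<exists>a\<in>L. \<exists>b\<in>L. \<forall>P\<in>fibre Q. X.vge P 0 (r P - (\<psi> a * f1 + \<psi> b * f2))" if Q: "Q \<in> E" for Q
  proof -
    have "fibre Q \<subseteq> X" by (auto simp: fibre_def)
    from X.weak_approximation[OF finite_fibre[OF Q] this, of r 0] obtain f
      where f: "f \<in> K" "\<forall>P\<in>fibre Q. X.vge P 0 (f - r P)" using X.adeles_K[OF r] by auto
    obtain a b where ab: "a \<in> L" "b \<in> L" "f = \<psi> a * f1 + \<psi> b * f2" using gen[OF f(1)] by blast
    have "X.vge P 0 (r P - f)" if "P \<in> fibre Q" for P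
      using f(2) that X.vge_minus[of P 0 "f - r P"] by (auto simp: fibre_def)
    then show ?thesis using ab by blast
  qed
  then obtain a b where ab: "\<And>Q. Q \<in> E \<Longrightarrow> a Q \<in> L" "\<And>Q. Q \<in> E \<Longrightarrow> b Q \<in> L"
    "\<And>Q P. Q \<in> E \<Longrightarrow> P \<in> fibre Q \<Longrightarrow> X.vge P 0 (r P - (\<psi> (a Q) * f1 + \<psi> (b Q) * f2))"
    by metis
  define a' where "a' Q = (if Q \<in> S then a Q else 0)" for Q
  define b' where "b' Q = (if Q \<in> S then b Q else 0)" for Q
  have adele: "a' \<in> E.adeles" "b' \<in> E.adeles"
    using ab(1,2) S by (auto simp: E.adeles_def a'_def b'_def intro: finite_subset[OF _ S(1)])
  have r': "X.vge P (- D P) (r P - (\<psi> (a' (\<phi> P)) * f1 + \<psi> (b' (\<phi> P)) * f2))" if P: "P \<in> X" for P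
  proof (cases "\<phi> P \<in> S")
    case True
    have "P \<in> fibre (\<phi> P)" using P by (simp add: fibre_def)
    from ab(3)[OF \<phi>[OF P] this] show ?thesis using True D[OF P] by (auto simp: a'_def b'_def intro: X.vge_mono)
  next
    case False
    then have "X.vge P 0 (r P)" using P by (auto simp: S_def)
    then show ?thesis using False D[OF P] by (auto simp: a'_def b'_def intro: X.vge_mono)
  qed
  \<comment> \<open>Replacing the local coefficient \<open>c\<close> by the global \<open>c0\<close>
    costs an error of order at least \<open>p - q\<close> on \<open>E\<close>; multiplication by
    \<open>f'\<close> turns this into order at least \<open>-D\<close>.\<close>
  have local_bound: "X.vge P (- D P) (\<psi> (c (\<phi> P) - c0) * f')"
    if P: "P \<in> X" and f': "f' \<in> K"
      "0 \<le> v P f' + D P + e P * ((if \<phi> P = p then 1 else 0) - (if \<phi> P = q then 1 else 0))"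
      and c: "\<forall>R\<in>E. E.vge R ((if R = p then 1 else 0) - (if R = q then 1 else 0)) (c R - c0)"
    for P f' p c c0
  proof -
    have "X.vge P (v P f') f'" using f' by (simp add: X.vge_def)
    with vge_\<psi>[OF P c[rule_format, OF \<phi>[OF P]]]
    have "X.vge P (e P * ((if \<phi> P = p then 1 else 0) - (if \<phi> P = q then 1 else 0)) + v P f') (\<psi> (c (\<phi> P) - c0) * f')"
      by (rule X.vge_mult[OF P])
    then show ?thesis by (rule X.vge_mono) (use f'(2) in linarith)
  qed
  obtain a0 where a0: "a0 \<in> L" "\<forall>R\<in>E. E.vge R ((if R = p1 then 1 else 0) - (if R = q then 1 else 0)) (a' R - a0)"
    using E.genus_one_approximation[OF gE pts(1,2) _ adele(1)] pts by blast
  obtain b0 where b0: "b0 \<in> L" "\<forall>R\<in>E. E.vge R ((if R = p2 then 1 else 0) - (if R = q then 1 else 0)) (b' R - b0)"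
    using E.genus_one_approximation[OF gE pts(1,3) _ adele(2)] pts by blast
  have "X.vge P (- D P) (r P - (\<psi> a0 * f1 + \<psi> b0 * f2))" if P: "P \<in> X" for P
  proof -
    have "X.vge P (- D P) (\<psi> (a' (\<phi> P) - a0) * f1 + \<psi> (b' (\<phi> P) - b0) * f2)"
      using P by (intro X.vge_add local_bound[OF P f1(1) D1[OF P] a0(2)] local_bound[OF P f2(1) D2[OF P] b0(2)])
    from X.vge_add[OF P r'[OF P] this] show ?thesis
      using a0(1) b0(1) E.adeles_K[OF adele(1)] E.adeles_K[OF adele(2)] by (simp add: \<psi>_diff algebra_simps)
  qed
  then show "\<exists>f\<in>K. \<forall>P\<in>X. X.vge P (- D P) (r P - f)"
    using a0(1) b0(1) f1 f2 by (intro bexI[of _ "\<psi> a0 * f1 + \<psi> b0 * f2"]) auto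
qed

lemma fibre_below_divisor:
  assumes gX: "X.genus g" and gE: "E.genus 1"
    and D: "\<And>P. P \<in> X \<Longrightarrow> 0 \<le> D P" and fin: "finite {P \<in> X. D P \<noteq> 0}"
    and deg: "(\<Sum>P\<in>{P \<in> X. D P \<noteq> 0}. D P) < int g"
    and pts: "q \<in> E" "p1 \<in> E" "p2 \<in> E" "p1 \<noteq> q" "p2 \<noteq> q" "p1 \<noteq> p2"
    and f1: "f1 \<in> K" "f1 \<noteq> 0" and f2: "f2 \<in> K" "f2 \<noteq> 0"
    and D1: "\<And>P. P \<in> X \<Longrightarrow> 0 \<le> v P f1 + D P + e P * ((if \<phi> P = p1 then 1 else 0) - (if \<phi> P = q then 1 else 0))"
    and D2: "\<And>P. P \<in> X \<Longrightarrow> 0 \<le> v P f2 + D P + e P * ((if \<phi> P = p2 then 1 else 0) - (if \<phi> P = q then 1 else 0))"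
  shows "\<exists>Q\<in>E.
    (\<forall>P\<in>fibre Q. e P \<le> v P f1 + D P + e P * ((if \<phi> P = p1 then 1 else 0) - (if \<phi> P = q then 1 else 0))) \<or>
    (\<forall>P\<in>fibre Q. e P \<le> v P f2 + D P + e P * ((if \<phi> P = p2 then 1 else 0) - (if \<phi> P = q then 1 else 0)))"
proof -
  obtain h where h: "h \<in> L" "f1 = \<psi> h * f2"
    using genus_le_of_independent_sections[OF gX gE D fin pts(1-5) f1 f2 D1 D2] deg by (meson not_le)
  have "h \<noteq> 0" using h f1 by auto
  \<comment> \<open>The coefficients of \<open>div h + p1 - p2\<close>, whose pullback is the first
    effective divisor minus the second. Where \<open>b Q\<close> is positive the first contains the
    fibre over \<open>Q\<close>, where it is negative the second does.\<close>
  define b where "b Q = w Q h + (if Q = p1 then 1 else 0) - (if Q = p2 then 1 else 0)" for Q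
  have "\<exists>Q\<in>E. b Q \<noteq> 0"
  proof (rule ccontr)
    assume "\<not> ?thesis"
    then have b0: "\<And>Q. Q \<in> E \<Longrightarrow> b Q = 0" by blast
    \<comment> \<open>If \<open>b\<close> vanishes, the only possible pole of \<open>h\<close> is a
      simple one at \<open>p1\<close>. Then \<open>h\<close> is constant, although
      \<open>b p1 = 0\<close> says that its order there is -1.\<close>
    have "h \<in> range B"
    proof (rule E.no_simple_pole[OF gE _ pts(2)])
      show "E.vge p1 (- 1) h" using b0[OF pts(2)] pts h by (intro E.v_le_imp_vge) (auto simp: b_def)
      show "E.vge Q 0 h" if "Q \<in> E" "Q \<noteq> p1" for Q
        using b0[OF that(1)] that h by (intro E.v_le_imp_vge) (auto simp: b_def split: if_splits)
    qed simp
    then have "w p1 h = 0" using \<open>h \<noteq> 0\<close> pts by auto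
    then show False using b0[OF pts(2)] pts by (simp add: b_def)
  qed
  then obtain Q where Q: "Q \<in> E" "b Q \<noteq> 0" by blast
  have vf1: "v P f1 = e P * w Q h + v P f2" if "P \<in> fibre Q" for P
    using that h f2 \<open>h \<noteq> 0\<close> by (auto simp: fibre_def X.v_mult v_\<psi>)
  have eb: "e P \<le> e P * b Q" if "P \<in> fibre Q" "1 \<le> b Q" for P
    using that e_pos[of P] by (auto simp: fibre_def mult_le_cancel_left1)
  have eb': "e P * b Q \<le> - e P" if "P \<in> fibre Q" "b Q \<le> -1" for P
    using that e_pos[of P] mult_left_mono[of "b Q" "-1" "e P"] by (auto simp: fibre_def)
  consider "1 \<le> b Q" | "b Q \<le> -1" using Q(2) by linarith
  then show ?thesis
  proof cases
    case 1
    have "\<forall>P\<in>fibre Q. e P \<le> v P f1 + D P + e P * ((if \<phi> P = p1 then 1 else 0) - (if \<phi> P = q then 1 else 0))"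
    proof
      fix P assume P: "P \<in> fibre Q"
      then have "P \<in> X" "\<phi> P = Q" by (auto simp: fibre_def)
      then show "e P \<le> v P f1 + D P + e P * ((if \<phi> P = p1 then 1 else 0) - (if \<phi> P = q then 1 else 0))"
        using eb[OF P 1] vf1[OF P] D2[of P] pts by (simp add: b_def algebra_simps split: if_splits)
    qed
    then show ?thesis using Q by blast
  next
    case 2
    have "\<forall>P\<in>fibre Q. e P \<le> v P f2 + D P + e P * ((if \<phi> P = p2 then 1 else 0) - (if \<phi> P = q then 1 else 0))"
    proof
      fix P assume P: "P \<in> fibre Q"
      then have "P \<in> X" "\<phi> P = Q" by (auto simp: fibre_def)
      then show "e P \<le> v P f2 + D P + e P * ((if \<phi> P = p2 then 1 else 0) - (if \<phi> P = q then 1 else 0))"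
        using eb'[OF P 2] vf1[OF P] D1[of P] pts by (simp add: b_def algebra_simps split: if_splits)
    qed
    then show ?thesis using Q by blast
  qed
qed

end

section \<open>Orders of functions at the points of a curve\<close>

lemma uniformizer_mem: "uniformizer X P t \<Longrightarrow> t \<in> max_ideal X P"
  unfolding uniformizer_def by (rule conjunct1)

context expansion_point
begin

text \<open>Numerator and denominator are both divided by a power of a coordinate that does not
  vanish at \<open>P\<close>.\<close>

lemma frac_of_local:
  assumes "f \<in> carrier FF"
  shows "\<exists>a b. a \<in> OP \<and> b \<in> OP \<and> b \<noteq> \<zero>\<^bsub>FF\<^esub> \<and> f \<otimes>\<^bsub>FF\<^esub> b = a"
proof -
  from assms obtain F G where FG: "(F, G) \<in> fractions X" "f = frac X F G" by (rule FF_carrierE)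
  then obtain d where d: "form d F" "form d G" "\<not> vanishes_on X G" by (auto simp: fractions_iff)
  obtain i where i: "rep_proj_point P $ i \<noteq> 0" using rep_proj_point_nonzero[of P] by (auto simp: vec_eq_iff)
  define L where "L = (linear_form (axis i 1) :: ('a, 'b) mpoly) ^ d"
  have L: "form d L" "form_at L P \<noteq> 0"
    using i form_power[OF form_linear_form, of d "axis i 1"] by (simp_all add: L_def)
  have fr: "(F, L) \<in> fractions X" "(G, L) \<in> fractions X" using d L P by (auto intro: fractions_at)
  have prod: "frac X F G \<otimes>\<^bsub>FF\<^esub> frac X G L = frac X F L"
    unfolding FF_mult[OF FG(1) fr(2)] by (rule frac_eqI[OF fractions_mult[OF FG(1) fr(2)] fr(1)]) simp
  have nz: "frac X G L \<noteq> \<zero>\<^bsub>FF\<^esub>" using frac_eq_zero[OF fr(2)] d(3) by simp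
  show ?thesis unfolding FG(2)
    by (intro exI conjI)
      (rule frac_local_ring[OF fr(1) L(2)], rule frac_local_ring[OF fr(2) L(2)], rule nz, rule prod)
qed

text \<open>Extends \<open>expansion\<close> from the local ring to its field of fractions;
  \<open>laurent_eq\<close> shows that the chosen fraction does not matter.\<close>

definition laurent :: "('a, 'b) ratfun \<Rightarrow> 'a fls" where
  "laurent f = (SOME y. \<exists>a b. a \<in> OP \<and> b \<in> OP \<and> b \<noteq> \<zero>\<^bsub>FF\<^esub> \<and> f \<otimes>\<^bsub>FF\<^esub> b = a \<and>
     y = fps_to_fls (expansion a) / fps_to_fls (expansion b))"

lemma laurent_eq:
  assumes f: "f \<in> carrier FF" and ab: "a \<in> OP" "b \<in> OP" "b \<noteq> \<zero>\<^bsub>FF\<^esub>" "f \<otimes>\<^bsub>FF\<^esub> b = a"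
  shows "laurent f = fps_to_fls (expansion a) / fps_to_fls (expansion b)"
  unfolding laurent_def
proof (rule some_equality)
  show "\<exists>a' b'. a' \<in> OP \<and> b' \<in> OP \<and> b' \<noteq> \<zero>\<^bsub>FF\<^esub> \<and> f \<otimes>\<^bsub>FF\<^esub> b' = a' \<and>
     fps_to_fls (expansion a) / fps_to_fls (expansion b) = fps_to_fls (expansion a') / fps_to_fls (expansion b')"
    using ab by blast
  fix y assume "\<exists>a b. a \<in> OP \<and> b \<in> OP \<and> b \<noteq> \<zero>\<^bsub>FF\<^esub> \<and> f \<otimes>\<^bsub>FF\<^esub> b = a \<and>
     y = fps_to_fls (expansion a) / fps_to_fls (expansion b)"
  then obtain a' b' where ab': "a' \<in> OP" "b' \<in> OP" "b' \<noteq> \<zero>\<^bsub>FF\<^esub>" "f \<otimes>\<^bsub>FF\<^esub> b' = a'"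
    "y = fps_to_fls (expansion a') / fps_to_fls (expansion b')" by blast
  note [simp] = local_ring_carrier[of _ P]
  have "a \<otimes>\<^bsub>FF\<^esub> b' = a' \<otimes>\<^bsub>FF\<^esub> b"
    unfolding ab(4)[symmetric] ab'(4)[symmetric] using f ab(2) ab'(2) by (simp add: FF.m_ac)
  then have "expansion a * expansion b' = expansion a' * expansion b"
    using ab ab' by (simp flip: expansion_mult)
  then have "fps_to_fls (expansion a) * fps_to_fls (expansion b') = fps_to_fls (expansion a') * fps_to_fls (expansion b)"
    by (simp flip: fls_times_fps_to_fls)
  moreover have "fps_to_fls (expansion b) \<noteq> 0" "fps_to_fls (expansion b') \<noteq> 0"
    using ab ab' by (auto simp: expansion_eq_0)
  ultimately show "y = fps_to_fls (expansion a) / fps_to_fls (expansion b)"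
    unfolding ab'(5) by (simp add: frac_eq_eq)
qed

lemma laurent_mult:
  assumes "f \<in> carrier FF" "h \<in> carrier FF"
  shows "laurent (f \<otimes>\<^bsub>FF\<^esub> h) = laurent f * laurent h"
proof -
  note [simp] = local_ring_carrier[of _ P]
  obtain a b where ab: "a \<in> OP" "b \<in> OP" "b \<noteq> \<zero>\<^bsub>FF\<^esub>" "f \<otimes>\<^bsub>FF\<^esub> b = a" using frac_of_local[OF assms(1)] by blast
  obtain a' b' where ab': "a' \<in> OP" "b' \<in> OP" "b' \<noteq> \<zero>\<^bsub>FF\<^esub>" "h \<otimes>\<^bsub>FF\<^esub> b' = a'" using frac_of_local[OF assms(2)] by blast
  have "(f \<otimes>\<^bsub>FF\<^esub> h) \<otimes>\<^bsub>FF\<^esub> (b \<otimes>\<^bsub>FF\<^esub> b') = a \<otimes>\<^bsub>FF\<^esub> a'"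
    unfolding ab(4)[symmetric] ab'(4)[symmetric] using assms ab(2) ab'(2) by (simp add: FF.m_ac)
  moreover have "b \<otimes>\<^bsub>FF\<^esub> b' \<noteq> \<zero>\<^bsub>FF\<^esub>" using ab ab' by (simp add: FF.integral_iff)
  ultimately have "laurent (f \<otimes>\<^bsub>FF\<^esub> h) = fps_to_fls (expansion (a \<otimes>\<^bsub>FF\<^esub> a')) / fps_to_fls (expansion (b \<otimes>\<^bsub>FF\<^esub> b'))"
    using ab ab' assms by (intro laurent_eq local_ring_mult) auto
  then show ?thesis
    using laurent_eq[OF assms(1) ab] laurent_eq[OF assms(2) ab'] ab ab'
    by (simp add: expansion_mult fls_times_fps_to_fls)
qed

lemma laurent_add:
  assumes "f \<in> carrier FF" "h \<in> carrier FF"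
  shows "laurent (f \<oplus>\<^bsub>FF\<^esub> h) = laurent f + laurent h"
proof -
  note [simp] = local_ring_carrier[of _ P]
  obtain a b where ab: "a \<in> OP" "b \<in> OP" "b \<noteq> \<zero>\<^bsub>FF\<^esub>" "f \<otimes>\<^bsub>FF\<^esub> b = a" using frac_of_local[OF assms(1)] by blast
  obtain a' b' where ab': "a' \<in> OP" "b' \<in> OP" "b' \<noteq> \<zero>\<^bsub>FF\<^esub>" "h \<otimes>\<^bsub>FF\<^esub> b' = a'" using frac_of_local[OF assms(2)] by blast
  have "(f \<oplus>\<^bsub>FF\<^esub> h) \<otimes>\<^bsub>FF\<^esub> (b \<otimes>\<^bsub>FF\<^esub> b') = (f \<otimes>\<^bsub>FF\<^esub> b) \<otimes>\<^bsub>FF\<^esub> b' \<oplus>\<^bsub>FF\<^esub> (h \<otimes>\<^bsub>FF\<^esub> b') \<otimes>\<^bsub>FF\<^esub> b"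
    using assms ab(2) ab'(2) by (simp add: FF.l_distr FF.m_assoc FF.m_comm[of b b'])
  then have "(f \<oplus>\<^bsub>FF\<^esub> h) \<otimes>\<^bsub>FF\<^esub> (b \<otimes>\<^bsub>FF\<^esub> b') = a \<otimes>\<^bsub>FF\<^esub> b' \<oplus>\<^bsub>FF\<^esub> a' \<otimes>\<^bsub>FF\<^esub> b" by (simp only: ab(4) ab'(4))
  moreover have "b \<otimes>\<^bsub>FF\<^esub> b' \<noteq> \<zero>\<^bsub>FF\<^esub>" using ab ab' by (simp add: FF.integral_iff)
  ultimately have "laurent (f \<oplus>\<^bsub>FF\<^esub> h) = fps_to_fls (expansion (a \<otimes>\<^bsub>FF\<^esub> b' \<oplus>\<^bsub>FF\<^esub> a' \<otimes>\<^bsub>FF\<^esub> b)) / fps_to_fls (expansion (b \<otimes>\<^bsub>FF\<^esub> b'))"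
    using ab ab' assms by (intro laurent_eq local_ring_mult local_ring_add) auto
  moreover have "fps_to_fls (expansion b) \<noteq> 0" "fps_to_fls (expansion b') \<noteq> 0"
    using ab ab' by (auto simp: expansion_eq_0)
  ultimately show ?thesis
    using laurent_eq[OF assms(1) ab] laurent_eq[OF assms(2) ab'] ab ab'
    by (simp add: expansion_mult expansion_add local_ring_mult fls_times_fps_to_fls add_frac_eq)
qed

lemma laurent_one: "laurent \<one>\<^bsub>FF\<^esub> = 1"
  using laurent_eq[of "\<one>\<^bsub>FF\<^esub>" "\<one>\<^bsub>FF\<^esub>" "\<one>\<^bsub>FF\<^esub>"] local_ring_const[of 1 P] expansion_const[of 1]
  by (simp add: const_fun_one)

end

text \<open>Any point of the curve serves; what matters is a homomorphism of \<open>k(X)\<close>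
  into a type-class field.\<close>

lemma (in smooth_curve) field_embedding_exists:
  "\<exists>\<iota> :: ('k, 'n) ratfun \<Rightarrow> 'k fls.
     (\<forall>f\<in>carrier FF. \<forall>h\<in>carrier FF. \<iota> (f \<otimes>\<^bsub>FF\<^esub> h) = \<iota> f * \<iota> h \<and> \<iota> (f \<oplus>\<^bsub>FF\<^esub> h) = \<iota> f + \<iota> h) \<and> \<iota> \<one>\<^bsub>FF\<^esub> = 1"
proof -
  obtain P where P: "P \<in> X" using nonempty by blast
  from uniformizer_exists[OF P] obtain t where t: "uniformizer X P t \<and> t \<noteq> \<zero>\<^bsub>FF\<^esub> \<and> (\<forall>f\<in>local_ring X P. f \<noteq> \<zero>\<^bsub>FF\<^esub> \<longrightarrow>
    (\<exists>N. \<forall>n h. h \<in> local_ring X P \<longrightarrow> f = t [^]\<^bsub>FF\<^esub> (n :: nat) \<otimes>\<^bsub>FF\<^esub> h \<longrightarrow> n \<le> N))" by (elim exE)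
  interpret expansion_point X P t
    by unfold_locales (use P t in blast)+
  show ?thesis using laurent_mult laurent_add laurent_one by (intro exI[of _ laurent]) simp
qed

section \<open>Orders of functions, seen inside a type-class field\<close>

locale embedded_curve = smooth_curve X for X :: "('k::alg_closed_field, 'n::finite) proj_point set" +
  fixes \<iota> :: "('k, 'n) ratfun \<Rightarrow> 'f::field"
  assumes \<iota>_mult: "\<And>f h. f \<in> carrier FF \<Longrightarrow> h \<in> carrier FF \<Longrightarrow> \<iota> (f \<otimes>\<^bsub>FF\<^esub> h) = \<iota> f * \<iota> h"
    and \<iota>_add: "\<And>f h. f \<in> carrier FF \<Longrightarrow> h \<in> carrier FF \<Longrightarrow> \<iota> (f \<oplus>\<^bsub>FF\<^esub> h) = \<iota> f + \<iota> h"
    and \<iota>_one: "\<iota> \<one>\<^bsub>FF\<^esub> = 1"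
begin

lemma \<iota>_zero: "\<iota> \<zero>\<^bsub>FF\<^esub> = 0"
  using \<iota>_add[of "\<zero>\<^bsub>FF\<^esub>" "\<zero>\<^bsub>FF\<^esub>"] by (metis FF.r_zero FF.zero_closed add.right_neutral add_left_cancel)

lemma \<iota>_minus: "f \<in> carrier FF \<Longrightarrow> \<iota> (\<ominus>\<^bsub>FF\<^esub> f) = - \<iota> f"
  using \<iota>_add[of f "\<ominus>\<^bsub>FF\<^esub> f"] by (simp add: FF.r_neg \<iota>_zero eq_neg_iff_add_eq_0 add.commute)

lemma \<iota>_diff: "f \<in> carrier FF \<Longrightarrow> h \<in> carrier FF \<Longrightarrow> \<iota> (f \<ominus>\<^bsub>FF\<^esub> h) = \<iota> f - \<iota> h"
  by (simp add: a_minus_def \<iota>_add \<iota>_minus)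

lemma \<iota>_inv_mult: "f \<in> carrier FF \<Longrightarrow> f \<noteq> \<zero>\<^bsub>FF\<^esub> \<Longrightarrow> inv\<^bsub>FF\<^esub> f \<in> carrier FF \<and> \<iota> (inv\<^bsub>FF\<^esub> f) * \<iota> f = 1"
proof -
  assume f: "f \<in> carrier FF" "f \<noteq> \<zero>\<^bsub>FF\<^esub>"
  then have U: "f \<in> Units FF" by (simp add: FF.field_Units)
  then have "inv\<^bsub>FF\<^esub> f \<otimes>\<^bsub>FF\<^esub> f = \<one>\<^bsub>FF\<^esub>" "inv\<^bsub>FF\<^esub> f \<in> carrier FF" by (simp_all add: FF.Units_l_inv)
  then show ?thesis using \<iota>_mult[of "inv\<^bsub>FF\<^esub> f" f] f \<iota>_one by simp
qed

lemma \<iota>_eq_0: "f \<in> carrier FF \<Longrightarrow> \<iota> f = 0 \<longleftrightarrow> f = \<zero>\<^bsub>FF\<^esub>"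
proof (cases "f = \<zero>\<^bsub>FF\<^esub>")
  case False
  assume "f \<in> carrier FF"
  then have "\<iota> (inv\<^bsub>FF\<^esub> f) * \<iota> f = 1" using \<iota>_inv_mult[OF _ False] by simp
  then have "\<iota> f \<noteq> 0" by auto
  then show ?thesis using False by simp
qed (simp add: \<iota>_zero)

lemma \<iota>_inv: "f \<in> carrier FF \<Longrightarrow> f \<noteq> \<zero>\<^bsub>FF\<^esub> \<Longrightarrow> \<iota> (inv\<^bsub>FF\<^esub> f) = inverse (\<iota> f)"
  using \<iota>_inv_mult[of f] by (metis inverse_unique inverse_inverse_eq)

lemma \<iota>_inj: "f \<in> carrier FF \<Longrightarrow> h \<in> carrier FF \<Longrightarrow> \<iota> f = \<iota> h \<longleftrightarrow> f = h"
  using \<iota>_eq_0[of "f \<ominus>\<^bsub>FF\<^esub> h"] \<iota>_diff[of f h] FF.r_right_minus_eq[of f h] by auto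

lemma \<iota>_nat_pow: "f \<in> carrier FF \<Longrightarrow> \<iota> (f [^]\<^bsub>FF\<^esub> (n :: nat)) = \<iota> f ^ n"
  by (induction n) (simp_all add: \<iota>_one \<iota>_mult mult.commute)

lemma nat_pow_nonzero: "f \<in> carrier FF \<Longrightarrow> f \<noteq> \<zero>\<^bsub>FF\<^esub> \<Longrightarrow> f [^]\<^bsub>FF\<^esub> (n :: nat) \<noteq> \<zero>\<^bsub>FF\<^esub>"
  using \<iota>_nat_pow[of f n] \<iota>_eq_0[of f] \<iota>_eq_0[of "f [^]\<^bsub>FF\<^esub> n"] by auto

lemma \<iota>_int_pow:
  assumes "f \<in> carrier FF" "f \<noteq> \<zero>\<^bsub>FF\<^esub>"
  shows "f [^]\<^bsub>FF\<^esub> (n :: int) \<in> carrier FF" "\<iota> (f [^]\<^bsub>FF\<^esub> n) = \<iota> f powi n"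
proof -
  have "f [^]\<^bsub>FF\<^esub> n \<in> carrier FF \<and> \<iota> (f [^]\<^bsub>FF\<^esub> n) = \<iota> f powi n"
  proof (cases "n < 0")
    case True
    have c: "f [^]\<^bsub>FF\<^esub> nat (- n) \<in> carrier FF" using assms by simp
    note nz = nat_pow_nonzero[OF assms, of "nat (- n)"]
    have "f [^]\<^bsub>FF\<^esub> n = inv\<^bsub>FF\<^esub> (f [^]\<^bsub>FF\<^esub> nat (- n))" 
      unfolding int_pow_def2 using True by (rule if_P)
    then show ?thesis
      using \<iota>_inv_mult[OF c nz] \<iota>_inv[OF c nz] True assms
      by (simp add: power_int_def \<iota>_nat_pow power_inverse del: pow_nat)
  next
    case False
    then have "f [^]\<^bsub>FF\<^esub> n = f [^]\<^bsub>FF\<^esub> nat n"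
      unfolding int_pow_def2 by (rule if_not_P)
    then show ?thesis using False assms by (simp add: power_int_def \<iota>_nat_pow del: pow_nat)
  qed
  then show "f [^]\<^bsub>FF\<^esub> n \<in> carrier FF" "\<iota> (f [^]\<^bsub>FF\<^esub> n) = \<iota> f powi n" by simp_all
qed

lemma \<iota>_finsum:
  "finite I \<Longrightarrow> (\<And>i. i \<in> I \<Longrightarrow> f i \<in> carrier FF) \<Longrightarrow>
    (\<Oplus>\<^bsub>FF\<^esub>i\<in>I. f i) \<in> carrier FF \<and> \<iota> (\<Oplus>\<^bsub>FF\<^esub>i\<in>I. f i) = (\<Sum>i\<in>I. \<iota> (f i))"
proof (induction I rule: finite_induct)
  case (insert i I)
  then have "f \<in> I \<rightarrow> carrier FF" "f i \<in> carrier FF" by auto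
  then show ?case using insert by (simp add: FF.finsum_insert \<iota>_add)
qed (simp add: \<iota>_zero)

lemma local_units_iff: "u \<in> local_units X P \<longleftrightarrow> u \<in> local_ring X P \<and> value_at u P \<noteq> 0"
  by (simp add: local_units_def)

lemma local_units_props:
  assumes P: "P \<in> X" and u: "u \<in> local_units X P"
  shows "u \<in> carrier FF" "u \<noteq> \<zero>\<^bsub>FF\<^esub>" "\<iota> u \<noteq> 0" "inv\<^bsub>FF\<^esub> u \<in> local_units X P" "\<iota> (inv\<^bsub>FF\<^esub> u) = inverse (\<iota> u)"
proof -
  have u': "u \<in> local_ring X P" "value_at u P \<noteq> 0" using u by (auto simp: local_units_iff)
  note inv = local_unit_inv[OF P u']
  show uc: "u \<in> carrier FF" by (rule local_ring_carrier[OF u'(1)])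
  show nz: "u \<noteq> \<zero>\<^bsub>FF\<^esub>" by (rule inv)
  show "\<iota> u \<noteq> 0" using uc nz by (simp add: \<iota>_eq_0)
  show "inv\<^bsub>FF\<^esub> u \<in> local_units X P" using inv by (simp add: local_units_iff)
  show "\<iota> (inv\<^bsub>FF\<^esub> u) = inverse (\<iota> u)" using uc nz by (rule \<iota>_inv)
qed

lemma local_units_mult: "P \<in> X \<Longrightarrow> u \<in> local_units X P \<Longrightarrow> w \<in> local_units X P \<Longrightarrow> u \<otimes>\<^bsub>FF\<^esub> w \<in> local_units X P"
  by (simp add: local_units_iff local_ring_mult value_at_mult)

lemma local_units_one: "P \<in> X \<Longrightarrow> \<one>\<^bsub>FF\<^esub> \<in> local_units X P"
  using local_ring_const[of 1 P] value_at_const[of P 1] by (simp add: local_units_iff const_fun_one)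

lemma local_units_powi:
  assumes P: "P \<in> X" and u: "u \<in> local_units X P"
  shows "\<exists>w\<in>local_units X P. \<iota> w = \<iota> u powi n"
proof -
  have nat: "\<exists>w\<in>local_units X P. \<iota> w = \<iota> u ^ k" if u: "u \<in> local_units X P" for u and k :: nat
  proof (induction k)
    case 0
    show ?case using local_units_one[OF P] \<iota>_one by (intro bexI[of _ "\<one>\<^bsub>FF\<^esub>"]) auto
  next
    case (Suc k)
    then obtain w where w: "w \<in> local_units X P" "\<iota> w = \<iota> u ^ k" by blast
    then show ?case using local_units_mult[OF P u w(1)] local_units_props(1)[OF P] u
      by (intro bexI[of _ "u \<otimes>\<^bsub>FF\<^esub> w"]) (auto simp: \<iota>_mult)
  qed
  show ?thesis
    using nat[OF u, of "nat n"] nat[OF local_units_props(4)[OF P u], of "nat (- n)"] local_units_props(5)[OF P u]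
    by (auto simp: power_int_def)
qed

lemma uniformizer_nonzero:
  assumes P: "P \<in> X" and t: "uniformizer X P t"
  shows "t \<in> carrier FF" "t \<noteq> \<zero>\<^bsub>FF\<^esub>" "\<iota> t \<noteq> 0"
proof -
  show tc: "t \<in> carrier FF" using uniformizer_mem[OF t] local_ring_carrier by (auto simp: max_ideal_iff)
  obtain s where s: "uniformizer X P s" "s \<noteq> \<zero>\<^bsub>FF\<^esub>" using uniformizer_exists[OF P] by blast
  show "t \<noteq> \<zero>\<^bsub>FF\<^esub>"
  proof
    assume "t = \<zero>\<^bsub>FF\<^esub>"
    moreover have "s \<in> max_ideal X P" by (rule uniformizer_mem) (rule s(1))
    then obtain h where "h \<in> local_ring X P" "s = t \<otimes>\<^bsub>FF\<^esub> h" using t unfolding uniformizer_def by blast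
    ultimately show False using s(2) local_ring_carrier[of h P] by simp
  qed
  then show "\<iota> t \<noteq> 0" using tc by (simp add: \<iota>_eq_0)
qed

lemma uniformizer_dvd:
  assumes "uniformizer X P t" "f \<in> max_ideal X P"
  obtains h where "h \<in> local_ring X P" "f = t \<otimes>\<^bsub>FF\<^esub> h"
  using assms unfolding uniformizer_def by blast

text \<open>Dividing by the largest possible power of \<open>t\<close> leaves a unit. A largest one
  exists because the bound known for one uniformizer \<open>s\<close> carries over to
  \<open>t = s k\<close>.\<close>

lemma local_decomposition:
  assumes P: "P \<in> X" and t: "uniformizer X P t" and f: "f \<in> local_ring X P" "f \<noteq> \<zero>\<^bsub>FF\<^esub>"
  shows "\<exists>u n. u \<in> local_units X P \<and> f = t [^]\<^bsub>FF\<^esub> (n :: nat) \<otimes>\<^bsub>FF\<^esub> u"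
proof -
  note [simp] = local_ring_carrier[of _ P]
  from uniformizer_exists[OF P] obtain s where s_all: "uniformizer X P s \<and> s \<noteq> \<zero>\<^bsub>FF\<^esub> \<and> (\<forall>f\<in>local_ring X P. f \<noteq> \<zero>\<^bsub>FF\<^esub> \<longrightarrow>
    (\<exists>N. \<forall>n h. h \<in> local_ring X P \<longrightarrow> f = s [^]\<^bsub>FF\<^esub> (n :: nat) \<otimes>\<^bsub>FF\<^esub> h \<longrightarrow> n \<le> N))" by (elim exE)
  note s = conjunct1[OF s_all]
  from mp[OF bspec[OF conjunct2[OF conjunct2[OF s_all]] f(1)] f(2)] obtain N
    where "\<forall>n h. h \<in> local_ring X P \<longrightarrow> f = s [^]\<^bsub>FF\<^esub> (n :: nat) \<otimes>\<^bsub>FF\<^esub> h \<longrightarrow> n \<le> N" by (elim exE)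
  note N = this[rule_format]
  have "t \<in> max_ideal X P" by (rule uniformizer_mem) (rule t)
  from uniformizer_dvd[OF s this] obtain k where k: "k \<in> local_ring X P" "t = s \<otimes>\<^bsub>FF\<^esub> k" .
  note sc = uniformizer_nonzero(1)[OF P s] and tc = uniformizer_nonzero(1)[OF P t]
  define R where "R n \<longleftrightarrow> (\<exists>h\<in>local_ring X P. f = t [^]\<^bsub>FF\<^esub> (n :: nat) \<otimes>\<^bsub>FF\<^esub> h)" for n
  have "R 0" unfolding R_def using f by (intro bexI[of _ f]) auto
  moreover have "n \<le> N" if "R n" for n
  proof -
    obtain h where h: "h \<in> local_ring X P" "f = t [^]\<^bsub>FF\<^esub> n \<otimes>\<^bsub>FF\<^esub> h" using \<open>R n\<close> by (auto simp: R_def)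
    have "f = s [^]\<^bsub>FF\<^esub> n \<otimes>\<^bsub>FF\<^esub> (k [^]\<^bsub>FF\<^esub> n \<otimes>\<^bsub>FF\<^esub> h)"
      unfolding h(2) k(2) using k(1) h(1) sc by (simp add: FF.nat_pow_distrib FF.m_assoc)
    then show ?thesis by (rule N[OF local_ring_mult[OF local_ring_nat_pow[OF k(1)] h(1)]])
  qed
  ultimately obtain n where n: "R n" "\<And>m. R m \<Longrightarrow> m \<le> n"
    using ex_has_greatest_nat[of R 0 id "Suc N"] by (auto simp: less_Suc_eq_le)
  then obtain h where h: "h \<in> local_ring X P" "f = t [^]\<^bsub>FF\<^esub> n \<otimes>\<^bsub>FF\<^esub> h" by (auto simp: R_def)
  have "h \<in> local_units X P"
  proof (rule ccontr)
    assume "h \<notin> local_units X P"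
    then have "h \<in> max_ideal X P" using h(1) by (simp add: local_units_iff max_ideal_iff)
    from uniformizer_dvd[OF t this] obtain h' where h': "h' \<in> local_ring X P" "h = t \<otimes>\<^bsub>FF\<^esub> h'" .
    have "f = t [^]\<^bsub>FF\<^esub> Suc n \<otimes>\<^bsub>FF\<^esub> h'" unfolding h(2) h'(2) using h'(1) tc by (simp add: FF.m_assoc)
    then have "R (Suc n)" using h'(1) by (auto simp: R_def)
    then show False using n(2) by fastforce
  qed
  then show ?thesis using h by blast
qed

lemma decomposition:
  assumes P: "P \<in> X" and t: "uniformizer X P t" and f: "f \<in> carrier FF" "f \<noteq> \<zero>\<^bsub>FF\<^esub>"
  shows "\<exists>u n. u \<in> local_units X P \<and> \<iota> f = \<iota> u * \<iota> t powi n"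
proof -
  note tc = uniformizer_nonzero[OF P t]
  from uniformizer_exists[OF P] obtain s where s: "uniformizer X P s \<and> s \<noteq> \<zero>\<^bsub>FF\<^esub> \<and> (\<forall>f\<in>local_ring X P. f \<noteq> \<zero>\<^bsub>FF\<^esub> \<longrightarrow>
    (\<exists>N. \<forall>n h. h \<in> local_ring X P \<longrightarrow> f = s [^]\<^bsub>FF\<^esub> (n :: nat) \<otimes>\<^bsub>FF\<^esub> h \<longrightarrow> n \<le> N))" by (elim exE)
  interpret ep: expansion_point X P s by unfold_locales (use P s in blast)+
  obtain a b where ab: "a \<in> local_ring X P" "b \<in> local_ring X P" "b \<noteq> \<zero>\<^bsub>FF\<^esub>" "f \<otimes>\<^bsub>FF\<^esub> b = a"
    using ep.frac_of_local[OF f(1)] by blast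
  note abc = local_ring_carrier[OF ab(1)] local_ring_carrier[OF ab(2)]
  have fb: "\<iota> f * \<iota> b = \<iota> a" using \<iota>_mult[OF f(1) abc(2)] ab(4) by simp
  have nz: "\<iota> b \<noteq> 0" "\<iota> f \<noteq> 0" using ab(3) abc f by (simp_all add: \<iota>_eq_0)
  then have "a \<noteq> \<zero>\<^bsub>FF\<^esub>" using fb abc by (auto simp: \<iota>_zero)
  from local_decomposition[OF P t ab(1) this] obtain u n
    where u: "u \<in> local_units X P" "a = t [^]\<^bsub>FF\<^esub> (n :: nat) \<otimes>\<^bsub>FF\<^esub> u" by blast
  from local_decomposition[OF P t ab(2,3)] obtain w m
    where w: "w \<in> local_units X P" "b = t [^]\<^bsub>FF\<^esub> (m :: nat) \<otimes>\<^bsub>FF\<^esub> w" by blast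
  note uw = local_units_props[OF P u(1)] and ww = local_units_props[OF P w(1)]
  have "\<iota> a = \<iota> t ^ n * \<iota> u" "\<iota> b = \<iota> t ^ m * \<iota> w"
    using u(2) w(2) uw(1) ww(1) tc(1) by (simp_all add: \<iota>_mult \<iota>_nat_pow)
  then have "\<iota> f = \<iota> u * inverse (\<iota> w) * \<iota> t powi (int n - int m)"
    using fb nz tc(3) ww(3) by (simp add: power_int_diff field_simps)
  moreover have "\<iota> (u \<otimes>\<^bsub>FF\<^esub> inv\<^bsub>FF\<^esub> w) = \<iota> u * inverse (\<iota> w)"
    using \<iota>_mult[OF uw(1) local_units_props(1)[OF P ww(4)]] ww(5) by simp
  ultimately show ?thesis using local_units_mult[OF P u(1) ww(4)] by metis
qed

text \<open>A positive power of \<open>t\<close> has value 0 at \<open>P\<close>; a negative one is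
  reduced to this case by inverting the unit.\<close>

lemma unit_power_trivial:
  assumes P: "P \<in> X" and t: "uniformizer X P t" and u: "u \<in> local_units X P" "\<iota> u = \<iota> t powi n"
  shows "n = 0"
proof -
  have pos: "\<not> 0 < k" if u: "u \<in> local_units X P" "\<iota> u = \<iota> t powi k" for u k
  proof
    assume k: "0 < k"
    note tc = uniformizer_nonzero[OF P t]
    have tO: "t \<in> local_ring X P" "value_at t P = 0" using uniformizer_mem[OF t] by (simp_all add: max_ideal_iff)
    have "\<iota> u = \<iota> (t \<otimes>\<^bsub>FF\<^esub> t [^]\<^bsub>FF\<^esub> nat (k - 1))"
      using u(2) k tc(1) by (simp add: \<iota>_mult \<iota>_nat_pow power_int_def nat_diff_distrib flip: power_Suc del: pow_nat)
    then have "u = t \<otimes>\<^bsub>FF\<^esub> t [^]\<^bsub>FF\<^esub> nat (k - 1)"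
      using local_units_props(1)[OF P u(1)] tc(1) by (simp add: \<iota>_inj)
    then have "value_at u P = 0" using tO by (simp add: value_at_mult[OF P] local_ring_nat_pow)
    then show False using u(1) by (simp add: local_units_iff)
  qed
  have "\<iota> (inv\<^bsub>FF\<^esub> u) = \<iota> t powi (- n)" using local_units_props(5)[OF P u(1)] u(2) by (simp add: power_int_minus)
  then show ?thesis using pos[OF u] pos[OF local_units_props(4)[OF P u(1)]] by force
qed

text \<open>The description defining \<open>ord_at\<close> ranges over all uniformizers, yet has a
  unique solution: two uniformizers differ by a unit, whose powers are units.\<close>

lemma ord_at_eqI:
  assumes P: "P \<in> X" and t: "uniformizer X P t" and u: "u \<in> local_units X P" and f: "f \<in> carrier FF"
    and eq: "\<iota> f = \<iota> u * \<iota> t powi n"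
  shows "ord_at X P f = n"
  unfolding ord_at_def
proof (rule the_equality)
  note tc = uniformizer_nonzero[OF P t] and uc = local_units_props[OF P u]
  have "f = u \<otimes>\<^bsub>FF\<^esub> t [^]\<^bsub>FF\<^esub> n"
    using eq \<iota>_int_pow[OF tc(1,2), of n] uc(1) f by (simp flip: \<iota>_inj add: \<iota>_mult)
  then show "\<exists>t u. uniformizer X P t \<and> u \<in> local_units X P \<and> f = u \<otimes>\<^bsub>FF\<^esub> t [^]\<^bsub>FF\<^esub> n" using t u by blast
  fix m :: int assume "\<exists>t u. uniformizer X P t \<and> u \<in> local_units X P \<and> f = u \<otimes>\<^bsub>FF\<^esub> t [^]\<^bsub>FF\<^esub> m"
  then obtain s w where s: "uniformizer X P s" and w: "w \<in> local_units X P" and fs: "f = w \<otimes>\<^bsub>FF\<^esub> s [^]\<^bsub>FF\<^esub> m" by blast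
  note sc = uniformizer_nonzero[OF P s] and wc = local_units_props[OF P w]
  have "s \<in> max_ideal X P" by (rule uniformizer_mem) (rule s)
  from uniformizer_dvd[OF t this] obtain h where h: "h \<in> local_ring X P" "s = t \<otimes>\<^bsub>FF\<^esub> h" .
  have "t \<in> max_ideal X P" by (rule uniformizer_mem) (rule t)
  from uniformizer_dvd[OF s this] obtain h' where h': "h' \<in> local_ring X P" "t = s \<otimes>\<^bsub>FF\<^esub> h'" .
  have \<iota>s: "\<iota> s = \<iota> t * \<iota> h" and \<iota>t: "\<iota> t = \<iota> s * \<iota> h'"
    using h h' tc(1) sc(1) \<iota>_mult local_ring_carrier by metis+
  then have "\<iota> h * \<iota> h' = 1" using tc(3) by (metis mult.assoc mult_cancel_left1)
  then have "h \<otimes>\<^bsub>FF\<^esub> h' = \<one>\<^bsub>FF\<^esub>"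
    using local_ring_carrier[OF h(1)] local_ring_carrier[OF h'(1)] by (simp flip: \<iota>_inj add: \<iota>_mult \<iota>_one)
  then have "value_at h P * value_at h' P = 1"
    using value_at_mult[OF P h(1) h'(1)] value_at_const[OF P, of 1] by (simp add: const_fun_one)
  then have hu: "h \<in> local_units X P" using h(1) by (auto simp: local_units_iff)
  note hc = local_units_props[OF P hu]
  obtain k where k: "k \<in> local_units X P" "\<iota> k = \<iota> h powi m" using local_units_powi[OF P hu] by blast
  have "\<iota> f = \<iota> w * \<iota> s powi m" using fs \<iota>_int_pow[OF sc(1,2), of m] wc(1) by (simp add: \<iota>_mult)
  then have "\<iota> u * \<iota> t powi n = \<iota> w * \<iota> k * \<iota> t powi m"
    using eq k(2) by (simp add: \<iota>s power_int_mult_distrib mult_ac)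
  then have "\<iota> w * \<iota> k * inverse (\<iota> u) = \<iota> t powi (n - m)"
    using tc(3) uc(3) by (simp add: power_int_diff field_simps)
  moreover have "\<iota> (w \<otimes>\<^bsub>FF\<^esub> k \<otimes>\<^bsub>FF\<^esub> inv\<^bsub>FF\<^esub> u) = \<iota> w * \<iota> k * inverse (\<iota> u)"
    using wc(1) local_units_props(1)[OF P k(1)] local_units_props(1)[OF P uc(4)] uc(5) by (simp add: \<iota>_mult)
  ultimately have "\<iota> (w \<otimes>\<^bsub>FF\<^esub> k \<otimes>\<^bsub>FF\<^esub> inv\<^bsub>FF\<^esub> u) = \<iota> t powi (n - m)" by simp
  from unit_power_trivial[OF P t local_units_mult[OF P local_units_mult[OF P w k(1)] uc(4)] this]
  have "n - m = 0" .
  then show "m = n" by simp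
qed

lemma ord_atE:
  assumes P: "P \<in> X" and t: "uniformizer X P t" and f: "f \<in> carrier FF" "f \<noteq> \<zero>\<^bsub>FF\<^esub>"
  obtains u where "u \<in> local_units X P" "\<iota> f = \<iota> u * \<iota> t powi ord_at X P f"
  using decomposition[OF assms] ord_at_eqI[OF P t _ f(1)] by metis

end

section \<open>Forms and functions with prescribed vanishing at finitely many points\<close>

lemma linear_form_nonzero_at: "\<exists>w. form_at (linear_form w) P \<noteq> 0"
proof -
  obtain i where "rep_proj_point P $ i \<noteq> 0" using rep_proj_point_nonzero[of P] by (auto simp: vec_eq_iff)
  then show ?thesis by (intro exI[of _ "axis i 1"]) simp
qed

lemma separating_form:
  assumes "finite S" "P \<notin> S"
  shows "\<exists>F. form (card S) F \<and> form_at F P \<noteq> 0 \<and> (\<forall>Q\<in>S. form_at F Q = 0)"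
proof -
  have "\<forall>Q\<in>S. \<exists>w. form_at (linear_form w) Q = 0 \<and> form_at (linear_form w) P \<noteq> 0"
  proof
    fix Q assume "Q \<in> S"
    then have "Q \<noteq> P" using assms by auto
    from linear_form_separating[OF this] obtain w
      where "form_at (linear_form w) Q = 0" "form_at (linear_form w) P \<noteq> 0" .
    then show "\<exists>w. form_at (linear_form w) Q = 0 \<and> form_at (linear_form w) P \<noteq> 0" by blast
  qed
  from bchoice[OF this] obtain w
    where w: "\<forall>Q\<in>S. form_at (linear_form (w Q)) Q = 0 \<and> form_at (linear_form (w Q)) P \<noteq> 0" by (elim exE)
  define F where "F = (\<Prod>Q\<in>S. linear_form (w Q))"
  have "form (\<Sum>Q\<in>S. 1) F" unfolding F_def by (intro form_prod form_linear_form)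
  moreover have "form_at F P \<noteq> 0" using w assms by (simp add: F_def meval_prod)
  moreover have "form_at F Q = 0" if "Q \<in> S" for Q
    using w assms that by (auto simp: F_def meval_prod intro!: prod_zero)
  ultimately show ?thesis by auto
qed

text \<open>Points are added one at a time. If \<open>D\<close> vanishes at the new point, a form
  \<open>E\<close> that vanishes exactly at the old ones among these points is added, after powers
  have brought both to degree \<open>e * d\<close>; positive exponents keep the zeros.\<close>

lemma nonvanishing_form:
  assumes "finite S"
  shows "\<exists>d D. 1 \<le> d \<and> form d D \<and> (\<forall>Q\<in>S. form_at D Q \<noteq> 0)"
  using assms
proof (induction S rule: finite_induct)
  case empty
  show ?case by (intro exI[of _ 1] exI[of _ 0]) simp
next
  case (insert Q S)
  then obtain d D where D: "1 \<le> d" "form d D" "\<forall>Q\<in>S. form_at D Q \<noteq> 0" by blast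
  show ?case
  proof (cases "form_at D Q = 0")
    case True
    obtain F where F: "form (card S) F" "form_at F Q \<noteq> 0" "\<forall>R\<in>S. form_at F R = 0"
      using separating_form[OF insert.hyps] by blast
    obtain w where w: "form_at (linear_form w) Q \<noteq> 0" using linear_form_nonzero_at by blast
    \<comment> \<open>The extra linear factor keeps the degree positive also for empty
      \<open>S\<close>.\<close>
    define e where "e = card S + 1"
    define E where "E = F * linear_form w"
    have E: "form e E" unfolding E_def e_def by (intro form_mult F form_linear_form)
    have "form (e * d) (D ^ e + E ^ d)"
      using form_power[OF D(2), of e] form_power[OF E, of d] by (intro form_add) (simp_all add: mult.commute)
    moreover have "form_at (D ^ e + E ^ d) R \<noteq> 0" if "R \<in> insert Q S" for R
      using that True D F w by (auto simp: E_def e_def power_0_left)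
    moreover have "1 \<le> e * d" using D(1) by (simp add: e_def)
    ultimately show ?thesis by blast
  qed (use D in blast)
qed

context embedded_curve
begin

lemma ord_unit:
  assumes P: "P \<in> X" and u: "u \<in> local_units X P" shows "ord_at X P u = 0"
proof -
  obtain t where t: "uniformizer X P t" using uniformizer_exists[OF P] by blast
  show ?thesis
    by (rule ord_at_eqI[OF P t u local_units_props(1)[OF P u]]) simp
qed

lemma ord_uniformizer:
  assumes P: "P \<in> X" and t: "uniformizer X P t" shows "ord_at X P t = 1"
  by (rule ord_at_eqI[OF P t local_units_one[OF P] uniformizer_nonzero(1)[OF P t]]) (simp add: \<iota>_one)

lemma ord_mult:
  assumes P: "P \<in> X" and f: "f \<in> carrier FF" "f \<noteq> \<zero>\<^bsub>FF\<^esub>" and h: "h \<in> carrier FF" "h \<noteq> \<zero>\<^bsub>FF\<^esub>"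
  shows "ord_at X P (f \<otimes>\<^bsub>FF\<^esub> h) = ord_at X P f + ord_at X P h"
proof -
  obtain t where t: "uniformizer X P t" using uniformizer_exists[OF P] by blast
  from ord_atE[OF P t f] obtain u where u: "u \<in> local_units X P" "\<iota> f = \<iota> u * \<iota> t powi ord_at X P f" .
  from ord_atE[OF P t h] obtain w where w: "w \<in> local_units X P" "\<iota> h = \<iota> w * \<iota> t powi ord_at X P h" .
  show ?thesis
  proof (rule ord_at_eqI[OF P t local_units_mult[OF P u(1) w(1)]])
    have "\<iota> (f \<otimes>\<^bsub>FF\<^esub> h) = \<iota> f * \<iota> h" using f h by (simp add: \<iota>_mult)
    also have "\<dots> = \<iota> (u \<otimes>\<^bsub>FF\<^esub> w) * (\<iota> t powi ord_at X P f * \<iota> t powi ord_at X P h)"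
      using local_units_props(1)[OF P u(1)] local_units_props(1)[OF P w(1)]
      by (subst u(2), subst w(2)) (simp add: \<iota>_mult mult_ac)
    also have "\<iota> t powi ord_at X P f * \<iota> t powi ord_at X P h = \<iota> t powi (ord_at X P f + ord_at X P h)"
      using uniformizer_nonzero(3)[OF P t] by (simp add: power_int_add)
    finally show "\<iota> (f \<otimes>\<^bsub>FF\<^esub> h) = \<iota> (u \<otimes>\<^bsub>FF\<^esub> w) * \<iota> t powi (ord_at X P f + ord_at X P h)" .
  qed (use f h in simp)
qed

lemma local_ring_iff_ord:
  assumes P: "P \<in> X" and f: "f \<in> carrier FF" "f \<noteq> \<zero>\<^bsub>FF\<^esub>"
  shows "f \<in> local_ring X P \<longleftrightarrow> 0 \<le> ord_at X P f"
proof -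
  obtain t where t: "uniformizer X P t" using uniformizer_exists[OF P] by blast
  have tO: "t \<in> local_ring X P" using uniformizer_mem[OF t] by (simp add: max_ideal_iff)
  show ?thesis
  proof
    assume "f \<in> local_ring X P"
    from local_decomposition[OF P t this f(2)] obtain u n
      where u: "u \<in> local_units X P" "f = t [^]\<^bsub>FF\<^esub> (n :: nat) \<otimes>\<^bsub>FF\<^esub> u" by blast
    have "ord_at X P f = int n"
      using u(2) uniformizer_nonzero(1)[OF P t] local_units_props(1)[OF P u(1)]
      by (intro ord_at_eqI[OF P t u(1) f(1)]) (simp add: \<iota>_mult \<iota>_nat_pow)
    then show "0 \<le> ord_at X P f" by simp
  next
    assume "0 \<le> ord_at X P f"
    then obtain n where n: "ord_at X P f = int n" by (metis nonneg_int_cases)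
    from ord_atE[OF P t f] obtain u where u: "u \<in> local_units X P" "\<iota> f = \<iota> u * \<iota> t powi ord_at X P f" .
    have "f = u \<otimes>\<^bsub>FF\<^esub> t [^]\<^bsub>FF\<^esub> n"
      using u(2) n uniformizer_nonzero(1)[OF P t] local_units_props(1)[OF P u(1)] f(1)
      by (simp flip: \<iota>_inj add: \<iota>_mult \<iota>_nat_pow)
    then show "f \<in> local_ring X P"
      using u(1) tO by (simp add: local_units_iff local_ring_mult local_ring_nat_pow)
  qed
qed

lemma max_ideal_iff_ord:
  assumes P: "P \<in> X" and f: "f \<in> carrier FF" "f \<noteq> \<zero>\<^bsub>FF\<^esub>"
  shows "f \<in> max_ideal X P \<longleftrightarrow> 1 \<le> ord_at X P f"
proof
  assume m: "f \<in> max_ideal X P"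
  obtain t where t: "uniformizer X P t" using uniformizer_exists[OF P] by blast
  from uniformizer_dvd[OF t m] obtain h where h: "h \<in> local_ring X P" "f = t \<otimes>\<^bsub>FF\<^esub> h" .
  note tc = uniformizer_nonzero[OF P t]
  have hc: "h \<in> carrier FF" "h \<noteq> \<zero>\<^bsub>FF\<^esub>" using h f tc local_ring_carrier by auto
  then have "0 \<le> ord_at X P h" using local_ring_iff_ord[OF P] h(1) by blast
  then show "1 \<le> ord_at X P f" unfolding h(2) using ord_mult[OF P tc(1,2) hc] ord_uniformizer[OF P t] by simp
next
  assume o: "1 \<le> ord_at X P f"
  then have "f \<in> local_ring X P" using local_ring_iff_ord[OF P f] by simp
  moreover have "f \<notin> local_units X P" using ord_unit[OF P] o by force
  ultimately show "f \<in> max_ideal X P" by (simp add: local_units_iff max_ideal_iff)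
qed

text \<open>Multiplication by a power of \<open>t\<close> shifts the smaller order to 0, where the
  claim says that the local ring is closed under subtraction.\<close>

lemma ord_diff:
  assumes P: "P \<in> X" and f: "f \<in> carrier FF" "f \<noteq> \<zero>\<^bsub>FF\<^esub>" and h: "h \<in> carrier FF" "h \<noteq> \<zero>\<^bsub>FF\<^esub>"
    and ne: "f \<noteq> h"
  shows "min (ord_at X P f) (ord_at X P h) \<le> ord_at X P (f \<ominus>\<^bsub>FF\<^esub> h)"
proof -
  obtain t where t: "uniformizer X P t" using uniformizer_exists[OF P] by blast
  note tc = uniformizer_nonzero[OF P t]
  define n where "n = min (ord_at X P f) (ord_at X P h)"
  define s where "s = t [^]\<^bsub>FF\<^esub> (- n)"
  have s: "s \<in> carrier FF" "\<iota> s = \<iota> t powi (- n)" unfolding s_def by (rule \<iota>_int_pow[OF tc(1,2)])+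
  have sz: "s \<noteq> \<zero>\<^bsub>FF\<^esub>" using s tc(3) by (auto simp flip: \<iota>_eq_0)
  have so: "ord_at X P s = - n"
    by (rule ord_at_eqI[OF P t local_units_one[OF P] s(1)]) (simp add: s(2) \<iota>_one)
  have mem: "k \<otimes>\<^bsub>FF\<^esub> s \<in> local_ring X P \<longleftrightarrow> n \<le> ord_at X P k" if "k \<in> carrier FF" "k \<noteq> \<zero>\<^bsub>FF\<^esub>" for k
    using that s(1) sz local_ring_iff_ord[OF P, of "k \<otimes>\<^bsub>FF\<^esub> s"] ord_mult[OF P that s(1) sz] so
    by (simp add: FF.integral_iff)
  have "f \<otimes>\<^bsub>FF\<^esub> s \<in> local_ring X P" "h \<otimes>\<^bsub>FF\<^esub> s \<in> local_ring X P" using mem f h by (auto simp: n_def)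
  then have "f \<otimes>\<^bsub>FF\<^esub> s \<ominus>\<^bsub>FF\<^esub> h \<otimes>\<^bsub>FF\<^esub> s \<in> local_ring X P" by (rule local_ring_diff)
  moreover have "f \<otimes>\<^bsub>FF\<^esub> s \<ominus>\<^bsub>FF\<^esub> h \<otimes>\<^bsub>FF\<^esub> s = (f \<ominus>\<^bsub>FF\<^esub> h) \<otimes>\<^bsub>FF\<^esub> s"
    using f h s(1) by (simp add: a_minus_def FF.l_distr FF.l_minus)
  moreover have "f \<ominus>\<^bsub>FF\<^esub> h \<in> carrier FF" "f \<ominus>\<^bsub>FF\<^esub> h \<noteq> \<zero>\<^bsub>FF\<^esub>" using f h ne by auto
  ultimately show ?thesis using mem by (simp add: n_def)
qed

lemma finite_ord:
  assumes f: "f \<in> carrier FF" "f \<noteq> \<zero>\<^bsub>FF\<^esub>"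
  shows "finite {P \<in> X. ord_at X P f \<noteq> 0}"
proof -
  from f(1) obtain F G where FG: "(F, G) \<in> fractions X" "f = frac X F G" by (rule FF_carrierE)
  then obtain d where d: "form d F" "form d G" "\<not> vanishes_on X G" by (auto simp: fractions_iff)
  have "\<not> vanishes_on X F" using frac_eq_zero[OF FG(1)] f(2) FG(2) by simp
  then have fin: "finite ({P \<in> X. form_at F P = 0} \<union> {P \<in> X. form_at G P = 0})"
    using finite_zeros[OF d(1)] finite_zeros[OF d(2,3)] by simp
  have "ord_at X P f = 0" if P: "P \<in> X" "form_at F P \<noteq> 0" "form_at G P \<noteq> 0" for P
  proof -
    have "f \<in> local_units X P"
      using frac_local_ring[OF FG(1) P(3)] value_at_frac[OF P(1) FG(1) P(3)] P(2,3) FG(2)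
      by (simp add: local_units_iff)
    then show ?thesis by (rule ord_unit[OF P(1)])
  qed
  then have "{P \<in> X. ord_at X P f \<noteq> 0} \<subseteq> {P \<in> X. form_at F P = 0} \<union> {P \<in> X. form_at G P = 0}" by auto
  then show ?thesis using fin finite_subset by blast
qed

lemma separating_function:
  assumes S: "finite S" "S \<subseteq> X" "P \<in> S"
  shows "\<exists>z. z \<in> local_ring X P \<and> value_at z P = 1 \<and> (\<forall>Q\<in>S - {P}. z \<in> max_ideal X Q)"
proof -
  obtain F where F: "form (card (S - {P})) F" "form_at F P \<noteq> 0" "\<forall>Q\<in>S - {P}. form_at F Q = 0"
    using separating_form[of "S - {P}" P] S by auto
  obtain d D where D: "1 \<le> d" "form d D" "\<forall>Q\<in>S. form_at D Q \<noteq> 0" using nonvanishing_form[OF S(1)] by blast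
  obtain w where w: "form_at (linear_form w) P \<noteq> 0" using linear_form_nonzero_at by blast
  define N where "N = card (S - {P})"
  \<comment> \<open>Padding with a linear form nonzero at \<open>P\<close> brings \<open>F\<close>
    to the degree of \<open>D ^ N\<close>, a denominator that vanishes nowhere on
    \<open>S\<close>.\<close>
  define A where "A = F * linear_form w ^ (N * d - N)"
  define B where "B = D ^ N"
  define c where "c = form_at B P / form_at A P"
  have "form (N + (N * d - N) * 1) A"
    unfolding A_def using F(1) N_def by (intro form_mult form_power form_linear_form) simp
  moreover have "N + (N * d - N) * 1 = N * d" using D(1) by (simp add: algebra_simps)
  ultimately have A: "form (N * d) A" by simp
  have B: "form (N * d) B" "\<And>Q. Q \<in> S \<Longrightarrow> form_at B Q \<noteq> 0"
    unfolding B_def using D by (auto intro: form_power)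
  have PX: "P \<in> X" using S by auto
  have AP: "form_at A P \<noteq> 0" using F w by (simp add: A_def)
  have fr: "(mconst c * A, B) \<in> fractions X"
    using A B S PX by (intro fractions_at[of "N * d"] form_mconst_mult) auto
  have "value_at (frac X (mconst c * A) B) Q = c * form_at A Q / form_at B Q" if "Q \<in> S" for Q
    using value_at_frac[OF _ fr B(2)[OF that]] that S by auto
  then have "value_at (frac X (mconst c * A) B) P = 1" "\<And>Q. Q \<in> S - {P} \<Longrightarrow> value_at (frac X (mconst c * A) B) Q = 0"
    using S(3) AP B(2)[OF S(3)] F(3) by (auto simp: c_def A_def)
  then show ?thesis using S frac_local_ring[OF fr B(2)]
    by (intro exI[of _ "frac X (mconst c * A) B"]) (auto simp: max_ideal_iff)
qed

definition K where "K = \<iota> ` carrier FF"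
definition C where "C c = \<iota> (const_fun X c)"
definition v where "v P y = ord_at X P (inv_into (carrier FF) \<iota> y)"

lemma inj_\<iota>: "inj_on \<iota> (carrier FF)" by (rule inj_onI) (simp add: \<iota>_inj)

lemma v_\<iota> [simp]: "f \<in> carrier FF \<Longrightarrow> v P (\<iota> f) = ord_at X P f"
  by (simp add: v_def inv_into_f_f[OF inj_\<iota>])

lemma K_\<iota> [simp]: "f \<in> carrier FF \<Longrightarrow> \<iota> f \<in> K" by (simp add: K_def)

lemma KE: assumes "y \<in> K" obtains f where "f \<in> carrier FF" "y = \<iota> f" using assms by (auto simp: K_def)

lemma places: "places K C X v"
proof
  show "1 \<in> K" using K_\<iota>[of "\<one>\<^bsub>FF\<^esub>"] \<iota>_one by simp
  show "f - g \<in> K" if "f \<in> K" "g \<in> K" for f g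
    using that by (elim KE) (simp flip: \<iota>_diff)
  show "f * g \<in> K" if "f \<in> K" "g \<in> K" for f g
    using that by (elim KE) (simp flip: \<iota>_mult)
  show "inverse f \<in> K" if fK: "f \<in> K" for f
  proof (cases "f = 0")
    case False
    obtain h where h: "h \<in> carrier FF" "f = \<iota> h" using fK by (rule KE)
    then have "h \<noteq> \<zero>\<^bsub>FF\<^esub>" using False \<iota>_zero by auto
    then show ?thesis using \<iota>_inv[OF h(1)] \<iota>_inv_mult[OF h(1)] h(2) K_\<iota> by metis
  qed (use fK in simp)
  show "C c \<in> K" for c by (simp add: C_def)
  show "C (a + b) = C a + C b" for a b by (simp add: C_def const_fun_add flip: \<iota>_add)
  show "C (a * b) = C a * C b" for a b by (simp add: C_def const_fun_mult flip: \<iota>_mult)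
  show "C 1 = 1" by (simp add: C_def const_fun_one \<iota>_one)
  show "v P (f * g) = v P f + v P g" if "P \<in> X" "f \<in> K" "g \<in> K" "f \<noteq> 0" "g \<noteq> 0" for P f g
    using that by (elim KE) (simp add: \<iota>_eq_0 ord_mult flip: \<iota>_mult)
  show "v P (C c) = 0" if "P \<in> X" "c \<noteq> 0" for P c
    using that by (auto simp: C_def local_units_iff intro!: ord_unit)
  show "min (v P f) (v P g) \<le> v P (f - g)" if fg: "P \<in> X" "f \<in> K" "g \<in> K" "f \<noteq> 0" "g \<noteq> 0" "f \<noteq> g" for P f g
  proof -
    obtain f' where f': "f' \<in> carrier FF" "f = \<iota> f'" using fg(2) by (rule KE)
    obtain g' where g': "g' \<in> carrier FF" "g = \<iota> g'" using fg(3) by (rule KE)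
    have "f' \<noteq> \<zero>\<^bsub>FF\<^esub>" "g' \<noteq> \<zero>\<^bsub>FF\<^esub>" "f' \<noteq> g'" using fg f' g' \<iota>_zero by auto
    from ord_diff[OF fg(1) f'(1) this(1) g'(1) this(2,3)] show ?thesis
      using f' g' by (simp flip: \<iota>_diff)
  qed
  show "\<exists>c. f = C c \<or> 1 \<le> v P (f - C c)" if P: "P \<in> X" and "f \<in> K" "f \<noteq> 0" "0 \<le> v P f" for P f
  proof -
    obtain h where h: "h \<in> carrier FF" "f = \<iota> h" using \<open>f \<in> K\<close> by (rule KE)
    then have "h \<in> local_ring X P" using that local_ring_iff_ord[OF P h(1)] \<iota>_zero by auto
    then have m: "h \<ominus>\<^bsub>FF\<^esub> const_fun X (value_at h P) \<in> max_ideal X P"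
      using P by (simp add: max_ideal_iff local_ring_diff value_at_diff)
    show ?thesis
    proof (cases "h \<ominus>\<^bsub>FF\<^esub> const_fun X (value_at h P) = \<zero>\<^bsub>FF\<^esub>")
      case True
      then have "h = const_fun X (value_at h P)" using h(1) by simp
      then have "f = C (value_at h P)" unfolding C_def h(2) by (rule arg_cong)
      then show ?thesis by blast
    next
      case False
      then have "1 \<le> ord_at X P (h \<ominus>\<^bsub>FF\<^esub> const_fun X (value_at h P))"
        using max_ideal_iff_ord[OF P _ False] m h(1) by simp
      then show ?thesis using h by (auto simp: C_def simp flip: \<iota>_diff intro!: exI[of _ "value_at h P"])
    qed
  qed
  show "\<exists>t\<in>K. t \<noteq> 0 \<and> v P t = 1" if P: "P \<in> X" for P
  proof -
    obtain t where t: "uniformizer X P t" using uniformizer_exists[OF P] by blast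
    then show ?thesis using uniformizer_nonzero[OF P t] ord_uniformizer[OF P t] by (intro bexI[of _ "\<iota> t"]) auto
  qed
  show "finite {P \<in> X. v P f \<noteq> 0}" if "f \<in> K" "f \<noteq> 0" for f
    using that by (elim KE) (auto simp: \<iota>_eq_0 finite_ord)
  show "\<exists>z\<in>K. (z = 1 \<or> 1 \<le> v P (z - 1)) \<and> (\<forall>Q\<in>S - {P}. z = 0 \<or> 1 \<le> v Q z)"
    if S: "finite S" "S \<subseteq> X" "P \<in> S" for S P
  proof -
    have PX: "P \<in> X" using S by auto
    obtain z where z: "z \<in> local_ring X P" "value_at z P = 1" "\<And>Q. Q \<in> S - {P} \<Longrightarrow> z \<in> max_ideal X Q"
      using separating_function[OF S] by blast
    have zc: "z \<in> carrier FF" using z(1) by (rule local_ring_carrier)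
    have vz: "\<iota> y = 0 \<or> 1 \<le> v Q (\<iota> y)" if "Q \<in> X" "y \<in> max_ideal X Q" for Q y
    proof -
      have "y \<in> carrier FF" using that local_ring_carrier by (auto simp: max_ideal_iff)
      then show ?thesis using max_ideal_iff_ord[OF that(1), of y] that(2) \<iota>_zero by (cases "y = \<zero>\<^bsub>FF\<^esub>") auto
    qed
    have "z \<ominus>\<^bsub>FF\<^esub> \<one>\<^bsub>FF\<^esub> \<in> max_ideal X P"
      using z(1,2) PX local_ring_const[of 1 P] value_at_const[OF PX, of 1]
      by (simp add: max_ideal_iff local_ring_diff value_at_diff const_fun_one)
    from vz[OF PX this] have "\<iota> z = 1 \<or> 1 \<le> v P (\<iota> z - 1)" using zc by (simp add: \<iota>_diff \<iota>_one)
    moreover have "\<iota> z = 0 \<or> 1 \<le> v Q (\<iota> z)" if "Q \<in> S - {P}" for Q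
      using vz[of Q z] z(3)[OF that] that S by auto
    ultimately show ?thesis using zc by (intro bexI[of _ "\<iota> z"]) auto
  qed
qed

end

sublocale embedded_curve \<subseteq> PL: places K C X v
  by (rule places)

context embedded_curve
begin

lemma vge_0_iff:
  assumes P: "P \<in> X" and f: "f \<in> carrier FF"
  shows "PL.vge P 0 (\<iota> f) \<longleftrightarrow> f \<in> local_ring X P"
proof (cases "f = \<zero>\<^bsub>FF\<^esub>")
  case True
  then show ?thesis using local_ring_const[of 0 P] by (simp add: \<iota>_zero const_fun_zero)
next
  case False
  then show ?thesis using local_ring_iff_ord[OF P f False] f by (simp add: PL.vge_def \<iota>_eq_0)
qed

text \<open>The embedding matches repartitions with adeles and regularity with
  \<open>vge P 0\<close>, so the same coefficients \<open>c\<close> solve both conditions.\<close>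

lemma genus_if_has_genus:
  assumes "has_genus X g" shows "PL.genus g"
proof -
  from assms obtain r where r0: "(\<forall>i<g. r i \<in> repartitions X) \<and>
        (\<forall>s\<in>repartitions X. \<exists>!c :: nat \<Rightarrow> 'k. (\<forall>i\<ge>g. c i = 0) \<and>
           (\<exists>f\<in>carrier FF. \<forall>P\<in>X.
              s P \<ominus>\<^bsub>FF\<^esub> (f \<oplus>\<^bsub>FF\<^esub> (\<Oplus>\<^bsub>FF\<^esub>i\<in>{..<g}. const_fun X (c i) \<otimes>\<^bsub>FF\<^esub> r i P)) \<in> local_ring X P))"
    unfolding has_genus_def by (elim exE)
  note r = conjunct1[OF r0, rule_format] and uniq = conjunct2[OF r0, rule_format]
  have rc: "r i P \<in> carrier FF" if "i < g" "P \<in> X" for i P using r[OF that(1)] that(2) by (simp add: repartitions_def)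
  \<comment> \<open>Put to 0 off \<open>X\<close>, where repartitions are unconstrained but adeles
    need values in \<open>K\<close>.\<close>
  define r' where "r' i P = (if P \<in> X then \<iota> (r i P) else 0)" for i P
  show ?thesis
    unfolding PL.genus_def
  proof (intro exI[of _ r'] conjI allI impI ballI)
    fix i assume i: "i < g"
    have "{P \<in> X. \<not> PL.vge P 0 (r' i P)} = {P \<in> X. r i P \<notin> local_ring X P}"
      using vge_0_iff rc[OF i] by (auto simp: r'_def)
    then show "r' i \<in> PL.adeles"
      using r[OF i] rc[OF i] by (simp add: PL.adeles_def repartitions_def) (simp add: r'_def)
  next
    fix s assume s: "s \<in> PL.adeles"
    define s0 where "s0 P = inv_into (carrier FF) \<iota> (s P)" for P
    have s0: "s0 P \<in> carrier FF" "\<iota> (s0 P) = s P" for P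
      using PL.adeles_K[OF s, of P] inv_into_into[of "s P" \<iota> "carrier FF"] f_inv_into_f[of "s P" \<iota> "carrier FF"]
      by (auto simp: K_def s0_def)
    have "{P \<in> X. s0 P \<notin> local_ring X P} = {P \<in> X. \<not> PL.vge P 0 (s P)}"
      using vge_0_iff[OF _ s0(1)] by (auto simp: s0(2))
    then have "s0 \<in> repartitions X" using s s0(1) by (simp add: PL.adeles_def repartitions_def)
    note u = uniq[OF this]
    have eq: "(\<exists>f\<in>carrier FF. \<forall>P\<in>X.
              s0 P \<ominus>\<^bsub>FF\<^esub> (f \<oplus>\<^bsub>FF\<^esub> (\<Oplus>\<^bsub>FF\<^esub>i\<in>{..<g}. const_fun X (c i) \<otimes>\<^bsub>FF\<^esub> r i P)) \<in> local_ring X P) \<longleftrightarrow>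
        (\<exists>f\<in>K. \<forall>P\<in>X. PL.vge P 0 (s P - (f + (\<Sum>i<g. C (c i) * r' i P))))" for c
    proof -
      have fs: "(\<Oplus>\<^bsub>FF\<^esub>i\<in>{..<g}. const_fun X (c i) \<otimes>\<^bsub>FF\<^esub> r i P) \<in> carrier FF \<and>
          \<iota> (\<Oplus>\<^bsub>FF\<^esub>i\<in>{..<g}. const_fun X (c i) \<otimes>\<^bsub>FF\<^esub> r i P) = (\<Sum>i<g. C (c i) * r' i P)" if P: "P \<in> X" for P
      proof -
        have "\<iota> (const_fun X (c i) \<otimes>\<^bsub>FF\<^esub> r i P) = C (c i) * r' i P" if "i < g" for i
          using rc[OF that P] P by (simp add: C_def \<iota>_mult r'_def)
        then show ?thesis
          using \<iota>_finsum[of "{..<g}" "\<lambda>i. const_fun X (c i) \<otimes>\<^bsub>FF\<^esub> r i P"] rc[OF _ P]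
          by (auto intro!: sum.cong)
      qed
      have "s0 P \<ominus>\<^bsub>FF\<^esub> (f \<oplus>\<^bsub>FF\<^esub> (\<Oplus>\<^bsub>FF\<^esub>i\<in>{..<g}. const_fun X (c i) \<otimes>\<^bsub>FF\<^esub> r i P)) \<in> local_ring X P \<longleftrightarrow>
          PL.vge P 0 (s P - (\<iota> f + (\<Sum>i<g. C (c i) * r' i P)))" if P: "P \<in> X" and f: "f \<in> carrier FF" for P f
        using f fs[OF P] s0[of P]
        by (subst vge_0_iff[OF P, symmetric]) (simp_all add: \<iota>_diff \<iota>_add)
      then show ?thesis unfolding K_def by auto
    qed
    from u show "\<exists>!c. (\<forall>i\<ge>g. c i = 0) \<and> (\<exists>f\<in>K. \<forall>P\<in>X. PL.vge P 0 (s P - (f + (\<Sum>i<g. C (c i) * r' i P))))"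
      unfolding eq .
  qed
qed

end

section \<open>Pullback of functions\<close>

definition msubst :: "('k::field, 'm::finite) mpoly \<Rightarrow> ('m \<Rightarrow> ('k, 'n::finite) mpoly) \<Rightarrow> ('k, 'n) mpoly" where
  "msubst F \<Phi> = (\<Sum>m\<in>Poly_Mapping.keys F. mconst (Poly_Mapping.lookup F m) * (\<Prod>j\<in>UNIV. \<Phi> j ^ Poly_Mapping.lookup m j))"

lemma meval_msubst: "meval (msubst F \<Phi>) v = meval F (\<chi> j. meval (\<Phi> j) v)"
  unfolding msubst_def meval_sum meval_mult meval_mconst meval_prod meval_power
  by (simp add: meval_def[of F])

lemma form_msubst:
  assumes F: "form n F" and \<Phi>: "\<And>j. form d (\<Phi> j)"
  shows "form (n * d) (msubst F \<Phi>)"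
  unfolding msubst_def
proof (intro form_sum form_mconst_mult)
  fix m assume "m \<in> Poly_Mapping.keys F"
  then have "(\<Sum>j\<in>UNIV. Poly_Mapping.lookup m j * d) = n * d"
    using F by (simp add: form_def flip: sum_distrib_right)
  moreover have "form (\<Sum>j\<in>UNIV. Poly_Mapping.lookup m j * d) (\<Prod>j\<in>UNIV. \<Phi> j ^ Poly_Mapping.lookup m j)"
    by (intro form_prod form_power \<Phi>)
  ultimately show "form (n * d) (\<Prod>j\<in>UNIV. \<Phi> j ^ Poly_Mapping.lookup m j)" by (simp only:)
qed

locale curve_morphism = X: smooth_curve X + E: smooth_curve E
  for X :: "('k::alg_closed_field, 'n::finite) proj_point set" and E :: "('k, 'm::finite) proj_point set" +
  fixes \<phi> :: "('k, 'n) proj_point \<Rightarrow> ('k, 'm) proj_point"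
  assumes morphism: "morphism X E \<phi>" and dominant: "dominant X E \<phi>"
begin

lemma \<phi>_E: "P \<in> X \<Longrightarrow> \<phi> P \<in> E"
  using morphism by (auto simp: morphism_def)

text \<open>A tuple describing \<open>\<phi>\<close> wherever its entries do not all vanish. One
  tuple need not work at every point of \<open>X\<close>, so the arguments below switch between
  tuples.\<close>

definition represents :: "nat \<Rightarrow> ('m \<Rightarrow> ('k, 'n) mpoly) \<Rightarrow> bool" where
  "represents d \<Phi> \<longleftrightarrow> (\<forall>j. form d (\<Phi> j)) \<and> (\<exists>P\<in>X. \<exists>j. form_at (\<Phi> j) P \<noteq> 0) \<and>
     (\<forall>Q\<in>X. (\<exists>j. form_at (\<Phi> j) Q \<noteq> 0) \<longrightarrow> \<phi> Q = abs_proj_point (\<chi> j. form_at (\<Phi> j) Q))"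

lemma represents_exists:
  assumes "P \<in> X" shows "\<exists>d \<Phi> j. represents d \<Phi> \<and> form_at (\<Phi> j) P \<noteq> 0"
proof -
  have "\<exists>d. \<exists>\<Phi> :: 'm \<Rightarrow> ('k, 'n) mpoly.
        (\<forall>j. form d (\<Phi> j)) \<and> (\<exists>j. form_at (\<Phi> j) P \<noteq> 0) \<and>
        (\<forall>Q\<in>X. (\<exists>j. form_at (\<Phi> j) Q \<noteq> 0) \<longrightarrow> \<phi> Q = abs_proj_point (\<chi> j. form_at (\<Phi> j) Q))"
    using bspec[OF conjunct2[OF morphism[unfolded morphism_def]] assms] .
  then obtain d and \<Phi> :: "'m \<Rightarrow> ('k, 'n) mpoly" where *: "(\<forall>j. form d (\<Phi> j)) \<and> (\<exists>j. form_at (\<Phi> j) P \<noteq> 0) \<and>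
        (\<forall>Q\<in>X. (\<exists>j. form_at (\<Phi> j) Q \<noteq> 0) \<longrightarrow> \<phi> Q = abs_proj_point (\<chi> j. form_at (\<Phi> j) Q))"
    by (elim exE)
  then obtain j where "form_at (\<Phi> j) P \<noteq> 0" by blast
  moreover have "represents d \<Phi>" unfolding represents_def
    by (intro conjI conjunct1[OF *] conjunct2[OF conjunct2[OF *]] bexI[OF _ assms] conjunct1[OF conjunct2[OF *]])
  ultimately show ?thesis by blast
qed

lemma represents_form: "represents d \<Phi> \<Longrightarrow> form d (\<Phi> j)"
  by (simp add: represents_def)

lemma represents_component:
  assumes "represents d \<Phi>" obtains j where "\<not> vanishes_on X (\<Phi> j)"
  using assms unfolding represents_def vanishes_on_def by blast

text \<open>\<open>c\<close> relates the chosen coordinates of \<open>\<phi> Q\<close> to the tuple.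
  It enters through the degree alone and so cancels in quotients of forms of equal degree.\<close>

lemma represents_at:
  assumes "represents d \<Phi>" "Q \<in> X" "form_at (\<Phi> j) Q \<noteq> 0"
  shows "\<exists>c. c \<noteq> 0 \<and> (\<forall>n F. form n F \<longrightarrow> form_at F (\<phi> Q) = c ^ n * form_at (msubst F \<Phi>) Q)"
proof -
  have "\<phi> Q = abs_proj_point (\<chi> j. form_at (\<Phi> j) Q)" using assms unfolding represents_def by blast
  moreover have "(\<chi> j. form_at (\<Phi> j) Q) \<noteq> 0" using assms(3) by (auto simp: vec_eq_iff)
  from rep_abs_proj_point[OF this] obtain c where "c \<noteq> 0"
    "rep_proj_point (abs_proj_point (\<chi> j. form_at (\<Phi> j) Q)) = c *s (\<chi> j. form_at (\<Phi> j) Q)" .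
  ultimately show ?thesis by (intro exI[of _ c]) (simp add: meval_scale meval_msubst)
qed

text \<open>Multiplied by one component of each tuple, \<open>H\<close> vanishes on all of
  \<open>X\<close>; primality of the vanishing ideal cancels the components.\<close>

lemma vanishes_via_components:
  assumes \<Phi>: "represents d \<Phi>" and \<Phi>': "represents d' \<Phi>'" and H: "form n H"
    and eq: "\<And>Q j j'. Q \<in> X \<Longrightarrow> form_at (\<Phi> j) Q \<noteq> 0 \<Longrightarrow> form_at (\<Phi>' j') Q \<noteq> 0 \<Longrightarrow> form_at H Q = 0"
  shows "vanishes_on X H"
proof -
  obtain j where j: "\<not> vanishes_on X (\<Phi> j)" by (rule represents_component[OF \<Phi>])
  obtain j' where j': "\<not> vanishes_on X (\<Phi>' j')" by (rule represents_component[OF \<Phi>'])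
  have "form_at (\<Phi> j * \<Phi>' j' * H) Q = 0" if "Q \<in> X" for Q
    using eq[OF that, of j j'] by auto
  then have "vanishes_on X (\<Phi> j * \<Phi>' j' * H)" unfolding vanishes_on_def by blast
  then show ?thesis
    using X.vanishes_on_mult[OF form_mult[OF represents_form[OF \<Phi>, of j] represents_form[OF \<Phi>', of j']] H]
      X.vanishes_on_mult[OF represents_form[OF \<Phi>, of j] represents_form[OF \<Phi>', of j']] j j' by blast
qed

text \<open>Dominance in use: otherwise \<open>G\<close> would vanish on the image of
  \<open>\<phi>\<close>, hence on \<open>E\<close>. At points where all entries of
  \<open>\<Phi>\<close> vanish, another tuple is taken.\<close>

lemma msubst_not_vanishes:
  assumes \<Phi>: "represents d \<Phi>" and G: "form n G" "\<not> vanishes_on E G"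
  shows "\<not> vanishes_on X (msubst G \<Phi>)"
proof
  assume van: "vanishes_on X (msubst G \<Phi>)"
  have "form_at G (\<phi> Q) = 0" if Q: "Q \<in> X" for Q
  proof -
    obtain d' \<Phi>' j' where \<Phi>': "represents d' \<Phi>'" "form_at (\<Phi>' j') Q \<noteq> 0" using represents_exists[OF Q] by blast
    have "vanishes_on X (msubst G \<Phi>')"
    proof (rule vanishes_via_components[OF \<Phi> \<Phi>'(1) form_msubst[OF G(1) represents_form[OF \<Phi>'(1)]]])
      fix R i i' assume R: "R \<in> X" "form_at (\<Phi> i) R \<noteq> 0" "form_at (\<Phi>' i') R \<noteq> 0"
      obtain c where c: "c \<noteq> 0" "form_at G (\<phi> R) = c ^ n * form_at (msubst G \<Phi>) R"
        using represents_at[OF \<Phi> R(1,2)] G(1) by blast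
      obtain c' where c': "c' \<noteq> 0" "form_at G (\<phi> R) = c' ^ n * form_at (msubst G \<Phi>') R"
        using represents_at[OF \<Phi>'(1) R(1,3)] G(1) by blast
      show "form_at (msubst G \<Phi>') R = 0" using c c' van R(1) by (simp add: vanishes_on_def)
    qed
    then show ?thesis using represents_at[OF \<Phi>'(1) Q \<Phi>'(2)] G(1) Q by (auto simp: vanishes_on_def)
  qed
  then have "\<phi> ` X \<subseteq> {P. form_at G P = 0}" by auto
  then have "E \<subseteq> {P. form_at G P = 0}" using dominant zariski_closed_zeros[OF G(1)] unfolding dominant_def by blast
  then show False using G(2) by (auto simp: vanishes_on_def)
qed

lemma msubst_fractions:
  assumes "represents d \<Phi>" "(F, G) \<in> fractions E"
  shows "(msubst F \<Phi>, msubst G \<Phi>) \<in> fractions X"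
proof -
  obtain n where "form n F" "form n G" "\<not> vanishes_on E G" using assms(2) by (auto simp: E.fractions_iff)
  then show ?thesis
    using form_msubst[OF _ represents_form[OF assms(1)]] msubst_not_vanishes[OF assms(1)]
    by (intro X.fractionsI[of "n * d"]) auto
qed

text \<open>Where both tuples are nonzero, the two fractions are compared through the values of
  forms at \<open>\<phi> R\<close>; the scalars \<open>c ^ n * c' ^ n'\<close> are common to both
  sides and cancel.\<close>

lemma frac_msubst_independent:
  assumes \<Phi>: "represents d \<Phi>" and \<Phi>': "represents d' \<Phi>'"
    and FG: "(F, G) \<in> fractions E" and FG': "(F', G') \<in> fractions E" and eq: "frac E F G = frac E F' G'"
  shows "frac X (msubst F \<Phi>) (msubst G \<Phi>) = frac X (msubst F' \<Phi>') (msubst G' \<Phi>')"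
proof (rule X.frac_eqI[OF msubst_fractions[OF \<Phi> FG] msubst_fractions[OF \<Phi>' FG']])
  obtain n where n: "form n F" "form n G" using FG by (auto simp: E.fractions_iff)
  obtain n' where n': "form n' F'" "form n' G'" using FG' by (auto simp: E.fractions_iff)
  define H where "H = msubst F \<Phi> * msubst G' \<Phi>' - msubst F' \<Phi>' * msubst G \<Phi>"
  note fm = form_msubst[OF _ represents_form[OF \<Phi>]] form_msubst[OF _ represents_form[OF \<Phi>']]
  have "form (n * d + n' * d') H"
    unfolding H_def by (rule form_diff[OF form_mult form_mult']) (rule fm n n')+
  then have "vanishes_on X H"
  proof (rule vanishes_via_components[OF \<Phi> \<Phi>'])
    fix R i i' assume R: "R \<in> X" "form_at (\<Phi> i) R \<noteq> 0" "form_at (\<Phi>' i') R \<noteq> 0"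
    obtain c where c: "c \<noteq> 0" "\<And>n F. form n F \<Longrightarrow> form_at F (\<phi> R) = c ^ n * form_at (msubst F \<Phi>) R"
      using represents_at[OF \<Phi> R(1,2)] by blast
    obtain c' where c': "c' \<noteq> 0" "\<And>n F. form n F \<Longrightarrow> form_at F (\<phi> R) = c' ^ n * form_at (msubst F \<Phi>') R"
      using represents_at[OF \<Phi>' R(1,3)] by blast
    have "form_at F (\<phi> R) * form_at G' (\<phi> R) = form_at F' (\<phi> R) * form_at G (\<phi> R)"
      using eq E.frac_eq_iff[OF FG FG'] \<phi>_E[OF R(1)] by blast
    then have "(c ^ n * c' ^ n') * (form_at (msubst F \<Phi>) R * form_at (msubst G' \<Phi>') R) =
        (c ^ n * c' ^ n') * (form_at (msubst F' \<Phi>') R * form_at (msubst G \<Phi>) R)"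
      by (simp only: c(2)[OF n(1)] c(2)[OF n(2)] c'(2)[OF n'(1)] c'(2)[OF n'(2)] mult_ac)
    then show "form_at H R = 0" using c(1) c'(1) by (simp add: H_def)
  qed
  then show "\<And>P. P \<in> X \<Longrightarrow> form_at (msubst F \<Phi>) P * form_at (msubst G' \<Phi>') P =
      form_at (msubst F' \<Phi>') P * form_at (msubst G \<Phi>) P"
    by (simp add: H_def vanishes_on_def)
qed

lemma frac_msubst_local:
  assumes \<Phi>: "represents d \<Phi>" and FG: "(F, G) \<in> fractions E" and P: "P \<in> X" and loc: "frac E F G \<in> local_ring E (\<phi> P)"
  shows "frac X (msubst F \<Phi>) (msubst G \<Phi>) \<in> local_ring X P"
    "value_at (frac X (msubst F \<Phi>) (msubst G \<Phi>)) P = value_at (frac E F G) (\<phi> P)"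
proof -
  from loc obtain F' G' where FG': "(F', G') \<in> fractions E" "frac E F G = frac E F' G'" "form_at G' (\<phi> P) \<noteq> 0"
    by (rule E.local_ringE)
  obtain n where n: "form n F'" "form n G'" using FG'(1) by (auto simp: E.fractions_iff)
  obtain d' \<Phi>' j where \<Phi>': "represents d' \<Phi>'" "form_at (\<Phi>' j) P \<noteq> 0" using represents_exists[OF P] by blast
  obtain c where c: "c \<noteq> 0" "\<And>n F. form n F \<Longrightarrow> form_at F (\<phi> P) = c ^ n * form_at (msubst F \<Phi>') P"
    using represents_at[OF \<Phi>'(1) P \<Phi>'(2)] by blast
  note h = frac_msubst_independent[OF \<Phi> \<Phi>'(1) FG FG'(1,2)]
  note fr = msubst_fractions[OF \<Phi>'(1) FG'(1)]
  have nz: "form_at (msubst G' \<Phi>') P \<noteq> 0" using FG'(3) c(2)[OF n(2)] by auto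
  show "frac X (msubst F \<Phi>) (msubst G \<Phi>) \<in> local_ring X P"
    unfolding h using fr nz by (rule X.frac_local_ring)
  show "value_at (frac X (msubst F \<Phi>) (msubst G \<Phi>)) P = value_at (frac E F G) (\<phi> P)"
    unfolding h FG'(2) X.value_at_frac[OF P fr nz] E.value_at_frac[OF \<phi>_E[OF P] FG'(1,3)]
    using c by (simp add: c(2)[OF n(1)] c(2)[OF n(2)])
qed

text \<open>Evaluates the description in \<open>pullback_fun\<close>. For uniqueness, a nonzero
  difference of two candidates is nonzero at some point where everything is defined, but there both
  have the value of the function on \<open>E\<close>.\<close>

lemma pullback_fun_frac:
  assumes \<Phi>: "represents d \<Phi>" and FG: "(F, G) \<in> fractions E"
  shows "pullback_fun X E \<phi> (frac E F G) = frac X (msubst F \<Phi>) (msubst G \<Phi>)"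
  unfolding pullback_fun_def
proof (rule the_equality)
  let ?h = "frac X (msubst F \<Phi>) (msubst G \<Phi>)"
  note fr = msubst_fractions[OF \<Phi> FG]
  show "?h \<in> carrier X.FF \<and> (\<forall>P\<in>X. frac E F G \<in> local_ring E (\<phi> P) \<longrightarrow>
      ?h \<in> local_ring X P \<and> value_at ?h P = value_at (frac E F G) (\<phi> P))"
    using X.frac_carrier[OF fr] frac_msubst_local[OF \<Phi> FG] by blast
  fix k assume k: "k \<in> carrier X.FF \<and> (\<forall>P\<in>X. frac E F G \<in> local_ring E (\<phi> P) \<longrightarrow>
      k \<in> local_ring X P \<and> value_at k P = value_at (frac E F G) (\<phi> P))"
  obtain n where n: "form n F" "form n G" "\<not> vanishes_on E G" using FG by (auto simp: E.fractions_iff)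
  show "k = ?h"
  proof (rule ccontr)
    assume "k \<noteq> ?h"
    then have nz: "k \<ominus>\<^bsub>X.FF\<^esub> ?h \<noteq> \<zero>\<^bsub>X.FF\<^esub>" "k \<ominus>\<^bsub>X.FF\<^esub> ?h \<in> carrier X.FF"
      using k X.frac_carrier[OF fr] by auto
    from nz(2) obtain A B where AB: "(A, B) \<in> fractions X" "k \<ominus>\<^bsub>X.FF\<^esub> ?h = frac X A B" by (rule X.FF_carrierE)
    obtain a where a: "form a A" "form a B" "\<not> vanishes_on X B" using AB(1) by (auto simp: X.fractions_iff)
    have A: "\<not> vanishes_on X A" using nz(1) X.frac_eq_zero[OF AB(1)] AB(2) by simp
    obtain j where j: "\<not> vanishes_on X (\<Phi> j)" by (rule represents_component[OF \<Phi>])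
    have "\<not> vanishes_on X (A * B)" using X.vanishes_on_mult[OF a(1,2)] A a(3) by blast
    then have 1: "\<not> vanishes_on X (A * B * \<Phi> j)"
      using X.vanishes_on_mult[OF form_mult[OF a(1,2)] represents_form[OF \<Phi>, of j]] j by blast
    have "form (n * d) (msubst G \<Phi>)" by (rule form_msubst[OF n(2)]) (rule represents_form[OF \<Phi>])
    then have "\<not> vanishes_on X (A * B * \<Phi> j * msubst G \<Phi>)"
      using X.vanishes_on_mult[OF form_mult[OF form_mult[OF a(1,2)] represents_form[OF \<Phi>, of j]]] 1 msubst_not_vanishes[OF \<Phi> n(2,3)] by blast
    then obtain R where R: "R \<in> X" "form_at A R \<noteq> 0" "form_at B R \<noteq> 0" "form_at (\<Phi> j) R \<noteq> 0" "form_at (msubst G \<Phi>) R \<noteq> 0"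
      by (auto simp: vanishes_on_def)
    have "form_at G (\<phi> R) \<noteq> 0" using represents_at[OF \<Phi> R(1,4)] n(2) R(5) by force
    then have loc: "frac E F G \<in> local_ring E (\<phi> R)" by (rule E.frac_local_ring[OF FG])
    have "k \<in> local_ring X R" "value_at k R = value_at ?h R" "?h \<in> local_ring X R"
      using k loc R(1) frac_msubst_local[OF \<Phi> FG R(1) loc] by auto
    then have "value_at (k \<ominus>\<^bsub>X.FF\<^esub> ?h) R = 0" using X.value_at_diff[OF R(1)] by simp
    then show False unfolding AB(2) X.value_at_frac[OF R(1) AB(1) R(3)] using R by simp
  qed
qed

abbreviation pb where "pb \<equiv> pullback_fun X E \<phi>"

lemma pullback_fun_props:
  shows pb_carrier: "f \<in> carrier E.FF \<Longrightarrow> pb f \<in> carrier X.FF"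
    and pb_mult: "f \<in> carrier E.FF \<Longrightarrow> h \<in> carrier E.FF \<Longrightarrow> pb (f \<otimes>\<^bsub>E.FF\<^esub> h) = pb f \<otimes>\<^bsub>X.FF\<^esub> pb h"
    and pb_add: "f \<in> carrier E.FF \<Longrightarrow> h \<in> carrier E.FF \<Longrightarrow> pb (f \<oplus>\<^bsub>E.FF\<^esub> h) = pb f \<oplus>\<^bsub>X.FF\<^esub> pb h"
    and pb_const: "pb (const_fun E c) = const_fun X c"
    and pb_local: "f \<in> carrier E.FF \<Longrightarrow> P \<in> X \<Longrightarrow> f \<in> local_ring E (\<phi> P) \<Longrightarrow>
      pb f \<in> local_ring X P \<and> value_at (pb f) P = value_at f (\<phi> P)"
proof -
  obtain P0 where P0: "P0 \<in> X" using X.nonempty by blast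
  obtain d \<Phi> j where \<Phi>: "represents d \<Phi>" using represents_exists[OF P0] by blast
  note fr = msubst_fractions[OF \<Phi>] and pf = pullback_fun_frac[OF \<Phi>]
  show c: "pb f \<in> carrier X.FF" if "f \<in> carrier E.FF" for f
    using that by (elim E.FF_carrierE) (simp add: pf fr)
  show "pb (f \<otimes>\<^bsub>E.FF\<^esub> h) = pb f \<otimes>\<^bsub>X.FF\<^esub> pb h" if "f \<in> carrier E.FF" "h \<in> carrier E.FF"
  proof -
    from that(1) obtain F G where f: "(F, G) \<in> fractions E" "f = frac E F G" by (rule E.FF_carrierE)
    from that(2) obtain F' G' where h: "(F', G') \<in> fractions E" "h = frac E F' G'" by (rule E.FF_carrierE)
    show ?thesis
      unfolding f(2) h(2) E.FF_mult[OF f(1) h(1)] pf[OF f(1)] pf[OF h(1)] pf[OF E.fractions_mult[OF f(1) h(1)]]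
        X.FF_mult[OF fr[OF f(1)] fr[OF h(1)]]
      by (rule X.frac_eqI[OF fr[OF E.fractions_mult[OF f(1) h(1)]] X.fractions_mult[OF fr[OF f(1)] fr[OF h(1)]]])
        (simp add: meval_msubst)
  qed
  show "pb (f \<oplus>\<^bsub>E.FF\<^esub> h) = pb f \<oplus>\<^bsub>X.FF\<^esub> pb h" if "f \<in> carrier E.FF" "h \<in> carrier E.FF"
  proof -
    from that(1) obtain F G where f: "(F, G) \<in> fractions E" "f = frac E F G" by (rule E.FF_carrierE)
    from that(2) obtain F' G' where h: "(F', G') \<in> fractions E" "h = frac E F' G'" by (rule E.FF_carrierE)
    show ?thesis
      unfolding f(2) h(2) E.FF_add[OF f(1) h(1)] pf[OF f(1)] pf[OF h(1)] pf[OF E.fractions_add[OF f(1) h(1)]]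
        X.FF_add[OF fr[OF f(1)] fr[OF h(1)]]
      by (rule X.frac_eqI[OF fr[OF E.fractions_add[OF f(1) h(1)]] X.fractions_add[OF fr[OF f(1)] fr[OF h(1)]]])
        (simp add: meval_msubst)
  qed
  show "pb (const_fun E c) = const_fun X c"
    unfolding const_fun_def pf[OF E.fractions_const(1)]
    by (rule X.frac_eqI[OF fr[OF E.fractions_const(1)] X.fractions_const(1)]) (simp add: meval_msubst)
  show "pb f \<in> local_ring X P \<and> value_at (pb f) P = value_at f (\<phi> P)"
    if "f \<in> carrier E.FF" "P \<in> X" "f \<in> local_ring E (\<phi> P)"
  proof -
    from that(1) obtain F G where f: "(F, G) \<in> fractions E" "f = frac E F G" by (rule E.FF_carrierE)
    show ?thesis
      using frac_msubst_local[OF \<Phi> f(1) that(2)] that(3) unfolding f(2) pf[OF f(1)] by blast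
  qed
qed

lemma pb_one: "pb \<one>\<^bsub>E.FF\<^esub> = \<one>\<^bsub>X.FF\<^esub>"
  using pb_const[of 1] by (simp add: E.const_fun_one X.const_fun_one)

end

section \<open>A morphism of degree 2 as an abstract double cover\<close>

lemma (in places) v_powi:
  assumes "P \<in> X" "f \<in> K" "f \<noteq> 0"
  shows "f powi n \<in> K" "v P (f powi n) = n * v P f"
  using assms by (auto simp: power_int_def v_power)

locale double_cover = curve_morphism X E \<phi> + XI: embedded_curve X \<iota>X + EI: embedded_curve E \<iota>E
  for X :: "('k::alg_closed_field, 'n::finite) proj_point set" and E :: "('k, 'm::finite) proj_point set"
    and \<phi> and \<iota>X :: "('k, 'n) ratfun \<Rightarrow> 'f::field" and \<iota>E :: "('k, 'm) ratfun \<Rightarrow> 'h::field" +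
  assumes degree_2: "ring.dimension X.FF 2 (pb ` carrier E.FF) (carrier X.FF)"
begin

definition \<Psi> where "\<Psi> y = \<iota>X (pb (inv_into (carrier E.FF) \<iota>E y))"

lemma \<Psi>_\<iota> [simp]: "f \<in> carrier E.FF \<Longrightarrow> \<Psi> (\<iota>E f) = \<iota>X (pb f)"
  by (simp add: \<Psi>_def inv_into_f_f[OF EI.inj_\<iota>])

abbreviation e where "e \<equiv> ramification_index X E \<phi>"

lemma pb_zero: "pb \<zero>\<^bsub>E.FF\<^esub> = \<zero>\<^bsub>X.FF\<^esub>"
  using pb_const[of 0] by (simp add: E.const_fun_zero X.const_fun_zero)

lemma pb_nonzero:
  assumes "f \<in> carrier E.FF" "f \<noteq> \<zero>\<^bsub>E.FF\<^esub>" shows "pb f \<noteq> \<zero>\<^bsub>X.FF\<^esub>"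
proof
  assume z: "pb f = \<zero>\<^bsub>X.FF\<^esub>"
  have i: "inv\<^bsub>E.FF\<^esub> f \<in> carrier E.FF" "inv\<^bsub>E.FF\<^esub> f \<otimes>\<^bsub>E.FF\<^esub> f = \<one>\<^bsub>E.FF\<^esub>"
    using assms E.FF.field_Units by (auto simp: E.FF.Units_l_inv)
  have "\<one>\<^bsub>X.FF\<^esub> = pb (inv\<^bsub>E.FF\<^esub> f) \<otimes>\<^bsub>X.FF\<^esub> pb f"
    using pb_mult[OF i(1) assms(1)] by (simp add: i(2) pb_one)
  then show False using z pb_carrier[OF i(1)] by simp
qed

lemma ring_hom_pb: "ring_hom_ring E.FF X.FF pb"
  by (rule ring_hom_ringI2[OF E.FF.is_ring X.FF.is_ring]) (auto simp: ring_hom_def pb_carrier pb_mult pb_add pb_one)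

lemma subfield_pb: "subfield (pb ` carrier E.FF) X.FF"
  using ring_hom_ring.img_is_subfield(2)[OF ring_hom_pb E.FF.carrier_is_subfield] by simp

lemma \<Psi>_hom:
  assumes "a \<in> EI.K" "b \<in> EI.K"
  shows "\<Psi> (a - b) = \<Psi> a - \<Psi> b" "\<Psi> (a * b) = \<Psi> a * \<Psi> b"
proof -
  obtain f where f: "f \<in> carrier E.FF" "a = \<iota>E f" using assms(1) by (rule EI.KE)
  obtain h where h: "h \<in> carrier E.FF" "b = \<iota>E h" using assms(2) by (rule EI.KE)
  show "\<Psi> (a * b) = \<Psi> a * \<Psi> b"
    using f(1) h(1) unfolding f(2) h(2)
    by (simp add: pb_mult pb_carrier XI.\<iota>_mult flip: EI.\<iota>_mult)
  have "\<Psi> (x + y) = \<Psi> x + \<Psi> y" if xy: "x \<in> EI.K" "y \<in> EI.K" for x y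
  proof -
    obtain f where f: "f \<in> carrier E.FF" "x = \<iota>E f" using xy(1) by (rule EI.KE)
    obtain h where h: "h \<in> carrier E.FF" "y = \<iota>E h" using xy(2) by (rule EI.KE)
    show ?thesis
      using f(1) h(1) unfolding f(2) h(2)
      by (simp add: pb_add pb_carrier XI.\<iota>_add flip: EI.\<iota>_add)
  qed
  from this[of "a - b" b] show "\<Psi> (a - b) = \<Psi> a - \<Psi> b" using assms by simp
qed

lemma \<Psi>_powi:
  assumes "a \<in> EI.K" "a \<noteq> 0" "\<Psi> a \<noteq> 0"
  shows "\<Psi> (a powi n) = \<Psi> a powi n"
proof -
  have one: "\<Psi> 1 = 1" using \<Psi>_\<iota>[of "\<one>\<^bsub>E.FF\<^esub>"] by (simp add: EI.\<iota>_one pb_one XI.\<iota>_one)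
  have pow: "\<Psi> (b ^ k) = \<Psi> b ^ k" if "b \<in> EI.K" for b k
    using that by (induction k) (simp_all add: one \<Psi>_hom)
  have "\<Psi> (inverse a) * \<Psi> a = 1"
    using \<Psi>_hom(2)[of "inverse a" a] assms one by simp
  then have "\<Psi> (inverse a) = inverse (\<Psi> a)" using assms(3) by (simp add: field_simps)
  then show ?thesis using assms pow[of a] pow[of "inverse a"] by (simp add: power_int_def)
qed

lemma pb_uniformizer:
  assumes P: "P \<in> X"
  obtains t where "uniformizer E (\<phi> P) t" "e P = ord_at X P (pb t)" "1 \<le> e P"
proof -
  define t where "t = (SOME t. uniformizer E (\<phi> P) t)"
  have t: "uniformizer E (\<phi> P) t"
    unfolding t_def using E.uniformizer_exists[OF \<phi>_E[OF P]] by (metis someI_ex)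
  have e: "e P = ord_at X P (pb t)" by (simp add: ramification_index_def t_def)
  note tc = EI.uniformizer_nonzero[OF \<phi>_E[OF P] t]
  have tm: "t \<in> local_ring E (\<phi> P)" "value_at t (\<phi> P) = 0"
    using uniformizer_mem[OF t] by (simp_all add: E.max_ideal_iff)
  have "pb t \<in> max_ideal X P" using pb_local[OF tc(1) P tm(1)] tm(2) by (simp add: X.max_ideal_iff)
  then have "1 \<le> e P"
    unfolding e using XI.max_ideal_iff_ord[OF P pb_carrier[OF tc(1)] pb_nonzero[OF tc(1,2)]] by blast
  then show thesis using t e that by blast
qed

text \<open>In \<open>f = u t^n\<close>, with a uniformizer \<open>t\<close> whose pullback has
  order \<open>e P\<close>, the unit pulls back to a unit and only \<open>n\<close> times
  \<open>e P\<close> remains.\<close>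

lemma ord_pb:
  assumes P: "P \<in> X" and f: "f \<in> carrier E.FF" "f \<noteq> \<zero>\<^bsub>E.FF\<^esub>"
  shows "ord_at X P (pb f) = e P * ord_at E (\<phi> P) f"
proof -
  obtain t where t: "uniformizer E (\<phi> P) t" "e P = ord_at X P (pb t)" using pb_uniformizer[OF P] by metis
  note tc = EI.uniformizer_nonzero[OF \<phi>_E[OF P] t(1)]
  define n where "n = ord_at E (\<phi> P) f"
  obtain u where u: "u \<in> local_units E (\<phi> P)" "\<iota>E f = \<iota>E u * \<iota>E t powi n"
    unfolding n_def by (rule EI.ord_atE[OF \<phi>_E[OF P] t(1) f])
  note uc = EI.local_units_props[OF \<phi>_E[OF P] u(1)]
  have tK: "\<iota>E t \<in> EI.K" "\<iota>E t \<noteq> 0" using tc by simp_all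
  have \<Psi>t: "\<Psi> (\<iota>E t) = \<iota>X (pb t)" using tc by simp
  have pbt: "pb t \<in> carrier X.FF" "\<iota>X (pb t) \<noteq> 0"
    using pb_carrier[OF tc(1)] pb_nonzero[OF tc(1,2)] by (simp_all add: XI.\<iota>_eq_0)
  have u': "pb u \<in> local_units X P"
    using pb_local[OF uc(1) P] u(1) by (auto simp: XI.local_units_iff EI.local_units_iff)
  note uc' = XI.local_units_props[OF P u']
  have "\<iota>X (pb f) = \<Psi> (\<iota>E u * \<iota>E t powi n)" using f u(2) by (metis \<Psi>_\<iota>)
  also have "\<dots> = \<iota>X (pb u) * \<iota>X (pb t) powi n"
    using uc(1) EI.PL.v_powi(1)[OF \<phi>_E[OF P] tK] \<Psi>_powi[OF tK] \<Psi>t pbt by (simp add: \<Psi>_hom)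
  finally have eq: "\<iota>X (pb f) = \<iota>X (pb u) * \<iota>X (pb t) powi n" .
  have "ord_at X P (pb f) = XI.v P (\<iota>X (pb f))" using pb_carrier[OF f(1)] by simp
  also have "\<dots> = XI.v P (\<iota>X (pb u)) + XI.v P (\<iota>X (pb t) powi n)"
    unfolding eq using uc' pbt XI.PL.v_powi(1)[OF P, of "\<iota>X (pb t)" n] by (intro XI.PL.v_mult P) auto
  also have "\<dots> = n * e P"
    using XI.ord_unit[OF P u'] uc' pbt t(2) by (simp add: XI.PL.v_powi(2)[OF P])
  finally show ?thesis by (simp add: n_def mult.commute)
qed

text \<open>Dimension 2 leaves no room for three independent functions. The relation arrives as a
  list that may be shorter or longer than 3, \<open>combine\<close> ignoring any surplus; hence the
  padding with 0 and the cases on \<open>Ks\<close>.\<close>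

lemma three_dependent:
  assumes u: "\<And>i. i < 3 \<Longrightarrow> u i \<in> XI.K"
  shows "\<exists>a. (\<forall>i<3. a i \<in> EI.K) \<and> (\<exists>i<3. a i \<noteq> 0) \<and> (\<Sum>i<(3::nat). \<Psi> (a i) * u i) = 0"
proof -
  let ?L = "pb ` carrier E.FF"
  have "\<forall>i\<in>{..<3}. \<exists>h. h \<in> carrier X.FF \<and> u i = \<iota>X h" using u by (auto elim: XI.KE)
  from bchoice[OF this] obtain h where h: "\<forall>i\<in>{..<3}. h i \<in> carrier X.FF \<and> u i = \<iota>X (h i)" by (elim exE)
  define Us where "Us = [h 0, h 1, h 2]"
  have Us: "set Us \<subseteq> carrier X.FF" using h by (auto simp: Us_def)
  have "\<not> X.FF.independent ?L Us"
    using X.FF.independent_length_le_dimension[OF subfield_pb degree_2 _ Us] by (auto simp: Us_def)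
  then have "\<exists>Ks. set Ks \<subseteq> ?L \<and> X.FF.combine Ks Us = \<zero>\<^bsub>X.FF\<^esub> \<and> \<not> set (take (length Us) Ks) \<subseteq> {\<zero>\<^bsub>X.FF\<^esub>}"
    using X.FF.trivial_combine_imp_independent[OF subfield_pb Us] by blast
  then obtain Ks where Ks_all: "set Ks \<subseteq> ?L \<and> X.FF.combine Ks Us = \<zero>\<^bsub>X.FF\<^esub> \<and> \<not> set (take (length Us) Ks) \<subseteq> {\<zero>\<^bsub>X.FF\<^esub>}"
    by (elim exE)
  have "length Us = 3" by (simp add: Us_def)
  note Ks = conjunct1[OF Ks_all] conjunct1[OF conjunct2[OF Ks_all]] conjunct2[OF conjunct2[OF Ks_all], unfolded this]
  have "\<forall>i\<in>{..<length Ks}. \<exists>k. k \<in> carrier E.FF \<and> Ks ! i = pb k"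
  proof
    fix i assume "i \<in> {..<length Ks}"
    then have "Ks ! i \<in> pb ` carrier E.FF" using Ks(1) nth_mem[of i Ks] by blast
    then show "\<exists>k. k \<in> carrier E.FF \<and> Ks ! i = pb k" by blast
  qed
  from bchoice[OF this] obtain k where k: "\<forall>i\<in>{..<length Ks}. k i \<in> carrier E.FF \<and> Ks ! i = pb (k i)" by (elim exE)
  define a where "a i = (if i < length Ks then \<iota>E (k i) else 0)" for i
  have aK: "a i \<in> EI.K" for i using k by (simp add: a_def)
  have \<Psi>a: "\<Psi> (a i) = (if i < length Ks then \<iota>X (Ks ! i) else 0)" for i
    using k \<Psi>_\<iota>[of "\<zero>\<^bsub>E.FF\<^esub>"] by (simp add: a_def EI.\<iota>_zero pb_zero XI.\<iota>_zero)
  have KsX: "set Ks \<subseteq> carrier X.FF" using Ks(1) pb_carrier by auto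
  have "(\<Sum>i<(3::nat). \<Psi> (a i) * u i) = \<iota>X (X.FF.combine Ks Us)"
  proof -
    have hX: "h 0 \<in> carrier X.FF" "h 1 \<in> carrier X.FF" "h 2 \<in> carrier X.FF"
      "u 0 = \<iota>X (h 0)" "u 1 = \<iota>X (h 1)" "u 2 = \<iota>X (h 2)" using h by auto
    consider "Ks = []" | k0 where "Ks = [k0]" | k0 k1 where "Ks = [k0, k1]" | k0 k1 k2 Ks' where "Ks = k0 # k1 # k2 # Ks'"
      by (metis neq_Nil_conv)
    then show ?thesis
    proof cases
      case 1
      then show ?thesis by (simp add: \<Psi>a XI.\<iota>_zero)
    next
      case 2
      then show ?thesis using KsX hX by (simp add: \<Psi>a Us_def eval_nat_numeral XI.\<iota>_mult XI.\<iota>_add)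
    next
      case 3
      then show ?thesis using KsX hX by (simp add: \<Psi>a Us_def eval_nat_numeral XI.\<iota>_mult XI.\<iota>_add)
    next
      case 4
      then show ?thesis using KsX hX
        by (simp add: \<Psi>a Us_def eval_nat_numeral XI.\<iota>_mult XI.\<iota>_add add.assoc)
    qed
  qed
  then have "(\<Sum>i<(3::nat). \<Psi> (a i) * u i) = 0" using Ks(2) by (simp add: XI.\<iota>_zero)
  moreover have "\<exists>i<3. a i \<noteq> 0"
  proof -
    obtain x where x: "x \<in> set (take 3 Ks)" "x \<noteq> \<zero>\<^bsub>X.FF\<^esub>" using Ks(3) by blast
    have "\<exists>i. i < 3 \<and> i < length Ks \<and> x = Ks ! i" using x(1) unfolding in_set_conv_nth by auto
    then obtain i where i: "i < 3" "i < length Ks" "x = Ks ! i" by blast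
    have "k i \<noteq> \<zero>\<^bsub>E.FF\<^esub>"
    proof
      assume "k i = \<zero>\<^bsub>E.FF\<^esub>"
      then have "Ks ! i = \<zero>\<^bsub>X.FF\<^esub>" using k i(2) pb_zero by simp
      then show False using x(2) i(3) by simp
    qed
    then have "a i \<noteq> 0" using k i(2) by (simp add: a_def EI.\<iota>_eq_0)
    then show ?thesis using i(1) by blast
  qed
  ultimately show ?thesis using aK by blast
qed

text \<open>A field has dimension 1 over itself, so a surjective pullback would contradict dimension
  2.\<close>

lemma pullback_proper: "\<exists>f\<in>XI.K. f \<notin> \<Psi> ` EI.K"
proof (rule ccontr)
  assume "\<not> ?thesis"
  then have sub: "XI.K \<subseteq> \<Psi> ` EI.K" by blast
  have "carrier X.FF \<subseteq> pb ` carrier E.FF"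
  proof
    fix f assume f: "f \<in> carrier X.FF"
    then have "\<iota>X f \<in> \<Psi> ` EI.K" using sub by auto
    then obtain h where h: "h \<in> carrier E.FF" "\<iota>X f = \<iota>X (pb h)" by (auto elim!: EI.KE)
    then have "f = pb h" using XI.\<iota>_inj[OF f pb_carrier[OF h(1)]] by blast
    then show "f \<in> pb ` carrier E.FF" using h(1) by blast
  qed
  then have eq: "pb ` carrier E.FF = carrier X.FF" using pb_carrier by blast
  have "X.FF.dimension 1 (pb ` carrier E.FF) (pb ` carrier E.FF)"
    by (rule X.FF.dimension_one[OF subfield_pb])
  then have "X.FF.dimension 1 (pb ` carrier E.FF) (carrier X.FF)" by (simp only: eq)
  from X.FF.dimension_is_inj[OF subfield_pb this degree_2] show False by simp
qed

lemma cover: "cover XI.K XI.C X XI.v EI.K EI.C E EI.v \<phi> \<Psi> e"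
proof
  show "\<phi> P \<in> E" if "P \<in> X" for P by (rule \<phi>_E[OF that])
  show "\<Psi> h \<in> XI.K" if "h \<in> EI.K" for h using that by (elim EI.KE) (simp add: pb_carrier)
  show "\<Psi> (a - b) = \<Psi> a - \<Psi> b" "\<Psi> (a * b) = \<Psi> a * \<Psi> b" if "a \<in> EI.K" "b \<in> EI.K" for a b
    using \<Psi>_hom[OF that] by simp_all
  show "\<Psi> (EI.C c) = XI.C c" for c by (simp add: EI.C_def XI.C_def pb_const)
  show "1 \<le> e P" if "P \<in> X" for P by (rule pb_uniformizer[OF that])
  show "XI.v P (\<Psi> h) = e P * EI.v (\<phi> P) h" if P: "P \<in> X" and "h \<in> EI.K" "h \<noteq> 0" for P h
  proof -
    obtain f where f: "f \<in> carrier E.FF" "h = \<iota>E f" using \<open>h \<in> EI.K\<close> by (rule EI.KE)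
    then have "f \<noteq> \<zero>\<^bsub>E.FF\<^esub>" using \<open>h \<noteq> 0\<close> EI.\<iota>_zero by auto
    then show ?thesis using f ord_pb[OF P f(1)] pb_carrier[OF f(1)] by simp
  qed
  show "\<exists>a. (\<forall>i<3. a i \<in> EI.K) \<and> (\<exists>i<3. a i \<noteq> 0) \<and> (\<Sum>i<3. \<Psi> (a i) * u i) = 0"
    if "\<And>i. i < 3 \<Longrightarrow> u i \<in> XI.K" for u :: "nat \<Rightarrow> _"
    by (rule three_dependent[OF that])
  show "\<exists>f\<in>XI.K. f \<notin> \<Psi> ` EI.K" by (rule pullback_proper)
qed

end

sublocale double_cover \<subseteq> CV: cover XI.K XI.C X XI.v EI.K EI.C E EI.v \<phi> \<Psi> "ramification_index X E \<phi>"
  by (rule cover)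

section \<open>Divisor classes\<close>

lemma free_Abelian_group_simps [simp]:
  "D \<in> carrier (free_Abelian_group S) \<longleftrightarrow> Poly_Mapping.keys D \<subseteq> S"
  "monoid.mult (free_Abelian_group S) = (+)" "\<one>\<^bsub>free_Abelian_group S\<^esub> = 0"
  by (auto simp: free_Abelian_group_def)

lemma divisor_degree_superset:
  assumes "finite S" "Poly_Mapping.keys D \<subseteq> S"
  shows "divisor_degree D = (\<Sum>P\<in>S. Poly_Mapping.lookup D P)"
  unfolding divisor_degree_def using assms by (intro sum.mono_neutral_left) (auto simp: in_keys_iff)

lemma divisor_degree_diff: "divisor_degree (D - D') = divisor_degree D - divisor_degree D'"
proof -
  let ?S = "Poly_Mapping.keys D \<union> Poly_Mapping.keys D'"
  have "Poly_Mapping.keys (D - D') \<subseteq> ?S" by (rule keys_diff)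
  then show ?thesis
    by (simp add: divisor_degree_superset[of ?S] lookup_minus sum_subtractf)
qed

lemma divisor_degree_add: "divisor_degree (D + D') = divisor_degree D + divisor_degree D'"
  using divisor_degree_diff[of "D + D'" D'] by simp

lemma divisor_degree_frag_of [simp]: "divisor_degree (frag_of P) = 1"
  by (simp add: divisor_degree_def keys_frag_of)

lemma keys_subset_add: "Poly_Mapping.keys D \<subseteq> S \<Longrightarrow> Poly_Mapping.keys D' \<subseteq> S \<Longrightarrow> Poly_Mapping.keys (D + D') \<subseteq> S"
  using keys_add[of D D'] by blast

lemma keys_subset_diff: "Poly_Mapping.keys D \<subseteq> S \<Longrightarrow> Poly_Mapping.keys D' \<subseteq> S \<Longrightarrow> Poly_Mapping.keys (D - D') \<subseteq> S"
  using keys_diff[of D D'] by blast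

context embedded_curve
begin

lemma principal_divisorsE:
  assumes "D \<in> principal_divisors X"
  obtains f where "Poly_Mapping.keys D \<subseteq> X" "f \<in> carrier FF" "f \<noteq> \<zero>\<^bsub>FF\<^esub>" "\<forall>P\<in>X. Poly_Mapping.lookup D P = ord_at X P f"
  using assms unfolding principal_divisors_def by auto

lemma principal_divisorsI:
  "Poly_Mapping.keys D \<subseteq> X \<Longrightarrow> f \<in> carrier FF \<Longrightarrow> f \<noteq> \<zero>\<^bsub>FF\<^esub> \<Longrightarrow> \<forall>P\<in>X. Poly_Mapping.lookup D P = ord_at X P f \<Longrightarrow>
    D \<in> principal_divisors X"
  unfolding principal_divisors_def by auto

lemma principal_zero: "0 \<in> principal_divisors X"
  using ord_unit[OF _ local_units_one] by (intro principal_divisorsI[of _ "\<one>\<^bsub>FF\<^esub>"]) auto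

lemma principal_diff:
  assumes "D \<in> principal_divisors X" "D' \<in> principal_divisors X"
  shows "D - D' \<in> principal_divisors X"
proof -
  from assms(1) obtain f where f: "Poly_Mapping.keys D \<subseteq> X" "f \<in> carrier FF" "f \<noteq> \<zero>\<^bsub>FF\<^esub>"
    "\<forall>P\<in>X. Poly_Mapping.lookup D P = ord_at X P f" by (rule principal_divisorsE)
  from assms(2) obtain h where h: "Poly_Mapping.keys D' \<subseteq> X" "h \<in> carrier FF" "h \<noteq> \<zero>\<^bsub>FF\<^esub>"
    "\<forall>P\<in>X. Poly_Mapping.lookup D' P = ord_at X P h" by (rule principal_divisorsE)
  define k where "k = f \<otimes>\<^bsub>FF\<^esub> inv\<^bsub>FF\<^esub> h"
  have i: "inv\<^bsub>FF\<^esub> h \<in> carrier FF" "inv\<^bsub>FF\<^esub> h \<otimes>\<^bsub>FF\<^esub> h = \<one>\<^bsub>FF\<^esub>"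
    using h FF.field_Units by (auto simp: FF.Units_l_inv)
  have k: "k \<in> carrier FF" "k \<otimes>\<^bsub>FF\<^esub> h = f" using f h i by (simp_all add: k_def FF.m_assoc)
  have kz: "k \<noteq> \<zero>\<^bsub>FF\<^esub>" using k f h by auto
  have "ord_at X P f = ord_at X P k + ord_at X P h" if "P \<in> X" for P
    using ord_mult[OF that k(1) kz h(2,3)] k(2) by simp
  then show ?thesis using f h k kz
    by (intro principal_divisorsI[of _ k]) (auto simp: lookup_minus keys_subset_diff)
qed

lemma principal_minus: "D \<in> principal_divisors X \<Longrightarrow> - D \<in> principal_divisors X"
  using principal_diff[OF principal_zero, of D] by simp

lemma principal_add: "D \<in> principal_divisors X \<Longrightarrow> D' \<in> principal_divisors X \<Longrightarrow> D + D' \<in> principal_divisors X"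
  using principal_diff[OF _ principal_minus, of D D'] by simp

lemma divisor_class_eq_image: "divisor_class X D = (\<lambda>p. p + D) ` principal_divisors X"
  by (auto simp: divisor_class_def r_coset_def)

lemma mem_divisor_class: "D' \<in> divisor_class X D \<longleftrightarrow> D' - D \<in> principal_divisors X"
  unfolding divisor_class_eq_image by (auto intro!: rev_image_eqI[of "D' - D"])

lemma divisor_class_eq_iff: "divisor_class X D = divisor_class X D' \<longleftrightarrow> D - D' \<in> principal_divisors X"
proof
  assume "divisor_class X D = divisor_class X D'"
  then show "D - D' \<in> principal_divisors X" using mem_divisor_class[of D D] mem_divisor_class[of D D'] principal_zero by simp
next
  assume p: "D - D' \<in> principal_divisors X"
  have "A \<in> divisor_class X D \<longleftrightarrow> A \<in> divisor_class X D'" for A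
    unfolding mem_divisor_class
    using principal_add[OF _ p, of "A - D"] principal_diff[OF _ p, of "A - D'"] by auto
  then show "divisor_class X D = divisor_class X D'" by blast
qed

lemma Pic_mult: "divisor_class X D \<otimes>\<^bsub>Pic X\<^esub> divisor_class X D' = divisor_class X (D + D')"
proof -
  have "divisor_class X D \<otimes>\<^bsub>Pic X\<^esub> divisor_class X D' =
      (\<Union>a\<in>divisor_class X D. \<Union>b\<in>divisor_class X D'. {a + b})"
    by (simp add: Pic_def FactGroup_def set_mult_def)
  also have "\<dots> = divisor_class X (D + D')"
  proof (intro equalityI subsetI)
    fix A assume "A \<in> (\<Union>a\<in>divisor_class X D. \<Union>b\<in>divisor_class X D'. {a + b})"
    then obtain a b where ab: "a - D \<in> principal_divisors X" "b - D' \<in> principal_divisors X" "A = a + b"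
      by (auto simp: mem_divisor_class)
    have eq: "A - (D + D') = (a - D) + (b - D')" by (simp add: ab(3))
    show "A \<in> divisor_class X (D + D')" unfolding mem_divisor_class eq by (rule principal_add[OF ab(1,2)])
  next
    fix A assume "A \<in> divisor_class X (D + D')"
    then have "(A - D') - D \<in> principal_divisors X" by (simp add: mem_divisor_class algebra_simps)
    then show "A \<in> (\<Union>a\<in>divisor_class X D. \<Union>b\<in>divisor_class X D'. {a + b})"
      using principal_zero by (intro UN_I[of "A - D'"] UN_I[of D']) (auto simp: mem_divisor_class)
  qed
  finally show ?thesis .
qed

end

section \<open>Pullback of divisor classes, and the final argument\<close>

context double_cover
begin

text \<open>Finite fibres make the support finite, which gives \<open>Abs_poly_mapping\<close> in
  the definition its meaning.\<close>

lemma lookup_pullback_divisor: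
  "Poly_Mapping.lookup (pullback_divisor X E \<phi> D) P = (if P \<in> X then e P * Poly_Mapping.lookup D (\<phi> P) else 0)"
proof -
  have "{P. (if P \<in> X then e P * Poly_Mapping.lookup D (\<phi> P) else 0) \<noteq> 0} \<subseteq>
      (\<Union>q\<in>Poly_Mapping.keys D \<inter> E. CV.fibre q)"
    using \<phi>_E by (auto simp: CV.fibre_def in_keys_iff split: if_splits)
  then have "finite {P. (if P \<in> X then e P * Poly_Mapping.lookup D (\<phi> P) else 0) \<noteq> 0}"
    by (rule finite_subset) (auto intro: CV.finite_fibre)
  then show ?thesis unfolding pullback_divisor_def by (simp add: Abs_poly_mapping_inverse)
qed

lemma keys_pullback_divisor: "Poly_Mapping.keys (pullback_divisor X E \<phi> D) \<subseteq> X"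
  by (auto simp: in_keys_iff lookup_pullback_divisor split: if_splits)

lemma pullback_divisor_add:
  "pullback_divisor X E \<phi> (D + D') = pullback_divisor X E \<phi> D + pullback_divisor X E \<phi> D'"
  by (rule poly_mapping_eqI) (simp add: lookup_pullback_divisor lookup_add distrib_left)

lemma pullback_divisor_diff:
  "pullback_divisor X E \<phi> (D - D') = pullback_divisor X E \<phi> D - pullback_divisor X E \<phi> D'"
  by (rule poly_mapping_eqI) (simp add: lookup_pullback_divisor lookup_minus right_diff_distrib)

lemma pullback_principal:
  assumes "D \<in> principal_divisors E" shows "pullback_divisor X E \<phi> D \<in> principal_divisors X"
proof -
  from assms obtain f where f: "Poly_Mapping.keys D \<subseteq> E" "f \<in> carrier E.FF" "f \<noteq> \<zero>\<^bsub>E.FF\<^esub>"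
    "\<forall>P\<in>E. Poly_Mapping.lookup D P = ord_at E P f" by (rule EI.principal_divisorsE)
  show ?thesis
    using f \<phi>_E
    by (intro XI.principal_divisorsI[of _ "pb f"] keys_pullback_divisor pb_carrier pb_nonzero)
      (auto simp: lookup_pullback_divisor ord_pb)
qed

text \<open>\<open>the_elem\<close> is meaningful because principal divisors pull back to principal
  divisors.\<close>

lemma pullback_Pic_class:
  "pullback_Pic X E \<phi> (divisor_class E D) = divisor_class X (pullback_divisor X E \<phi> D)"
proof -
  have "divisor_class X (pullback_divisor X E \<phi> A) = divisor_class X (pullback_divisor X E \<phi> D)"
    if "A \<in> divisor_class E D" for A
    using pullback_principal[of "A - D"] that
    by (simp add: XI.divisor_class_eq_iff EI.mem_divisor_class pullback_divisor_diff)
  moreover have "D \<in> divisor_class E D" using EI.principal_zero by (simp add: EI.mem_divisor_class)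
  ultimately have "(\<lambda>D. divisor_class X (pullback_divisor X E \<phi> D)) ` divisor_class E D =
      {divisor_class X (pullback_divisor X E \<phi> D)}" by blast
  then show ?thesis by (simp add: pullback_Pic_def)
qed

lemma translate_Pic_deg:
  "divisor_class X D <#\<^bsub>Pic X\<^esub> (pullback_Pic X E \<phi> ` Pic_deg E n) =
    {divisor_class X (D + pullback_divisor X E \<phi> S) | S. Poly_Mapping.keys S \<subseteq> E \<and> divisor_degree S = n}"
proof -
  have "divisor_class X D <#\<^bsub>Pic X\<^esub> (pullback_Pic X E \<phi> ` Pic_deg E n) =
      (\<lambda>S. divisor_class X D \<otimes>\<^bsub>Pic X\<^esub> pullback_Pic X E \<phi> (divisor_class E S)) `
        {S. Poly_Mapping.keys S \<subseteq> E \<and> divisor_degree S = n}"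
    by (auto simp: l_coset_def Pic_deg_def)
  then show ?thesis by (auto simp: pullback_Pic_class XI.Pic_mult)
qed

text \<open>The two bounds on the degree of a fibre meet.\<close>

lemma degree_pullback_point:
  assumes gX: "XI.PL.genus g" "1 \<le> g" and gE: "EI.PL.genus 1" and q: "q \<in> E"
  shows "divisor_degree (pullback_divisor X E \<phi> (frag_of q)) = 2"
proof -
  have "Poly_Mapping.keys (pullback_divisor X E \<phi> (frag_of q)) \<subseteq> CV.fibre q"
    by (auto simp: in_keys_iff lookup_pullback_divisor CV.fibre_def lookup_frag_of split: if_splits)
  then have "divisor_degree (pullback_divisor X E \<phi> (frag_of q)) = (\<Sum>P\<in>CV.fibre q. e P)"
    by (subst divisor_degree_superset[OF CV.finite_fibre[OF q]])
      (auto simp: lookup_pullback_divisor CV.fibre_def intro!: sum.cong)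
  then show ?thesis using CV.fibre_degree_le[OF q] CV.fibre_degree_ge[OF gX gE q] by simp
qed

theorem translate_by_pullback_Pic:
  assumes gX: "has_genus X g" and gE: "has_genus E 1" and d: "2 < d" "d < g" and x: "x \<in> W X d"
    and sub: "x <#\<^bsub>Pic X\<^esub> (pullback_Pic X E \<phi> ` Pic_deg E 0) \<subseteq> W X d"
  shows "\<exists>y\<in>W X (d - 2). x <#\<^bsub>Pic X\<^esub> (pullback_Pic X E \<phi> ` Pic_deg E 0) =
    y <#\<^bsub>Pic X\<^esub> (pullback_Pic X E \<phi> ` Pic_deg E 1)"
proof -
  note gX' = XI.genus_if_has_genus[OF gX] and gE' = EI.genus_if_has_genus[OF gE]
  have g1: "1 \<le> g" using d by simp
  obtain D where D: "Poly_Mapping.keys D \<subseteq> X" "effective D" "divisor_degree D = int d" "x = divisor_class X D"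
    using x by (auto simp: W_def)
  have "infinite E" using EI.PL.genus_pos_imp_infinite[OF gE'] by simp
  then obtain Q3 where "Q3 \<subseteq> E" "card Q3 = 3" by (meson infinite_arbitrarily_large)
  then obtain q p1 p2 where pts: "q \<in> E" "p1 \<in> E" "p2 \<in> E" "p1 \<noteq> q" "p2 \<noteq> q" "p1 \<noteq> p2"
    by (auto simp: card_3_iff)
  \<comment> \<open>Degree-0 divisors \<open>p - q\<close>; translating \<open>x\<close> by the
    pullbacks of \<open>T p1\<close> and \<open>T p2\<close> yields the effective divisors
    \<open>D1\<close> and \<open>D2\<close>.\<close>
  define T where "T p = frag_of p - frag_of q" for p
  have T: "Poly_Mapping.keys (T p) \<subseteq> E" "divisor_degree (T p) = 0" if "p \<in> E" for p
    using that pts keys_subset_diff[of "frag_of p" E "frag_of q"] by (auto simp: T_def keys_frag_of divisor_degree_diff)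
  have sect: "\<exists>D' f. Poly_Mapping.keys D' \<subseteq> X \<and> effective D' \<and> divisor_degree D' = int d \<and>
      D' - (D + pullback_divisor X E \<phi> (T p)) \<in> principal_divisors X \<and> f \<in> carrier X.FF \<and> f \<noteq> \<zero>\<^bsub>X.FF\<^esub> \<and>
      (\<forall>P\<in>X. Poly_Mapping.lookup D' P = XI.v P (\<iota>X f) + Poly_Mapping.lookup D P +
        e P * ((if \<phi> P = p then 1 else 0) - (if \<phi> P = q then 1 else 0)))" if p: "p \<in> E" for p
  proof -
    have "divisor_class X (D + pullback_divisor X E \<phi> (T p)) \<in> W X d"
      using sub T[OF p] unfolding D(4) translate_Pic_deg by blast
    then obtain D' where D': "Poly_Mapping.keys D' \<subseteq> X" "effective D'" "divisor_degree D' = int d"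
      "divisor_class X D' = divisor_class X (D + pullback_divisor X E \<phi> (T p))"
      unfolding W_def by auto
    then have pr: "D' - (D + pullback_divisor X E \<phi> (T p)) \<in> principal_divisors X"
      by (simp add: XI.divisor_class_eq_iff)
    then obtain f where f: "f \<in> carrier X.FF" "f \<noteq> \<zero>\<^bsub>X.FF\<^esub>"
      "\<forall>P\<in>X. Poly_Mapping.lookup (D' - (D + pullback_divisor X E \<phi> (T p))) P = ord_at X P f"
      by (rule XI.principal_divisorsE)
    have "Poly_Mapping.lookup D' P = XI.v P (\<iota>X f) + Poly_Mapping.lookup D P +
        e P * ((if \<phi> P = p then 1 else 0) - (if \<phi> P = q then 1 else 0))" if "P \<in> X" for P
    proof -
      have "Poly_Mapping.lookup (T p) (\<phi> P) = (if \<phi> P = p then 1 else 0) - (if \<phi> P = q then 1 else 0)"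
        by (simp add: T_def lookup_minus)
      then show ?thesis
        using bspec[OF f(3) that] f(1) that by (simp add: lookup_minus lookup_add lookup_pullback_divisor)
    qed
    then show ?thesis using D'(1-3) pr f(1,2) by blast
  qed
  obtain D1 f1 where 1: "Poly_Mapping.keys D1 \<subseteq> X" "effective D1" "divisor_degree D1 = int d"
      "D1 - (D + pullback_divisor X E \<phi> (T p1)) \<in> principal_divisors X" "f1 \<in> carrier X.FF" "f1 \<noteq> \<zero>\<^bsub>X.FF\<^esub>"
      "\<forall>P\<in>X. Poly_Mapping.lookup D1 P = XI.v P (\<iota>X f1) + Poly_Mapping.lookup D P +
        e P * ((if \<phi> P = p1 then 1 else 0) - (if \<phi> P = q then 1 else 0))"
    using sect[OF pts(2)] by blast
  obtain D2 f2 where 2: "Poly_Mapping.keys D2 \<subseteq> X" "effective D2" "divisor_degree D2 = int d"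
      "D2 - (D + pullback_divisor X E \<phi> (T p2)) \<in> principal_divisors X" "f2 \<in> carrier X.FF" "f2 \<noteq> \<zero>\<^bsub>X.FF\<^esub>"
      "\<forall>P\<in>X. Poly_Mapping.lookup D2 P = XI.v P (\<iota>X f2) + Poly_Mapping.lookup D P +
        e P * ((if \<phi> P = p2 then 1 else 0) - (if \<phi> P = q then 1 else 0))"
    using sect[OF pts(3)] by blast
  have supp: "{P \<in> X. Poly_Mapping.lookup D P \<noteq> 0} = Poly_Mapping.keys D" using D(1) by (auto simp: in_keys_iff)
  have "\<exists>Q\<in>E.
    (\<forall>P\<in>CV.fibre Q. e P \<le> XI.v P (\<iota>X f1) + Poly_Mapping.lookup D P + e P * ((if \<phi> P = p1 then 1 else 0) - (if \<phi> P = q then 1 else 0))) \<or>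
    (\<forall>P\<in>CV.fibre Q. e P \<le> XI.v P (\<iota>X f2) + Poly_Mapping.lookup D P + e P * ((if \<phi> P = p2 then 1 else 0) - (if \<phi> P = q then 1 else 0)))"
  proof (rule CV.fibre_below_divisor[OF gX' gE' _ _ _ pts])
    show "0 \<le> Poly_Mapping.lookup D P" for P using D(2) by (simp add: effective_def)
    show "finite {P \<in> X. Poly_Mapping.lookup D P \<noteq> 0}" by (simp add: supp)
    show "(\<Sum>P\<in>{P \<in> X. Poly_Mapping.lookup D P \<noteq> 0}. Poly_Mapping.lookup D P) < int g"
      using D(3) d by (simp add: supp divisor_degree_def)
    show "\<iota>X f1 \<in> XI.K" "\<iota>X f1 \<noteq> 0" using 1(5,6) by (simp_all add: XI.\<iota>_eq_0)
    show "\<iota>X f2 \<in> XI.K" "\<iota>X f2 \<noteq> 0" using 2(5,6) by (simp_all add: XI.\<iota>_eq_0)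
    fix P assume "P \<in> X"
    then show "0 \<le> XI.v P (\<iota>X f1) + Poly_Mapping.lookup D P + e P * ((if \<phi> P = p1 then 1 else 0) - (if \<phi> P = q then 1 else 0))"
      using 1(2,7) by (metis effective_def)
    show "0 \<le> XI.v P (\<iota>X f2) + Poly_Mapping.lookup D P + e P * ((if \<phi> P = p2 then 1 else 0) - (if \<phi> P = q then 1 else 0))"
      using 2(2,7) \<open>P \<in> X\<close> by (metis effective_def)
  qed
  then obtain Q D' p where Q: "Q \<in> E" and p: "p \<in> E"
    and D': "Poly_Mapping.keys D' \<subseteq> X" "effective D'" "divisor_degree D' = int d"
      "D' - (D + pullback_divisor X E \<phi> (T p)) \<in> principal_divisors X"
      "\<forall>P\<in>CV.fibre Q. e P \<le> Poly_Mapping.lookup D' P"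
  proof (elim bexE disjE)
    fix Q assume Q: "Q \<in> E" and le: "\<forall>P\<in>CV.fibre Q. e P \<le> XI.v P (\<iota>X f1) + Poly_Mapping.lookup D P +
        e P * ((if \<phi> P = p1 then 1 else 0) - (if \<phi> P = q then 1 else 0))"
    have "\<forall>P\<in>CV.fibre Q. e P \<le> Poly_Mapping.lookup D1 P"
      using le bspec[OF 1(7)] unfolding CV.fibre_def by auto
    then show thesis using that[OF Q pts(2) 1(1-4)] by blast
  next
    fix Q assume Q: "Q \<in> E" and le: "\<forall>P\<in>CV.fibre Q. e P \<le> XI.v P (\<iota>X f2) + Poly_Mapping.lookup D P +
        e P * ((if \<phi> P = p2 then 1 else 0) - (if \<phi> P = q then 1 else 0))"
    have "\<forall>P\<in>CV.fibre Q. e P \<le> Poly_Mapping.lookup D2 P"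
      using le bspec[OF 2(7)] unfolding CV.fibre_def by auto
    then show thesis using that[OF Q pts(3) 2(1-4)] by blast
  qed
  \<comment> \<open>Removing the fibre over \<open>Q\<close> lowers the degree by 2, and
    \<open>Y\<close> stays effective because \<open>D'\<close> contains that fibre.\<close>
  define Y where "Y = D' - pullback_divisor X E \<phi> (frag_of Q)"
  have Yk: "Poly_Mapping.keys Y \<subseteq> X" unfolding Y_def by (intro keys_subset_diff D'(1) keys_pullback_divisor)
  have Yeff: "effective Y"
    using D'(2,5) unfolding effective_def
    by (auto simp: Y_def lookup_minus lookup_pullback_divisor CV.fibre_def)
  have "divisor_degree Y = int (d - 2)"
    using D'(3) degree_pullback_point[OF gX' g1 gE' Q] d by (simp add: Y_def divisor_degree_diff)
  then have YW: "divisor_class X Y \<in> W X (d - 2)"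
    unfolding W_def using Yk Yeff by auto
  \<comment> \<open>\<open>D'\<close> is equivalent to \<open>D\<close> plus the pullback of
    \<open>T p\<close>, and equal to \<open>Y\<close> plus the fibre over \<open>Q\<close>. Hence
    \<open>D\<close> is equivalent to \<open>Y\<close> plus the pullback of \<open>U\<close>, and
    adding \<open>U\<close>, of degree 1, matches the two families of translates.\<close>
  define U where "U = frag_of Q - T p"
  have U: "Poly_Mapping.keys U \<subseteq> E" "divisor_degree U = 1"
    unfolding U_def using T[OF p] Q keys_subset_diff[of "frag_of Q" E "T p"]
    by (simp_all add: divisor_degree_diff keys_frag_of)
  have YD: "Y + pullback_divisor X E \<phi> U - D \<in> principal_divisors X"
  proof -
    have "Y + pullback_divisor X E \<phi> U - D = D' - (D + pullback_divisor X E \<phi> (T p))"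
      by (simp add: Y_def U_def pullback_divisor_diff algebra_simps)
    then show ?thesis using D'(4) by (simp only:)
  qed
  have shift: "divisor_class X (D + pullback_divisor X E \<phi> S) = divisor_class X (Y + pullback_divisor X E \<phi> (S + U))" for S
  proof -
    have eq: "Y + pullback_divisor X E \<phi> (S + U) - (D + pullback_divisor X E \<phi> S) = Y + pullback_divisor X E \<phi> U - D"
      by (simp add: pullback_divisor_add algebra_simps)
    have "divisor_class X (Y + pullback_divisor X E \<phi> (S + U)) = divisor_class X (D + pullback_divisor X E \<phi> S)"
      unfolding XI.divisor_class_eq_iff eq by (rule YD)
    then show ?thesis by (rule sym)
  qed
  have "x <#\<^bsub>Pic X\<^esub> (pullback_Pic X E \<phi> ` Pic_deg E 0) =
      divisor_class X Y <#\<^bsub>Pic X\<^esub> (pullback_Pic X E \<phi> ` Pic_deg E 1)"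
    unfolding D(4) translate_Pic_deg
  proof (intro equalityI subsetI)
    fix c assume "c \<in> {divisor_class X (D + pullback_divisor X E \<phi> S) | S. Poly_Mapping.keys S \<subseteq> E \<and> divisor_degree S = 0}"
    then obtain S where S: "c = divisor_class X (D + pullback_divisor X E \<phi> S)" "Poly_Mapping.keys S \<subseteq> E" "divisor_degree S = 0"
      by blast
    have "Poly_Mapping.keys (S + U) \<subseteq> E" "divisor_degree (S + U) = 1"
      using S U keys_subset_add[of S E U] by (simp_all add: divisor_degree_add)
    then show "c \<in> {divisor_class X (Y + pullback_divisor X E \<phi> S) | S. Poly_Mapping.keys S \<subseteq> E \<and> divisor_degree S = 1}"
      using S(1) shift by blast
  next
    fix c assume "c \<in> {divisor_class X (Y + pullback_divisor X E \<phi> S) | S. Poly_Mapping.keys S \<subseteq> E \<and> divisor_degree S = 1}"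
    then obtain S where S: "c = divisor_class X (Y + pullback_divisor X E \<phi> S)" "Poly_Mapping.keys S \<subseteq> E" "divisor_degree S = 1"
      by blast
    have "Poly_Mapping.keys (S - U) \<subseteq> E" "divisor_degree (S - U) = 0"
      using S U keys_subset_diff[of S E U] by (simp_all add: divisor_degree_diff)
    moreover have "c = divisor_class X (D + pullback_divisor X E \<phi> (S - U))" using S(1) shift[of "S - U"] by simp
    ultimately show "c \<in> {divisor_class X (D + pullback_divisor X E \<phi> S) | S. Poly_Mapping.keys S \<subseteq> E \<and> divisor_degree S = 0}"
      by blast
  qed
  then show ?thesis using YW by blast
qed

end

theorem proposition3p0p1:
  fixes X :: "('k::alg_closed_field, 'n::finite) proj_point set"
    and E :: "('k, 'm::finite) proj_point set"
    and e :: "('k, 'm) proj_point"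
    and \<phi> :: "('k, 'n) proj_point \<Rightarrow> ('k, 'm) proj_point"
    and g d :: nat
    and x :: "(('k, 'n) proj_point \<Rightarrow>\<^sub>0 int) set"
  assumes "smooth_projective_curve X"
    and "has_genus X g"
    and "elliptic_curve E e"
    and "morphism_of_degree 2 X E \<phi>"
    and "2 < d"
    and "d < g"
    and "x \<in> W X d"
    and "x <#\<^bsub>Pic X\<^esub> (pullback_Pic X E \<phi> ` Pic_deg E 0) \<subseteq> W X d"
  shows "\<exists>y\<in>W X (d - 2).
    x <#\<^bsub>Pic X\<^esub> (pullback_Pic X E \<phi> ` Pic_deg E 0) =
    y <#\<^bsub>Pic X\<^esub> (pullback_Pic X E \<phi> ` Pic_deg E 1)"
proof -
  have E: "smooth_projective_curve E" "has_genus E 1" using assms(3) by (auto simp: elliptic_curve_def)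
  interpret X: smooth_curve X by unfold_locales (rule assms(1))
  interpret E: smooth_curve E by unfold_locales (rule E(1))
  interpret curve_morphism X E \<phi>
    by unfold_locales (use assms(4) in \<open>auto simp: morphism_of_degree_def\<close>)
  \<comment> \<open>The embeddings of \<open>k(X)\<close> and \<open>k(E)\<close> are chosen
    independently of each other and of \<open>\<phi>\<close>; the pullback between their images is
    \<open>\<Psi>\<close>.\<close>
  from X.field_embedding_exists obtain \<iota>X :: "('k, 'n) ratfun \<Rightarrow> 'k fls" where \<iota>X:
    "(\<forall>f\<in>carrier X.FF. \<forall>h\<in>carrier X.FF. \<iota>X (f \<otimes>\<^bsub>X.FF\<^esub> h) = \<iota>X f * \<iota>X h \<and> \<iota>X (f \<oplus>\<^bsub>X.FF\<^esub> h) = \<iota>X f + \<iota>X h) \<and> \<iota>X \<one>\<^bsub>X.FF\<^esub> = 1"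
    by (elim exE)
  from E.field_embedding_exists obtain \<iota>E :: "('k, 'm) ratfun \<Rightarrow> 'k fls" where \<iota>E:
    "(\<forall>f\<in>carrier E.FF. \<forall>h\<in>carrier E.FF. \<iota>E (f \<otimes>\<^bsub>E.FF\<^esub> h) = \<iota>E f * \<iota>E h \<and> \<iota>E (f \<oplus>\<^bsub>E.FF\<^esub> h) = \<iota>E f + \<iota>E h) \<and> \<iota>E \<one>\<^bsub>E.FF\<^esub> = 1"
    by (elim exE)
  interpret double_cover X E \<phi> \<iota>X \<iota>E
    by unfold_locales (use \<iota>X \<iota>E assms(4) in \<open>auto simp: morphism_of_degree_def\<close>)
  show ?thesis by (rule translate_by_pullback_Pic[OF assms(2) E(2) assms(5-8)])
qed

end
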